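(* Let $\Lambda$ be an affine monoid, let $\rho\in\Lambda$ be reducible, let $r\ge 2$ be an integer, and let $K$ be a field. Then the multi-graded Poincaré series of $\Lambda[\rho/r]$ satisfies $$P_{\Lambda[\rho/r]}(t,\mathbf z)=\frac{P_\Lambda(t,\mathbf z)\cdot(1+t\,\mathbf z^{\rho/r})}{1-t^2\mathbf z^\rho}.$$ In particular, if $r=2$, then $$P_{\Lambda[\rho/2]}(t,\mathbf z)=\frac{P_\Lambda(t,\mathbf z)}{1-t\,\mathbf z^{\rho/2}}.$$
   Context: $\mathbb N$ is the additive monoid of non-negative integers. An affine monoid is a commutative monoid $\Lambda$, written additively, which is (1) cancellative, (2) without non-zero invertible elements ($\lambda+\mu=0$ implies $\lambda=\mu=0$), and (3) finitely generated. $\Lambda_+=\Lambda\setminus\{0\}$. An element $\rho$ is reducible if $\rho=\sigma+\tau$ for some $\sigma,\tau\in\Lambda_+$. Construction of $\Lambda[\rho/r]$: let $\Lambda\oplus\mathbb N\alpha$ be the direct sum of $\Lambda$ with the free additive monoid on one formal generator $\alpha$, and let $\sim$ be the equivalence relation generated by $(\lambda+\rho)+k\alpha\sim\lambda+(r+k)\alpha$ ($\lambda\in\Lambda$, $k\in\mathbb N$). It is a congruence, and $\Lambda[\rho/r]=(\Lambda\oplus\mathbb N\alpha)/\!\sim$ with the induced monoid structure; the class of $\lambda+k\alpha$ is written $\lambda+k\rho/r$. $\Lambda[\rho/r]$ is an affine monoid, $(\lambda,k)\mapsto\lambda+k\rho/r$ is a bijection $\Lambda\times\{0,\dots,r-1\}\to\Lambda[\rho/r]$,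 and $\Lambda$ is regarded as a submonoid of $\Lambda[\rho/r]$. For an affine monoid $\Lambda$, $K[\Lambda]$ is the monoid algebra, graded by $\Lambda$, and $K$ is the $K[\Lambda]$-module $K[\Lambda]/(\mathbf z^\lambda\mid\lambda\in\Lambda_+)$. Then $\operatorname{Tor}^{K[\Lambda]}_i(K,K)$ is $\Lambda$-graded with graded components $\operatorname{Tor}^{K[\Lambda]}_{i,\lambda}(K,K)$. The multi-graded Poincaré series is the formal series $$P_\Lambda(t,\mathbf z)=\sum_{i\in\mathbb N}\sum_{\lambda\in\Lambda}\dim_K\operatorname{Tor}^{K[\Lambda]}_{i,\lambda}(K,K)\,t^i\mathbf z^\lambda .$$ The identities are in the ring of formal series $\sum_{i,\gamma}c_{i,\gamma}t^i\mathbf z^\gamma$ ($i\in\mathbb N$, $\gamma\in\Lambda[\rho/r]$, integer coefficients) with multiplication $\mathbf z^\gamma\mathbf z^{\gamma'}=\mathbf z^{\gamma+\gamma'}$; this is well defined since each element of an affine monoid has only finitely many decompositions as a sum of two elements, and $1-t^2\mathbf z^\rho$ and $1-t\mathbf z^{\rho/2}$ are invertible in it. *)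

theory Defs
  imports "HOL-Algebra.Divisibility" "HOL-Algebra.Generated_Groups" "HOL-Algebra.Ideal" "HOL-Algebra.Module"
    "HOL-Library.FuncSet"
begin

section \<open>Affine monoids\<close>

text \<open>Commutative monoids are HOL-Algebra monoids and so are written multiplicatively: the sum
  \<open>\<lambda> + \<mu>\<close> is \<open>\<lambda> \<otimes> \<mu>\<close> and the neutral element \<open>0\<close> is \<open>\<one>\<close>.\<close>

locale affine_monoid = comm_monoid_cancel G for G (structure) +
  assumes no_invertibles:
      "\<lbrakk>x \<in> carrier G; y \<in> carrier G; x \<otimes> y = \<one>\<rbrakk> \<Longrightarrow> x = \<one> \<and> y = \<one>"
    and finitely_generated:
      "\<exists>A. finite A \<and> A \<subseteq> carrier G \<and> (\<forall>H. submonoid H G \<and> A \<subseteq> H \<longrightarrow> H = carrier G)"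

definition reducible :: "'a monoid \<Rightarrow> 'a \<Rightarrow> bool" where
  "reducible \<Lambda> \<rho> \<longleftrightarrow>
     (\<exists>\<sigma> \<in> carrier \<Lambda> - {\<one>\<^bsub>\<Lambda>\<^esub>}. \<exists>\<tau> \<in> carrier \<Lambda> - {\<one>\<^bsub>\<Lambda>\<^esub>}. \<rho> = \<sigma> \<otimes>\<^bsub>\<Lambda>\<^esub> \<tau>)"


section \<open>The monoid obtained by adjoining a fraction\<close>

definition nat_add_monoid :: "nat monoid" where
  "nat_add_monoid = \<lparr>carrier = UNIV, monoid.mult = (+), one = 0\<rparr>"

text \<open>The pair \<open>(\<lambda>, k)\<close> stands for \<open>\<lambda> + k \<alpha>\<close>.\<close>

definition adjoin_rel :: "'a monoid \<Rightarrow> 'a \<Rightarrow> nat \<Rightarrow> (('a \<times> nat) \<times> ('a \<times> nat)) set" where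
  "adjoin_rel \<Lambda> \<rho> r =
     {(p, q). p \<in> carrier (\<Lambda> \<times>\<times> nat_add_monoid) \<and> q \<in> carrier (\<Lambda> \<times>\<times> nat_add_monoid) \<and>
        equivclp (\<lambda>p q. \<exists>l \<in> carrier \<Lambda>. \<exists>k. p = (l \<otimes>\<^bsub>\<Lambda>\<^esub> \<rho>, k) \<and> q = (l, r + k)) p q}"

definition adjoin_class :: "'a monoid \<Rightarrow> 'a \<Rightarrow> nat \<Rightarrow> 'a \<times> nat \<Rightarrow> ('a \<times> nat) set" where
  "adjoin_class \<Lambda> \<rho> r p = adjoin_rel \<Lambda> \<rho> r `` {p}"

definition adjoin_fraction :: "'a monoid \<Rightarrow> 'a \<Rightarrow> nat \<Rightarrow> ('a \<times> nat) set monoid" where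
  "adjoin_fraction \<Lambda> \<rho> r =
     \<lparr>carrier = carrier (\<Lambda> \<times>\<times> nat_add_monoid) // adjoin_rel \<Lambda> \<rho> r,
      monoid.mult = (\<lambda>X Y. \<Union>p\<in>X. \<Union>q\<in>Y. adjoin_class \<Lambda> \<rho> r (p \<otimes>\<^bsub>\<Lambda> \<times>\<times> nat_add_monoid\<^esub> q)),
      one = adjoin_class \<Lambda> \<rho> r \<one>\<^bsub>\<Lambda> \<times>\<times> nat_add_monoid\<^esub>\<rparr>"

text \<open>The inclusion of \<open>\<Lambda>\<close> and the element \<open>\<rho>/r\<close>, the class of \<open>0 + 1 \<alpha>\<close>.\<close>

definition adjoin_incl :: "'a monoid \<Rightarrow> 'a \<Rightarrow> nat \<Rightarrow> 'a \<Rightarrow> ('a \<times> nat) set" where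
  "adjoin_incl \<Lambda> \<rho> r l = adjoin_class \<Lambda> \<rho> r (l, 0)"

definition fraction :: "'a monoid \<Rightarrow> 'a \<Rightarrow> nat \<Rightarrow> ('a \<times> nat) set" where
  "fraction \<Lambda> \<rho> r = adjoin_class \<Lambda> \<rho> r (\<one>\<^bsub>\<Lambda>\<^esub>, 1)"


section \<open>Modules\<close>

text \<open>In the module records below the fields \<^const>\<open>monoid.mult\<close> and \<^const>\<open>monoid.one\<close>, inherited from rings,
  play no role.\<close>

definition regular_module :: "'r ring \<Rightarrow> ('r, 'r) module" where
  "regular_module R = \<lparr>carrier = carrier R, monoid.mult = monoid.mult R, one = one R, zero = zero R,
     add = add R, smult = monoid.mult R\<rparr>"

definition quot_module :: "('r, 'm) module \<Rightarrow> 'm set \<Rightarrow> ('r, 'm set) module" where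
  "quot_module M N = \<lparr>carrier = a_rcosets\<^bsub>M\<^esub> N, monoid.mult = undefined, one = undefined, zero = N,
     add = set_add M, smult = (\<lambda>r X. \<Union>x\<in>X. N +>\<^bsub>M\<^esub> (r \<odot>\<^bsub>M\<^esub> x))\<rparr>"

definition submodule_gen :: "'r ring \<Rightarrow> ('r, 'm) module \<Rightarrow> 'm set \<Rightarrow> 'm set" where
  "submodule_gen R M S = \<Inter>{N. submodule N R M \<and> S \<subseteq> N}"

definition module_hom :: "'r ring \<Rightarrow> ('r, 'm) module \<Rightarrow> ('r, 'n) module \<Rightarrow> ('m \<Rightarrow> 'n) set" where
  "module_hom R M N =
     {h \<in> carrier M \<rightarrow> carrier N.
        (\<forall>x \<in> carrier M. \<forall>y \<in> carrier M. h (x \<oplus>\<^bsub>M\<^esub> y) = h x \<oplus>\<^bsub>N\<^esub> h y) \<and>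
        (\<forall>r \<in> carrier R. \<forall>x \<in> carrier M. h (r \<odot>\<^bsub>M\<^esub> x) = r \<odot>\<^bsub>N\<^esub> h x)}"

text \<open>The free module on a set of generators \<open>X\<close> consists of the finitely supported functions
  from \<open>X\<close> to \<open>R\<close>, extended by zero outside \<open>X\<close>.\<close>

definition free_module :: "'r ring \<Rightarrow> 'x set \<Rightarrow> ('r, 'x \<Rightarrow> 'r) module" where
  "free_module R X =
     \<lparr>carrier = {f. (\<forall>x. f x \<in> carrier R) \<and> finite {x. f x \<noteq> \<zero>\<^bsub>R\<^esub>} \<and> {x. f x \<noteq> \<zero>\<^bsub>R\<^esub>} \<subseteq> X},
      monoid.mult = undefined, one = undefined, zero = (\<lambda>x. \<zero>\<^bsub>R\<^esub>),
      add = (\<lambda>f g x. f x \<oplus>\<^bsub>R\<^esub> g x), smult = (\<lambda>r f x. r \<otimes>\<^bsub>R\<^esub> f x)\<rparr>"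

definition free_gen :: "'r ring \<Rightarrow> 'x \<Rightarrow> 'x \<Rightarrow> 'r" where
  "free_gen R x = (\<lambda>y. if y = x then \<one>\<^bsub>R\<^esub> else \<zero>\<^bsub>R\<^esub>)"

subsection \<open>Tensor products over a commutative ring\<close>

definition tensor_free :: "'r ring \<Rightarrow> ('r, 'm) module \<Rightarrow> ('r, 'n) module \<Rightarrow>
    ('r, 'm \<times> 'n \<Rightarrow> 'r) module" where
  "tensor_free R M N = free_module R (carrier M \<times> carrier N)"

definition tensor_relations :: "'r ring \<Rightarrow> ('r, 'm) module \<Rightarrow> ('r, 'n) module \<Rightarrow>
    ('m \<times> 'n \<Rightarrow> 'r) set" where
  "tensor_relations R M N =
     (let F = tensor_free R M N; e = (\<lambda>x y. free_gen R (x, y)) in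
       {e (x \<oplus>\<^bsub>M\<^esub> x') y \<ominus>\<^bsub>F\<^esub> (e x y \<oplus>\<^bsub>F\<^esub> e x' y) | x x' y.
          x \<in> carrier M \<and> x' \<in> carrier M \<and> y \<in> carrier N} \<union>
       {e x (y \<oplus>\<^bsub>N\<^esub> y') \<ominus>\<^bsub>F\<^esub> (e x y \<oplus>\<^bsub>F\<^esub> e x y') | x y y'.
          x \<in> carrier M \<and> y \<in> carrier N \<and> y' \<in> carrier N} \<union>
       {e (r \<odot>\<^bsub>M\<^esub> x) y \<ominus>\<^bsub>F\<^esub> r \<odot>\<^bsub>F\<^esub> e x y | r x y.
          r \<in> carrier R \<and> x \<in> carrier M \<and> y \<in> carrier N} \<union>
       {e x (r \<odot>\<^bsub>N\<^esub> y) \<ominus>\<^bsub>F\<^esub> r \<odot>\<^bsub>F\<^esub> e x y | r x y.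
          r \<in> carrier R \<and> x \<in> carrier M \<and> y \<in> carrier N})"

definition tensor_null :: "'r ring \<Rightarrow> ('r, 'm) module \<Rightarrow> ('r, 'n) module \<Rightarrow>
    ('m \<times> 'n \<Rightarrow> 'r) set" where
  "tensor_null R M N = submodule_gen R (tensor_free R M N) (tensor_relations R M N)"

definition tensor_module :: "'r ring \<Rightarrow> ('r, 'm) module \<Rightarrow> ('r, 'n) module \<Rightarrow>
    ('r, ('m \<times> 'n \<Rightarrow> 'r) set) module" where
  "tensor_module R M N = quot_module (tensor_free R M N) (tensor_null R M N)"

definition pure_tensor :: "'r ring \<Rightarrow> ('r, 'm) module \<Rightarrow> ('r, 'n) module \<Rightarrow>
    'm \<Rightarrow> 'n \<Rightarrow> ('m \<times> 'n \<Rightarrow> 'r) set" where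
  "pure_tensor R M N x y = tensor_null R M N +>\<^bsub>tensor_free R M N\<^esub> free_gen R (x, y)"

text \<open>The map induced by \<open>h : M \<rightarrow> M'\<close> on tensor products with \<open>N\<close>; it is uniquely determined
  on the carrier, since the pure tensors generate the tensor product.\<close>

definition tensor_map :: "'r ring \<Rightarrow> ('r, 'm) module \<Rightarrow> ('r, 'l) module \<Rightarrow> ('r, 'n) module \<Rightarrow>
    ('m \<Rightarrow> 'l) \<Rightarrow> ('m \<times> 'n \<Rightarrow> 'r) set \<Rightarrow> ('l \<times> 'n \<Rightarrow> 'r) set" where
  "tensor_map R M M' N h =
     (SOME g. g \<in> module_hom R (tensor_module R M N) (tensor_module R M' N) \<and>
        (\<forall>x \<in> carrier M. \<forall>y \<in> carrier N.
           g (pure_tensor R M N x y) = pure_tensor R M' N (h x) y))"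


section \<open>Monoid algebras and graded modules\<close>

text \<open>An element \<open>f\<close> of the monoid algebra is the finite sum of the terms \<open>f x \<cdot> z\<^sup>x\<close>.\<close>

definition monoid_algebra :: "'a monoid \<Rightarrow> ('a \<Rightarrow> 'k::field) ring" where
  "monoid_algebra \<Lambda> =
     \<lparr>carrier = {f. finite {x. f x \<noteq> 0} \<and> {x. f x \<noteq> 0} \<subseteq> carrier \<Lambda>},
      monoid.mult = (\<lambda>f g x. \<Sum>y | f y \<noteq> 0. \<Sum>z | g z \<noteq> 0. if y \<otimes>\<^bsub>\<Lambda>\<^esub> z = x then f y * g z else 0),
      one = (\<lambda>x. if x = \<one>\<^bsub>\<Lambda>\<^esub> then 1 else 0),
      zero = (\<lambda>x. 0),
      add = (\<lambda>f g x. f x + g x)\<rparr>"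

definition monom_elt :: "'k::field \<Rightarrow> 'a \<Rightarrow> 'a \<Rightarrow> 'k" where
  "monom_elt c l = (\<lambda>x. if x = l then c else 0)"

text \<open>A \<open>\<Lambda>\<close>-grading of a module is given by the function sending each degree to the
  corresponding homogeneous component.\<close>

definition regular_component :: "'a monoid \<Rightarrow> 'a \<Rightarrow> ('a \<Rightarrow> 'k::field) set" where
  "regular_component \<Lambda> l = {f \<in> carrier (monoid_algebra \<Lambda>). \<forall>m. f m \<noteq> 0 \<longrightarrow> m = l}"

definition quot_component :: "('r, 'm) module \<Rightarrow> 'm set \<Rightarrow> ('a \<Rightarrow> 'm set) \<Rightarrow> 'a \<Rightarrow> 'm set set" where
  "quot_component M N GM l = {N +>\<^bsub>M\<^esub> x | x. x \<in> GM l}"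

definition tensor_component :: "'a monoid \<Rightarrow> 'r ring \<Rightarrow> ('r, 'm) module \<Rightarrow> ('a \<Rightarrow> 'm set) \<Rightarrow>
    ('r, 'n) module \<Rightarrow> ('a \<Rightarrow> 'n set) \<Rightarrow> 'a \<Rightarrow> ('m \<times> 'n \<Rightarrow> 'r) set set" where
  "tensor_component \<Lambda> R M GM N GN l =
     generate (add_monoid (tensor_module R M N))
       {pure_tensor R M N x y | x y. \<exists>m \<in> carrier \<Lambda>. \<exists>n \<in> carrier \<Lambda>.
          m \<otimes>\<^bsub>\<Lambda>\<^esub> n = l \<and> x \<in> GM m \<and> y \<in> GN n}"

text \<open>The grading of the free module on \<open>B\<close> in which the generator \<open>b\<close> has degree \<open>dg b\<close>.\<close>

definition free_component :: "'a monoid \<Rightarrow> 'b set \<Rightarrow> ('b \<Rightarrow> 'a) \<Rightarrow> 'a \<Rightarrow>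
    ('b \<Rightarrow> 'a \<Rightarrow> 'k::field) set" where
  "free_component \<Lambda> B dg l =
     {f \<in> carrier (free_module (monoid_algebra \<Lambda>) B). \<forall>b m. f b m \<noteq> 0 \<longrightarrow> dg b \<otimes>\<^bsub>\<Lambda>\<^esub> m = l}"

text \<open>The module \<open>K = K[\<Lambda>]/(z\<^sup>l | l \<noteq> 0)\<close> with the induced grading.\<close>

definition irrelevant_ideal :: "'a monoid \<Rightarrow> ('a \<Rightarrow> 'k::field) set" where
  "irrelevant_ideal \<Lambda> =
     Idl\<^bsub>monoid_algebra \<Lambda>\<^esub> {monom_elt 1 l | l. l \<in> carrier \<Lambda> - {\<one>\<^bsub>\<Lambda>\<^esub>}}"

definition residue_module :: "'a monoid \<Rightarrow> ('a \<Rightarrow> 'k::field, ('a \<Rightarrow> 'k) set) module" where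
  "residue_module \<Lambda> = quot_module (regular_module (monoid_algebra \<Lambda>)) (irrelevant_ideal \<Lambda>)"

definition residue_component :: "'a monoid \<Rightarrow> 'a \<Rightarrow> ('a \<Rightarrow> 'k::field) set set" where
  "residue_component \<Lambda> =
     quot_component (regular_module (monoid_algebra \<Lambda>)) (irrelevant_ideal \<Lambda>) (regular_component \<Lambda>)"


section \<open>Graded Tor over a monoid algebra\<close>

text \<open>The data of a graded free resolution
  \<open>\<dots> \<rightarrow> F\<^sub>2 \<rightarrow> F\<^sub>1 \<rightarrow> F\<^sub>0 \<rightarrow> M \<rightarrow> 0\<close>: homogeneous bases, their degrees, the differentials
  \<open>res_diff i : F\<^bsub>i+1\<^esub> \<rightarrow> F\<^bsub>i\<^esub>\<close> and the augmentation \<open>F\<^sub>0 \<rightarrow> M\<close>.\<close>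

record ('a, 'b, 'k, 'm) resolution =
  res_basis :: "nat \<Rightarrow> 'b set"
  res_deg :: "nat \<Rightarrow> 'b \<Rightarrow> 'a"
  res_diff :: "nat \<Rightarrow> ('b \<Rightarrow> 'a \<Rightarrow> 'k) \<Rightarrow> ('b \<Rightarrow> 'a \<Rightarrow> 'k)"
  res_aug :: "('b \<Rightarrow> 'a \<Rightarrow> 'k) \<Rightarrow> 'm"

definition res_module :: "'a monoid \<Rightarrow> ('a, 'b, 'k::field, 'm) resolution \<Rightarrow> nat \<Rightarrow>
    ('a \<Rightarrow> 'k, 'b \<Rightarrow> 'a \<Rightarrow> 'k) module" where
  "res_module \<Lambda> F i = free_module (monoid_algebra \<Lambda>) (res_basis F i)"

definition res_component :: "'a monoid \<Rightarrow> ('a, 'b, 'k::field, 'm) resolution \<Rightarrow> nat \<Rightarrow> 'a \<Rightarrow>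
    ('b \<Rightarrow> 'a \<Rightarrow> 'k) set" where
  "res_component \<Lambda> F i = free_component \<Lambda> (res_basis F i) (res_deg F i)"

definition graded_free_resolution :: "'a monoid \<Rightarrow> ('a \<Rightarrow> 'k::field, 'm) module \<Rightarrow>
    ('a \<Rightarrow> 'm set) \<Rightarrow> ('a, 'b, 'k, 'm) resolution \<Rightarrow> bool" where
  "graded_free_resolution \<Lambda> M GM F \<longleftrightarrow>
     (\<forall>i. res_deg F i \<in> res_basis F i \<rightarrow> carrier \<Lambda>) \<and>
     (\<forall>i. res_diff F i \<in>
        module_hom (monoid_algebra \<Lambda>) (res_module \<Lambda> F (Suc i)) (res_module \<Lambda> F i)) \<and>
     res_aug F \<in> module_hom (monoid_algebra \<Lambda>) (res_module \<Lambda> F 0) M \<and>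
     (\<forall>i. \<forall>l \<in> carrier \<Lambda>.
        res_diff F i ` res_component \<Lambda> F (Suc i) l \<subseteq> res_component \<Lambda> F i l) \<and>
     (\<forall>l \<in> carrier \<Lambda>. res_aug F ` res_component \<Lambda> F 0 l \<subseteq> GM l) \<and>
     res_aug F ` carrier (res_module \<Lambda> F 0) = carrier M \<and>
     a_kernel (res_module \<Lambda> F 0) M (res_aug F)
       = res_diff F 0 ` carrier (res_module \<Lambda> F (Suc 0)) \<and>
     (\<forall>i. a_kernel (res_module \<Lambda> F (Suc i)) (res_module \<Lambda> F i) (res_diff F i)
       = res_diff F (Suc i) ` carrier (res_module \<Lambda> F (Suc (Suc i))))"

text \<open>The bar resolution of \<open>M\<close> over \<open>K[\<Lambda>]\<close> has in position \<open>i\<close> a homogeneous basis indexed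
  by pairs of a list of \<open>i\<close> elements of \<open>\<Lambda>\<close> and an element of a homogeneous \<open>K\<close>-basis of \<open>M\<close>.
  Therefore the index type \<open>'a list \<times> 'm\<close> is large enough for a resolution to exist.\<close>

definition some_resolution :: "'a monoid \<Rightarrow> ('a \<Rightarrow> 'k::field, 'm) module \<Rightarrow> ('a \<Rightarrow> 'm set) \<Rightarrow>
    ('a, 'a list \<times> 'm, 'k, 'm) resolution" where
  "some_resolution \<Lambda> M GM = (SOME F. graded_free_resolution \<Lambda> M GM F)"

text \<open>The complex \<open>F \<otimes> N\<close>, whose differential \<open>res_tensor_diff i\<close> goes from position
  \<open>i + 1\<close> to position \<open>i\<close>, and its homogeneous cycles and boundaries.\<close>

definition res_tensor :: "'a monoid \<Rightarrow> ('a, 'b, 'k::field, 'm) resolution \<Rightarrow>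
    ('a \<Rightarrow> 'k, 'n) module \<Rightarrow> nat \<Rightarrow>
    ('a \<Rightarrow> 'k, (('b \<Rightarrow> 'a \<Rightarrow> 'k) \<times> 'n \<Rightarrow> 'a \<Rightarrow> 'k) set) module" where
  "res_tensor \<Lambda> F N i = tensor_module (monoid_algebra \<Lambda>) (res_module \<Lambda> F i) N"

definition res_tensor_diff :: "'a monoid \<Rightarrow> ('a, 'b, 'k::field, 'm) resolution \<Rightarrow>
    ('a \<Rightarrow> 'k, 'n) module \<Rightarrow> nat \<Rightarrow>
    (('b \<Rightarrow> 'a \<Rightarrow> 'k) \<times> 'n \<Rightarrow> 'a \<Rightarrow> 'k) set \<Rightarrow> (('b \<Rightarrow> 'a \<Rightarrow> 'k) \<times> 'n \<Rightarrow> 'a \<Rightarrow> 'k) set" where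
  "res_tensor_diff \<Lambda> F N i =
     tensor_map (monoid_algebra \<Lambda>) (res_module \<Lambda> F (Suc i)) (res_module \<Lambda> F i) N (res_diff F i)"

definition res_tensor_component :: "'a monoid \<Rightarrow> ('a, 'b, 'k::field, 'm) resolution \<Rightarrow>
    ('a \<Rightarrow> 'k, 'n) module \<Rightarrow> ('a \<Rightarrow> 'n set) \<Rightarrow> nat \<Rightarrow> 'a \<Rightarrow>
    (('b \<Rightarrow> 'a \<Rightarrow> 'k) \<times> 'n \<Rightarrow> 'a \<Rightarrow> 'k) set set" where
  "res_tensor_component \<Lambda> F N GN i =
     tensor_component \<Lambda> (monoid_algebra \<Lambda>) (res_module \<Lambda> F i) (res_component \<Lambda> F i) N GN"

definition res_cycles :: "'a monoid \<Rightarrow> ('a, 'b, 'k::field, 'm) resolution \<Rightarrow>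
    ('a \<Rightarrow> 'k, 'n) module \<Rightarrow> ('a \<Rightarrow> 'n set) \<Rightarrow> nat \<Rightarrow> 'a \<Rightarrow>
    (('b \<Rightarrow> 'a \<Rightarrow> 'k) \<times> 'n \<Rightarrow> 'a \<Rightarrow> 'k) set set" where
  "res_cycles \<Lambda> F N GN i l =
     {u \<in> res_tensor_component \<Lambda> F N GN i l.
        \<forall>j. i = Suc j \<longrightarrow> res_tensor_diff \<Lambda> F N j u = \<zero>\<^bsub>res_tensor \<Lambda> F N j\<^esub>}"

definition res_boundaries :: "'a monoid \<Rightarrow> ('a, 'b, 'k::field, 'm) resolution \<Rightarrow>
    ('a \<Rightarrow> 'k, 'n) module \<Rightarrow> ('a \<Rightarrow> 'n set) \<Rightarrow> nat \<Rightarrow> 'a \<Rightarrow>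
    (('b \<Rightarrow> 'a \<Rightarrow> 'k) \<times> 'n \<Rightarrow> 'a \<Rightarrow> 'k) set set" where
  "res_boundaries \<Lambda> F N GN i l =
     res_tensor_diff \<Lambda> F N i ` res_tensor_component \<Lambda> F N GN (Suc i) l"

text \<open>A subset \<open>V\<close> of a \<open>K[\<Lambda>]\<close>-module, viewed as a vector space over \<open>K\<close> through the
  constants \<open>c \<cdot> z\<^sup>0\<close>.\<close>

definition K_space :: "'a monoid \<Rightarrow> ('a \<Rightarrow> 'k::field, 'm) module \<Rightarrow> 'm set \<Rightarrow> ('k, 'm) module" where
  "K_space \<Lambda> M V = \<lparr>carrier = V, monoid.mult = undefined, one = undefined, zero = zero M, add = add M,
     smult = (\<lambda>c x. monom_elt c \<one>\<^bsub>\<Lambda>\<^esub> \<odot>\<^bsub>M\<^esub> x)\<rparr>"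

definition Tor :: "'a monoid \<Rightarrow> ('a \<Rightarrow> 'k::field, 'm) module \<Rightarrow> ('a \<Rightarrow> 'm set) \<Rightarrow>
    ('a \<Rightarrow> 'k, 'n) module \<Rightarrow> ('a \<Rightarrow> 'n set) \<Rightarrow> nat \<Rightarrow> 'a \<Rightarrow>
    ('k, (('a list \<times> 'm \<Rightarrow> 'a \<Rightarrow> 'k) \<times> 'n \<Rightarrow> 'a \<Rightarrow> 'k) set set) module" where
  "Tor \<Lambda> M GM N GN i l =
     (let F = some_resolution \<Lambda> M GM in
       quot_module (K_space \<Lambda> (res_tensor \<Lambda> F N i) (res_cycles \<Lambda> F N GN i l))
         (res_boundaries \<Lambda> F N GN i l))"

text \<open>The dimension of a vector space that has a finite basis (unspecified otherwise); a basis is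
  a set in terms of which each vector has exactly one expression as a linear combination.\<close>

definition vs_basis :: "('k::field, 'v) module \<Rightarrow> 'v set \<Rightarrow> bool" where
  "vs_basis V B \<longleftrightarrow> finite B \<and> B \<subseteq> carrier V \<and>
     (\<forall>v \<in> carrier V. \<exists>!c. c \<in> B \<rightarrow>\<^sub>E UNIV \<and> v = (\<Oplus>\<^bsub>V\<^esub> b \<in> B. c b \<odot>\<^bsub>V\<^esub> b))"

definition vs_dim :: "('k::field, 'v) module \<Rightarrow> nat" where
  "vs_dim V = (THE n. \<exists>B. vs_basis V B \<and> card B = n)"


section \<open>Poincare series\<close>

text \<open>The formal series over \<open>M\<close>: the coefficient of \<open>t\<^sup>i z\<^sup>g\<close> in \<open>f\<close> is \<open>f i g\<close>. The inner
  sum in the product is finite when \<open>M\<close> is an affine monoid.\<close>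

definition series_ring :: "'g monoid \<Rightarrow> (nat \<Rightarrow> 'g \<Rightarrow> int) ring" where
  "series_ring M =
     \<lparr>carrier = {f. \<forall>i g. g \<notin> carrier M \<longrightarrow> f i g = 0},
      monoid.mult = (\<lambda>f f' i g. \<Sum>j\<le>i.
        \<Sum>(x, y) \<in> {(x, y). x \<in> carrier M \<and> y \<in> carrier M \<and> x \<otimes>\<^bsub>M\<^esub> y = g}. f j x * f' (i - j) y),
      one = (\<lambda>i g. if i = 0 \<and> g = \<one>\<^bsub>M\<^esub> then 1 else 0),
      zero = (\<lambda>i g. 0),
      add = (\<lambda>f f' i g. f i g + f' i g)\<rparr>"

definition series_monom :: "nat \<Rightarrow> 'g \<Rightarrow> nat \<Rightarrow> 'g \<Rightarrow> int" where
  "series_monom j x = (\<lambda>i g. if i = j \<and> g = x then 1 else 0)"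

text \<open>The series obtained by replacing each \<open>z\<^sup>l\<close> with \<open>z\<close> to the power \<open>h l\<close>, for \<open>h\<close>
  injective on the carrier.\<close>

definition series_map :: "'a monoid \<Rightarrow> ('a \<Rightarrow> 'g) \<Rightarrow> (nat \<Rightarrow> 'a \<Rightarrow> int) \<Rightarrow> nat \<Rightarrow> 'g \<Rightarrow> int" where
  "series_map \<Lambda> h f = (\<lambda>i g. \<Sum>l | l \<in> carrier \<Lambda> \<and> h l = g. f i l)"

definition poincare_series :: "'k::field itself \<Rightarrow> 'a monoid \<Rightarrow> nat \<Rightarrow> 'a \<Rightarrow> int" where
  "poincare_series K \<Lambda> = (\<lambda>i l. if l \<in> carrier \<Lambda>
     then int (vs_dim (Tor \<Lambda>
       (residue_module \<Lambda> :: ('a \<Rightarrow> 'k, _) module) (residue_component \<Lambda>)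
       (residue_module \<Lambda> :: ('a \<Rightarrow> 'k, _) module) (residue_component \<Lambda>) i l))
     else 0)"

end

theory Submission
  imports Complex_Main "HOL-Library.Poly_Mapping" Defs
begin

text \<open>Put \<open>R = K[\<Lambda>]\<close> and \<open>R' = K[\<Lambda>[\<rho>/r]]\<close>. Then \<open>R' = R[x]/(x\<^sup>r - z\<^sup>\<rho>)\<close>, where \<open>x\<close> stands for
  the monomial of \<open>\<rho>/r\<close>. From a free resolution \<open>F\<close> of \<open>K\<close> over \<open>R\<close> Tate's method of killing cycles
  gives the resolution \<open>F \<otimes> R'\<langle>X, Y\<rangle>\<close> of \<open>K\<close> over \<open>R'\<close>, in which \<open>X\<close> is an exterior variable of homological
  degree \<open>1\<close> and inner degree \<open>\<rho>/r\<close>, and \<open>Y\<close> a divided power variable of homological degree \<open>2\<close> and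
  inner degree \<open>\<rho>\<close>. The differential sends \<open>X\<close> to \<open>x\<close>, and it sends \<open>Y\<close> to \<open>x\<^bsup>r-1\<^esup> X - z\<^bsup>u'\<^esup> h\<close>, where
  \<open>\<rho> = u + u'\<close> is a decomposition into two non-zero elements and \<open>h\<close> is a homotopy on \<open>F\<close> from the
  multiplication by \<open>z\<^sup>u\<close> to zero. The coefficients \<open>x\<close>, \<open>x\<^bsup>r-1\<^esup>\<close> and \<open>z\<^bsup>u'\<^esup>\<close> all lie in the maximal ideal,
  the second one since \<open>r \<ge> 2\<close> and the third one since \<open>\<rho>\<close> is reducible. Modulo the maximal ideal the
  resolution therefore splits into shifted copies of \<open>F \<otimes> K\<close>, one for each monomial \<open>X\<^sup>e Y\<^bsup>(j)\<^esup>\<close>, and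
  these monomials have the generating function \<open>(1 + t z\<^bsup>\<rho>/r\<^esup>)/(1 - t\<^sup>2 z\<^sup>\<rho>)\<close>. The formula for \<open>r = 2\<close>
  follows from \<open>1 - t\<^sup>2 z\<^sup>\<rho> = (1 - t z\<^bsup>\<rho>/2\<^esup>)(1 + t z\<^bsup>\<rho>/2\<^esup>)\<close>.

  Resolutions are handled through their strands. The part of degree \<open>l\<close> of a graded free module has as its
  \<open>K\<close>-basis the basis elements whose degree divides \<open>l\<close>, each with the one monomial that fills up the degree.
  Forgetting these monomials turns a graded free resolution into one vector space per homological
  degree with a linear differential, filtered by the divisors of \<open>l\<close>, and exactness is required in each
  strand (\<open>strand_resolution\<close>). All monomials become \<open>1\<close>: the differential of \<open>X\<close> is \<open>1\<close>, and \<open>h\<close>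
  contracts the complex. Tensoring with the residue field keeps the basis elements of degree exactly
  \<open>l\<close>, so the Betti numbers are dimensions of the homology of the complexes spanned by these
  (\<open>hom_dim\<close>).

  The proof has four parts. Two strand resolutions over the same monoid have the same homology after
  reduction (\<open>tor_comparison\<close>). The chains in the divisibility order form such a resolution for \<open>\<Lambda>\<close>
  (\<open>bar\<close>), with \<open>h\<close> a prism operator (\<open>bdry_prism\<close>); Tate's construction turns it into one for
  \<open>\<Lambda>[\<rho>/r]\<close> (\<open>tate\<close>), whose Betti numbers satisfy the expected recursion (\<open>tate_betti_split\<close>). The
  graded components of \<open>Tor\<close>, with their tensor products and quotients, have the dimensions that are computed
  from any strand resolution (\<open>tor_vs_dim\<close>), and a graded free resolution exists with basis elements of
  the required type (\<open>some_resolution_exists\<close>). The recursion is an equation in the ring of formal series,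
  where \<open>1 - t\<^sup>2 z\<^sup>\<rho>\<close> is a unit (\<open>poincare_recursion\<close>, \<open>one_minus_monom_unit\<close>).\<close>

section \<open>Vector spaces with a basis\<close>

abbreviation lookup :: "('b \<Rightarrow>\<^sub>0 'k::zero) \<Rightarrow> 'b \<Rightarrow> 'k" where
  "lookup \<equiv> Poly_Mapping.lookup"

abbreviation keys :: "('b \<Rightarrow>\<^sub>0 'k::zero) \<Rightarrow> 'b set" where
  "keys \<equiv> Poly_Mapping.keys"

definition scl :: "'k::field \<Rightarrow> ('b \<Rightarrow>\<^sub>0 'k) \<Rightarrow> ('b \<Rightarrow>\<^sub>0 'k)" where
  "scl c v = Poly_Mapping.map ((*) c) v"

lemma lookup_scl [simp]: "lookup (scl c v) b = c * lookup v b"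
  by (simp add: scl_def Poly_Mapping.map.rep_eq when_def)

interpretation vs: vector_space "scl :: 'k::field \<Rightarrow> ('b \<Rightarrow>\<^sub>0 'k) \<Rightarrow> ('b \<Rightarrow>\<^sub>0 'k)"
  by standard (auto intro!: poly_mapping_eqI simp: lookup_add algebra_simps)

interpretation vsp: vector_space_pair
    "scl :: 'k::field \<Rightarrow> ('b \<Rightarrow>\<^sub>0 'k) \<Rightarrow> ('b \<Rightarrow>\<^sub>0 'k)" "scl :: 'k \<Rightarrow> ('c \<Rightarrow>\<^sub>0 'k) \<Rightarrow> ('c \<Rightarrow>\<^sub>0 'k)"
  ..

abbreviation lin :: "(('b \<Rightarrow>\<^sub>0 'k::field) \<Rightarrow> ('c \<Rightarrow>\<^sub>0 'k)) \<Rightarrow> bool" where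
  "lin \<equiv> Vector_Spaces.linear scl scl"

abbreviation bvec :: "'b \<Rightarrow> ('b \<Rightarrow>\<^sub>0 'k::field)" where
  "bvec b \<equiv> Poly_Mapping.single b 1"

lemma linI:
  "(\<And>u v. f (u + v) = f u + f v) \<Longrightarrow> (\<And>c v. f (scl c v) = scl c (f v)) \<Longrightarrow> lin f"
  unfolding Vector_Spaces.linear_iff by (simp add: vs.vector_space_axioms)

lemma lin_add: "lin f \<Longrightarrow> f (u + v) = f u + f v"
  and lin_scl: "lin f \<Longrightarrow> f (scl c v) = scl c (f v)"
  and lin_diff: "lin f \<Longrightarrow> f (u - v) = f u - f v"
  and lin_minus: "lin f \<Longrightarrow> f (- v) = - f v"
  and lin_0: "lin f \<Longrightarrow> f 0 = 0"
  by (simp_all add: vsp.linear_add vsp.linear_scale vsp.linear_diff vsp.linear_neg vsp.linear_0)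

lemmas lin_simps = lin_add lin_scl lin_diff lin_minus lin_0

lemma lin_sum: "lin f \<Longrightarrow> f (\<Sum>a\<in>A. g a) = (\<Sum>a\<in>A. f (g a))"
  by (rule vsp.linear_sum)

lemma lin_compose: "lin f \<Longrightarrow> lin g \<Longrightarrow> lin (\<lambda>v. f (g v))"
  and lin_plus: "lin f \<Longrightarrow> lin h \<Longrightarrow> lin (\<lambda>v. f v + h v)"
  and lin_minus': "lin f \<Longrightarrow> lin h \<Longrightarrow> lin (\<lambda>v. f v - h v)"
  and lin_uminus: "lin f \<Longrightarrow> lin (\<lambda>v. - f v)"
  and lin_id: "lin (\<lambda>v. v)"
  and lin_zero: "lin (\<lambda>v. 0)"
  by (rule linI; simp add: lin_simps vs.scale_right_distrib vs.scale_right_diff_distrib)+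

lemma sum_bvec: "(\<Sum>b\<in>keys v. scl (lookup v b) (bvec b)) = v"
  by (rule poly_mapping_eqI)
    (simp add: lookup_sum lookup_single when_def if_distrib not_in_keys_iff_lookup_eq_zero cong: if_cong)

lemma scl_bvec: "scl c (bvec b) = Poly_Mapping.single b c"
  by (rule poly_mapping_eqI) (simp add: lookup_single when_def)

text \<open>To check that all images of vectors supported on some set lie in a subspace it is enough to look at basis
  vectors; this replaces induction on the support.\<close>

lemma lin_in_subspace:
  assumes "lin f" "vs.subspace S" "\<And>b. b \<in> keys v \<Longrightarrow> f (bvec b) \<in> S"
  shows "f v \<in> S"
proof -
  have "f v = (\<Sum>b\<in>keys v. scl (lookup v b) (f (bvec b)))"
    by (subst sum_bvec [of v, symmetric]) (simp only: lin_sum [OF assms(1)] lin_scl [OF assms(1)])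
  then show ?thesis
    using assms by (auto intro!: vs.subspace_sum vs.subspace_scale)
qed

lemma lin_eqI:
  assumes "lin f" "lin g" "\<And>b. b \<in> keys v \<Longrightarrow> f (bvec b) = g (bvec b)"
  shows "f v = g v"
  using lin_in_subspace [OF lin_minus' [OF assms(1,2)] vs.subspace_single_0, of v] assms(3) by simp

definition lext :: "('b \<Rightarrow> ('c \<Rightarrow>\<^sub>0 'k::field)) \<Rightarrow> ('b \<Rightarrow>\<^sub>0 'k) \<Rightarrow> ('c \<Rightarrow>\<^sub>0 'k)" where
  "lext f v = (\<Sum>b\<in>keys v. scl (lookup v b) (f b))"

lemma lext_superset:
  "finite X \<Longrightarrow> keys v \<subseteq> X \<Longrightarrow> lext f v = (\<Sum>b\<in>X. scl (lookup v b) (f b))"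
  unfolding lext_def
  by (rule sum.mono_neutral_left) (auto simp: not_in_keys_iff_lookup_eq_zero)

lemma lin_lext [intro!]:
  fixes f :: "'b \<Rightarrow> ('c \<Rightarrow>\<^sub>0 'k::field)"
  shows "lin (lext f)"
proof (rule linI)
  fix u v :: "'b \<Rightarrow>\<^sub>0 'k" and c :: 'k
  let ?X = "keys u \<union> keys v"
  show "lext f (u + v) = lext f u + lext f v"
    using Poly_Mapping.keys_add [of u v]
    by (simp add: lext_superset [of ?X] lookup_add vs.scale_left_distrib sum.distrib)
  have "keys (scl c v) \<subseteq> keys v"
    by (auto simp: in_keys_iff)
  then show "lext f (scl c v) = scl c (lext f v)"
    by (simp add: lext_superset [of "keys v"] vs.scale_sum_right)
qed

lemma lext_bvec [simp]: "lext f (bvec b) = f b"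
  by (simp add: lext_def)

lemma lext_single: "lext f (Poly_Mapping.single b c) = scl c (f b)"
  using lin_scl [OF lin_lext, of f c "bvec b"] by (simp add: scl_bvec)

subsection \<open>Vectors supported on part of the basis\<close>

definition supp_in :: "'b set \<Rightarrow> ('b \<Rightarrow>\<^sub>0 'k::field) set" where
  "supp_in X = {v. keys v \<subseteq> X}"

lemma subspace_supp_in: "vs.subspace (supp_in X :: ('b \<Rightarrow>\<^sub>0 'k::field) set)"
proof (rule vs.subspaceI)
  fix u v :: "'b \<Rightarrow>\<^sub>0 'k" and c :: 'k
  show "u \<in> supp_in X \<Longrightarrow> v \<in> supp_in X \<Longrightarrow> u + v \<in> supp_in X"
    using Poly_Mapping.keys_add [of u v] by (auto simp: supp_in_def)
  show "u \<in> supp_in X \<Longrightarrow> scl c u \<in> supp_in X"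
    by (auto simp: supp_in_def in_keys_iff)
qed (simp add: supp_in_def)

lemma bvec_supp_in [simp]: "bvec b \<in> supp_in X \<longleftrightarrow> b \<in> X"
  by (simp add: supp_in_def)

lemma supp_in_mono: "v \<in> supp_in X \<Longrightarrow> X \<subseteq> Y \<Longrightarrow> v \<in> supp_in Y"
  by (auto simp: supp_in_def)

lemma lin_supp_in:
  "lin f \<Longrightarrow> v \<in> supp_in X \<Longrightarrow> (\<And>b. b \<in> X \<Longrightarrow> f (bvec b) \<in> supp_in Y) \<Longrightarrow> f v \<in> supp_in Y"
  by (rule lin_in_subspace [OF _ subspace_supp_in]) (auto simp: supp_in_def)

lemma lin_eq_supp_in:
  "lin f \<Longrightarrow> lin g \<Longrightarrow> v \<in> supp_in X \<Longrightarrow> (\<And>b. b \<in> X \<Longrightarrow> f (bvec b) = g (bvec b)) \<Longrightarrow> f v = g v"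
  by (rule lin_eqI) (auto simp: supp_in_def)

definition restr :: "'b set \<Rightarrow> ('b \<Rightarrow>\<^sub>0 'k::field) \<Rightarrow> ('b \<Rightarrow>\<^sub>0 'k)" where
  "restr X = lext (\<lambda>b. if b \<in> X then bvec b else 0)"

lemma lin_restr [intro!]: "lin (restr X)"
  unfolding restr_def by (rule lin_lext)

lemma lookup_restr: "lookup (restr X v) b = (if b \<in> X then lookup v b else 0)"
proof (cases "b \<in> keys v")
  case True
  have "lookup (restr X v) b = (\<Sum>a\<in>keys v. if a = b then (if b \<in> X then lookup v b else 0) else 0)"
    unfolding restr_def lext_def lookup_sum by (rule sum.cong) (auto simp: lookup_single when_def)
  with True show ?thesis by simp
next
  case False
  have "lookup (restr X v) b = (\<Sum>a\<in>keys v. 0)"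
    unfolding restr_def lext_def lookup_sum
    by (rule sum.cong) (use False in \<open>auto simp: lookup_single when_def\<close>)
  with False show ?thesis by (simp add: not_in_keys_iff_lookup_eq_zero)
qed

lemma restr_in [simp]: "restr X v \<in> supp_in X"
  by (auto simp: supp_in_def in_keys_iff lookup_restr split: if_splits)

lemma restr_id: "v \<in> supp_in X \<Longrightarrow> restr X v = v"
  by (rule poly_mapping_eqI) (auto simp: lookup_restr supp_in_def in_keys_iff)

lemma restr_eq_0: "v \<in> supp_in Y \<Longrightarrow> X \<inter> Y = {} \<Longrightarrow> restr X v = 0"
  by (rule poly_mapping_eqI) (auto simp: lookup_restr supp_in_def in_keys_iff)

subsection \<open>Dimensions\<close>

text \<open>The whole space may be infinite-dimensional, so that dimensions are meaningful only for the subspaces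
  of the span of finitely many basis vectors.\<close>

lemma finite_dim_supp_in:
  assumes "finite X" "vs.subspace S" "S \<subseteq> supp_in X"
  obtains b where "b \<subseteq> S" "vs.independent b" "vs.span b = S" "finite b" "card b = vs.dim S"
proof -
  obtain b where b: "b \<subseteq> S" "vs.independent b" "S \<subseteq> vs.span b" "card b = vs.dim S"
    using vs.basis_exists [of S] .
  have "supp_in X \<subseteq> vs.span ((bvec :: 'a \<Rightarrow> _ \<Rightarrow>\<^sub>0 'b) ` X)"
  proof
    fix v :: "'a \<Rightarrow>\<^sub>0 'b" assume v: "v \<in> supp_in X"
    show "v \<in> vs.span (bvec ` X)"
      by (rule lin_in_subspace [OF lin_id vs.subspace_span])
        (use v in \<open>auto simp: supp_in_def intro!: vs.span_base\<close>)
  qed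
  with assms b(1) have "b \<subseteq> vs.span (bvec ` X)"
    by auto
  then have "finite b"
    using vs.independent_span_bound [of "bvec ` X" b] assms(1) b(2) by auto
  moreover have "vs.span b = S"
    using b assms(2) vs.span_minimal by blast
  ultimately show thesis
    using b that by blast
qed

lemma dim_inj_image:
  assumes "lin f" "inj_on f S" "vs.subspace S"
  shows "vs.dim (f ` S) = vs.dim S"
proof -
  obtain b where b: "b \<subseteq> S" "vs.independent b" "S \<subseteq> vs.span b" "card b = vs.dim S"
    using vs.basis_exists [of S] .
  have sp: "vs.span b = S"
    using b assms(3) vs.span_minimal by blast
  have "vs.independent (f ` b)"
    using assms b(2) sp by (intro vsp.linear_independent_injective_image) auto
  moreover have "vs.span (f ` b) = f ` S"
    using vsp.linear_span_image [OF assms(1)] sp by simp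
  ultimately have "vs.dim (f ` S) = card (f ` b)"
    by (metis vs.dim_span_eq_card_independent)
  then show ?thesis
    using b assms(2) by (simp add: card_image inj_on_subset)
qed

lemma dim_direct_sum:
  assumes "vs.subspace S" "S \<subseteq> supp_in X" "vs.subspace T" "T \<subseteq> supp_in Y" "X \<inter> Y = {}"
    "finite X" "finite Y"
  shows "vs.dim {u + v | u v. u \<in> S \<and> v \<in> T} = vs.dim S + vs.dim T"
proof -
  obtain b where b: "b \<subseteq> S" "vs.independent b" "vs.span b = S" "finite b" "card b = vs.dim S"
    using finite_dim_supp_in [OF assms(6,1,2)] .
  obtain c where c: "c \<subseteq> T" "vs.independent c" "vs.span c = T" "finite c" "card c = vs.dim T"
    using finite_dim_supp_in [OF assms(7,3,4)] .
  have disj: "w = 0" if "w \<in> S" "w \<in> T" for w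
    using that assms(2,4,5) by (intro poly_mapping_eqI) (auto simp: supp_in_def in_keys_iff subset_iff disjoint_iff)
  have "0 \<notin> b"
    using b(2) vs.dependent_zero by blast
  then have bc: "b \<inter> c = {}"
    using disj b(1) c(1) by auto
  have "vs.independent (b \<union> c)"
  proof (rule vs.independent_if_scalars_zero)
    fix f x assume z: "(\<Sum>x\<in>b \<union> c. scl (f x) x) = 0" and x: "x \<in> b \<union> c"
    define u where "u = (\<Sum>x\<in>b. scl (f x) x)"
    define w where "w = (\<Sum>x\<in>c. scl (f x) x)"
    have uS: "u \<in> S" and wT: "w \<in> T"
      unfolding u_def w_def using b(1) c(1) assms(1,3) by (auto intro!: vs.subspace_sum vs.subspace_scale)
    have "u + w = 0"
      using z b(4) c(4) bc by (simp add: sum.union_disjoint u_def w_def)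
    then have uw: "u = - w" "w = - u"
      by (auto simp: eq_neg_iff_add_eq_0 add.commute)
    have "u = 0" "w = 0"
      using disj uS wT uw assms(1,3) vs.subspace_neg by metis+
    then show "f x = 0"
      using x b(2,4) c(2,4) unfolding u_def w_def vs.dependent_finite [OF b(4)] vs.dependent_finite [OF c(4)]
      by blast
  qed (use b c in auto)
  moreover have "vs.span (b \<union> c) = {u + v | u v. u \<in> S \<and> v \<in> T}"
    by (simp add: vs.span_Un b c)
  ultimately have "vs.dim {u + v | u v. u \<in> S \<and> v \<in> T} = card (b \<union> c)"
    by (metis vs.dim_span_eq_card_independent)
  then show ?thesis
    using b c bc by (simp add: card_Un_disjoint)
qed


section \<open>Strands of graded free resolutions\<close>

locale reduced_monoid = comm_monoid_cancel G for G (structure) +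
  assumes no_invertibles:
    "x \<in> carrier G \<Longrightarrow> y \<in> carrier G \<Longrightarrow> x \<otimes> y = \<one> \<Longrightarrow> x = \<one> \<and> y = \<one>"
begin

lemma divides_antisym:
  assumes "x divides y" "y divides x" "x \<in> carrier G" "y \<in> carrier G"
  shows "x = y"
proof -
  obtain c d where c: "c \<in> carrier G" "y = x \<otimes> c" and d: "d \<in> carrier G" "x = y \<otimes> d"
    using assms(1,2) by (auto simp: factor_def)
  have "x \<otimes> (c \<otimes> d) = y \<otimes> d"
    using m_assoc [of x c d] c d(1) assms(3) by simp
  then have "x \<otimes> (c \<otimes> d) = x \<otimes> \<one>"
    using assms d(2) by simp
  then have "c \<otimes> d = \<one>"
    using assms c d by (metis l_cancel m_closed one_closed)
  then have "c = \<one>"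
    using no_invertibles c(1) d(1) by blast
  then show ?thesis
    using c(2) assms(3) by simp
qed

lemma divides_one: "x divides \<one> \<Longrightarrow> x \<in> carrier G \<Longrightarrow> x = \<one>"
  by (metis factor_def no_invertibles)

end

text \<open>The basis elements that contribute to the strand of \<open>l\<close>, and those that survive in it after
  reduction modulo the maximal ideal.\<close>

definition below :: "('a, 'm) monoid_scheme \<Rightarrow> (nat \<Rightarrow> 'b set) \<Rightarrow> (nat \<Rightarrow> 'b \<Rightarrow> 'a) \<Rightarrow> nat \<Rightarrow> 'a \<Rightarrow> 'b set" where
  "below G B dg n l = {b \<in> B n. dg n b divides\<^bsub>G\<^esub> l}"

definition at_deg :: "(nat \<Rightarrow> 'b set) \<Rightarrow> (nat \<Rightarrow> 'b \<Rightarrow> 'a) \<Rightarrow> nat \<Rightarrow> 'a \<Rightarrow> 'b set" where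
  "at_deg B dg n l = {b \<in> B n. dg n b = l}"

text \<open>In homological degree \<open>0\<close> the cycles are the kernel of the augmentation onto \<open>K\<close>, which is non-zero
  only in the strand of the neutral element.\<close>

definition strand_cycles where
  "strand_cycles G B dg d \<eta> n l =
     {v \<in> supp_in (below G B dg n l).
        case n of 0 \<Rightarrow> l = \<one>\<^bsub>G\<^esub> \<longrightarrow> \<eta> v = 0 | Suc m \<Rightarrow> d m v = 0}"

text \<open>A graded free resolution of the residue field with the monomial coefficients forgotten: one differential
  serves all strands at once, because the inclusion of a strand into that of a multiple is the
  multiplication by a monomial.\<close>

locale strand_resolution = reduced_monoid G for G (structure) +
  fixes B :: "nat \<Rightarrow> 'b set" and dg :: "nat \<Rightarrow> 'b \<Rightarrow> 'a"
    and d :: "nat \<Rightarrow> ('b \<Rightarrow>\<^sub>0 'k::field) \<Rightarrow> ('b \<Rightarrow>\<^sub>0 'k)" and \<eta> :: "('b \<Rightarrow>\<^sub>0 'k) \<Rightarrow> 'k"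
  assumes dg_closed: "b \<in> B n \<Longrightarrow> dg n b \<in> carrier G"
    and lin_d: "lin (d n)"
    and aug_add: "\<eta> (u + v) = \<eta> u + \<eta> v"
    and aug_scl: "\<eta> (scl c v) = c * \<eta> v"
    and aug_onto: "\<exists>v \<in> supp_in (below G B dg 0 \<one>). \<eta> v = 1"
    and exact: "l \<in> carrier G \<Longrightarrow>
      d n ` supp_in (below G B dg (Suc n) l) = strand_cycles G B dg d \<eta> n l"
begin

abbreviation strand :: "nat \<Rightarrow> 'a \<Rightarrow> ('b \<Rightarrow>\<^sub>0 'k) set" where
  "strand n l \<equiv> supp_in (below G B dg n l)"

abbreviation cyc :: "nat \<Rightarrow> 'a \<Rightarrow> ('b \<Rightarrow>\<^sub>0 'k) set" where
  "cyc \<equiv> strand_cycles G B dg d \<eta>"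

lemma bvec_strand: "b \<in> B n \<Longrightarrow> bvec b \<in> strand n (dg n b)"
  by (simp add: below_def dg_closed)

lemma cyc_strand: "v \<in> cyc n l \<Longrightarrow> v \<in> strand n l"
  by (simp add: strand_cycles_def)

lemma cyc_d: "v \<in> cyc (Suc n) l \<Longrightarrow> d n v = 0"
  by (simp add: strand_cycles_def)

lemma cycI: "v \<in> strand (Suc n) l \<Longrightarrow> d n v = 0 \<Longrightarrow> v \<in> cyc (Suc n) l"
  by (simp add: strand_cycles_def)

lemma strand_mono:
  "l divides l' \<Longrightarrow> l \<in> carrier G \<Longrightarrow> l' \<in> carrier G \<Longrightarrow> v \<in> strand n l \<Longrightarrow> v \<in> strand n l'"
  by (erule supp_in_mono) (auto simp: below_def dg_closed intro: divides_trans)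

lemma lin_strand:
  assumes "lin f" "\<And>b. b \<in> X \<Longrightarrow> f (bvec b) \<in> strand n (deg b)" "\<And>b. b \<in> X \<Longrightarrow> deg b \<in> carrier G"
    and "l \<in> carrier G" "v \<in> supp_in {b \<in> X. deg b divides l}"
  shows "f v \<in> strand n l"
proof (rule lin_in_subspace [OF assms(1) subspace_supp_in])
  fix b assume "b \<in> keys v"
  with assms(5) have "b \<in> X" "deg b divides l"
    by (auto simp: supp_in_def)
  then show "f (bvec b) \<in> strand n l"
    using strand_mono [of "deg b" l] assms(2-4) by blast
qed

lemma d_strand: "v \<in> strand (Suc n) l \<Longrightarrow> l \<in> carrier G \<Longrightarrow> d n v \<in> strand n l"
  using exact [of l n] cyc_strand by blast

lemma d_d_bvec: "b \<in> B (Suc (Suc n)) \<Longrightarrow> d n (d (Suc n) (bvec b)) = 0"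
  using exact [of "dg (Suc (Suc n)) b" "Suc n"] bvec_strand [of b "Suc (Suc n)"] dg_closed [of b]
  by (blast intro: cyc_d)

lemma aug_d: "v \<in> strand (Suc 0) \<one> \<Longrightarrow> \<eta> (d 0 v) = 0"
  using exact [of \<one> 0] by (auto simp: strand_cycles_def)

text \<open>By exactness each cycle has a preimage in its own strand. Since the domain is free on \<open>X\<close>, preimages
  can be chosen for the basis elements separately.\<close>

lemma lift_through_d:
  assumes "lin \<phi>" "\<And>b. b \<in> X \<Longrightarrow> deg b \<in> carrier G" "\<And>b. b \<in> X \<Longrightarrow> \<phi> (bvec b) \<in> cyc n (deg b)"
  shows "\<exists>\<psi>. lin \<psi> \<and> (\<forall>b\<in>X. \<psi> (bvec b) \<in> strand (Suc n) (deg b) \<and> d n (\<psi> (bvec b)) = \<phi> (bvec b))"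
proof -
  have "\<forall>b\<in>X. \<exists>w. w \<in> strand (Suc n) (deg b) \<and> d n w = \<phi> (bvec b)"
    using assms exact by (metis (no_types, lifting) imageE)
  then obtain g where "\<forall>b\<in>X. g b \<in> strand (Suc n) (deg b) \<and> d n (g b) = \<phi> (bvec b)"
    by metis
  then show ?thesis
    by (intro exI [of _ "lext g"]) auto
qed

end

subsection \<open>Comparison of two resolutions\<close>

locale strand_resolution_pair =
  C: strand_resolution G B dg d \<eta> + D: strand_resolution G B' dg' d' \<eta>'
  for G :: "('a, 'm) monoid_scheme" (structure)
    and B :: "nat \<Rightarrow> 'b set" and dg and d :: "nat \<Rightarrow> ('b \<Rightarrow>\<^sub>0 'k::field) \<Rightarrow> ('b \<Rightarrow>\<^sub>0 'k)" and \<eta>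
    and B' :: "nat \<Rightarrow> 'c set" and dg' and d' :: "nat \<Rightarrow> ('c \<Rightarrow>\<^sub>0 'k) \<Rightarrow> ('c \<Rightarrow>\<^sub>0 'k)" and \<eta>'
begin

definition chain_map :: "(nat \<Rightarrow> ('b \<Rightarrow>\<^sub>0 'k) \<Rightarrow> ('c \<Rightarrow>\<^sub>0 'k)) \<Rightarrow> bool" where
  "chain_map f \<longleftrightarrow> (\<forall>n. lin (f n) \<and> (\<forall>b\<in>B n. f n (bvec b) \<in> D.strand n (dg n b)) \<and>
     (\<forall>b\<in>B (Suc n). d' n (f (Suc n) (bvec b)) = f n (d n (bvec b)))) \<and>
     (\<forall>v\<in>C.strand 0 \<one>. \<eta>' (f 0 v) = \<eta> v)"

lemma hom_strand:
  assumes "lin f" "\<And>b. b \<in> B n \<Longrightarrow> f (bvec b) \<in> D.strand m (dg n b)" "v \<in> C.strand n l" "l \<in> carrier G"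
  shows "f v \<in> D.strand m l"
  by (rule D.lin_strand [where X = "B n" and deg = "dg n"]) (use assms C.dg_closed in \<open>auto simp: below_def\<close>)

text \<open>The comparison theorem: the augmentations agree in homological degree \<open>0\<close>, and each further component is
  a lift of the previous one through the differential.\<close>

lemma chain_map_exists: "\<exists>f. chain_map f"
proof -
  obtain v1 where v1: "v1 \<in> D.strand 0 \<one>" "\<eta>' v1 = 1"
    using D.aug_onto by blast
  \<comment> \<open>The third condition allows the lift to the next position.\<close>
  define P where "P n f \<longleftrightarrow> lin f \<and> (\<forall>b\<in>B n. f (bvec b) \<in> D.strand n (dg n b)) \<and>
    (\<forall>b\<in>B (Suc n). f (d n (bvec b)) \<in> D.cyc n (dg (Suc n) b)) \<and>
    (n = 0 \<longrightarrow> (\<forall>v\<in>C.strand 0 \<one>. \<eta>' (f v) = \<eta> v))" for n f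
  define f0 where "f0 = lext (\<lambda>b. if dg 0 b = \<one> then scl (\<eta> (bvec b)) v1 else 0)"
  have [simp]: "C.strand 0 \<one> = supp_in {b \<in> B 0. dg 0 b = \<one>}"
    using C.divides_one C.dg_closed by (auto simp: below_def intro!: arg_cong [where f = supp_in])
  have aug: "\<eta>' (f0 v) = \<eta> v" if "v \<in> C.strand 0 \<one>" for v
  proof -
    have eta0: "\<eta> 0 = 0" using C.aug_scl [of 0 0] by simp
    have "f0 v = scl (\<eta> v) v1"
      unfolding f0_def
      by (rule lin_eq_supp_in [where X = "{b \<in> B 0. dg 0 b = \<one>}"])
        (use that in \<open>auto intro!: linI simp: C.aug_add C.aug_scl vs.scale_left_distrib\<close>)
    then show ?thesis
      by (simp add: D.aug_scl v1)
  qed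
  have P0: "P 0 f0"
  proof -
    have st: "\<forall>b\<in>B 0. f0 (bvec b) \<in> D.strand 0 (dg 0 b)"
      using v1 vs.subspace_scale [OF subspace_supp_in] vs.subspace_0 [OF subspace_supp_in]
      by (auto simp: f0_def)
    moreover have "f0 (d 0 (bvec b)) \<in> D.cyc 0 (dg (Suc 0) b)" if b: "b \<in> B (Suc 0)" for b
    proof -
      have in0: "d 0 (bvec b) \<in> C.strand 0 (dg (Suc 0) b)"
        using b C.d_strand C.bvec_strand C.dg_closed by blast
      have "f0 (d 0 (bvec b)) \<in> D.strand 0 (dg (Suc 0) b)"
        by (rule hom_strand) (use st in0 b C.dg_closed in \<open>auto simp: f0_def\<close>)
      moreover have "\<eta>' (f0 (d 0 (bvec b))) = 0" if "dg (Suc 0) b = \<one>"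
        using aug in0 that C.aug_d [of "bvec b"] C.bvec_strand [OF b] by simp
      ultimately show ?thesis
        by (simp add: strand_cycles_def)
    qed
    ultimately show ?thesis
      using aug by (auto simp: P_def f0_def)
  qed
  have step: "\<exists>f'. P (Suc n) f' \<and> (\<forall>b\<in>B (Suc n). d' n (f' (bvec b)) = f (d n (bvec b)))" if Pf: "P n f" for n f
  proof -
    have "lin f"
      using Pf by (simp add: P_def)
    then have l: "lin (\<lambda>v. f (d n v))"
      using C.lin_d by (rule lin_compose)
    obtain f' where f': "lin f'" "\<forall>b\<in>B (Suc n). f' (bvec b) \<in> D.strand (Suc n) (dg (Suc n) b)"
      "\<forall>b\<in>B (Suc n). d' n (f' (bvec b)) = f (d n (bvec b))"
      using D.lift_through_d [OF l, of "B (Suc n)" "dg (Suc n)" n] Pf C.dg_closed unfolding P_def by metis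
    have "f' (d (Suc n) (bvec b)) \<in> D.cyc (Suc n) (dg (Suc (Suc n)) b)" if b: "b \<in> B (Suc (Suc n))" for b
    proof (rule D.cycI)
      have in0: "d (Suc n) (bvec b) \<in> C.strand (Suc n) (dg (Suc (Suc n)) b)"
        using b C.d_strand C.bvec_strand C.dg_closed by blast
      show "f' (d (Suc n) (bvec b)) \<in> D.strand (Suc n) (dg (Suc (Suc n)) b)"
        by (rule hom_strand) (use f' in0 b C.dg_closed in auto)
      have "d' n (f' (d (Suc n) (bvec b))) = f (d n (d (Suc n) (bvec b)))"
        by (rule lin_eq_supp_in [OF lin_compose [OF D.lin_d f'(1)] l in0]) (use f'(3) in \<open>auto simp: below_def\<close>)
      then show "d' n (f' (d (Suc n) (bvec b))) = 0"
        using C.d_d_bvec [OF b] Pf by (simp add: P_def lin_0)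
    qed
    with f' show ?thesis
      by (auto simp: P_def)
  qed
  obtain f where f: "\<And>n. P n (f n)"
    "\<And>n b. b \<in> B (Suc n) \<Longrightarrow> d' n (f (Suc n) (bvec b)) = f n (d n (bvec b))"
    using dependent_nat_choice [of P "\<lambda>n f f'. \<forall>b\<in>B (Suc n). d' n (f' (bvec b)) = f (d n (bvec b))"]
      P0 step by metis
  then have "chain_map f"
    unfolding chain_map_def P_def by auto
  then show ?thesis
    by (rule exI [of chain_map])
qed

end

text \<open>If \<open>c\<close> induces zero on the residue field, then \<open>c\<close> minus the part of the homotopy that is already
  built maps basis elements to cycles, so the homotopy can be lifted one step further.\<close>

lemma (in strand_resolution) homotopy_exists:
  assumes lin_c: "\<And>n. lin (c n)"
    and c_strand: "\<And>n b. b \<in> B n \<Longrightarrow> c n (bvec b) \<in> strand n (dg n b)"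
    and c_d: "\<And>n b. b \<in> B (Suc n) \<Longrightarrow> d n (c (Suc n) (bvec b)) = c n (d n (bvec b))"
    and c_aug: "\<And>v. v \<in> strand 0 \<one> \<Longrightarrow> \<eta> (c 0 v) = 0"
  shows "\<exists>h. \<forall>n. lin (h n) \<and> (\<forall>b\<in>B n. h n (bvec b) \<in> strand (Suc n) (dg n b)) \<and>
    (\<forall>b\<in>B 0. c 0 (bvec b) = d 0 (h 0 (bvec b))) \<and>
    (\<forall>b\<in>B (Suc n). c (Suc n) (bvec b) = d (Suc n) (h (Suc n) (bvec b)) + h n (d n (bvec b)))"
proof -
  have hom: "f v \<in> strand m l" if "lin f" "\<And>b. b \<in> B n \<Longrightarrow> f (bvec b) \<in> strand m (dg n b)"
    "v \<in> strand n l" "l \<in> carrier G" for f n m l v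
    by (rule lin_strand [where X = "B n" and deg = "dg n"]) (use that dg_closed in \<open>auto simp: below_def\<close>)
  define P where "P n h \<longleftrightarrow> lin h \<and> (\<forall>b\<in>B n. h (bvec b) \<in> strand (Suc n) (dg n b)) \<and>
    (\<forall>b\<in>B (Suc n). c (Suc n) (bvec b) - h (d n (bvec b)) \<in> cyc (Suc n) (dg (Suc n) b)) \<and>
    (n = 0 \<longrightarrow> (\<forall>b\<in>B 0. c 0 (bvec b) = d 0 (h (bvec b))))" for n h
  have key: "c (Suc n) (bvec b) - h (d n (bvec b)) \<in> cyc (Suc n) (dg (Suc n) b)"
    if h: "lin h" "\<And>b. b \<in> B n \<Longrightarrow> h (bvec b) \<in> strand (Suc n) (dg n b)" and b: "b \<in> B (Suc n)"
      and dh: "d n (h (d n (bvec b))) = c n (d n (bvec b))" for n h b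
  proof (rule cycI)
    have "h (d n (bvec b)) \<in> strand (Suc n) (dg (Suc n) b)"
      by (rule hom [OF h]) (use b d_strand bvec_strand dg_closed in blast)+
    then show "c (Suc n) (bvec b) - h (d n (bvec b)) \<in> strand (Suc n) (dg (Suc n) b)"
      using c_strand b vs.subspace_diff [OF subspace_supp_in] by blast
    show "d n (c (Suc n) (bvec b) - h (d n (bvec b))) = 0"
      using dh c_d b by (simp add: lin_diff [OF lin_d])
  qed
  have P0: "\<exists>h. P 0 h"
  proof -
    have "c 0 (bvec b) \<in> cyc 0 (dg 0 b)" if "b \<in> B 0" for b
      using that c_strand [of b 0] c_aug [of "bvec b"] bvec_strand [of b 0] by (auto simp: strand_cycles_def)
    then obtain h where h: "lin h" "\<forall>b\<in>B 0. h (bvec b) \<in> strand (Suc 0) (dg 0 b)"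
      "\<forall>b\<in>B 0. d 0 (h (bvec b)) = c 0 (bvec b)"
      using lift_through_d [OF lin_c, of "B 0" "dg 0" 0 0] dg_closed by metis
    have "d 0 (h (d 0 (bvec b))) = c 0 (d 0 (bvec b))" if b: "b \<in> B (Suc 0)" for b
      by (rule lin_eq_supp_in [OF lin_compose [OF lin_d h(1)] lin_c d_strand [OF bvec_strand [OF b]]])
        (use h(3) b dg_closed in \<open>auto simp: below_def\<close>)
    then show ?thesis
      using h key [OF h(1)] by (intro exI [of _ h]) (auto simp: P_def)
  qed
  have step: "\<exists>h'. P (Suc n) h' \<and>
      (\<forall>b\<in>B (Suc n). c (Suc n) (bvec b) = d (Suc n) (h' (bvec b)) + h (d n (bvec b)))"
    if Ph: "P n h" for n h
  proof -
    have "lin h"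
      using Ph by (simp add: P_def)
    then have l: "lin (\<lambda>v. c (Suc n) v - h (d n v))"
      by (rule lin_minus' [OF lin_c lin_compose [OF _ lin_d]])
    obtain h' where h': "lin h'" "\<forall>b\<in>B (Suc n). h' (bvec b) \<in> strand (Suc (Suc n)) (dg (Suc n) b)"
      "\<forall>b\<in>B (Suc n). d (Suc n) (h' (bvec b)) = c (Suc n) (bvec b) - h (d n (bvec b))"
      using lift_through_d [OF l, of "B (Suc n)" "dg (Suc n)" "Suc n"] Ph dg_closed unfolding P_def by metis
    have "d (Suc n) (h' (d (Suc n) (bvec b))) = c (Suc n) (d (Suc n) (bvec b))"
      if b: "b \<in> B (Suc (Suc n))" for b
    proof -
      have "d (Suc n) (h' (d (Suc n) (bvec b))) = c (Suc n) (d (Suc n) (bvec b)) - h (d n (d (Suc n) (bvec b)))"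
        by (rule lin_eq_supp_in [OF lin_compose [OF lin_d h'(1)] l d_strand [OF bvec_strand [OF b]]])
          (use h'(3) b dg_closed in \<open>auto simp: below_def\<close>)
      then show ?thesis
        using d_d_bvec [OF b] Ph by (simp add: P_def lin_0)
    qed
    then have "P (Suc n) h'"
      using h' key [OF h'(1)] by (auto simp: P_def)
    with h' show ?thesis
      by auto
  qed
  obtain h where h: "\<And>n. P n (h n)"
    "\<And>n b. b \<in> B (Suc n) \<Longrightarrow> c (Suc n) (bvec b) = d (Suc n) (h (Suc n) (bvec b)) + h n (d n (bvec b))"
    using dependent_nat_choice [of P "\<lambda>n h h'. \<forall>b\<in>B (Suc n). c (Suc n) (bvec b) =
        d (Suc n) (h' (bvec b)) + h (d n (bvec b))"] P0 step by metis
  then show ?thesis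
    by (intro exI [of _ h]) (use h(1) [of 0] in \<open>auto simp: P_def\<close>)
qed

subsection \<open>The homology of the residual complex\<close>

text \<open>For a set \<open>X n\<close> of basis vectors in each position, the quotient complex spanned by these has the
  differential \<open>restr (X n) \<circ> d n\<close>.\<close>

definition hom_cycles :: "(nat \<Rightarrow> 'b set) \<Rightarrow> (nat \<Rightarrow> ('b \<Rightarrow>\<^sub>0 'k::field) \<Rightarrow> ('b \<Rightarrow>\<^sub>0 'k)) \<Rightarrow> nat \<Rightarrow> ('b \<Rightarrow>\<^sub>0 'k) set" where
  "hom_cycles X d n = {v \<in> supp_in (X n). \<forall>m. n = Suc m \<longrightarrow> restr (X m) (d m v) = 0}"

definition hom_boundaries :: "(nat \<Rightarrow> 'b set) \<Rightarrow> (nat \<Rightarrow> ('b \<Rightarrow>\<^sub>0 'k::field) \<Rightarrow> ('b \<Rightarrow>\<^sub>0 'k)) \<Rightarrow> nat \<Rightarrow> ('b \<Rightarrow>\<^sub>0 'k) set" where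
  "hom_boundaries X d n = (\<lambda>v. restr (X n) (d n v)) ` supp_in (X (Suc n))"

definition hom_dim :: "(nat \<Rightarrow> 'b set) \<Rightarrow> (nat \<Rightarrow> ('b \<Rightarrow>\<^sub>0 'k::field) \<Rightarrow> ('b \<Rightarrow>\<^sub>0 'k)) \<Rightarrow> nat \<Rightarrow> nat" where
  "hom_dim X d n = vs.dim (hom_cycles X d n) - vs.dim (hom_boundaries X d n)"

abbreviation tor_cycles where
  "tor_cycles B dg d n l \<equiv> hom_cycles (\<lambda>n. at_deg B dg n l) d n"

abbreviation tor_boundaries where
  "tor_boundaries B dg d n l \<equiv> hom_boundaries (\<lambda>n. at_deg B dg n l) d n"

lemma hom_cycles_supp: "v \<in> hom_cycles X d n \<Longrightarrow> v \<in> supp_in (X n)"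
  by (simp add: hom_cycles_def)

lemma subspace_hom_cycles:
  assumes "\<And>n. lin (d n)"
  shows "vs.subspace (hom_cycles X d n)"
  unfolding hom_cycles_def
  by (rule vs.subspaceI)
    (use assms in \<open>auto simp: lin_simps lin_simps [OF lin_restr] intro: vs.subspace_add [OF subspace_supp_in]
      vs.subspace_scale [OF subspace_supp_in] vs.subspace_0 [OF subspace_supp_in]\<close>)

lemma subspace_hom_boundaries:
  assumes "\<And>n. lin (d n)"
  shows "vs.subspace (hom_boundaries X d n)"
  unfolding hom_boundaries_def
  by (rule vsp.linear_subspace_image [OF lin_compose [OF lin_restr assms] subspace_supp_in])

context reduced_monoid
begin

text \<open>A homogeneous map cannot raise a degree that properly divides \<open>l\<close> to \<open>l\<close>, so its component
  in degree \<open>l\<close> depends only on the component in degree \<open>l\<close> of the argument.\<close>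

lemma restr_hom:
  assumes f: "lin f" "\<And>b. b \<in> B n \<Longrightarrow> f (bvec b) \<in> supp_in (below G B' dg' m (dg n b))"
    and dg: "\<And>b. b \<in> B n \<Longrightarrow> dg n b \<in> carrier G"
    and v: "v \<in> supp_in (below G B dg n l)" and l: "l \<in> carrier G"
  shows "restr (at_deg B' dg' m l) (f (restr (at_deg B dg n l) v)) = restr (at_deg B' dg' m l) (f v)"
proof (rule lin_eq_supp_in [OF lin_compose [OF lin_restr lin_compose [OF f(1) lin_restr]]
      lin_compose [OF lin_restr f(1)] v])
  fix b assume b: "b \<in> below G B dg n l"
  show "restr (at_deg B' dg' m l) (f (restr (at_deg B dg n l) (bvec b))) = restr (at_deg B' dg' m l) (f (bvec b))"
  proof (cases "dg n b = l")
    case True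
    with b show ?thesis by (simp add: restr_id at_deg_def below_def)
  next
    case False
    with b have r0: "restr (at_deg B dg n l) (bvec b) = (0 :: _ \<Rightarrow>\<^sub>0 'c)"
      by (intro restr_eq_0 [of _ "{b}"]) (auto simp: at_deg_def)
    have "restr (at_deg B' dg' m l) (f (bvec b)) = 0"
    proof (rule restr_eq_0)
      show "f (bvec b) \<in> supp_in (below G B' dg' m (dg n b))"
        using f b by (simp add: below_def)
      show "at_deg B' dg' m l \<inter> below G B' dg' m (dg n b) = {}"
        using b False l dg divides_antisym by (auto simp: at_deg_def below_def)
    qed
    with r0 show ?thesis
      by (simp add: lin_0 [OF lin_restr] lin_0 [OF f(1)])
  qed
qed

end

lemma at_deg_strand:
  "reduced_monoid G \<Longrightarrow> v \<in> supp_in (at_deg B dg n l) \<Longrightarrow> l \<in> carrier G \<Longrightarrow> v \<in> supp_in (below G B dg n l)"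
  by (erule supp_in_mono)
    (auto simp: at_deg_def below_def reduced_monoid_def comm_monoid_cancel_def
      monoid_cancel_def intro: monoid.divides_refl)

context strand_resolution
begin

lemma at_strand: "v \<in> supp_in (at_deg B dg n l) \<Longrightarrow> l \<in> carrier G \<Longrightarrow> v \<in> strand n l"
  by (rule at_deg_strand [OF reduced_monoid_axioms])

lemma restr_d:
  "v \<in> strand (Suc n) l \<Longrightarrow> l \<in> carrier G \<Longrightarrow>
    restr (at_deg B dg n l) (d n (restr (at_deg B dg (Suc n) l) v)) = restr (at_deg B dg n l) (d n v)"
  by (rule restr_hom [OF lin_d]) (use d_strand bvec_strand dg_closed in auto)

end

context strand_resolution_pair
begin

lemma chain_map_strand:
  "chain_map f \<Longrightarrow> v \<in> C.strand n l \<Longrightarrow> l \<in> carrier G \<Longrightarrow> f n v \<in> D.strand n l"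
  by (rule hom_strand) (auto simp: chain_map_def)

lemma chain_map_restr:
  "chain_map f \<Longrightarrow> v \<in> C.strand n l \<Longrightarrow> l \<in> carrier G \<Longrightarrow>
    restr (at_deg B' dg' n l) (f n (restr (at_deg B dg n l) v)) = restr (at_deg B' dg' n l) (f n v)"
  by (rule C.restr_hom) (auto simp: chain_map_def C.dg_closed)

lemma chain_map_comm:
  assumes "chain_map f" "v \<in> C.strand (Suc n) l"
  shows "d' n (f (Suc n) v) = f n (d n v)"
proof -
  have "lin (f m)" for m
    using assms(1) by (simp add: chain_map_def)
  from lin_compose [OF D.lin_d this] lin_compose [OF this C.lin_d] assms(2) show ?thesis
    by (rule lin_eq_supp_in) (use assms(1) in \<open>auto simp: chain_map_def below_def\<close>)
qed

lemma chain_map_tor_cycles: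
  assumes f: "chain_map f" and l: "l \<in> carrier G" and v: "v \<in> tor_cycles B dg d n l"
  shows "restr (at_deg B' dg' n l) (f n v) \<in> tor_cycles B' dg' d' n l"
proof -
  have vs: "v \<in> C.strand n l"
    by (rule C.at_strand [OF hom_cycles_supp [OF v] l])
  have lf: "lin (f m)" for m
    using f by (simp add: chain_map_def)
  have "restr (at_deg B' dg' m l) (d' m (restr (at_deg B' dg' n l) (f n v))) = 0" if n: "n = Suc m" for m
  proof -
    have "restr (at_deg B' dg' m l) (d' m (restr (at_deg B' dg' n l) (f n v)))
        = restr (at_deg B' dg' m l) (f m (d m v))"
      using D.restr_d [OF chain_map_strand [OF f vs l, unfolded n] l] chain_map_comm [OF f vs [unfolded n]]
      by (simp add: n)
    also have "\<dots> = restr (at_deg B' dg' m l) (f m (restr (at_deg B dg m l) (d m v)))"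
      using chain_map_restr [OF f C.d_strand [OF vs [unfolded n] l] l] by simp
    also have "\<dots> = 0"
      using v n by (simp add: hom_cycles_def lin_0 [OF lf] lin_0 [OF lin_restr])
    finally show ?thesis .
  qed
  then show ?thesis
    by (simp add: hom_cycles_def)
qed

lemma chain_map_tor_boundaries:
  assumes f: "chain_map f" and l: "l \<in> carrier G" and v: "v \<in> tor_boundaries B dg d n l"
  shows "restr (at_deg B' dg' n l) (f n v) \<in> tor_boundaries B' dg' d' n l"
proof -
  obtain w where w: "w \<in> supp_in (at_deg B dg (Suc n) l)" "v = restr (at_deg B dg n l) (d n w)"
    using v by (auto simp: hom_boundaries_def)
  have ws: "w \<in> C.strand (Suc n) l"
    by (rule C.at_strand [OF w(1) l])
  have "restr (at_deg B' dg' n l) (f n v) = restr (at_deg B' dg' n l) (d' n (f (Suc n) w))"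
    using chain_map_restr [OF f C.d_strand [OF ws l] l] chain_map_comm [OF f ws] w(2) by simp
  also have "\<dots> = restr (at_deg B' dg' n l) (d' n (restr (at_deg B' dg' (Suc n) l) (f (Suc n) w)))"
    using D.restr_d [OF chain_map_strand [OF f ws l] l] by simp
  finally show ?thesis
    unfolding hom_boundaries_def by auto
qed

text \<open>The composite of \<open>f\<close> and \<open>g\<close> is homotopic to the identity. On a cycle the homotopy formula leaves,
  after reduction, only the boundary of the homotopy.\<close>

lemma chain_map_inverse:
  assumes f: "chain_map f" and g: "strand_resolution_pair.chain_map G B' dg' d' \<eta>' B dg d \<eta> g"
    and l: "l \<in> carrier G" and v: "v \<in> tor_cycles B dg d n l"
  shows "v - restr (at_deg B dg n l) (g n (restr (at_deg B' dg' n l) (f n v))) \<in> tor_boundaries B dg d n l"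
proof -
  interpret S: strand_resolution_pair G B' dg' d' \<eta>' B dg d \<eta>
    by unfold_locales
  define c where "c n v = v - g n (f n v)" for n v
  have lf: "lin (f m)" and lg: "lin (g m)" for m
    using f g by (auto simp: chain_map_def S.chain_map_def)
  have gf: "g m (f m w) \<in> C.strand m k" if "w \<in> C.strand m k" "k \<in> carrier G" for m w k
    using that chain_map_strand [OF f] S.chain_map_strand [OF g] by blast
  have "\<exists>h. \<forall>n. lin (h n) \<and> (\<forall>b\<in>B n. h n (bvec b) \<in> C.strand (Suc n) (dg n b)) \<and>
    (\<forall>b\<in>B 0. c 0 (bvec b) = d 0 (h 0 (bvec b))) \<and>
    (\<forall>b\<in>B (Suc n). c (Suc n) (bvec b) = d (Suc n) (h (Suc n) (bvec b)) + h n (d n (bvec b)))"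
  proof (rule C.homotopy_exists)
    show "lin (c n)" for n
      unfolding c_def by (rule lin_minus' [OF lin_id lin_compose [OF lg lf]])
    show "c n (bvec b) \<in> C.strand n (dg n b)" if "b \<in> B n" for n b
      unfolding c_def
      using that C.bvec_strand gf C.dg_closed by (intro vs.subspace_diff [OF subspace_supp_in]) auto
    show "d n (c (Suc n) (bvec b)) = c n (d n (bvec b))" if b: "b \<in> B (Suc n)" for n b
      using chain_map_comm [OF f C.bvec_strand [OF b]] C.dg_closed [OF b]
        S.chain_map_comm [OF g chain_map_strand [OF f C.bvec_strand [OF b]]]
      by (simp add: c_def lin_diff [OF C.lin_d])
    show "\<eta> (c 0 v) = 0" if v: "v \<in> C.strand 0 \<one>" for v
    proof -
      have "\<eta> (g 0 (f 0 v)) = \<eta> v"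
        using f g v chain_map_strand [OF f v] by (simp add: chain_map_def S.chain_map_def)
      moreover have "\<eta> v = \<eta> (c 0 v) + \<eta> (g 0 (f 0 v))"
        by (simp add: c_def flip: C.aug_add)
      ultimately show ?thesis by simp
    qed
  qed
  then obtain h where h: "\<And>n. lin (h n)" "\<And>n b. b \<in> B n \<Longrightarrow> h n (bvec b) \<in> C.strand (Suc n) (dg n b)"
    "\<And>b. b \<in> B 0 \<Longrightarrow> c 0 (bvec b) = d 0 (h 0 (bvec b))"
    "\<And>n b. b \<in> B (Suc n) \<Longrightarrow> c (Suc n) (bvec b) = d (Suc n) (h (Suc n) (bvec b)) + h n (d n (bvec b))"
    by metis
  have lc: "lin (c m)" for m
    unfolding c_def by (rule lin_minus' [OF lin_id lin_compose [OF lg lf]])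
  let ?r = "\<lambda>n. restr (at_deg B dg n l)"
  have vs: "v \<in> C.strand n l"
    by (rule C.at_strand [OF hom_cycles_supp [OF v] l])
  have hs: "h m w \<in> C.strand (Suc m) k" if "w \<in> C.strand m k" "k \<in> carrier G" for m w k
    by (rule C.lin_strand [OF h(1), where X = "B m" and deg = "dg m"])
      (use that h(2) C.dg_closed in \<open>auto simp: below_def\<close>)
  have rc: "?r n (c n v) = ?r n (d n (h n v))"
  proof (cases n)
    case 0
    have "c 0 v = d 0 (h 0 v)"
      by (rule lin_eq_supp_in [OF lc lin_compose [OF C.lin_d h(1)] vs [unfolded 0]])
        (use h(3) in \<open>auto simp: below_def\<close>)
    with 0 show ?thesis by simp
  next
    case (Suc m)
    have "c (Suc m) v = d (Suc m) (h (Suc m) v) + h m (d m v)"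
      by (rule lin_eq_supp_in [OF lc lin_plus [OF lin_compose [OF C.lin_d h(1)] lin_compose [OF h(1) C.lin_d]]
            vs [unfolded Suc]])
        (use h(4) in \<open>auto simp: below_def\<close>)
    moreover have "?r (Suc m) (h m (d m v)) = ?r (Suc m) (h m (?r m (d m v)))"
      by (rule C.restr_hom [symmetric]) (use h C.d_strand [OF vs [unfolded Suc] l] l C.dg_closed in auto)
    moreover have "?r m (d m v) = 0"
      using v Suc by (simp add: hom_cycles_def)
    ultimately show ?thesis
      by (simp add: Suc lin_simps [OF lin_restr] lin_0 [OF h(1)])
  qed
  have "v - ?r n (g n (restr (at_deg B' dg' n l) (f n v))) = ?r n (c n v)"
    using S.chain_map_restr [OF g chain_map_strand [OF f vs l] l]
    by (simp add: c_def lin_diff [OF lin_restr] restr_id [OF hom_cycles_supp [OF v]])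
  also have "\<dots> = ?r n (d n (?r (Suc n) (h n v)))"
    using C.restr_d [OF hs [OF vs l] l] rc by simp
  finally show ?thesis
    unfolding hom_boundaries_def by auto
qed

text \<open>The isomorphism of homology is expressed by a linear map on cycles, without forming quotients: \<open>\<phi>\<close>
  preserves and reflects boundaries, and it is onto up to boundaries.\<close>

theorem tor_comparison:
  assumes l: "l \<in> carrier G"
  obtains \<phi> where "lin \<phi>"
    "\<forall>v \<in> tor_cycles B dg d n l. \<phi> v \<in> tor_cycles B' dg' d' n l"
    "\<forall>v \<in> tor_cycles B dg d n l. \<phi> v \<in> tor_boundaries B' dg' d' n l \<longleftrightarrow> v \<in> tor_boundaries B dg d n l"
    "\<forall>w \<in> tor_cycles B' dg' d' n l. \<exists>v \<in> tor_cycles B dg d n l. w - \<phi> v \<in> tor_boundaries B' dg' d' n l"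
proof -
  interpret S: strand_resolution_pair G B' dg' d' \<eta>' B dg d \<eta>
    by unfold_locales
  obtain f where f: "chain_map f"
    using chain_map_exists by blast
  obtain g where g: "S.chain_map g"
    using S.chain_map_exists by blast
  have lf: "lin (f m)" for m
    using f by (simp add: chain_map_def)
  define \<phi> where "\<phi> v = restr (at_deg B' dg' n l) (f n v)" for v
  define \<gamma> where "\<gamma> v = restr (at_deg B dg n l) (g n v)" for v
  show thesis
  proof (rule that; (intro ballI)?)
    show "lin \<phi>"
      unfolding \<phi>_def by (rule lin_compose [OF lin_restr lf])
  next
    fix v assume v: "v \<in> tor_cycles B dg d n l"
    show "\<phi> v \<in> tor_cycles B' dg' d' n l"
      unfolding \<phi>_def using chain_map_tor_cycles [OF f l v] .
    show "\<phi> v \<in> tor_boundaries B' dg' d' n l \<longleftrightarrow> v \<in> tor_boundaries B dg d n l"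
    proof
      assume "\<phi> v \<in> tor_boundaries B' dg' d' n l"
      then have "\<gamma> (\<phi> v) \<in> tor_boundaries B dg d n l"
        unfolding \<gamma>_def by (rule S.chain_map_tor_boundaries [OF g l])
      moreover have "v - \<gamma> (\<phi> v) \<in> tor_boundaries B dg d n l"
        unfolding \<gamma>_def \<phi>_def by (rule chain_map_inverse [OF f g l v])
      ultimately show "v \<in> tor_boundaries B dg d n l"
        using vs.subspace_add [OF subspace_hom_boundaries [OF C.lin_d]] by fastforce
    next
      assume "v \<in> tor_boundaries B dg d n l"
      then show "\<phi> v \<in> tor_boundaries B' dg' d' n l"
        unfolding \<phi>_def by (rule chain_map_tor_boundaries [OF f l])
    qed
  next
    fix w assume w: "w \<in> tor_cycles B' dg' d' n l"
    show "\<exists>v \<in> tor_cycles B dg d n l. w - \<phi> v \<in> tor_boundaries B' dg' d' n l"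
      using S.chain_map_tor_cycles [OF g l w] S.chain_map_inverse [OF g f l w] unfolding \<phi>_def by blast
  qed
qed

end


section \<open>The bar resolution as chains for divisibility\<close>

text \<open>A list \<open>[t\<^sub>1, \<dots>, t\<^sub>n]\<close> in which each entry divides the one before it stands for the bar
  symbol with the successive differences as entries; its degree is the largest entry \<open>t\<^sub>1\<close>. In the bar
  resolution the first face has the coefficient \<open>z\<^bsup>t\<^sub>1 - t\<^sub>2\<^esup>\<close>; with monomials forgotten
  all faces are obtained by leaving out one entry.\<close>

definition prepend :: "'a \<Rightarrow> ('a list \<Rightarrow>\<^sub>0 'k::field) \<Rightarrow> ('a list \<Rightarrow>\<^sub>0 'k)" where
  "prepend a = lext (\<lambda>ts. bvec (a # ts))"

primrec bdry_list :: "'a list \<Rightarrow> ('a list \<Rightarrow>\<^sub>0 'k::field)" where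
  "bdry_list [] = 0"
| "bdry_list (t # ts) = bvec ts - prepend t (bdry_list ts)"

definition bdry :: "('a list \<Rightarrow>\<^sub>0 'k::field) \<Rightarrow> ('a list \<Rightarrow>\<^sub>0 'k)" where
  "bdry = lext bdry_list"

text \<open>The sign \<open>(-1)\<^sup>n\<close> that arises when an odd symbol is moved past a chain of length \<open>n\<close>.\<close>

definition sgn_op :: "('a list \<Rightarrow>\<^sub>0 'k::field) \<Rightarrow> ('a list \<Rightarrow>\<^sub>0 'k)" where
  "sgn_op = lext (\<lambda>ts. Poly_Mapping.single ts ((- 1) ^ length ts))"

text \<open>The prism between the chain \<open>[t\<^sub>1, \<dots>, t\<^sub>n]\<close> and its translate by \<open>u\<close>, where the neutral element is
  regarded as a last vertex of each chain, which is moved to \<open>u\<close>. It is subdivided into the simplices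
  \<open>[u t\<^sub>1, \<dots>, u t\<^sub>i, t\<^sub>i, \<dots>, t\<^sub>n]\<close> and \<open>[u t\<^sub>1, \<dots>, u t\<^sub>n, u]\<close>.\<close>

primrec prism_list :: "('a, 'm) monoid_scheme \<Rightarrow> 'a \<Rightarrow> 'a list \<Rightarrow> ('a list \<Rightarrow>\<^sub>0 'k::field)" where
  "prism_list G u [] = bvec [u]"
| "prism_list G u (t # ts) = bvec ((u \<otimes>\<^bsub>G\<^esub> t) # t # ts) - prepend (u \<otimes>\<^bsub>G\<^esub> t) (prism_list G u ts)"

definition prism :: "('a, 'm) monoid_scheme \<Rightarrow> 'a \<Rightarrow> ('a list \<Rightarrow>\<^sub>0 'k::field) \<Rightarrow> ('a list \<Rightarrow>\<^sub>0 'k)" where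
  "prism G u = lext (prism_list G u)"

lemma lin_prepend: "lin (prepend a)"
  and lin_bdry: "lin bdry"
  and lin_sgn_op: "lin sgn_op"
  and lin_prism: "lin (prism G u)"
  unfolding prepend_def bdry_def sgn_op_def prism_def by (rule lin_lext)+

lemmas chain_lin [simp] =
  lin_simps [OF lin_prepend] lin_simps [OF lin_bdry] lin_simps [OF lin_sgn_op] lin_simps [OF lin_prism]

lemma prepend_bvec [simp]: "prepend a (bvec ts) = bvec (a # ts)"
  by (simp add: prepend_def)

text \<open>Identities between linear maps on chains are proved by list induction, once all maps are known to
  satisfy recursion equations for \<^const>\<open>prepend\<close>.\<close>

lemma list_lin_eqI:
  assumes "lin f" "lin g" "f (bvec []) = g (bvec [])"
    and "\<And>a ts. f (bvec ts) = g (bvec ts) \<Longrightarrow> f (prepend a (bvec ts)) = g (prepend a (bvec ts))"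
  shows "f v = g v"
proof (rule lin_eqI [OF assms(1,2)])
  fix ts show "f (bvec ts) = g (bvec ts)"
    by (induction ts) (use assms in simp_all)
qed

lemma bdry_Nil [simp]: "bdry (bvec []) = 0"
  by (simp add: bdry_def)

lemma bdry_prepend [simp]: "bdry (prepend a v) = v - prepend a (bdry v)"
  by (rule lin_eqI [where f = "\<lambda>v. bdry (prepend a v)"])
    (auto intro!: linI simp: bdry_def lin_simps [OF lin_lext] vs.scale_right_diff_distrib)

lemma sgn_op_Nil [simp]: "sgn_op (bvec []) = bvec []"
  by (simp add: sgn_op_def)

lemma sgn_op_prepend [simp]: "sgn_op (prepend a v) = - prepend a (sgn_op v)"
  by (rule lin_eqI [where f = "\<lambda>v. sgn_op (prepend a v)"])
    (auto intro!: linI poly_mapping_eqI simp: sgn_op_def prepend_def lin_simps [OF lin_lext] lext_single lookup_single when_def)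

lemma prism_Nil [simp]: "prism G u (bvec []) = bvec [u]"
  by (simp add: prism_def)

lemma prism_prepend [simp]:
  "prism G u (prepend a v) = prepend (u \<otimes>\<^bsub>G\<^esub> a) (prepend a v) - prepend (u \<otimes>\<^bsub>G\<^esub> a) (prism G u v)"
  by (rule lin_eqI [where f = "\<lambda>v. prism G u (prepend a v)"])
    (auto intro!: linI simp: prism_def lin_simps [OF lin_lext] vs.scale_right_diff_distrib)

lemma bvec_Cons: "bvec (a # ts) = prepend a (bvec ts)"
  by simp

lemma bdry_bdry [simp]: "bdry (bdry v) = 0"
  by (rule list_lin_eqI [OF lin_compose [OF lin_bdry lin_bdry] lin_zero])
    (simp_all del: prepend_bvec)

text \<open>The element \<open>z\<^sup>u\<close> annihilates the residue field, so the multiplication by it is homotopic to zero on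
  any free resolution. When monomials are forgotten, this multiplication is the identity, and the
  homotopy becomes a contraction that enlarges degrees by \<open>u\<close>.\<close>

lemma bdry_prism:
  fixes v :: "'a list \<Rightarrow>\<^sub>0 'k::field"
  shows "bdry (prism G u v) + prism G u (bdry v) = v"
proof (rule list_lin_eqI [OF lin_plus [OF lin_compose [OF lin_bdry lin_prism] lin_compose [OF lin_prism lin_bdry]] lin_id])
  show "bdry (prism G u (bvec [])) + prism G u (bdry (bvec [])) = bvec []"
    by (simp add: bvec_Cons del: prepend_bvec)
next
  fix a ts
  assume IH: "bdry (prism G u (bvec ts :: 'a list \<Rightarrow>\<^sub>0 'k)) + prism G u (bdry (bvec ts :: 'a list \<Rightarrow>\<^sub>0 'k)) = bvec ts"
  have "prepend (u \<otimes>\<^bsub>G\<^esub> a) (bdry (prism G u (bvec ts :: 'a list \<Rightarrow>\<^sub>0 'k))) + prepend (u \<otimes>\<^bsub>G\<^esub> a) (prism G u (bdry (bvec ts :: 'a list \<Rightarrow>\<^sub>0 'k)))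
    = prepend (u \<otimes>\<^bsub>G\<^esub> a) (bvec ts :: 'a list \<Rightarrow>\<^sub>0 'k)"
    unfolding lin_add [OF lin_prepend, symmetric] IH ..
  then show "bdry (prism G u (prepend a (bvec ts :: 'a list \<Rightarrow>\<^sub>0 'k))) + prism G u (bdry (prepend a (bvec ts :: 'a list \<Rightarrow>\<^sub>0 'k))) = prepend a (bvec ts :: 'a list \<Rightarrow>\<^sub>0 'k)"
    by (simp add: algebra_simps del: prepend_bvec)
qed

lemma prism_prism [simp]: "prism G u (prism G u v) = 0"
  by (rule list_lin_eqI [OF lin_compose [OF lin_prism lin_prism] lin_zero])
    (simp_all add: bvec_Cons del: prepend_bvec)

lemma sgn_op_sgn_op [simp]: "sgn_op (sgn_op v) = v"
  by (rule list_lin_eqI [OF lin_compose [OF lin_sgn_op lin_sgn_op] lin_id])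
    (simp_all add: bvec_Cons del: prepend_bvec)

lemma sgn_op_bdry: "sgn_op (bdry v) = - bdry (sgn_op v)"
  by (rule list_lin_eqI [OF lin_compose [OF lin_sgn_op lin_bdry] lin_uminus [OF lin_compose [OF lin_bdry lin_sgn_op]]])
    (simp_all add: bvec_Cons del: prepend_bvec)

lemma sgn_op_prism: "sgn_op (prism G u v) = - prism G u (sgn_op v)"
  by (rule list_lin_eqI [OF lin_compose [OF lin_sgn_op lin_prism] lin_uminus [OF lin_compose [OF lin_prism lin_sgn_op]]])
    (simp_all add: bvec_Cons del: prepend_bvec)

locale divisor_finite_monoid = reduced_monoid +
  assumes finite_divisors: "l \<in> carrier G \<Longrightarrow> finite {x \<in> carrier G. x divides l}"
begin

text \<open>Entries may be repeated. This makes prepending the largest element \<open>l\<close> to a chain of divisors of \<open>l\<close>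
  possible in all cases.\<close>

definition div_chains :: "nat \<Rightarrow> 'a list set" where
  "div_chains n = {ts. length ts = n \<and> set ts \<subseteq> carrier G - {\<one>} \<and> sorted_wrt (\<lambda>x y. y divides x) ts}"

definition chain_max :: "'a list \<Rightarrow> 'a" where
  "chain_max ts = (if ts = [] then \<one> else hd ts)"

lemma chain_max_simps [simp]: "chain_max [] = \<one>" "chain_max (t # ts) = t"
  by (simp_all add: chain_max_def)

lemma div_chains_0 [simp]: "div_chains 0 = {[]}"
  by (auto simp: div_chains_def)

lemma chain_max_closed: "ts \<in> div_chains n \<Longrightarrow> chain_max ts \<in> carrier G"
  by (cases ts) (auto simp: div_chains_def)

lemma divides_top: "ts \<in> div_chains n \<Longrightarrow> x \<in> set ts \<Longrightarrow> x divides chain_max ts"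
  by (cases ts) (auto simp: div_chains_def)

lemma top_divides: "(\<And>x. x \<in> set ts \<Longrightarrow> x divides l) \<Longrightarrow> l \<in> carrier G \<Longrightarrow> chain_max ts divides l"
  by (cases ts) (auto simp: factor_def)

lemma Cons_div_chains:
  "t # ts \<in> div_chains (Suc n) \<longleftrightarrow> ts \<in> div_chains n \<and> t \<in> carrier G - {\<one>} \<and> (\<forall>x\<in>set ts. x divides t)"
  by (auto simp: div_chains_def)

lemma div_chains_SucE:
  assumes "ts \<in> div_chains (Suc n)"
  obtains t us where "ts = t # us" "us \<in> div_chains n" "t \<in> carrier G - {\<one>}" "\<forall>x\<in>set us. x divides t"
  using assms by (cases ts) (auto simp: div_chains_def)

lemma chain_max_eq_one: "ts \<in> div_chains n \<Longrightarrow> chain_max ts = \<one> \<Longrightarrow> ts = []"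
  by (cases ts) (auto simp: div_chains_def)

lemma div_chains_length: "ts \<in> div_chains n \<Longrightarrow> length ts = n"
  by (simp add: div_chains_def)

lemma div_chains_set: "ts \<in> div_chains n \<Longrightarrow> x \<in> set ts \<Longrightarrow> x \<in> carrier G"
  by (auto simp: div_chains_def)

lemma chain_elem_divides:
  assumes "ts \<in> div_chains n" "chain_max ts divides l" "x \<in> set ts"
  shows "x divides l"
  by (rule divides_trans [OF divides_top [OF assms(1,3)] assms(2) div_chains_set [OF assms(1,3)]])

lemma below_one:
  assumes "ts \<in> div_chains n" "chain_max ts divides \<one>"
  shows "ts = []"
  using chain_max_eq_one [OF assms(1) divides_one [OF assms(2) chain_max_closed [OF assms(1)]]] .

lemma prepend_supp_in: "v \<in> supp_in X \<Longrightarrow> (\<And>ts. ts \<in> X \<Longrightarrow> a # ts \<in> Y) \<Longrightarrow> prepend a v \<in> supp_in Y"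
  by (rule lin_supp_in [OF lin_prepend]) auto

lemma bdry_supp:
  "ts \<in> div_chains (Suc n) \<Longrightarrow> (bdry (bvec ts) :: 'a list \<Rightarrow>\<^sub>0 'k::field) \<in> supp_in {us \<in> div_chains n. set us \<subseteq> set ts}"
proof (induction n arbitrary: ts)
  case 0
  then obtain t where "ts = [t]"
    by (auto elim!: div_chains_SucE)
  then show ?case
    by (simp add: bvec_Cons del: prepend_bvec)
next
  case (Suc n)
  obtain t us where ts: "ts = t # us" "us \<in> div_chains (Suc n)" "t \<in> carrier G - {\<one>}" "\<forall>x\<in>set us. x divides t"
    using Suc.prems by (rule div_chains_SucE)
  have "(prepend t (bdry (bvec us)) :: 'a list \<Rightarrow>\<^sub>0 'k) \<in> supp_in {us \<in> div_chains (Suc n). set us \<subseteq> set ts}"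
    by (rule prepend_supp_in [OF Suc.IH [OF ts(2)]]) (use ts in \<open>auto simp: Cons_div_chains\<close>)
  moreover have "(bvec us :: 'a list \<Rightarrow>\<^sub>0 'k) \<in> supp_in {us \<in> div_chains (Suc n). set us \<subseteq> set ts}"
    using ts by auto
  ultimately show ?case
    unfolding ts(1) bvec_Cons bdry_prepend by (intro vs.subspace_diff [OF subspace_supp_in]) (simp_all add: ts(1))
qed

lemma bdry_top:
  assumes "ts \<in> div_chains (Suc n)"
  shows "bdry (bvec ts) \<in> supp_in {us \<in> div_chains n. chain_max us divides chain_max ts}"
  using bdry_supp [OF assms]
  by (rule supp_in_mono) (use divides_top [OF assms] chain_max_closed [OF assms] top_divides in blast)

text \<open>All simplices of the prism have entries that divide \<open>u\<close> times the largest entry: this bounds the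
  degree of the homotopy.\<close>

lemma prism_supp:
  assumes u: "u \<in> carrier G - {\<one>}"
  shows "ts \<in> div_chains n \<Longrightarrow> (prism G u (bvec ts) :: 'a list \<Rightarrow>\<^sub>0 'k::field) \<in> supp_in {us \<in> div_chains (Suc n). \<forall>x\<in>set us. x divides u \<otimes> chain_max ts}"
proof (induction n arbitrary: ts)
  case 0
  then show ?case
    using u by (auto simp: Cons_div_chains)
next
  case (Suc n)
  obtain t us where ts: "ts = t # us" "us \<in> div_chains n" "t \<in> carrier G - {\<one>}" "\<forall>x\<in>set us. x divides t"
    using Suc.prems by (rule div_chains_SucE)
  have ut: "u \<otimes> t \<in> carrier G - {\<one>}"
    using u ts(3) no_invertibles by auto
  have tut: "t divides u \<otimes> t"
    using u ts(3) m_comm [of u t] by (intro dividesI [of u]) auto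
  have *: "x divides u \<otimes> t" if "x divides u \<otimes> chain_max us" "x \<in> carrier G" for x
  proof (rule divides_trans [OF that(1)])
    have "chain_max us divides t"
      using top_divides ts by blast
    then show "u \<otimes> chain_max us divides u \<otimes> t"
      using u chain_max_closed ts divides_mult_l by blast
  qed (use that in auto)
  have "(prepend (u \<otimes> t) (prism G u (bvec us)) :: 'a list \<Rightarrow>\<^sub>0 'k) \<in> supp_in {us \<in> div_chains (Suc (Suc n)). \<forall>x\<in>set us. x divides u \<otimes> chain_max ts}"
  proof (rule prepend_supp_in [OF Suc.IH [OF ts(2)]])
    fix vs assume "vs \<in> {us' \<in> div_chains (Suc n). \<forall>x\<in>set us'. x divides u \<otimes> chain_max us}"
    then have "vs \<in> div_chains (Suc n)" "\<forall>x\<in>set vs. x divides u \<otimes> t"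
      using * by (auto simp: div_chains_def)
    then show "(u \<otimes> t) # vs \<in> {us \<in> div_chains (Suc (Suc n)). \<forall>x\<in>set us. x divides u \<otimes> chain_max ts}"
      using ut by (auto simp: Cons_div_chains ts(1))
  qed
  moreover have "(bvec ((u \<otimes> t) # t # us) :: 'a list \<Rightarrow>\<^sub>0 'k) \<in> supp_in {us \<in> div_chains (Suc (Suc n)). \<forall>x\<in>set us. x divides u \<otimes> chain_max ts}"
  proof -
    have "\<forall>x\<in>set us. x divides u \<otimes> t"
      using ts tut ut divides_trans by (auto simp: div_chains_def subset_iff)
    then show ?thesis
      using ts ut tut by (auto simp: Cons_div_chains)
  qed
  ultimately show ?case
    unfolding ts(1) bvec_Cons prism_prepend by (intro vs.subspace_diff [OF subspace_supp_in]) (simp_all add: ts(1))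
qed

lemma prism_top:
  assumes u: "u \<in> carrier G - {\<one>}" and ts: "ts \<in> div_chains n"
  shows "prism G u (bvec ts) \<in> supp_in {us \<in> div_chains (Suc n). chain_max us divides u \<otimes> chain_max ts}"
  using prism_supp [OF assms]
  by (rule supp_in_mono) (use top_divides chain_max_closed [OF ts] u in auto)

lemma sgn_op_supp: "v \<in> supp_in X \<Longrightarrow> sgn_op v \<in> supp_in X"
  by (rule lin_supp_in [OF lin_sgn_op]) (auto simp: sgn_op_def supp_in_def split: if_splits)

lemma bdry_chains_0: "v \<in> supp_in (div_chains 0) \<Longrightarrow> bdry v = 0"
  by (rule lin_eq_supp_in [OF lin_bdry lin_zero]) auto

text \<open>The strand of \<open>l\<close> is the augmented complex of chains in the set of the divisors \<open>\<noteq> \<one>\<close> of \<open>l\<close>. For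
  \<open>l \<noteq> \<one>\<close> this set has the largest element \<open>l\<close>, so that the complex is a cone.\<close>

sublocale bar: strand_resolution G div_chains "\<lambda>_. chain_max" "\<lambda>_. bdry" "\<lambda>v. lookup v []"
proof
  show "chain_max b \<in> carrier G" if "b \<in> div_chains n" for b n
    using that by (rule chain_max_closed)
  show "\<exists>v\<in>supp_in (below G div_chains (\<lambda>_. chain_max) 0 \<one>). lookup v [] = 1"
    by (rule bexI [of _ "bvec []"]) (auto simp: below_def)
  fix l n assume l: "l \<in> carrier G"
  let ?S = "\<lambda>n. supp_in (below G div_chains (\<lambda>_. chain_max) n l)"
  show "bdry ` ?S (Suc n) = strand_cycles G div_chains (\<lambda>_. chain_max) (\<lambda>_. bdry) (\<lambda>v. lookup v []) n l"
  proof (intro equalityI subsetI)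
    fix w assume "w \<in> bdry ` ?S (Suc n)"
    then obtain v where v: "v \<in> ?S (Suc n)" "w = bdry v"
      by auto
    have "w \<in> ?S n"
      unfolding v(2)
    proof (rule lin_supp_in [OF lin_bdry v(1)])
      fix ts assume ts: "ts \<in> below G div_chains (\<lambda>_. chain_max) (Suc n) l"
      then have "ts \<in> div_chains (Suc n)"
        by (simp add: below_def)
      from bdry_top [OF this] show "bdry (bvec ts) \<in> ?S n"
        by (rule supp_in_mono) (use ts l divides_trans chain_max_closed in \<open>auto simp: below_def\<close>)
    qed
    moreover have "lookup w [] = 0" if "l = \<one>"
    proof -
      have "below G div_chains (\<lambda>_. chain_max) (Suc n) \<one> = {}"
        using below_one [of _ "Suc n"] by (fastforce simp: below_def dest: div_chains_length)
      then have "v = 0"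
        using v(1) that by (simp add: supp_in_def)
      then show ?thesis
        using v(2) by simp
    qed
    ultimately show "w \<in> strand_cycles G div_chains (\<lambda>_. chain_max) (\<lambda>_. bdry) (\<lambda>v. lookup v []) n l"
      using v(2) by (simp add: strand_cycles_def split: nat.split)
  next
    fix w assume w: "w \<in> strand_cycles G div_chains (\<lambda>_. chain_max) (\<lambda>_. bdry) (\<lambda>v. lookup v []) n l"
    then have wS: "w \<in> ?S n"
      by (simp add: strand_cycles_def)
    have dw: "bdry w = 0"
      using w bdry_chains_0 [of w] wS by (auto simp: strand_cycles_def below_def supp_in_def split: nat.splits)
    show "w \<in> bdry ` ?S (Suc n)"
    proof (cases "l = \<one>")
      case False
      \<comment> \<open>The cone over the largest element.\<close>
      have "prepend l w \<in> ?S (Suc n)"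
      proof (rule prepend_supp_in [OF wS])
        fix ts assume ts: "ts \<in> below G div_chains (\<lambda>_. chain_max) n l"
        then have "\<forall>x\<in>set ts. x divides l"
          using chain_elem_divides by (auto simp: below_def)
        then show "l # ts \<in> below G div_chains (\<lambda>_. chain_max) (Suc n) l"
          using l False ts by (auto simp: below_def Cons_div_chains)
      qed
      moreover have "bdry (prepend l w) = w"
        by (simp add: dw)
      ultimately show ?thesis
        by (metis imageI)
    next
      case True
      have "w = 0"
      proof (rule poly_mapping_eqI)
        fix ts
        have "ts = []" if "lookup w ts \<noteq> 0"
          using that wS True below_one [of ts n] by (auto simp: supp_in_def in_keys_iff below_def)
        moreover have "lookup w [] = 0"
        proof (cases n)
          case 0
          with w True show ?thesis by (simp add: strand_cycles_def)
        next
          case (Suc m)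
          then show ?thesis
            using wS by (auto simp: supp_in_def in_keys_iff below_def div_chains_def)
        qed
        ultimately show "lookup w ts = lookup 0 ts"
          by auto
      qed
      then show ?thesis
        by (intro image_eqI [of _ _ 0]) (simp_all add: vs.subspace_0 [OF subspace_supp_in])
    qed
  qed
qed (auto simp: lin_bdry lookup_add)

lemma finite_chains_below:
  assumes "l \<in> carrier G"
  shows "finite {ts \<in> div_chains n. chain_max ts divides l}"
proof (rule finite_subset)
  show "finite {ts. set ts \<subseteq> {x \<in> carrier G. x divides l} \<and> length ts = n}"
    by (rule finite_lists_length_eq [OF finite_divisors [OF assms]])
  show "{ts \<in> div_chains n. chain_max ts divides l} \<subseteq> {ts. set ts \<subseteq> {x \<in> carrier G. x divides l} \<and> length ts = n}"
  proof clarify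
    fix ts assume ts: "ts \<in> div_chains n" "chain_max ts divides l"
    have "x \<in> carrier G \<and> x divides l" if "x \<in> set ts" for x
      using chain_elem_divides [OF ts that] div_chains_set [OF ts(1) that] by simp
    then show "set ts \<subseteq> {x \<in> carrier G. x divides l} \<and> length ts = n"
      using div_chains_length [OF ts(1)] by auto
  qed
qed

lemma finite_at_max:
  assumes "l \<in> carrier G"
  shows "finite (at_deg div_chains (\<lambda>_. chain_max) n l)"
  by (rule finite_subset [OF _ finite_chains_below [OF assms, of n]]) (use divides_refl [OF assms] in \<open>auto simp: at_deg_def\<close>)

end


section \<open>Tate's resolution over the extended monoid\<close>

text \<open>The triple \<open>(ts, e, j)\<close> stands for the product of the chain \<open>ts\<close>, of \<open>X\<close> if \<open>e\<close> is true, and of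
  the divided power \<open>Y\<^bsup>(j)\<^esup>\<close>.\<close>

type_synonym 'a tate_index = "'a list \<times> bool \<times> nat"

definition emb :: "bool \<Rightarrow> nat \<Rightarrow> ('a list \<Rightarrow>\<^sub>0 'k::field) \<Rightarrow> ('a tate_index \<Rightarrow>\<^sub>0 'k)" where
  "emb e j = lext (\<lambda>ts. bvec (ts, e, j))"

text \<open>The differential of \<open>X\<close> is \<open>1\<close> and that of \<open>Y\<^bsup>(i+1)\<^esup>\<close> is \<open>X Y\<^bsup>(i)\<^esup>\<close> minus the
  prism operator applied to the coefficient of \<open>Y\<^bsup>(i)\<^esup>\<close>, with monomials forgotten.\<close>

definition tate_d :: "('a, 'm) monoid_scheme \<Rightarrow> 'a \<Rightarrow> ('a tate_index \<Rightarrow>\<^sub>0 'k::field) \<Rightarrow> ('a tate_index \<Rightarrow>\<^sub>0 'k)" where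
  "tate_d G u = lext (\<lambda>(ts, e, j).
     emb e j (bdry (bvec ts)) + (if e then emb False j (sgn_op (bvec ts)) else 0) +
     (case j of 0 \<Rightarrow> 0 | Suc i \<Rightarrow>
       (if e then 0 else emb True i (sgn_op (bvec ts))) - emb e i (prism G u (bvec ts))))"

text \<open>Two homotopies: the multiplication by \<open>X\<close>, and the map \<open>X Y\<^bsup>(j)\<^esup> \<mapsto> Y\<^bsup>(j+1)\<^esup>\<close>. What the second
  leaves over is the copy of the bar complex without \<open>X\<close> and \<open>Y\<close>, onto which \<open>tate_proj\<close> projects.\<close>

definition contract_X :: "('a tate_index \<Rightarrow>\<^sub>0 'k::field) \<Rightarrow> ('a tate_index \<Rightarrow>\<^sub>0 'k)" where
  "contract_X = lext (\<lambda>(ts, e, j). if e then 0 else emb True j (sgn_op (bvec ts)))"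

definition contract_Y :: "('a tate_index \<Rightarrow>\<^sub>0 'k::field) \<Rightarrow> ('a tate_index \<Rightarrow>\<^sub>0 'k)" where
  "contract_Y = lext (\<lambda>(ts, e, j). if e then emb False (Suc j) (sgn_op (bvec ts)) else 0)"

definition tate_proj :: "('a, 'm) monoid_scheme \<Rightarrow> 'a \<Rightarrow> ('a tate_index \<Rightarrow>\<^sub>0 'k::field) \<Rightarrow> ('a list \<Rightarrow>\<^sub>0 'k)" where
  "tate_proj G u = lext (\<lambda>(ts, e, j).
     if j = 0 then if e then - sgn_op (prism G u (bvec ts)) else bvec ts else 0)"

lemma lin_emb: "lin (emb e j)"
  and lin_tate_d: "lin (tate_d G u)"
  and lin_contract_X: "lin contract_X"
  and lin_contract_Y: "lin contract_Y"
  and lin_tate_proj: "lin (tate_proj G u)"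
  unfolding emb_def tate_d_def contract_X_def contract_Y_def tate_proj_def by (rule lin_lext)+

lemmas tate_lin [simp] =
  lin_simps [OF lin_emb] lin_simps [OF lin_tate_d] lin_simps [OF lin_contract_X]
  lin_simps [OF lin_contract_Y] lin_simps [OF lin_tate_proj]

lemma emb_bvec: "emb e j (bvec ts) = bvec (ts, e, j)"
  by (simp add: emb_def)

lemma linear_emb_eqI:
  assumes "lin f" "lin g" "\<And>ts. f (bvec (ts, e, j)) = g (bvec ts)"
  shows "f (emb e j v) = g v"
  by (rule lin_eqI [OF lin_compose [OF assms(1) lin_emb] assms(2)]) (simp add: emb_bvec assms)

lemma tate_d_emb:
  "tate_d G u (emb e j v) = emb e j (bdry v) + (if e then emb False j (sgn_op v) else 0) +
     (case j of 0 \<Rightarrow> 0 | Suc i \<Rightarrow> (if e then 0 else emb True i (sgn_op v)) - emb e i (prism G u v))"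
proof (rule linear_emb_eqI [OF lin_tate_d])
  show "lin (\<lambda>v. emb e j (bdry v) + (if e then emb False j (sgn_op v) else 0) +
     (case j of 0 \<Rightarrow> 0 | Suc i \<Rightarrow> (if e then 0 else emb True i (sgn_op v)) - emb e i (prism G u v)))"
    by (rule linI) (auto simp: vs.scale_right_distrib vs.scale_right_diff_distrib algebra_simps split: nat.split)
  show "tate_d G u (bvec (ts, e, j)) = emb e j (bdry (bvec ts)) + (if e then emb False j (sgn_op (bvec ts)) else 0) +
     (case j of 0 \<Rightarrow> 0 | Suc i \<Rightarrow> (if e then 0 else emb True i (sgn_op (bvec ts))) - emb e i (prism G u (bvec ts)))" for ts
    unfolding tate_d_def by simp
qed

lemma tate_d_simps [simp]:
  "tate_d G u (emb False 0 v) = emb False 0 (bdry v)"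
  "tate_d G u (emb True 0 v) = emb True 0 (bdry v) + emb False 0 (sgn_op v)"
  "tate_d G u (emb False (Suc i) v) = emb False (Suc i) (bdry v) + emb True i (sgn_op v) - emb False i (prism G u v)"
  "tate_d G u (emb True (Suc i) v) = emb True (Suc i) (bdry v) + emb False (Suc i) (sgn_op v) - emb True i (prism G u v)"
  by (simp_all add: tate_d_emb)

lemma contract_X_simps [simp]:
  "contract_X (emb False j v) = emb True j (sgn_op v)"
  "contract_X (emb True j v) = 0"
  by (rule linear_emb_eqI [OF lin_contract_X];
      simp add: contract_X_def lin_zero lin_compose [OF lin_emb lin_sgn_op])+

lemma contract_Y_simps [simp]:
  "contract_Y (emb True j v) = emb False (Suc j) (sgn_op v)"
  "contract_Y (emb False j v) = 0"
  by (rule linear_emb_eqI [OF lin_contract_Y];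
      simp add: contract_Y_def lin_zero lin_compose [OF lin_emb lin_sgn_op])+

lemma tate_proj_simps [simp]:
  "tate_proj G u (emb False 0 v) = v"
  "tate_proj G u (emb True 0 v) = - sgn_op (prism G u v)"
  "tate_proj G u (emb e (Suc j) v) = 0"
  by (rule linear_emb_eqI [OF lin_tate_proj];
      simp add: tate_proj_def lin_zero lin_id lin_uminus [OF lin_compose [OF lin_sgn_op lin_prism]])+

text \<open>The case distinction between \<open>Y\<^bsup>(0)\<^esup>\<close> and higher divided powers matches the equations of the
  differential, and an arbitrary chain \<open>v\<close> in each summand makes the rules for chains applicable.\<close>

lemma tate_eqI:
  assumes "lin f" "lin g"
    and "\<And>v. f (emb False 0 v) = g (emb False 0 v)" "\<And>v. f (emb True 0 v) = g (emb True 0 v)"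
    and "\<And>i v. f (emb False (Suc i) v) = g (emb False (Suc i) v)"
    and "\<And>i v. f (emb True (Suc i) v) = g (emb True (Suc i) v)"
  shows "f z = g z"
proof (rule lin_eqI [OF assms(1,2)])
  fix b
  show "f (bvec b) = g (bvec b)"
  proof (cases b)
    case (fields ts e j)
    then show ?thesis
      unfolding fields emb_bvec [symmetric] by (cases e; cases j) (simp_all add: assms)
  qed
qed

lemma prism_bdry: "prism G u (bdry v) = v - bdry (prism G u v)"
  using bdry_prism [of G u v] by (simp add: algebra_simps)

lemmas chain_rules = prism_bdry sgn_op_bdry sgn_op_prism

lemma tate_d_tate_d [simp]: "tate_d G u (tate_d G u z) = 0"
proof (rule tate_eqI [OF lin_compose [OF lin_tate_d lin_tate_d] lin_zero])
  fix i v
  show "tate_d G u (tate_d G u (emb False (Suc i) v)) = 0"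
    by (cases i) (simp_all add: chain_rules)
  show "tate_d G u (tate_d G u (emb True (Suc i) v)) = 0"
    by (cases i) (simp_all add: chain_rules)
qed (simp_all add: chain_rules)

text \<open>The homotopies hold for all vectors; the restriction to strands is needed only to keep
  their values in the strand.\<close>

lemma contract_X: "tate_d G u (contract_X z) + contract_X (tate_d G u z) = z"
proof (rule tate_eqI [OF lin_plus [OF lin_compose [OF lin_tate_d lin_contract_X] lin_compose [OF lin_contract_X lin_tate_d]] lin_id])
qed (simp_all add: chain_rules)

lemma contract_Y: "tate_d G u (contract_Y z) + contract_Y (tate_d G u z) + emb False 0 (tate_proj G u z) = z"
proof (rule tate_eqI [OF lin_plus [OF lin_plus [OF lin_compose [OF lin_tate_d lin_contract_Y]
          lin_compose [OF lin_contract_Y lin_tate_d]] lin_compose [OF lin_emb lin_tate_proj]] lin_id])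
qed (simp_all add: chain_rules)

lemma emb_eq_0: "emb e j v = 0 \<Longrightarrow> v = 0"
proof -
  assume 0: "emb e j v = 0"
  have "lext (\<lambda>(ts, e, j). bvec ts) (emb e j v) = v"
    by (rule linear_emb_eqI [OF lin_lext lin_id]) simp
  then show "v = 0"
    by (simp add: 0 lin_0 [OF lin_lext])
qed

lemma emb_supp_in: "v \<in> supp_in X \<Longrightarrow> (\<And>ts. ts \<in> X \<Longrightarrow> (ts, e, j) \<in> Y) \<Longrightarrow> emb e j v \<in> supp_in Y"
  by (rule lin_supp_in [OF lin_emb]) (auto simp: emb_bvec)

text \<open>The properties of \<open>\<Lambda>[\<rho>/r]\<close> on which Tate's construction depends; \<open>cl l k\<close> is the element
  \<open>l + k \<rho>/r\<close>, and normal forms have \<open>k < r\<close>.\<close>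

locale fraction_extension =
  G: divisor_finite_monoid G + H: reduced_monoid H for G :: "('a, 'm) monoid_scheme" (structure)
    and H :: "('b, 'n) monoid_scheme" (structure) +
  fixes cl :: "'a \<Rightarrow> nat \<Rightarrow> 'b" and r :: nat and \<rho> u u'
  assumes r: "r \<ge> 2"
    and u: "u \<in> carrier G - {\<one>\<^bsub>G\<^esub>}" and u': "u' \<in> carrier G - {\<one>\<^bsub>G\<^esub>}" and rho: "\<rho> = u \<otimes>\<^bsub>G\<^esub> u'"
    and cl_closed: "l \<in> carrier G \<Longrightarrow> cl l k \<in> carrier H"
    and cl_onto: "h \<in> carrier H \<Longrightarrow> \<exists>l \<in> carrier G. \<exists>k < r. h = cl l k"
    and cl_mult: "l \<in> carrier G \<Longrightarrow> m \<in> carrier G \<Longrightarrow> cl l k \<otimes>\<^bsub>H\<^esub> cl m j = cl (l \<otimes>\<^bsub>G\<^esub> m) (k + j)"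
    and cl_one: "\<one>\<^bsub>H\<^esub> = cl \<one>\<^bsub>G\<^esub> 0"
    and cl_eq: "l \<in> carrier G \<Longrightarrow> m \<in> carrier G \<Longrightarrow> cl l k = cl m j \<longleftrightarrow>
      k mod r = j mod r \<and> l \<otimes>\<^bsub>G\<^esub> (\<rho> [^]\<^bsub>G\<^esub> (k div r)) = m \<otimes>\<^bsub>G\<^esub> (\<rho> [^]\<^bsub>G\<^esub> (j div r))"
begin

lemma rho_closed [simp]: "\<rho> \<in> carrier G"
  using u u' rho by simp

lemma cl_inj: "l \<in> carrier G \<Longrightarrow> m \<in> carrier G \<Longrightarrow> k < r \<Longrightarrow> j < r \<Longrightarrow> cl l k = cl m j \<longleftrightarrow> l = m \<and> k = j"
  by (auto simp: cl_eq)

lemma cl_carry: "l \<in> carrier G \<Longrightarrow> k < r \<Longrightarrow> cl l (r + k) = cl (l \<otimes>\<^bsub>G\<^esub> \<rho>) k"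
  using r by (simp add: cl_eq)

text \<open>In a strand of degree \<open>l + k \<rho>/r\<close> with \<open>k > 0\<close> the variable \<open>X\<close> costs nothing; for \<open>k = 0\<close> the
  quotient by \<open>\<rho>/r\<close> must borrow a whole \<open>\<rho>\<close> from \<open>l\<close>. This dichotomy decides which homotopy applies.\<close>

lemma cl_divides:
  assumes m: "m \<in> carrier G" and l: "l \<in> carrier G" and k: "k < r"
  shows "cl m (of_bool e) divides\<^bsub>H\<^esub> cl l k \<longleftrightarrow>
    (if e \<and> k = 0 then m \<otimes>\<^bsub>G\<^esub> \<rho> else m) divides\<^bsub>G\<^esub> l"
proof
  assume "cl m (of_bool e) divides\<^bsub>H\<^esub> cl l k"
  then obtain h where "h \<in> carrier H" "cl l k = cl m (of_bool e) \<otimes>\<^bsub>H\<^esub> h"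
    by (auto simp: factor_def)
  then obtain n c where n: "n \<in> carrier G" "c < r" "cl l k = cl (m \<otimes>\<^bsub>G\<^esub> n) (of_bool e + c)"
    using cl_onto cl_mult m by metis
  then have eq: "k = (of_bool e + c) mod r"
    "l = m \<otimes>\<^bsub>G\<^esub> n \<otimes>\<^bsub>G\<^esub> (\<rho> [^]\<^bsub>G\<^esub> ((of_bool e + c) div r))"
    using cl_eq [of l "m \<otimes>\<^bsub>G\<^esub> n" k "of_bool e + c"] m l k by auto
  show "(if e \<and> k = 0 then m \<otimes>\<^bsub>G\<^esub> \<rho> else m) divides\<^bsub>G\<^esub> l"
  proof (cases "e \<and> k = 0")
    case True
    then have "Suc c = r"
      using eq(1) n(2) r by (cases "Suc c = r") auto
    then have "(of_bool e + c) div r = 1"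
      using True r by auto
    then have "l = (m \<otimes>\<^bsub>G\<^esub> \<rho>) \<otimes>\<^bsub>G\<^esub> n"
      using eq(2) m n(1) by (simp add: G.m_ac)
    with True n show ?thesis
      by (auto simp: factor_def)
  next
    case False
    have "l = m \<otimes>\<^bsub>G\<^esub> (n \<otimes>\<^bsub>G\<^esub> (\<rho> [^]\<^bsub>G\<^esub> ((of_bool e + c) div r)))"
      using eq(2) m n(1) by (simp add: G.m_assoc)
    then have "m divides\<^bsub>G\<^esub> l"
      using n(1) by (intro dividesI) auto
    then show ?thesis
      by (subst if_not_P [OF False])
  qed
next
  assume div: "(if e \<and> k = 0 then m \<otimes>\<^bsub>G\<^esub> \<rho> else m) divides\<^bsub>G\<^esub> l"
  show "cl m (of_bool e) divides\<^bsub>H\<^esub> cl l k"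
  proof (cases "e \<and> k = 0")
    case True
    then obtain n where n: "n \<in> carrier G" "l = m \<otimes>\<^bsub>G\<^esub> \<rho> \<otimes>\<^bsub>G\<^esub> n"
      using div by (auto simp: factor_def)
    have "cl m (of_bool e) \<otimes>\<^bsub>H\<^esub> cl n (r - 1) = cl (m \<otimes>\<^bsub>G\<^esub> n) (r + 0)"
      using True r m n(1) by (simp add: cl_mult)
    also have "\<dots> = cl l k"
      using True r m n by (subst cl_carry) (simp_all add: G.m_ac)
    finally show ?thesis
      using n(1) cl_closed by (intro dividesI [of "cl n (r - 1)"]) auto
  next
    case False
    then obtain n where n: "n \<in> carrier G" "l = m \<otimes>\<^bsub>G\<^esub> n"
      using div by (auto simp: factor_def)
    have "cl m (of_bool e) \<otimes>\<^bsub>H\<^esub> cl n (k - of_bool e) = cl l k"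
      using False m n by (auto simp: cl_mult)
    then show ?thesis
      using n(1) cl_closed by (intro dividesI [of "cl n (k - of_bool e)"]) auto
  qed
qed

lemma divisor_finite_extension: "divisor_finite_monoid H"
proof
  fix h assume "h \<in> carrier H"
  then obtain l k where lk: "l \<in> carrier G" "k < r" "h = cl l k"
    using cl_onto by blast
  have "{x \<in> carrier H. x divides\<^bsub>H\<^esub> h} \<subseteq> (\<lambda>(m, j). cl m j) ` ({m \<in> carrier G. m divides\<^bsub>G\<^esub> l} \<times> {..<r})"
  proof clarify
    fix x assume x: "x \<in> carrier H" "x divides\<^bsub>H\<^esub> h"
    then obtain m j where mj: "m \<in> carrier G" "j < r" "x = cl m j"
      using cl_onto by blast
    obtain y where "y \<in> carrier H" "h = x \<otimes>\<^bsub>H\<^esub> y"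
      using x(2) by (auto simp: factor_def)
    then obtain n c where n: "n \<in> carrier G" "cl l k = cl (m \<otimes>\<^bsub>G\<^esub> n) (j + c)"
      using cl_onto cl_mult mj lk(3) by metis
    then have "l = m \<otimes>\<^bsub>G\<^esub> (n \<otimes>\<^bsub>G\<^esub> (\<rho> [^]\<^bsub>G\<^esub> ((j + c) div r)))"
      using cl_eq [of l "m \<otimes>\<^bsub>G\<^esub> n" k "j + c"] mj lk by (simp add: G.m_assoc)
    then have "m divides\<^bsub>G\<^esub> l"
      using n(1) by (intro dividesI) auto
    then show "x \<in> (\<lambda>(m, j). cl m j) ` ({m \<in> carrier G. m divides\<^bsub>G\<^esub> l} \<times> {..<r})"
      using mj by auto
  qed
  then show "finite {x \<in> carrier H. x divides\<^bsub>H\<^esub> h}"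
    by (rule finite_subset) (use G.finite_divisors lk(1) in auto)
qed

definition tate_basis :: "nat \<Rightarrow> 'a tate_index set" where
  "tate_basis n = {(ts, e, j). ts \<in> G.div_chains (length ts) \<and> length ts + of_bool e + 2 * j = n}"

definition tate_deg :: "'a tate_index \<Rightarrow> 'b" where
  "tate_deg = (\<lambda>(ts, e, j). cl (G.chain_max ts \<otimes>\<^bsub>G\<^esub> (\<rho> [^]\<^bsub>G\<^esub> j)) (of_bool e))"

abbreviation tate_below :: "nat \<Rightarrow> 'b \<Rightarrow> 'a tate_index set" where
  "tate_below \<equiv> below H tate_basis (\<lambda>_. tate_deg)"

lemma tate_below_iff:
  assumes l: "l \<in> carrier G" and k: "k < r"
  shows "(ts, e, j) \<in> tate_below n (cl l k) \<longleftrightarrow>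
    ts \<in> G.div_chains (length ts) \<and> length ts + of_bool e + 2 * j = n \<and>
    (G.chain_max ts \<otimes>\<^bsub>G\<^esub> (\<rho> [^]\<^bsub>G\<^esub> (if e \<and> k = 0 then Suc j else j))) divides\<^bsub>G\<^esub> l"
  using G.chain_max_closed [of ts "length ts"] cl_divides [of "G.chain_max ts \<otimes>\<^bsub>G\<^esub> (\<rho> [^]\<^bsub>G\<^esub> j)" l k e] l k
  by (auto simp: below_def tate_basis_def tate_deg_def G.m_assoc)

lemma max_pow_closed [simp]:
  "ts \<in> G.div_chains n \<Longrightarrow> G.chain_max ts \<otimes>\<^bsub>G\<^esub> (\<rho> [^]\<^bsub>G\<^esub> (x::nat)) \<in> carrier G"
  by (simp add: G.chain_max_closed)

lemma mult_pow_divides: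
  assumes "a divides\<^bsub>G\<^esub> b" "a \<in> carrier G" "b \<in> carrier G" "(b \<otimes>\<^bsub>G\<^esub> (\<rho> [^]\<^bsub>G\<^esub> (x::nat))) divides\<^bsub>G\<^esub> l"
  shows "(a \<otimes>\<^bsub>G\<^esub> (\<rho> [^]\<^bsub>G\<^esub> x)) divides\<^bsub>G\<^esub> l"
  by (rule G.divides_trans [OF _ assms(4)]) (use assms in \<open>auto intro: G.divides_mult_r\<close>)

lemma pow_Suc_divides:
  assumes "a \<in> carrier G" "(a \<otimes>\<^bsub>G\<^esub> (\<rho> [^]\<^bsub>G\<^esub> Suc x)) divides\<^bsub>G\<^esub> l"
  shows "(a \<otimes>\<^bsub>G\<^esub> (\<rho> [^]\<^bsub>G\<^esub> x)) divides\<^bsub>G\<^esub> l"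
proof (rule G.divides_trans [OF _ assms(2)])
  have "a \<otimes>\<^bsub>G\<^esub> (\<rho> [^]\<^bsub>G\<^esub> Suc x) = (a \<otimes>\<^bsub>G\<^esub> (\<rho> [^]\<^bsub>G\<^esub> x)) \<otimes>\<^bsub>G\<^esub> \<rho>"
    using assms(1) by (simp add: G.m_assoc)
  then show "(a \<otimes>\<^bsub>G\<^esub> (\<rho> [^]\<^bsub>G\<^esub> x)) divides\<^bsub>G\<^esub> (a \<otimes>\<^bsub>G\<^esub> (\<rho> [^]\<^bsub>G\<^esub> Suc x))"
    by (rule dividesI [OF rho_closed])
qed (use assms in auto)

text \<open>The prism operator multiplies degrees by \<open>u\<close> while one factor \<open>Y\<close>, of degree \<open>\<rho>\<close>, disappears.
  As \<open>u\<close> divides \<open>\<rho>\<close>, the strand is not left.\<close>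

lemma factor_pow_divides:
  assumes "b divides\<^bsub>G\<^esub> u \<otimes>\<^bsub>G\<^esub> a" "b \<in> carrier G" "a \<in> carrier G"
    and "(a \<otimes>\<^bsub>G\<^esub> (\<rho> [^]\<^bsub>G\<^esub> Suc x)) divides\<^bsub>G\<^esub> l"
  shows "(b \<otimes>\<^bsub>G\<^esub> (\<rho> [^]\<^bsub>G\<^esub> x)) divides\<^bsub>G\<^esub> l"
proof (rule mult_pow_divides [OF assms(1,2)])
  have "a \<otimes>\<^bsub>G\<^esub> (\<rho> [^]\<^bsub>G\<^esub> Suc x) = ((u \<otimes>\<^bsub>G\<^esub> a) \<otimes>\<^bsub>G\<^esub> (\<rho> [^]\<^bsub>G\<^esub> x)) \<otimes>\<^bsub>G\<^esub> u'"
    using assms(3) u u' by (simp add: rho G.m_ac)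
  then have "((u \<otimes>\<^bsub>G\<^esub> a) \<otimes>\<^bsub>G\<^esub> (\<rho> [^]\<^bsub>G\<^esub> x)) divides\<^bsub>G\<^esub> (a \<otimes>\<^bsub>G\<^esub> (\<rho> [^]\<^bsub>G\<^esub> Suc x))"
    using u' by (intro dividesI [of u']) auto
  then show "((u \<otimes>\<^bsub>G\<^esub> a) \<otimes>\<^bsub>G\<^esub> (\<rho> [^]\<^bsub>G\<^esub> x)) divides\<^bsub>G\<^esub> l"
    by (rule G.divides_trans [OF _ assms(4)]) (use u assms in auto)
qed (use u assms in auto)

lemma tate_d_bvec:
  "tate_d G u (bvec (ts, e, j)) = emb e j (bdry (bvec ts)) + (if e then emb False j (sgn_op (bvec ts)) else 0) +
     (case j of 0 \<Rightarrow> 0 | Suc i \<Rightarrow> (if e then 0 else emb True i (sgn_op (bvec ts))) - emb e i (prism G u (bvec ts)))"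
  by (simp only: tate_d_emb flip: emb_bvec)

lemma tate_d_below:
  assumes l: "l \<in> carrier G" and k: "k < r" and z: "z \<in> supp_in (tate_below (Suc n) (cl l k))"
  shows "tate_d G u z \<in> supp_in (tate_below n (cl l k))"
proof (rule lin_supp_in [OF lin_tate_d z])
  fix b assume b: "b \<in> tate_below (Suc n) (cl l k)"
  obtain ts e j where tej: "b = (ts, e, j)"
    by (cases b)
  define x where "x j = (if e \<and> k = 0 then Suc j else j)" for j
  have ts: "ts \<in> G.div_chains (length ts)" and len: "length ts + of_bool e + 2 * j = Suc n"
    and div: "(G.chain_max ts \<otimes>\<^bsub>G\<^esub> (\<rho> [^]\<^bsub>G\<^esub> x j)) divides\<^bsub>G\<^esub> l"
    using b by (auto simp: tej tate_below_iff l k x_def)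
  note mts = G.chain_max_closed [OF ts]
  have a: "emb e j (bdry (bvec ts)) \<in> supp_in (tate_below n (cl l k))"
  proof (cases ts)
    case Nil
    then show ?thesis
      by (simp add: vs.subspace_0 [OF subspace_supp_in])
  next
    case (Cons t us)
    then have ts': "ts \<in> G.div_chains (Suc (length us))"
      using ts by simp
    show ?thesis
    proof (rule emb_supp_in [OF G.bdry_top [OF ts']])
      fix vs assume vs: "vs \<in> {vs \<in> G.div_chains (length us). G.chain_max vs divides\<^bsub>G\<^esub> G.chain_max ts}"
      then have "(G.chain_max vs \<otimes>\<^bsub>G\<^esub> (\<rho> [^]\<^bsub>G\<^esub> x j)) divides\<^bsub>G\<^esub> l"
        using mult_pow_divides [OF _ _ mts div] G.chain_max_closed by blast
      then show "(vs, e, j) \<in> tate_below n (cl l k)"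
        using vs len G.div_chains_length by (auto simp: tate_below_iff l k x_def Cons)
    qed
  qed
  have b: "(if e then emb False j (sgn_op (bvec ts)) else 0) \<in> supp_in (tate_below n (cl l k))"
  proof (cases e)
    case True
    have "emb False j (sgn_op (bvec ts)) \<in> supp_in (tate_below n (cl l k))"
      by (rule emb_supp_in [OF G.sgn_op_supp [of _ "{ts}"]])
        (use ts len True div pow_Suc_divides [OF mts] in
          \<open>auto simp: tate_below_iff l k x_def split: if_splits simp del: G.nat_pow_Suc\<close>)
    with True show ?thesis by simp
  qed (simp add: vs.subspace_0 [OF subspace_supp_in])
  have c: "(case j of 0 \<Rightarrow> 0 | Suc i \<Rightarrow> (if e then 0 else emb True i (sgn_op (bvec ts))) - emb e i (prism G u (bvec ts)))
    \<in> supp_in (tate_below n (cl l k))"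
  proof (cases j)
    case (Suc i)
    have "emb True i (sgn_op (bvec ts)) \<in> supp_in (tate_below n (cl l k))" if "\<not> e"
      by (rule emb_supp_in [OF G.sgn_op_supp [of _ "{ts}"]])
        (use ts len that div Suc pow_Suc_divides [OF mts] in
          \<open>auto simp: tate_below_iff l k x_def split: if_splits simp del: G.nat_pow_Suc\<close>)
    moreover have "emb e i (prism G u (bvec ts)) \<in> supp_in (tate_below n (cl l k))"
    proof (rule emb_supp_in [OF G.prism_top [OF u ts]])
      fix vs assume vs: "vs \<in> {vs \<in> G.div_chains (Suc (length ts)). G.chain_max vs divides\<^bsub>G\<^esub> u \<otimes>\<^bsub>G\<^esub> G.chain_max ts}"
      have "x j = Suc (x i)"
        by (simp add: x_def Suc)
      then have "(G.chain_max vs \<otimes>\<^bsub>G\<^esub> (\<rho> [^]\<^bsub>G\<^esub> x i)) divides\<^bsub>G\<^esub> l"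
        using factor_pow_divides [OF _ _ mts, of _ "x i" l] vs div G.chain_max_closed by auto
      then show "(vs, e, i) \<in> tate_below n (cl l k)"
        using vs len G.div_chains_length by (auto simp: tate_below_iff l k x_def Suc)
    qed
    ultimately show ?thesis
      using Suc vs.subspace_diff [OF subspace_supp_in] vs.subspace_neg [OF subspace_supp_in] by auto
  qed (simp add: vs.subspace_0 [OF subspace_supp_in])
  show "tate_d G u (bvec b) \<in> supp_in (tate_below n (cl l k))"
    unfolding tej tate_d_bvec by (rule vs.subspace_add [OF subspace_supp_in vs.subspace_add [OF subspace_supp_in a b] c])
qed

text \<open>For \<open>k > 0\<close> the degree of a term divides \<open>l + k \<rho>/r\<close> with and without the factor \<open>X\<close>, so that the
  multiplication by \<open>X\<close> contracts the strand.\<close>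

lemma contract_X_below:
  fixes z :: "'a tate_index \<Rightarrow>\<^sub>0 'k::field"
  assumes l: "l \<in> carrier G" and k: "k < r" "k \<noteq> 0" and z: "z \<in> supp_in (tate_below n (cl l k))"
  shows "contract_X z \<in> supp_in (tate_below (Suc n) (cl l k))"
proof (rule lin_supp_in [OF lin_contract_X z])
  fix b assume b: "b \<in> tate_below n (cl l k)"
  obtain ts e j where tej: "b = (ts, e, j)"
    by (cases b)
  have "(emb True j (sgn_op (bvec ts)) :: 'a tate_index \<Rightarrow>\<^sub>0 'k) \<in> supp_in (tate_below (Suc n) (cl l k))" if "\<not> e"
    by (rule emb_supp_in [OF G.sgn_op_supp [of _ "{ts}"]]) (use b k that in \<open>auto simp: tej tate_below_iff l\<close>)
  then show "contract_X (bvec b :: 'a tate_index \<Rightarrow>\<^sub>0 'k) \<in> supp_in (tate_below (Suc n) (cl l k))"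
    unfolding tej contract_X_def by (simp add: vs.subspace_0 [OF subspace_supp_in])
qed

text \<open>For \<open>k = 0\<close> the factors \<open>X\<close> and \<open>Y\<close> impose the same divisibility condition, hence one may be
  replaced by the other.\<close>

lemma contract_Y_below:
  fixes z :: "'a tate_index \<Rightarrow>\<^sub>0 'k::field"
  assumes l: "l \<in> carrier G" and z: "z \<in> supp_in (tate_below n (cl l 0))"
  shows "contract_Y z \<in> supp_in (tate_below (Suc n) (cl l 0))"
proof (rule lin_supp_in [OF lin_contract_Y z])
  fix b assume b: "b \<in> tate_below n (cl l 0)"
  obtain ts e j where tej: "b = (ts, e, j)"
    by (cases b)
  have r0: "0 < r"
    using r by simp
  have "(emb False (Suc j) (sgn_op (bvec ts)) :: 'a tate_index \<Rightarrow>\<^sub>0 'k) \<in> supp_in (tate_below (Suc n) (cl l 0))" if "e"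
    by (rule emb_supp_in [OF G.sgn_op_supp [of _ "{ts}"]])
      (use b that in \<open>auto simp: tej tate_below_iff [OF l r0] simp del: G.nat_pow_Suc\<close>)
  then show "contract_Y (bvec b :: 'a tate_index \<Rightarrow>\<^sub>0 'k) \<in> supp_in (tate_below (Suc n) (cl l 0))"
    unfolding tej contract_Y_def by (simp add: vs.subspace_0 [OF subspace_supp_in])
qed

lemma tate_proj_below:
  fixes z :: "'a tate_index \<Rightarrow>\<^sub>0 'k::field"
  assumes l: "l \<in> carrier G" and z: "z \<in> supp_in (tate_below n (cl l 0))"
  shows "tate_proj G u z \<in> G.bar.strand n l"
proof (rule lin_supp_in [OF lin_tate_proj z])
  fix b assume b: "b \<in> tate_below n (cl l 0)"
  obtain ts e j where tej: "b = (ts, e, j)"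
    by (cases b)
  have r0: "0 < r"
    using r by simp
  show "tate_proj G u (bvec b :: 'a tate_index \<Rightarrow>\<^sub>0 'k) \<in> G.bar.strand n l"
  proof (cases "j = 0")
    case False
    then show ?thesis
      by (simp add: tej tate_proj_def vs.subspace_0 [OF subspace_supp_in])
  next
    case j: True
    have ts: "ts \<in> G.div_chains (length ts)"
      using b by (auto simp: tej tate_below_iff [OF l r0])
    note mts = G.chain_max_closed [OF ts]
    show ?thesis
    proof (cases e)
      case False
      then have "ts \<in> G.div_chains n \<and> G.chain_max ts divides\<^bsub>G\<^esub> l"
        using b j mts by (auto simp: tej tate_below_iff [OF l r0])
      with False j show ?thesis
        by (simp add: tej tate_proj_def below_def)
    next
      case True
      then have len: "n = Suc (length ts)" and div: "(G.chain_max ts \<otimes>\<^bsub>G\<^esub> (\<rho> [^]\<^bsub>G\<^esub> Suc 0)) divides\<^bsub>G\<^esub> l"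
        using b j by (auto simp: tej tate_below_iff [OF l r0])
      have "(prism G u (bvec ts) :: 'a list \<Rightarrow>\<^sub>0 'k) \<in> G.bar.strand n l"
      proof (rule supp_in_mono [OF G.prism_top [OF u ts]], clarify)
        fix us assume us: "us \<in> G.div_chains (Suc (length ts))" "G.chain_max us divides\<^bsub>G\<^esub> u \<otimes>\<^bsub>G\<^esub> G.chain_max ts"
        have "G.chain_max us divides\<^bsub>G\<^esub> l"
          using factor_pow_divides [OF us(2) G.chain_max_closed [OF us(1)] mts div] G.chain_max_closed [OF us(1)] by simp
        then show "us \<in> below G G.div_chains (\<lambda>_. G.chain_max) n l"
          using us(1) by (simp add: below_def len)
      qed
      then show ?thesis
        using True j by (simp add: tej tate_proj_def G.sgn_op_supp vs.subspace_neg [OF subspace_supp_in])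
    qed
  qed
qed

lemma emb_below:
  assumes l: "l \<in> carrier G" and v: "v \<in> G.bar.strand n l"
  shows "emb False 0 v \<in> supp_in (tate_below n (cl l 0))"
proof (rule emb_supp_in [OF v])
  fix ts assume ts: "ts \<in> below G G.div_chains (\<lambda>_. G.chain_max) n l"
  have r0: "0 < r"
    using r by simp
  have "ts \<in> G.div_chains n" "G.chain_max ts divides\<^bsub>G\<^esub> l"
    using ts by (auto simp: below_def)
  then show "(ts, False, 0) \<in> tate_below n (cl l 0)"
    using G.chain_max_closed G.div_chains_length by (auto simp: tate_below_iff [OF l r0])
qed

lemma tate_deg_closed: "b \<in> tate_basis n \<Longrightarrow> tate_deg b \<in> carrier H"
  by (auto simp: tate_basis_def tate_deg_def intro!: cl_closed max_pow_closed)

lemma tate_below_one: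
  assumes "(ts, e, j) \<in> tate_below n (cl \<one>\<^bsub>G\<^esub> 0)"
  shows "ts = [] \<and> j = 0 \<and> \<not> e"
proof -
  have r0: "0 < r"
    using r by simp
  define x where "x = (if e then Suc j else j)"
  have ts: "ts \<in> G.div_chains (length ts)" and div: "(G.chain_max ts \<otimes>\<^bsub>G\<^esub> (\<rho> [^]\<^bsub>G\<^esub> x)) divides\<^bsub>G\<^esub> \<one>\<^bsub>G\<^esub>"
    using assms by (auto simp: tate_below_iff [OF G.one_closed r0] x_def)
  note mts = G.chain_max_closed [OF ts]
  have "G.chain_max ts \<otimes>\<^bsub>G\<^esub> (\<rho> [^]\<^bsub>G\<^esub> x) = \<one>\<^bsub>G\<^esub>"
    using G.divides_one [OF div] mts by simp
  then have *: "G.chain_max ts = \<one>\<^bsub>G\<^esub>" "\<rho> [^]\<^bsub>G\<^esub> x = \<one>\<^bsub>G\<^esub>"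
    using G.no_invertibles [OF mts, of "\<rho> [^]\<^bsub>G\<^esub> x"] by auto
  have "x = 0"
  proof (cases x)
    case (Suc y)
    then have "\<rho> [^]\<^bsub>G\<^esub> y \<otimes>\<^bsub>G\<^esub> \<rho> = \<one>\<^bsub>G\<^esub>"
      using *(2) by simp
    then have "u \<otimes>\<^bsub>G\<^esub> u' = \<one>\<^bsub>G\<^esub>"
      using G.no_invertibles [of "\<rho> [^]\<^bsub>G\<^esub> y" \<rho>] rho_closed by (simp add: rho [symmetric])
    then show ?thesis
      using G.no_invertibles [of u u'] u u' by auto
  qed simp
  then show ?thesis
    using G.chain_max_eq_one [OF ts *(1)] by (auto simp: x_def split: if_splits)
qed

text \<open>A strand with \<open>k > 0\<close> is contracted by the multiplication by \<open>X\<close>. In a strand with \<open>k = 0\<close> every cycle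
  differs by a boundary from a cycle of the bar resolution, which is exact.\<close>

lemma tate_exact:
  assumes "h \<in> carrier H"
  shows "tate_d G u ` supp_in (tate_below (Suc n) h) =
    (strand_cycles H tate_basis (\<lambda>_. tate_deg) (\<lambda>_. tate_d G u) (\<lambda>z. lookup z ([], False, 0)) n h
      :: ('a tate_index \<Rightarrow>\<^sub>0 'k::field) set)"
proof -
  have r0: "0 < r"
    using r by simp
  obtain l k where l: "l \<in> carrier G" and k: "k < r" and h: "h = cl l k"
    using cl_onto assms by blast
  show ?thesis
  proof (intro equalityI subsetI)
    fix w :: "'a tate_index \<Rightarrow>\<^sub>0 'k" assume "w \<in> tate_d G u ` supp_in (tate_below (Suc n) h)"
    then obtain z where z: "z \<in> supp_in (tate_below (Suc n) h)" "w = tate_d G u z"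
      by auto
    have "lookup w ([], False, 0) = 0" if n: "n = 0" and one: "h = \<one>\<^bsub>H\<^esub>"
    proof -
      have "tate_below (Suc n) h = {}"
      proof (rule equals0I)
        fix b assume b: "b \<in> tate_below (Suc n) h"
        obtain ts e j where tej: "b = (ts, e, j)"
          by (cases b)
        have "ts = [] \<and> j = 0 \<and> \<not> e"
          using b by (intro tate_below_one) (simp add: one cl_one tej)
        with b show False
          by (simp add: tej one cl_one tate_below_iff [OF G.one_closed r0])
      qed
      then have "z = 0"
        using z(1) by (simp add: supp_in_def)
      then show ?thesis
        by (simp add: z(2))
    qed
    then show "w \<in> strand_cycles H tate_basis (\<lambda>_. tate_deg) (\<lambda>_. tate_d G u) (\<lambda>z. lookup z ([], False, 0)) n h"
      using tate_d_below [OF l k, of z n] z by (simp add: h strand_cycles_def split: nat.split)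
  next
    fix w :: "'a tate_index \<Rightarrow>\<^sub>0 'k"
    assume w: "w \<in> strand_cycles H tate_basis (\<lambda>_. tate_deg) (\<lambda>_. tate_d G u) (\<lambda>z. lookup z ([], False, 0)) n h"
    then have wS: "w \<in> supp_in (tate_below n (cl l k))"
      by (simp add: strand_cycles_def h)
    have low: "b = ([], False, 0)" if "b \<in> tate_below 0 (cl l k)" for b
      using that by (cases b) (auto simp: tate_below_iff l k)
    have dw: "tate_d G u w = 0"
    proof (cases n)
      case 0
      show ?thesis
      proof (rule lin_eq_supp_in [OF lin_tate_d lin_zero wS])
        fix b assume "b \<in> tate_below n (cl l k)"
        then have "b = ([], False, 0)"
          using low 0 by simp
        then show "tate_d G u (bvec b) = 0"
          by (simp add: tate_d_bvec)
      qed
    next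
      case (Suc m)
      with w show ?thesis by (simp add: strand_cycles_def)
    qed
    show "w \<in> tate_d G u ` supp_in (tate_below (Suc n) h)"
    proof (cases "k = 0")
      case False
      have "w = tate_d G u (contract_X w)"
        using contract_X [of G u w] dw by simp
      then show ?thesis
        using contract_X_below [OF l k False wS] by (auto simp: h)
    next
      case k0: True
      define v where "v = tate_proj G u w"
      have weq: "w = tate_d G u (contract_Y w) + emb False 0 v"
        using contract_Y [of G u w] dw by (simp add: v_def)
      have "tate_d G u w = tate_d G u (tate_d G u (contract_Y w) + emb False 0 v)"
        using weq by simp
      then have "emb False 0 (bdry v) = 0"
        by (simp add: dw)
      then have dv: "bdry v = 0"
        by (rule emb_eq_0)
      have vS: "v \<in> G.bar.strand n l"
        unfolding v_def using tate_proj_below [OF l] wS k0 by simp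
      have "v \<in> G.bar.cyc n l"
      proof -
        have "lookup v [] = 0" if n: "n = 0" and "l = \<one>\<^bsub>G\<^esub>"
        proof -
          have "lookup w ([], False, 0) = 0"
            using w that k0 by (simp add: strand_cycles_def h cl_one)
          then have "w = 0"
            using wS low by (intro poly_mapping_eqI) (auto simp: supp_in_def in_keys_iff n)
          then show ?thesis
            by (simp add: v_def)
        qed
        then show ?thesis
          using vS dv by (auto simp: strand_cycles_def split: nat.split)
      qed
      then obtain x where x: "x \<in> G.bar.strand (Suc n) l" "v = bdry x"
        using G.bar.exact [OF l, of n] by auto
      have "w = tate_d G u (contract_Y w + emb False 0 x)"
        using weq by (simp add: x(2))
      moreover have "contract_Y w + emb False 0 x \<in> supp_in (tate_below (Suc n) h)"
        unfolding h k0
        using contract_Y_below [OF l] emb_below [OF l x(1)] wS k0 by (intro vs.subspace_add [OF subspace_supp_in]) auto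
      ultimately show ?thesis
        by blast
    qed
  qed
qed

sublocale tate: strand_resolution H tate_basis "\<lambda>_. tate_deg" "\<lambda>_. tate_d G u" "\<lambda>z. lookup z ([], False, 0)"
proof
  have r0: "0 < r"
    using r by simp
  show "tate_deg b \<in> carrier H" if "b \<in> tate_basis n" for b n
    using that by (rule tate_deg_closed)
  show "\<exists>v\<in>supp_in (tate_below 0 \<one>\<^bsub>H\<^esub>). lookup v ([], False, 0) = 1"
    by (rule bexI [of _ "bvec ([], False, 0)"]) (auto simp: cl_one tate_below_iff [OF G.one_closed r0])
  show "tate_d G u ` supp_in (tate_below (Suc n) h)
    = strand_cycles H tate_basis (\<lambda>_. tate_deg) (\<lambda>_. tate_d G u) (\<lambda>z. lookup z ([], False, 0)) n h"
    if "h \<in> carrier H" for h n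
    using that by (rule tate_exact)
qed (auto simp: lin_tate_d lookup_add)

end


section \<open>The Betti numbers of the extended monoid\<close>

lemma dim_mono_supp_in:
  assumes "vs.subspace S" "vs.subspace T" "S \<subseteq> T" "T \<subseteq> supp_in X" "finite X"
  shows "vs.dim S \<le> vs.dim T"
proof -
  have "S \<subseteq> supp_in X"
    using assms by blast
  then obtain b where b: "b \<subseteq> S" "vs.independent b" "card b = vs.dim S"
    using finite_dim_supp_in [OF assms(5,1)] by metis
  obtain c where c: "vs.span c = T" "finite c" "card c = vs.dim T"
    using finite_dim_supp_in [OF assms(5,2,4)] by metis
  show ?thesis
    using vs.independent_span_bound [OF c(2) b(2)] b c assms(3) by auto
qed

lemma hom_dim_empty: "X n = {} \<Longrightarrow> hom_dim X d n = 0"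
proof -
  assume X: "X n = {}"
  have "hom_cycles X d n \<subseteq> {0}"
    by (auto simp: hom_cycles_def X supp_in_def)
  then have "vs.dim (hom_cycles X d n) \<le> card ({} :: ('a \<Rightarrow>\<^sub>0 'b) set)"
    by (intro vs.dim_le_card) auto
  then show ?thesis
    by (simp add: hom_dim_def)
qed

lemma restr_Un: "A \<inter> B = {} \<Longrightarrow> restr (A \<union> B) v = restr A v + restr B v"
  by (rule poly_mapping_eqI) (auto simp: lookup_restr lookup_add)

lemma disjoint_sum_eq_0:
  assumes "x + y = 0" "x \<in> supp_in A" "y \<in> supp_in B" "A \<inter> B = {}"
  shows "x = 0 \<and> y = 0"
proof -
  have "restr B x = 0" "restr A y = 0"
    using restr_eq_0 [OF assms(2), of B] restr_eq_0 [OF assms(3), of A] assms(4) by (auto simp: Int_commute)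
  then have "x = restr A (x + y)" "y = restr B (x + y)"
    using assms(2,3) by (simp_all only: lin_add [OF lin_restr] restr_id add_0_left add_0_right)
  then show ?thesis
    using assms(1) by (simp add: lin_0 [OF lin_restr])
qed

text \<open>If no component of the differential connects two sets of basis vectors, then the complex is the
  direct sum of the complexes on the two sets.\<close>

lemma hom_dim_split:
  fixes d :: "nat \<Rightarrow> ('b \<Rightarrow>\<^sub>0 'k::field) \<Rightarrow> ('b \<Rightarrow>\<^sub>0 'k)"
  assumes lin_d: "\<And>m. lin (d m)"
    and disj: "\<And>m. P m \<inter> Q m = {}" and fin: "finite (P n)" "finite (Q n)"
    and PQ: "\<And>m b. b \<in> P (Suc m) \<Longrightarrow> restr (Q m) (d m (bvec b)) = 0"
    and QP: "\<And>m b. b \<in> Q (Suc m) \<Longrightarrow> restr (P m) (d m (bvec b)) = 0"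
    and complex: "hom_boundaries (\<lambda>m. P m \<union> Q m) d n \<subseteq> hom_cycles (\<lambda>m. P m \<union> Q m) d n"
  shows "hom_dim (\<lambda>m. P m \<union> Q m) d n = hom_dim P d n + hom_dim Q d n"
proof -
  let ?X = "\<lambda>m. P m \<union> Q m"
  have rPQ: "restr (Q m) (d m v) = 0" if "v \<in> supp_in (P (Suc m))" for m v
    by (rule lin_eq_supp_in [OF lin_compose [OF lin_restr lin_d] lin_zero that]) (rule PQ)
  have rQP: "restr (P m) (d m v) = 0" if "v \<in> supp_in (Q (Suc m))" for m v
    by (rule lin_eq_supp_in [OF lin_compose [OF lin_restr lin_d] lin_zero that]) (rule QP)
  have split: "restr (?X m) (d m (u + v)) = restr (P m) (d m u) + restr (Q m) (d m v)"
    if "u \<in> supp_in (P (Suc m))" "v \<in> supp_in (Q (Suc m))" for m u v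
    using that by (simp add: restr_Un disj lin_add [OF lin_d] lin_add [OF lin_restr] rPQ rQP)
  have decomp: "\<exists>u v. z = u + v \<and> u \<in> supp_in (P m) \<and> v \<in> supp_in (Q m)" if "z \<in> supp_in (?X m)" for z :: "'b \<Rightarrow>\<^sub>0 'k" and m
    by (rule exI [of _ "restr (P m) z"], rule exI [of _ "restr (Q m) z"])
      (use that restr_Un [OF disj, of m z] in \<open>simp add: restr_id\<close>)
  have inX: "u \<in> supp_in (P m) \<Longrightarrow> v \<in> supp_in (Q m) \<Longrightarrow> u + v \<in> supp_in (?X m)" for u v :: "'b \<Rightarrow>\<^sub>0 'k" and m
    by (intro vs.subspace_add [OF subspace_supp_in]) (auto elim: supp_in_mono)
  have cyc: "hom_cycles ?X d n = {u + v | u v. u \<in> hom_cycles P d n \<and> v \<in> hom_cycles Q d n}"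
  proof (intro equalityI subsetI)
    fix z assume z: "z \<in> hom_cycles ?X d n"
    obtain u v where uv: "z = u + v" "u \<in> supp_in (P n)" "v \<in> supp_in (Q n)"
      using decomp [OF hom_cycles_supp [OF z]] by blast
    have "restr (P m) (d m u) = 0 \<and> restr (Q m) (d m v) = 0" if "n = Suc m" for m
      using z uv split [of u m v] that
      by (intro disjoint_sum_eq_0 [OF _ restr_in restr_in disj]) (auto simp: hom_cycles_def)
    then show "z \<in> {u + v | u v. u \<in> hom_cycles P d n \<and> v \<in> hom_cycles Q d n}"
      using uv by (auto simp: hom_cycles_def)
  next
    fix z assume "z \<in> {u + v | u v. u \<in> hom_cycles P d n \<and> v \<in> hom_cycles Q d n}"
    then obtain u v where uv: "z = u + v" "u \<in> hom_cycles P d n" "v \<in> hom_cycles Q d n"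
      by blast
    then show "z \<in> hom_cycles ?X d n"
      using inX [of u n v] split [of u _ v] by (auto simp: hom_cycles_def)
  qed
  have bd: "hom_boundaries ?X d n = {u + v | u v. u \<in> hom_boundaries P d n \<and> v \<in> hom_boundaries Q d n}"
  proof (intro equalityI subsetI)
    fix z assume "z \<in> hom_boundaries ?X d n"
    then obtain w where w: "w \<in> supp_in (?X (Suc n))" "z = restr (?X n) (d n w)"
      by (auto simp: hom_boundaries_def)
    obtain u v where uv: "w = u + v" "u \<in> supp_in (P (Suc n))" "v \<in> supp_in (Q (Suc n))"
      using decomp [OF w(1)] by blast
    then show "z \<in> {u + v | u v. u \<in> hom_boundaries P d n \<and> v \<in> hom_boundaries Q d n}"
      using split [of u n v] w(2) by (auto simp: hom_boundaries_def)
  next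
    fix z assume "z \<in> {u + v | u v. u \<in> hom_boundaries P d n \<and> v \<in> hom_boundaries Q d n}"
    then obtain u v where uv: "z = restr (P n) (d n u) + restr (Q n) (d n v)"
      "u \<in> supp_in (P (Suc n))" "v \<in> supp_in (Q (Suc n))"
      by (auto simp: hom_boundaries_def)
    then have "z = restr (?X n) (d n (u + v))"
      using split by simp
    then show "z \<in> hom_boundaries ?X d n"
      using inX [OF uv(2,3)] by (auto simp: hom_boundaries_def)
  qed
  note sc = subspace_hom_cycles [where d = d, OF lin_d] and sb = subspace_hom_boundaries [where d = d, OF lin_d]
  have cs: "hom_cycles Y d n \<subseteq> supp_in (Y n)" and bs: "hom_boundaries Y d n \<subseteq> supp_in (Y n)" for Y
    by (auto simp: hom_cycles_def hom_boundaries_def)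
  have "hom_boundaries P d n \<subseteq> hom_cycles P d n"
  proof
    fix z assume z: "z \<in> hom_boundaries P d n"
    then have "z + 0 \<in> hom_boundaries ?X d n"
      unfolding bd using vs.subspace_0 [OF sb] by blast
    then have "z \<in> hom_cycles ?X d n"
      using complex by auto
    then obtain u v where uv: "z = u + v" "u \<in> hom_cycles P d n" "v \<in> hom_cycles Q d n"
      unfolding cyc by blast
    have "(u - z) + v = 0"
      by (simp add: uv(1))
    then have "u - z = 0"
      using disjoint_sum_eq_0 [OF _ _ _ disj, of "u - z" v n] z uv cs [of P] cs [of Q] bs [of P]
        vs.subspace_diff [OF subspace_supp_in] by blast
    then show "z \<in> hom_cycles P d n"
      using uv(2) by simp
  qed
  then have le1: "vs.dim (hom_boundaries P d n) \<le> vs.dim (hom_cycles P d n)"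
    by (intro dim_mono_supp_in [where X = "P n"] sb sc cs fin(1))
  have "hom_boundaries Q d n \<subseteq> hom_cycles Q d n"
  proof
    fix z assume z: "z \<in> hom_boundaries Q d n"
    then have "0 + z \<in> hom_boundaries ?X d n"
      unfolding bd using vs.subspace_0 [OF sb] by blast
    then have "z \<in> hom_cycles ?X d n"
      using complex by auto
    then obtain u v where uv: "z = u + v" "u \<in> hom_cycles P d n" "v \<in> hom_cycles Q d n"
      unfolding cyc by blast
    have "u + (v - z) = 0"
      by (simp add: uv(1))
    then have "v - z = 0"
      using disjoint_sum_eq_0 [OF _ _ _ disj, of u "v - z" n] z uv cs [of P] cs [of Q] bs [of Q]
        vs.subspace_diff [OF subspace_supp_in] by blast
    then show "z \<in> hom_cycles Q d n"
      using uv(3) by simp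
  qed
  then have le2: "vs.dim (hom_boundaries Q d n) \<le> vs.dim (hom_cycles Q d n)"
    by (intro dim_mono_supp_in [where X = "Q n"] sb sc cs fin(2))
  show ?thesis
    unfolding hom_dim_def cyc bd dim_direct_sum [OF sc cs [of P] sc cs [of Q] disj fin] dim_direct_sum [OF sb bs [of P] sb bs [of Q] disj fin]
    using le1 le2 by simp
qed

text \<open>The shift \<open>s\<close> of the homological degree accounts for a factor \<open>X\<close> (\<open>s = 1\<close>) or \<open>Y\<close> (\<open>s = 2\<close>).\<close>

lemma hom_dim_reindex:
  fixes d :: "nat \<Rightarrow> ('b \<Rightarrow>\<^sub>0 'k::field) \<Rightarrow> ('b \<Rightarrow>\<^sub>0 'k)" and e :: "'b \<Rightarrow> 'c"
  assumes lin_d: "\<And>m. lin (d m)" and lin_d': "\<And>m. lin (d' m)" and e: "inj e"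
    and X': "\<And>m. X' (m + s) = e ` X m" and X'0: "\<And>m. m < s \<Longrightarrow> X' m = {}"
    and comm: "\<And>m b. b \<in> X (Suc m) \<Longrightarrow>
      restr (X' (m + s)) (d' (m + s) (bvec (e b))) = lext (\<lambda>b. bvec (e b)) (restr (X m) (d m (bvec b)))"
  shows "hom_dim X' d' (n + s) = hom_dim X d n"
proof -
  define E :: "('b \<Rightarrow>\<^sub>0 'k) \<Rightarrow> ('c \<Rightarrow>\<^sub>0 'k)" where "E = lext (\<lambda>b. bvec (e b))"
  define E' :: "('c \<Rightarrow>\<^sub>0 'k) \<Rightarrow> ('b \<Rightarrow>\<^sub>0 'k)" where "E' = lext (\<lambda>c. bvec (inv_into UNIV e c))"
  have lin_E: "lin E" and lin_E': "lin E'"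
    by (auto simp: E_def E'_def)
  have E'E: "E' (E v) = v" for v
    by (rule lin_eqI [OF lin_compose [OF lin_E' lin_E] lin_id]) (simp add: E_def E'_def e)
  have suppE: "E v \<in> supp_in (e ` Y)" if "v \<in> supp_in Y" for v Y
    by (rule lin_supp_in [OF lin_E that]) (simp add: E_def)
  have suppE': "\<exists>v\<in>supp_in Y. w = E v" if w: "w \<in> supp_in (e ` Y)" for w Y
  proof (rule bexI [of _ "E' w"])
    show "E' w \<in> supp_in Y"
      by (rule lin_supp_in [OF lin_E' w]) (auto simp: E'_def e)
    show "w = E (E' w)"
      by (rule lin_eq_supp_in [OF lin_id lin_compose [OF lin_E lin_E'] w]) (auto simp: E'_def E_def e)
  qed
  have commE: "restr (X' (m + s)) (d' (m + s) (E v)) = E (restr (X m) (d m v))" if "v \<in> supp_in (X (Suc m))" for m v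
    by (rule lin_eq_supp_in [OF lin_compose [OF lin_restr lin_compose [OF lin_d' lin_E]]
          lin_compose [OF lin_E lin_compose [OF lin_restr lin_d]] that])
      (simp add: E_def comm)
  have E0: "E v = 0 \<longleftrightarrow> v = 0" for v
    using E'E [of v] lin_0 [OF lin_E] lin_0 [OF lin_E'] by metis
  have cyc: "hom_cycles X' d' (n + s) = E ` hom_cycles X d n"
  proof (intro equalityI subsetI)
    fix w assume w: "w \<in> hom_cycles X' d' (n + s)"
    obtain v where v: "v \<in> supp_in (X n)" "w = E v"
      using suppE' [OF hom_cycles_supp [OF w, unfolded X']] by blast
    have "restr (X m) (d m v) = 0" if "n = Suc m" for m
      using w commE [of v m] v that by (auto simp: hom_cycles_def E0)
    then show "w \<in> E ` hom_cycles X d n"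
      using v by (auto simp: hom_cycles_def)
  next
    fix w assume "w \<in> E ` hom_cycles X d n"
    then obtain v where v: "v \<in> hom_cycles X d n" "w = E v"
      by auto
    have "restr (X' m') (d' m' (E v)) = 0" if m': "n + s = Suc m'" for m'
    proof (cases n)
      case 0
      then show ?thesis
        using m' by (intro restr_eq_0 [of _ UNIV]) (auto simp: X'0 supp_in_def)
    next
      case (Suc m)
      then show ?thesis
        using m' v(1) commE [of v m] by (auto simp: hom_cycles_def E0)
    qed
    then show "w \<in> hom_cycles X' d' (n + s)"
      using v suppE [OF hom_cycles_supp [OF v(1)]] by (simp add: hom_cycles_def X')
  qed
  have bd: "hom_boundaries X' d' (n + s) = E ` hom_boundaries X d n"
  proof -
    have "supp_in (X' (Suc (n + s))) = E ` supp_in (X (Suc n))"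
      using X' [of "Suc n"] suppE suppE' by (fastforce simp: image_iff)
    then show ?thesis
      by (auto simp: hom_boundaries_def image_image commE intro!: image_eqI)
  qed
  have "inj_on E Y" for Y
    using E'E by (metis inj_on_inverseI)
  then show ?thesis
    unfolding hom_dim_def cyc bd
    using dim_inj_image [OF lin_E _ subspace_hom_cycles [where d = d, OF lin_d]]
      dim_inj_image [OF lin_E _ subspace_hom_boundaries [where d = d, OF lin_d]] by metis
qed

text \<open>The composite of two differentials vanishes also after reduction. In finite dimension this means that
  the subtraction in \<^const>\<open>hom_dim\<close> is not truncated.\<close>

lemma (in strand_resolution) tor_boundaries_cycles:
  assumes l: "l \<in> carrier G"
  shows "tor_boundaries B dg d n l \<subseteq> tor_cycles B dg d n l"
proof
  fix w assume "w \<in> tor_boundaries B dg d n l"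
  then obtain v where v: "v \<in> supp_in (at_deg B dg (Suc n) l)" "w = restr (at_deg B dg n l) (d n v)"
    by (auto simp: hom_boundaries_def)
  have vs: "v \<in> strand (Suc n) l"
    by (rule at_strand [OF v(1) l])
  have "restr (at_deg B dg m l) (d m w) = 0" if n: "n = Suc m" for m
  proof -
    have "d n v \<in> cyc n l"
      using exact [OF l, of n] vs by blast
    then have "d m (d n v) = 0"
      by (simp add: n cyc_d)
    then show ?thesis
      using restr_d [OF d_strand [OF vs l, unfolded n] l] v(2) by (simp add: n lin_0 [OF lin_restr])
  qed
  then show "w \<in> tor_cycles B dg d n l"
    by (simp add: hom_cycles_def v(2))
qed

context fraction_extension
begin

abbreviation tate_at :: "nat \<Rightarrow> 'b \<Rightarrow> 'a tate_index set" where
  "tate_at \<equiv> at_deg tate_basis (\<lambda>_. tate_deg)"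

abbreviation bar_at :: "nat \<Rightarrow> 'a \<Rightarrow> 'a list set" where
  "bar_at \<equiv> at_deg G.div_chains (\<lambda>_. G.chain_max)"

lemma tate_at_iff:
  assumes "l \<in> carrier G" "k < r"
  shows "(ts, e, j) \<in> tate_at n (cl l k) \<longleftrightarrow> ts \<in> G.div_chains (length ts) \<and>
    length ts + of_bool e + 2 * j = n \<and> of_bool e = k \<and> G.chain_max ts \<otimes>\<^bsub>G\<^esub> (\<rho> [^]\<^bsub>G\<^esub> j) = l"
proof -
  have "of_bool e < r"
    using r by (cases e) auto
  then show ?thesis
    using assms cl_inj [of "G.chain_max ts \<otimes>\<^bsub>G\<^esub> (\<rho> [^]\<^bsub>G\<^esub> j)" l "of_bool e" k]
    by (auto simp: at_deg_def tate_basis_def tate_deg_def)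
qed

lemma finite_tate_at:
  assumes l: "l \<in> carrier G" and k: "k < r"
  shows "finite (tate_at n (cl l k))"
proof (rule finite_subset)
  show "tate_at n (cl l k) \<subseteq> (\<Union>m\<in>{..n}. {ts \<in> G.div_chains m. G.chain_max ts divides\<^bsub>G\<^esub> l}) \<times> UNIV \<times> {..n}"
  proof
    fix b assume "b \<in> tate_at n (cl l k)"
    then obtain ts e j where b: "b = (ts, e, j)" "(ts, e, j) \<in> tate_at n (cl l k)"
      by (cases b) auto
    then have *: "ts \<in> G.div_chains (length ts)" "length ts + of_bool e + 2 * j = n"
      "G.chain_max ts \<otimes>\<^bsub>G\<^esub> (\<rho> [^]\<^bsub>G\<^esub> j) = l"
      by (auto simp: tate_at_iff l k)
    then have "G.chain_max ts divides\<^bsub>G\<^esub> l"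
      by (intro dividesI [of "\<rho> [^]\<^bsub>G\<^esub> j"]) auto
    with * have "ts \<in> (\<Union>m\<in>{..n}. {ts \<in> G.div_chains m. G.chain_max ts divides\<^bsub>G\<^esub> l})" "j \<le> n"
      by auto
    then show "b \<in> (\<Union>m\<in>{..n}. {ts \<in> G.div_chains m. G.chain_max ts divides\<^bsub>G\<^esub> l}) \<times> UNIV \<times> {..n}"
      by (simp add: b(1))
  qed
  show "finite ((\<Union>m\<in>{..n}. {ts \<in> G.div_chains m. G.chain_max ts divides\<^bsub>G\<^esub> l}) \<times> (UNIV :: bool set) \<times> {..n})"
    using G.finite_chains_below [OF l] by auto
qed

lemma restr_emb:
  assumes "\<And>ts. (ts, e, j) \<in> Y \<longleftrightarrow> ts \<in> A"
  shows "restr Y (emb e j v) = emb e j (restr A v)"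
  by (rule lin_eqI [OF lin_compose [OF lin_restr lin_emb] lin_compose [OF lin_emb lin_restr]])
    (simp add: emb_bvec restr_def assms)

lemma restr_emb_0: "(\<And>ts. (ts, e, j) \<notin> Y) \<Longrightarrow> restr Y (emb e j v) = 0"
  using restr_emb [of e j Y "{}" v] restr_eq_0 [of v UNIV "{}"] by (simp add: supp_in_def)

text \<open>The residual complex in degree \<open>g\<close> splits into the part without \<open>Y\<close> and the part divisible by \<open>Y\<close>;
  the latter is a copy of the whole complex in degree \<open>g - \<rho>\<close>.\<close>

definition Y_free :: "nat \<Rightarrow> 'b \<Rightarrow> 'a tate_index set" where
  "Y_free n g = {(ts, e, j) \<in> tate_at n g. j = 0}"

definition Y_divisible :: "nat \<Rightarrow> 'b \<Rightarrow> 'a tate_index set" where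
  "Y_divisible n g = {(ts, e, j) \<in> tate_at n g. j \<noteq> 0}"

text \<open>The differential of \<open>Y\<close> has two terms. The degree of \<open>X\<close> falls short of \<open>\<rho>\<close> by \<open>(r - 1) \<rho>/r\<close>,
  which is not zero since \<open>r \<ge> 2\<close>. The prism operator gives chains whose degree divides \<open>u \<otimes> chain_max ts\<close>;
  this falls short of \<open>\<rho> \<otimes> chain_max ts\<close> by the factor \<open>u' \<noteq> \<one>\<close>. Both terms vanish in the residual
  complex.\<close>

lemma Y_free_emb_0:
  assumes l: "l \<in> carrier G" and k: "k < r" and ts: "(ts, e, Suc i) \<in> tate_at (Suc m) (cl l k)"
  shows "restr (Y_free m (cl l k)) (tate_d G u (bvec (ts, e, Suc i)) :: 'a tate_index \<Rightarrow>\<^sub>0 'k::field) = 0"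
proof -
  let ?P = "Y_free m (cl l k)"
  have c: "ts \<in> G.div_chains (length ts)" and e: "of_bool e = k"
    and eq: "G.chain_max ts \<otimes>\<^bsub>G\<^esub> (\<rho> [^]\<^bsub>G\<^esub> Suc i) = l"
    using ts by (auto simp: tate_at_iff l k simp del: G.nat_pow_Suc)
  note mts = G.chain_max_closed [OF c]
  have z: "restr ?P (emb e' (Suc i') v) = 0" for e' i' and v :: "'a list \<Rightarrow>\<^sub>0 'k"
    by (rule restr_emb_0) (simp add: Y_free_def)
  have t: "restr ?P (if e then 0 else emb True i (sgn_op (bvec ts))) = (0 :: 'a tate_index \<Rightarrow>\<^sub>0 'k)"
  proof (cases e)
    case False
    have "restr ?P (emb True i (sgn_op (bvec ts) :: 'a list \<Rightarrow>\<^sub>0 'k)) = 0"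
    proof (rule restr_emb_0)
      fix ts'
      show "(ts', True, i) \<notin> ?P"
      proof
        assume "(ts', True, i) \<in> ?P"
        then have "of_bool True = k"
          by (simp add: Y_free_def tate_at_iff [OF l k])
        with e False show False
          by simp
      qed
    qed
    with False show ?thesis by simp
  qed (simp add: lin_0 [OF lin_restr])
  have p: "restr ?P (emb e i (prism G u (bvec ts) :: 'a list \<Rightarrow>\<^sub>0 'k)) = 0"
  proof (rule restr_eq_0)
    show "emb e i (prism G u (bvec ts)) \<in> supp_in ((\<lambda>us. (us, e, i)) ` {us \<in> G.div_chains (Suc (length ts)). G.chain_max us divides\<^bsub>G\<^esub> u \<otimes>\<^bsub>G\<^esub> G.chain_max ts})"
      by (rule emb_supp_in [OF G.prism_top [OF u c]]) auto
    have False if us: "us \<in> G.div_chains (Suc (length ts))" "G.chain_max us divides\<^bsub>G\<^esub> u \<otimes>\<^bsub>G\<^esub> G.chain_max ts"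
      and P: "(us, e, i) \<in> ?P" for us
    proof -
      note mus = G.chain_max_closed [OF us(1)]
      have i: "i = 0" and l': "l = G.chain_max us"
        using P mus by (auto simp: Y_free_def tate_at_iff l k)
      \<comment> \<open>The degree of the new chain would have to be \<open>\<rho> + chain_max ts\<close>, a proper multiple of its bound.\<close>
      have "l = (u \<otimes>\<^bsub>G\<^esub> G.chain_max ts) \<otimes>\<^bsub>G\<^esub> u'"
        using eq u u' mts by (simp add: i rho G.m_ac)
      moreover obtain c where c: "c \<in> carrier G" "u \<otimes>\<^bsub>G\<^esub> G.chain_max ts = l \<otimes>\<^bsub>G\<^esub> c"
        using us(2) l' by (auto simp: factor_def)
      ultimately have "l \<otimes>\<^bsub>G\<^esub> \<one>\<^bsub>G\<^esub> = l \<otimes>\<^bsub>G\<^esub> (c \<otimes>\<^bsub>G\<^esub> u')"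
        using l u' G.m_assoc [of l c u'] G.r_one [of l] by simp
      then have "c \<otimes>\<^bsub>G\<^esub> u' = \<one>\<^bsub>G\<^esub>"
        using l u' c(1) G.l_cancel [of l "\<one>\<^bsub>G\<^esub>" "c \<otimes>\<^bsub>G\<^esub> u'"] by simp
      then show False
        using G.no_invertibles [of c u'] c(1) u' by auto
    qed
    then show "?P \<inter> ((\<lambda>us. (us, e, i)) ` {us \<in> G.div_chains (Suc (length ts)). G.chain_max us divides\<^bsub>G\<^esub> u \<otimes>\<^bsub>G\<^esub> G.chain_max ts}) = {}"
      by blast
  qed
  show ?thesis
    unfolding tate_d_bvec using z t p
    by (cases e) (simp_all add: lin_add [OF lin_restr] lin_diff [OF lin_restr] lin_0 [OF lin_restr])
qed

lemma Y_divisible_emb_0: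
  "restr (Y_divisible m g) (tate_d G u (bvec (ts, e, 0)) :: 'a tate_index \<Rightarrow>\<^sub>0 'k::field) = 0"
proof -
  have z: "restr (Y_divisible m g) (emb e' 0 v) = 0" for e' and v :: "'a list \<Rightarrow>\<^sub>0 'k"
    by (rule restr_emb_0) (simp add: Y_divisible_def)
  show ?thesis
    unfolding tate_d_bvec by (cases e) (simp_all add: z lin_add [OF lin_restr] lin_0 [OF lin_restr])
qed

text \<open>Without \<open>Y\<close> the remaining terms are \<open>ts\<close> for \<open>k = 0\<close> and \<open>ts X\<close> for \<open>k = 1\<close>, and in each case
  the differential is that of the bar complex, as the differential of \<open>X\<close> is not a unit.\<close>

lemma hom_dim_Y_free:
  assumes l: "l \<in> carrier G" and k: "k < r"
  shows "hom_dim (\<lambda>m. Y_free m (cl l k)) (\<lambda>_. tate_d G u :: _ \<Rightarrow> 'a tate_index \<Rightarrow>\<^sub>0 'k::field) n =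
    (if k \<le> 1 \<and> k \<le> n then hom_dim (\<lambda>m. bar_at m l) (\<lambda>_. bdry :: _ \<Rightarrow> 'a list \<Rightarrow>\<^sub>0 'k) (n - k) else 0)"
proof -
  have iff: "(ts, e, 0) \<in> Y_free m (cl l k) \<longleftrightarrow> of_bool e = k \<and> k \<le> m \<and> ts \<in> bar_at (m - k) l" for ts e m
  proof -
    have A: "(ts, e, 0) \<in> Y_free m (cl l k) \<longleftrightarrow> ts \<in> G.div_chains (length ts) \<and> length ts + of_bool e = m \<and>
        of_bool e = k \<and> G.chain_max ts = l"
      using G.chain_max_closed [of ts "length ts"] by (auto simp: Y_free_def tate_at_iff [OF l k])
    have B: "ts \<in> bar_at (m - k) l \<longleftrightarrow> ts \<in> G.div_chains (m - k) \<and> G.chain_max ts = l"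
      by (simp add: at_deg_def)
    show ?thesis
      unfolding A B using G.div_chains_length [of ts "m - k"] by auto
  qed
  show ?thesis
  proof (cases "k \<le> 1 \<and> k \<le> n")
    case False
    have "Y_free n (cl l k) = {}"
    proof (rule equals0I)
      fix b assume b: "b \<in> Y_free n (cl l k)"
      then obtain ts e where "b = (ts, e, 0)"
        by (auto simp: Y_free_def)
      with b False iff [of ts e n] show False
        by (cases e) auto
    qed
    then show ?thesis
      unfolding if_not_P [OF False] by (rule hom_dim_empty)
  next
    case True
    define e where "e \<longleftrightarrow> k = 1"
    have ek: "of_bool e = k"
      using True by (auto simp: e_def)
    have "hom_dim (\<lambda>m. Y_free m (cl l k)) (\<lambda>_. tate_d G u :: _ \<Rightarrow> 'a tate_index \<Rightarrow>\<^sub>0 'k) ((n - k) + k)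
      = hom_dim (\<lambda>m. bar_at m l) (\<lambda>_. bdry :: _ \<Rightarrow> 'a list \<Rightarrow>\<^sub>0 'k) (n - k)"
    proof (rule hom_dim_reindex [where e = "\<lambda>ts. (ts, e, 0)"])
      have e': "e' = e" if "of_bool e' = k" for e'
        using that ek by (cases e; cases e') auto
      show "Y_free (m + k) (cl l k) = (\<lambda>ts. (ts, e, 0)) ` bar_at m l" for m
      proof (intro equalityI subsetI)
        fix b assume b: "b \<in> Y_free (m + k) (cl l k)"
        then obtain ts e' where b': "b = (ts, e', 0)"
          by (auto simp: Y_free_def)
        with b show "b \<in> (\<lambda>ts. (ts, e, 0)) ` bar_at m l"
          using iff [of ts e' "m + k"] e' by auto
      qed (auto simp: iff ek)
      show "Y_free m (cl l k) = {}" if "m < k" for m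
      proof (rule equals0I)
        fix b assume b: "b \<in> Y_free m (cl l k)"
        then obtain ts e' where b': "b = (ts, e', 0)"
          by (auto simp: Y_free_def)
        with b that iff [of ts e' m] show False
          by auto
      qed
      show "restr (Y_free (m + k) (cl l k)) (tate_d G u (bvec (ts, e, 0))) =
        lext (\<lambda>ts. bvec (ts, e, 0)) (restr (bar_at m l) (bdry (bvec ts) :: 'a list \<Rightarrow>\<^sub>0 'k))" for m ts
      proof -
        have "restr (Y_free (m + k) (cl l k)) (emb e 0 (bdry (bvec ts) :: 'a list \<Rightarrow>\<^sub>0 'k)) = emb e 0 (restr (bar_at m l) (bdry (bvec ts)))"
          by (rule restr_emb) (simp add: iff ek)
        moreover have "restr (Y_free (m + k) (cl l k)) (emb False 0 (sgn_op (bvec ts) :: 'a list \<Rightarrow>\<^sub>0 'k)) = 0" if e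
          by (rule restr_emb_0) (use that ek in \<open>simp add: iff\<close>)
        ultimately show ?thesis
          unfolding tate_d_bvec emb_def [of e 0, symmetric]
          by (cases e) (simp_all add: lin_add [OF lin_restr] emb_def)
      qed
    qed (auto simp: lin_tate_d lin_bdry inj_on_def)
    then show ?thesis
      using True by simp
  qed
qed

text \<open>Division by \<open>Y\<close>, that is, \<open>Y\<^bsup>(j+1)\<^esup> \<mapsto> Y\<^bsup>(j)\<^esup>\<close>, commutes with the differential up to terms
  without \<open>Y\<close>.\<close>

lemma hom_dim_Y_divisible:
  assumes m: "m \<in> carrier G" and k: "k < r"
  shows "hom_dim (\<lambda>n. Y_divisible n (cl (m \<otimes>\<^bsub>G\<^esub> \<rho>) k)) (\<lambda>_. tate_d G u :: _ \<Rightarrow> 'a tate_index \<Rightarrow>\<^sub>0 'k::field) n =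
    (if 2 \<le> n then hom_dim (\<lambda>n. tate_at n (cl m k)) (\<lambda>_. tate_d G u :: _ \<Rightarrow> 'a tate_index \<Rightarrow>\<^sub>0 'k) (n - 2) else 0)"
proof -
  let ?Q = "\<lambda>n. Y_divisible n (cl (m \<otimes>\<^bsub>G\<^esub> \<rho>) k)"
  let ?e = "\<lambda>(ts, e, j). (ts, e, Suc j)"
  have l: "m \<otimes>\<^bsub>G\<^esub> \<rho> \<in> carrier G"
    using m by simp
  have iff: "(ts, e, Suc j) \<in> ?Q n \<longleftrightarrow> 2 \<le> n \<and> (ts, e, j) \<in> tate_at (n - 2) (cl m k)" for ts e j n
  proof -
    have "G.chain_max ts \<otimes>\<^bsub>G\<^esub> (\<rho> [^]\<^bsub>G\<^esub> Suc j) = m \<otimes>\<^bsub>G\<^esub> \<rho> \<longleftrightarrow> G.chain_max ts \<otimes>\<^bsub>G\<^esub> (\<rho> [^]\<^bsub>G\<^esub> j) = m"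
      if "ts \<in> G.div_chains (length ts)"
      using G.r_cancel [of "G.chain_max ts \<otimes>\<^bsub>G\<^esub> (\<rho> [^]\<^bsub>G\<^esub> j)" \<rho> m] G.chain_max_closed [OF that] m
      by (auto simp: G.m_assoc)
    then show ?thesis
      by (auto simp: Y_divisible_def tate_at_iff [OF l k] tate_at_iff [OF m k] simp del: G.nat_pow_Suc)
  qed
  have Q0: "b \<in> ?Q n \<Longrightarrow> \<exists>ts e j. b = (ts, e, Suc j)" for b n
    by (cases b) (auto simp: Y_divisible_def gr0_conv_Suc)
  show ?thesis
  proof (cases "2 \<le> n")
    case False
    have "?Q n = {}"
      using Q0 [of _ n] iff False by (metis equals0I)
    then show ?thesis
      unfolding if_not_P [OF False] by (rule hom_dim_empty)
  next
    case True
    have "hom_dim ?Q (\<lambda>_. tate_d G u :: _ \<Rightarrow> 'a tate_index \<Rightarrow>\<^sub>0 'k) ((n - 2) + 2)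
      = hom_dim (\<lambda>n. tate_at n (cl m k)) (\<lambda>_. tate_d G u :: _ \<Rightarrow> 'a tate_index \<Rightarrow>\<^sub>0 'k) (n - 2)"
    proof (rule hom_dim_reindex [where e = ?e])
      show "?Q (n + 2) = ?e ` tate_at n (cl m k)" for n
      proof (intro equalityI subsetI)
        fix b assume b: "b \<in> ?Q (n + 2)"
        then obtain ts e j where "b = (ts, e, Suc j)"
          using Q0 by blast
        with b iff [of ts e j "n + 2"] show "b \<in> ?e ` tate_at n (cl m k)"
          by (auto intro!: image_eqI [of _ _ "(ts, e, j)"])
      qed (auto simp: iff)
      show "?Q n = {}" if "n < 2" for n
        using Q0 [of _ n] iff [of _ _ _ n] that by (metis equals0I not_less)
      show "restr (?Q (n + 2)) (tate_d G u (bvec (?e b))) =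
        lext (\<lambda>b. bvec (?e b)) (restr (tate_at n (cl m k)) (tate_d G u (bvec b) :: 'a tate_index \<Rightarrow>\<^sub>0 'k))" for n b
      proof -
        obtain ts e j where b: "b = (ts, e, j)"
          by (cases b)
        define E :: "('a tate_index \<Rightarrow>\<^sub>0 'k) \<Rightarrow> ('a tate_index \<Rightarrow>\<^sub>0 'k)" where "E = lext (\<lambda>b. bvec (?e b))"
        have lin_E: "lin E"
          by (auto simp: E_def)
        have Eemb: "E (emb e' j' v) = emb e' (Suc j') v" for e' j' v
          by (rule linear_emb_eqI [OF lin_E lin_emb]) (simp add: E_def emb_bvec)
        have rE: "restr (?Q (n + 2)) (E z) = E (restr (tate_at n (cl m k)) z)" for z
        proof (rule lin_eqI [OF lin_compose [OF lin_restr lin_E] lin_compose [OF lin_E lin_restr]])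
          fix b show "restr (?Q (n + 2)) (E (bvec b)) = E (restr (tate_at n (cl m k)) (bvec b))"
            by (cases b) (simp add: E_def restr_def iff lin_0 [OF lin_lext])
        qed
        have z: "restr (?Q (n + 2)) (emb e' 0 v) = 0" for e' and v :: "'a list \<Rightarrow>\<^sub>0 'k"
          by (rule restr_emb_0) (simp add: Y_divisible_def)
        have "restr (?Q (n + 2)) (tate_d G u (bvec (ts, e, Suc j))) = restr (?Q (n + 2)) (E (tate_d G u (bvec (ts, e, j))))"
          unfolding tate_d_bvec
          by (cases j; cases e)
            (simp_all add: lin_simps [OF lin_E] Eemb z [simplified] lin_add [OF lin_restr] lin_diff [OF lin_restr] lin_minus [OF lin_restr] lin_0 [OF lin_restr])
        then show ?thesis
          unfolding rE by (simp add: b E_def)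
      qed
    qed (auto simp: lin_tate_d inj_on_def)
    moreover have "(n - 2) + 2 = n"
      using True by simp
    ultimately show ?thesis
      using True by simp
  qed
qed

definition bar_betti :: "'k::field itself \<Rightarrow> nat \<Rightarrow> 'a \<Rightarrow> nat" where
  "bar_betti K n l = hom_dim (\<lambda>m. bar_at m l) (\<lambda>_. bdry :: _ \<Rightarrow> 'a list \<Rightarrow>\<^sub>0 'k) n"

definition tate_betti :: "'k::field itself \<Rightarrow> nat \<Rightarrow> 'b \<Rightarrow> nat" where
  "tate_betti K n g = hom_dim (\<lambda>m. tate_at m g) (\<lambda>_. tate_d G u :: _ \<Rightarrow> 'a tate_index \<Rightarrow>\<^sub>0 'k) n"

text \<open>The coefficient form of
  \<open>P\<^bsub>\<Lambda>[\<rho>/r]\<^esub> = P\<^sub>\<Lambda> (1 + t z\<^bsup>\<rho>/r\<^esup>) + t\<^sup>2 z\<^sup>\<rho> P\<^bsub>\<Lambda>[\<rho>/r]\<^esub>\<close>.\<close>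

lemma tate_betti_split:
  assumes l: "l \<in> carrier G" and k: "k < r"
  shows "tate_betti (K :: 'k::field itself) n (cl l k) = (if k \<le> 1 \<and> k \<le> n then bar_betti K (n - k) l else 0) +
    hom_dim (\<lambda>m. Y_divisible m (cl l k)) (\<lambda>_. tate_d G u :: _ \<Rightarrow> 'a tate_index \<Rightarrow>\<^sub>0 'k::field) n"
proof -
  let ?d = "\<lambda>_. tate_d G u :: _ \<Rightarrow> 'a tate_index \<Rightarrow>\<^sub>0 'k"
  have un: "tate_at m (cl l k) = Y_free m (cl l k) \<union> Y_divisible m (cl l k)" for m
    by (auto simp: Y_free_def Y_divisible_def)
  have "hom_dim (\<lambda>m. Y_free m (cl l k) \<union> Y_divisible m (cl l k)) ?d n
    = hom_dim (\<lambda>m. Y_free m (cl l k)) ?d n + hom_dim (\<lambda>m. Y_divisible m (cl l k)) ?d n"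
  proof (rule hom_dim_split)
    show "finite (Y_free n (cl l k))" "finite (Y_divisible n (cl l k))"
      using finite_tate_at [OF l k, of n] by (auto simp: un)
    show "restr (Y_divisible m (cl l k)) (tate_d G u (bvec b)) = (0 :: 'a tate_index \<Rightarrow>\<^sub>0 'k)"
      if "b \<in> Y_free (Suc m) (cl l k)" for b m
      using that Y_divisible_emb_0 by (auto simp: Y_free_def)
    show "restr (Y_free m (cl l k)) (tate_d G u (bvec b)) = (0 :: 'a tate_index \<Rightarrow>\<^sub>0 'k)"
      if "b \<in> Y_divisible (Suc m) (cl l k)" for b m
      using that Y_free_emb_0 [OF l k] by (auto simp: Y_divisible_def gr0_conv_Suc)
    show "hom_boundaries (\<lambda>m. Y_free m (cl l k) \<union> Y_divisible m (cl l k)) ?d n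
      \<subseteq> hom_cycles (\<lambda>m. Y_free m (cl l k) \<union> Y_divisible m (cl l k)) ?d n"
      using tate.tor_boundaries_cycles [OF cl_closed [OF l, of k], of n] unfolding un .
  qed (auto simp: lin_tate_d Y_free_def Y_divisible_def)
  then show ?thesis
    unfolding tate_betti_def bar_betti_def un hom_dim_Y_free [OF l k] .
qed

lemma tate_betti_mult_rho:
  assumes "m \<in> carrier G" "k < r"
  shows "tate_betti (K :: 'k::field itself) n (cl (m \<otimes>\<^bsub>G\<^esub> \<rho>) k) =
    (if k \<le> 1 \<and> k \<le> n then bar_betti K (n - k) (m \<otimes>\<^bsub>G\<^esub> \<rho>) else 0) +
    (if 2 \<le> n then tate_betti (K :: 'k::field itself) (n - 2) (cl m k) else 0)"
  using tate_betti_split [of "m \<otimes>\<^bsub>G\<^esub> \<rho>" k K n] assms hom_dim_Y_divisible [OF assms, of n, where ?'k = 'k]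
  by (simp add: tate_betti_def)

lemma tate_betti_not_divides:
  assumes l: "l \<in> carrier G" and k: "k < r" and "\<not> \<rho> divides\<^bsub>G\<^esub> l"
  shows "tate_betti (K :: 'k::field itself) n (cl l k) = (if k \<le> 1 \<and> k \<le> n then bar_betti K (n - k) l else 0)"
proof -
  have "Y_divisible n (cl l k) = {}"
  proof (rule equals0I)
    fix b assume b: "b \<in> Y_divisible n (cl l k)"
    then obtain ts e j where b': "b = (ts, e, Suc j)"
      by (cases b) (auto simp: Y_divisible_def gr0_conv_Suc)
    have c: "ts \<in> G.div_chains (length ts)" and "l = G.chain_max ts \<otimes>\<^bsub>G\<^esub> (\<rho> [^]\<^bsub>G\<^esub> Suc j)"
      using b by (auto simp: b' Y_divisible_def tate_at_iff l k simp del: G.nat_pow_Suc)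
    then have "l = \<rho> \<otimes>\<^bsub>G\<^esub> (G.chain_max ts \<otimes>\<^bsub>G\<^esub> (\<rho> [^]\<^bsub>G\<^esub> j))"
      using G.chain_max_closed [OF c] by (simp add: G.m_ac)
    then have "\<rho> divides\<^bsub>G\<^esub> l"
      using c by (intro dividesI) auto
    with assms(3) show False ..
  qed
  then have "hom_dim (\<lambda>m. Y_divisible m (cl l k)) (\<lambda>_. tate_d G u :: _ \<Rightarrow> 'a tate_index \<Rightarrow>\<^sub>0 'k) n = 0"
    by (rule hom_dim_empty)
  then show ?thesis
    by (simp add: tate_betti_split [OF l k])
qed

end


section \<open>Monoid algebras and free modules as vector spaces\<close>

lemma poly_mapping_add_induct [consumes 1, case_names zero add]:
  assumes p: "p \<in> supp_in X"
    and "P 0" "\<And>p b c. p \<in> supp_in X \<Longrightarrow> b \<in> X \<Longrightarrow> P p \<Longrightarrow> P (p + Poly_Mapping.single b c)"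
  shows "P p"
proof -
  have fin: "(\<Sum>b\<in>Y. scl (lookup p b) (bvec b)) \<in> supp_in X \<and> P (\<Sum>b\<in>Y. scl (lookup p b) (bvec b))"
    if "finite Y" "Y \<subseteq> keys p" for Y
    using that
  proof (induction Y)
    case empty
    then show ?case using assms(2) by (simp add: vs.subspace_0 [OF subspace_supp_in])
  next
    case (insert b Y)
    then have b: "b \<in> X"
      using p by (auto simp: supp_in_def)
    have eq: "(\<Sum>b\<in>insert b Y. scl (lookup p b) (bvec b)) = (\<Sum>b\<in>Y. scl (lookup p b) (bvec b)) + Poly_Mapping.single b (lookup p b)"
      using insert by (simp add: scl_bvec add.commute)
    have IH: "(\<Sum>b\<in>Y. scl (lookup p b) (bvec b)) \<in> supp_in X" "P (\<Sum>b\<in>Y. scl (lookup p b) (bvec b))"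
      using insert by auto
    have "Poly_Mapping.single b (lookup p b) \<in> supp_in X"
      using b by (simp add: supp_in_def)
    then show ?case
      unfolding eq using vs.subspace_add [OF subspace_supp_in IH(1)] assms(3) [OF IH(1) b IH(2)] by blast
  qed
  from fin [OF finite_keys subset_refl] show ?thesis
    by (simp add: sum_bvec)
qed

lemma lin_lext_param:
  assumes "\<And>y. lin (f y)"
  shows "lin (\<lambda>p. lext (\<lambda>y. f y p) q)"
  by (rule linI)
    (simp_all add: lext_def lin_simps [OF assms] vs.scale_right_distrib sum.distrib vs.scale_sum_right mult.commute)

lemma lin_single: "lin f \<Longrightarrow> f (Poly_Mapping.single b c) = scl c (f (bvec b))"
  using lin_scl [of f c "bvec b"] by (simp add: scl_bvec)

text \<open>An element of a free module over the monoid algebra is a function of a basis element and a monoid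
  element. As a finitely supported function of pairs it lies in a vector space with a basis, to which
  the previous results on linear maps apply.\<close>

definition cur :: "('x \<times> 'a \<Rightarrow>\<^sub>0 'k::zero) \<Rightarrow> 'x \<Rightarrow> 'a \<Rightarrow> 'k" where
  "cur p = (\<lambda>x a. lookup p (x, a))"

definition uncur :: "('x \<Rightarrow> 'a \<Rightarrow> 'k::zero) \<Rightarrow> ('x \<times> 'a \<Rightarrow>\<^sub>0 'k)" where
  "uncur f = Abs_poly_mapping (\<lambda>(x, a). f x a)"

lemma uncur_cur [simp]: "uncur (cur p) = p"
  by (simp add: cur_def uncur_def case_prod_eta)

lemma cur_inject [simp]: "cur p = cur q \<longleftrightarrow> p = q"
  by (metis uncur_cur)

lemma cur_uncur: "finite {(x, a). f x a \<noteq> 0} \<Longrightarrow> cur (uncur f) = f"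
proof -
  assume "finite {(x, a). f x a \<noteq> 0}"
  then have "finite {z. (\<lambda>(x, a). f x a) z \<noteq> 0}"
    by (simp add: case_prod_unfold)
  then show ?thesis
    by (simp add: cur_def uncur_def)
qed

locale reduced_monoid_algebra = reduced_monoid \<Lambda>
  for \<Lambda> :: "'a monoid" (structure) +
  fixes K :: "'k::field itself"
begin

abbreviation A :: "('a \<Rightarrow> 'k) ring" where
  "A \<equiv> monoid_algebra \<Lambda>"

text \<open>Multiplication in the monoid algebra and its action on free modules, on the side of vector spaces.\<close>

definition amul :: "('a \<Rightarrow>\<^sub>0 'k) \<Rightarrow> ('a \<Rightarrow>\<^sub>0 'k) \<Rightarrow> ('a \<Rightarrow>\<^sub>0 'k)" where
  "amul q p = lext (\<lambda>y. lext (\<lambda>z. bvec (y \<otimes> z)) p) q"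

definition shift :: "'a \<Rightarrow> ('x \<times> 'a \<Rightarrow>\<^sub>0 'k) \<Rightarrow> ('x \<times> 'a \<Rightarrow>\<^sub>0 'k)" where
  "shift y = lext (\<lambda>(x, z). bvec (x, y \<otimes> z))"

definition act :: "('a \<Rightarrow>\<^sub>0 'k) \<Rightarrow> ('x \<times> 'a \<Rightarrow>\<^sub>0 'k) \<Rightarrow> ('x \<times> 'a \<Rightarrow>\<^sub>0 'k)" where
  "act q p = lext (\<lambda>y. shift y p) q"

lemma lin_shift: "lin (shift y)"
  unfolding shift_def by (rule lin_lext)

lemma lin_act_left: "lin (\<lambda>q. act q p)"
  unfolding act_def by (rule lin_lext)

lemma lin_act_right: "lin (act q)"
  unfolding act_def by (rule lin_lext_param [OF lin_shift])

lemma lin_amul_left: "lin (\<lambda>q. amul q p)"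
  unfolding amul_def by (rule lin_lext)

lemma lin_amul_right: "lin (amul q)"
  unfolding amul_def by (rule lin_lext_param [OF lin_lext])

lemma shift_bvec [simp]: "shift y (bvec (x, z)) = bvec (x, y \<otimes> z)"
  by (simp add: shift_def)

lemma act_bvec [simp]: "act (bvec y) p = shift y p"
  by (simp add: act_def)

lemma amul_bvec [simp]: "amul (bvec y) (bvec z) = bvec (y \<otimes> z)"
  by (simp add: amul_def)

lemma A_carrier_iff: "f \<in> carrier A \<longleftrightarrow> (\<exists>q \<in> supp_in (carrier \<Lambda>). f = lookup q)"
proof
  assume f: "f \<in> carrier A"
  then have fin: "finite {x. f x \<noteq> 0}"
    by (simp add: monoid_algebra_def)
  then have "f = lookup (Abs_poly_mapping f)"
    by simp
  moreover have "Abs_poly_mapping f \<in> supp_in (carrier \<Lambda>)"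
    using f fin by (auto simp: supp_in_def in_keys_iff monoid_algebra_def)
  ultimately show "\<exists>q \<in> supp_in (carrier \<Lambda>). f = lookup q"
    by blast
qed (auto simp: monoid_algebra_def supp_in_def in_keys_iff)

lemma lookup_in_A: "q \<in> supp_in (carrier \<Lambda>) \<Longrightarrow> lookup q \<in> carrier A"
  using A_carrier_iff by blast

lemma keys_alt: "{x. lookup q x \<noteq> 0} = keys q"
  by (auto simp: in_keys_iff)

lemma mult_A: "lookup q \<otimes>\<^bsub>A\<^esub> lookup p = lookup (amul q p)"
proof
  fix x
  show "(lookup q \<otimes>\<^bsub>A\<^esub> lookup p) x = lookup (amul q p) x"
    unfolding monoid_algebra_def amul_def
    by (simp add: keys_alt lext_def lookup_sum lookup_single when_def sum_distrib_left if_distrib cong: if_cong)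
qed

lemma add_A: "lookup q \<oplus>\<^bsub>A\<^esub> lookup p = lookup (q + p)"
  by (simp add: monoid_algebra_def fun_eq_iff lookup_add)

lemma zero_A: "\<zero>\<^bsub>A\<^esub> = lookup 0"
  by (simp add: monoid_algebra_def fun_eq_iff)

lemma one_A: "\<one>\<^bsub>A\<^esub> = lookup (bvec \<one>)"
  by (auto simp: monoid_algebra_def fun_eq_iff lookup_single when_def)

lemma amul_supp: "q \<in> supp_in (carrier \<Lambda>) \<Longrightarrow> p \<in> supp_in (carrier \<Lambda>) \<Longrightarrow> amul q p \<in> supp_in (carrier \<Lambda>)"
proof -
  assume q: "q \<in> supp_in (carrier \<Lambda>)" and p: "p \<in> supp_in (carrier \<Lambda>)"
  show ?thesis
  proof (rule lin_supp_in [OF lin_amul_left q])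
    fix y assume "y \<in> carrier \<Lambda>"
    then show "amul (bvec y) p \<in> supp_in (carrier \<Lambda>)"
      by (intro lin_supp_in [OF lin_amul_right p]) simp
  qed
qed

lemma amul_comm: "q \<in> supp_in (carrier \<Lambda>) \<Longrightarrow> p \<in> supp_in (carrier \<Lambda>) \<Longrightarrow> amul q p = amul p q"
proof -
  assume q: "q \<in> supp_in (carrier \<Lambda>)" and p: "p \<in> supp_in (carrier \<Lambda>)"
  show ?thesis
  proof (rule lin_eq_supp_in [OF lin_amul_left lin_amul_right q])
    fix y assume y: "y \<in> carrier \<Lambda>"
    show "amul (bvec y) p = amul p (bvec y)"
      by (rule lin_eq_supp_in [OF lin_amul_right lin_amul_left p]) (simp add: y m_comm)
  qed
qed

lemma amul_one: "p \<in> supp_in (carrier \<Lambda>) \<Longrightarrow> amul (bvec \<one>) p = p"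
  by (rule lin_eq_supp_in [OF lin_amul_right lin_id]) auto

lemma amul_assoc:
  assumes q: "q \<in> supp_in (carrier \<Lambda>)" "q' \<in> supp_in (carrier \<Lambda>)" and p: "p \<in> supp_in (carrier \<Lambda>)"
  shows "amul (amul q q') p = amul q (amul q' p)"
proof (rule lin_eq_supp_in [OF lin_compose [OF lin_amul_left lin_amul_left] lin_amul_left q(1)])
  fix y assume y: "y \<in> carrier \<Lambda>"
  show "amul (amul (bvec y) q') p = amul (bvec y) (amul q' p)"
  proof (rule lin_eq_supp_in [OF lin_compose [OF lin_amul_left lin_amul_right] lin_compose [OF lin_amul_right lin_amul_left] q(2)])
    fix y' assume y': "y' \<in> carrier \<Lambda>"
    show "amul (amul (bvec y) (bvec y')) p = amul (bvec y) (amul (bvec y') p)"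
      by (rule lin_eq_supp_in [OF lin_amul_right lin_compose [OF lin_amul_right lin_amul_right] p])
        (use y y' in \<open>auto simp: m_assoc\<close>)
  qed
qed

lemma cring_A: "cring A"
proof (rule cringI)
  show "abelian_group A"
  proof (rule abelian_groupI)
    fix x y z assume "x \<in> carrier A" "y \<in> carrier A" "z \<in> carrier A"
    then obtain p q s where "p \<in> supp_in (carrier \<Lambda>)" "q \<in> supp_in (carrier \<Lambda>)" "s \<in> supp_in (carrier \<Lambda>)"
      "x = lookup p" "y = lookup q" "z = lookup s"
      by (auto simp: A_carrier_iff)
    then show "x \<oplus>\<^bsub>A\<^esub> y \<in> carrier A" "x \<oplus>\<^bsub>A\<^esub> y \<oplus>\<^bsub>A\<^esub> z = x \<oplus>\<^bsub>A\<^esub> (y \<oplus>\<^bsub>A\<^esub> z)"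
      "x \<oplus>\<^bsub>A\<^esub> y = y \<oplus>\<^bsub>A\<^esub> x" "\<zero>\<^bsub>A\<^esub> \<oplus>\<^bsub>A\<^esub> x = x" "\<exists>y\<in>carrier A. y \<oplus>\<^bsub>A\<^esub> x = \<zero>\<^bsub>A\<^esub>"
      using vs.subspace_add [OF subspace_supp_in, of p "carrier \<Lambda>" q] vs.subspace_neg [OF subspace_supp_in, of p "carrier \<Lambda>"]
      by (auto simp: add_A zero_A ac_simps lookup_in_A intro!: bexI [of _ "lookup (- p)"])
  next
    show "\<zero>\<^bsub>A\<^esub> \<in> carrier A"
      unfolding zero_A by (rule lookup_in_A) (rule vs.subspace_0 [OF subspace_supp_in])
  qed
  show "comm_monoid A"
  proof (rule comm_monoidI)
    fix x y z assume "x \<in> carrier A" "y \<in> carrier A" "z \<in> carrier A"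
    then obtain p q s where "p \<in> supp_in (carrier \<Lambda>)" "q \<in> supp_in (carrier \<Lambda>)" "s \<in> supp_in (carrier \<Lambda>)"
      "x = lookup p" "y = lookup q" "z = lookup s"
      by (auto simp: A_carrier_iff)
    then show "x \<otimes>\<^bsub>A\<^esub> y \<in> carrier A" "x \<otimes>\<^bsub>A\<^esub> y \<otimes>\<^bsub>A\<^esub> z = x \<otimes>\<^bsub>A\<^esub> (y \<otimes>\<^bsub>A\<^esub> z)"
      "x \<otimes>\<^bsub>A\<^esub> y = y \<otimes>\<^bsub>A\<^esub> x" "\<one>\<^bsub>A\<^esub> \<otimes>\<^bsub>A\<^esub> x = x"
      using amul_comm [of p q] amul_assoc [of p q s]
      by (auto simp: mult_A one_A lookup_in_A amul_supp amul_one)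
  next
    show "\<one>\<^bsub>A\<^esub> \<in> carrier A"
      unfolding one_A by (rule lookup_in_A) simp
  qed
  fix x y z assume "x \<in> carrier A" "y \<in> carrier A" "z \<in> carrier A"
  then obtain p q s where "x = lookup p" "y = lookup q" "z = lookup s"
    by (auto simp: A_carrier_iff)
  then show "(x \<oplus>\<^bsub>A\<^esub> y) \<otimes>\<^bsub>A\<^esub> z = x \<otimes>\<^bsub>A\<^esub> z \<oplus>\<^bsub>A\<^esub> y \<otimes>\<^bsub>A\<^esub> z"
    by (simp add: mult_A add_A lin_add [OF lin_amul_left])
qed

subsection \<open>Free modules\<close>

abbreviation FM :: "'x set \<Rightarrow> ('a \<Rightarrow> 'k, 'x \<Rightarrow> 'a \<Rightarrow> 'k) module" where
  "FM X \<equiv> free_module A X"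

lemma FM_carrier_iff: "f \<in> carrier (FM X) \<longleftrightarrow> (\<exists>p \<in> supp_in (X \<times> carrier \<Lambda>). f = cur p)"
proof
  assume f: "f \<in> carrier (FM X)"
  then have fin: "finite {x. f x \<noteq> (\<lambda>_. 0)}" "\<And>x. finite {a. f x a \<noteq> 0}"
    and sub: "\<And>x a. f x a \<noteq> 0 \<Longrightarrow> x \<in> X \<and> a \<in> carrier \<Lambda>"
    by (auto simp: free_module_def monoid_algebra_def subset_iff fun_eq_iff)
  have "{(x, a). f x a \<noteq> 0} \<subseteq> (SIGMA x : {x. f x \<noteq> (\<lambda>_. 0)}. {a. f x a \<noteq> 0})"
    by auto
  then have fin2: "finite {(x, a). f x a \<noteq> 0}"
    by (rule finite_subset) (use fin in auto)
  then have c: "cur (uncur f) = f"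
    by (rule cur_uncur)
  moreover have "uncur f \<in> supp_in (X \<times> carrier \<Lambda>)"
  proof -
    have "lookup (uncur f) (x, a) = f x a" for x a
      using c by (metis cur_def)
    then show ?thesis
      using sub by (auto simp: supp_in_def in_keys_iff)
  qed
  ultimately show "\<exists>p \<in> supp_in (X \<times> carrier \<Lambda>). f = cur p"
    by metis
next
  assume "\<exists>p \<in> supp_in (X \<times> carrier \<Lambda>). f = cur p"
  then obtain p where p: "keys p \<subseteq> X \<times> carrier \<Lambda>" "f = cur p"
    by (auto simp: supp_in_def)
  have "finite {a. f x a \<noteq> 0}" for x
    by (rule finite_subset [of _ "snd ` keys p"]) (force simp: p(2) cur_def in_keys_iff)+
  moreover have "finite {x. f x \<noteq> (\<lambda>_. 0)}"
    by (rule finite_subset [of _ "fst ` keys p"]) (force simp: p(2) cur_def in_keys_iff fun_eq_iff)+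
  moreover have "x \<in> X \<and> a \<in> carrier \<Lambda>" if "f x a \<noteq> 0" for x a
    using that p by (auto simp: cur_def in_keys_iff subset_iff)
  ultimately show "f \<in> carrier (FM X)"
    by (auto simp: free_module_def monoid_algebra_def fun_eq_iff)
qed

lemma cur_in_FM: "p \<in> supp_in (X \<times> carrier \<Lambda>) \<Longrightarrow> cur p \<in> carrier (FM X)"
  using FM_carrier_iff by blast

lemma add_FM: "cur p \<oplus>\<^bsub>FM X\<^esub> cur q = cur (p + q)"
  by (simp add: free_module_def monoid_algebra_def cur_def fun_eq_iff lookup_add)

lemma zero_FM: "\<zero>\<^bsub>FM X\<^esub> = cur 0"
  by (simp add: free_module_def monoid_algebra_def cur_def fun_eq_iff)

lemma lookup_shift:
  "lookup (shift y p) (x, a) = (\<Sum>z | lookup p (x, z) \<noteq> 0. if y \<otimes> z = a then lookup p (x, z) else 0)"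
proof -
  have "lookup (shift y p) (x, a) = (\<Sum>(x', z)\<in>keys p. if x' = x then if y \<otimes> z = a then lookup p (x, z) else 0 else 0)"
    unfolding shift_def lext_def lookup_sum by (rule sum.cong) (auto simp: lookup_single when_def)
  also have "\<dots> = (\<Sum>(x', z)\<in>{b \<in> keys p. fst b = x}. if y \<otimes> z = a then lookup p (x, z) else 0)"
    by (rule sum.mono_neutral_cong_right) (auto split: if_splits)
  also have "\<dots> = (\<Sum>z | lookup p (x, z) \<noteq> 0. if y \<otimes> z = a then lookup p (x, z) else 0)"
    by (rule sum.reindex_bij_witness [where j = snd and i = "\<lambda>z. (x, z)"]) (auto simp: in_keys_iff)
  finally show ?thesis .
qed

lemma smult_FM: "lookup q \<odot>\<^bsub>FM X\<^esub> cur p = cur (act q p)"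
proof (rule ext, rule ext)
  fix x a
  have "(lookup q \<odot>\<^bsub>FM X\<^esub> cur p) x a =
    (\<Sum>y\<in>keys q. \<Sum>z | lookup p (x, z) \<noteq> 0. if y \<otimes> z = a then lookup q y * lookup p (x, z) else 0)"
    by (simp add: free_module_def monoid_algebra_def cur_def keys_alt)
  also have "\<dots> = (\<Sum>y\<in>keys q. lookup q y * lookup (shift y p) (x, a))"
    unfolding lookup_shift sum_distrib_left by (intro sum.cong refl) auto
  also have "\<dots> = cur (act q p) x a"
    by (simp add: cur_def act_def lext_def lookup_sum)
  finally show "(lookup q \<odot>\<^bsub>FM X\<^esub> cur p) x a = cur (act q p) x a" .
qed

lemma shift_supp: "y \<in> carrier \<Lambda> \<Longrightarrow> p \<in> supp_in (X \<times> carrier \<Lambda>) \<Longrightarrow> shift y p \<in> supp_in (X \<times> carrier \<Lambda>)"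
  by (erule lin_supp_in [OF lin_shift]) auto

lemma act_supp:
  assumes "q \<in> supp_in (carrier \<Lambda>)" "p \<in> supp_in (X \<times> carrier \<Lambda>)"
  shows "act q p \<in> supp_in (X \<times> carrier \<Lambda>)"
  by (rule lin_supp_in [OF lin_act_left assms(1)]) (simp add: shift_supp assms)

lemma act_single_one:
  assumes "p \<in> supp_in (X \<times> carrier \<Lambda>)"
  shows "act (Poly_Mapping.single \<one> c) p = scl c p"
proof -
  have "shift \<one> p = p"
    by (rule lin_eq_supp_in [OF lin_shift lin_id assms]) auto
  then show ?thesis
    using lin_single [OF lin_act_left, of \<one> c p] by simp
qed

lemma abelian_group_FM: "abelian_group (FM X)"
proof (rule abelian_groupI)
  fix x y z assume "x \<in> carrier (FM X)" "y \<in> carrier (FM X)" "z \<in> carrier (FM X)"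
  then obtain p q s where "p \<in> supp_in (X \<times> carrier \<Lambda>)" "q \<in> supp_in (X \<times> carrier \<Lambda>)" "s \<in> supp_in (X \<times> carrier \<Lambda>)"
    "x = cur p" "y = cur q" "z = cur s"
    by (auto simp: FM_carrier_iff)
  then show "x \<oplus>\<^bsub>FM X\<^esub> y \<in> carrier (FM X)" "x \<oplus>\<^bsub>FM X\<^esub> y \<oplus>\<^bsub>FM X\<^esub> z = x \<oplus>\<^bsub>FM X\<^esub> (y \<oplus>\<^bsub>FM X\<^esub> z)"
    "x \<oplus>\<^bsub>FM X\<^esub> y = y \<oplus>\<^bsub>FM X\<^esub> x" "\<zero>\<^bsub>FM X\<^esub> \<oplus>\<^bsub>FM X\<^esub> x = x" "\<exists>y\<in>carrier (FM X). y \<oplus>\<^bsub>FM X\<^esub> x = \<zero>\<^bsub>FM X\<^esub>"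
    using vs.subspace_add [OF subspace_supp_in, of p "X \<times> carrier \<Lambda>" q] vs.subspace_neg [OF subspace_supp_in, of p "X \<times> carrier \<Lambda>"]
    by (auto simp: add_FM zero_FM ac_simps cur_in_FM intro!: bexI [of _ "cur (- p)"])
next
  show "\<zero>\<^bsub>FM X\<^esub> \<in> carrier (FM X)"
    unfolding zero_FM by (rule cur_in_FM) (rule vs.subspace_0 [OF subspace_supp_in])
qed

lemma a_inv_FM: "p \<in> supp_in (X \<times> carrier \<Lambda>) \<Longrightarrow> \<ominus>\<^bsub>FM X\<^esub> cur p = cur (- p)"
  by (rule abelian_group.minus_equality [OF abelian_group_FM])
    (auto simp: add_FM zero_FM cur_in_FM vs.subspace_neg [OF subspace_supp_in])

lemma minus_FM: "q \<in> supp_in (X \<times> carrier \<Lambda>) \<Longrightarrow> cur p \<ominus>\<^bsub>FM X\<^esub> cur q = cur (p - q)"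
  by (simp add: a_minus_def a_inv_FM add_FM)

lemma free_gen_cur: "free_gen A x = cur (bvec (x, \<one>))"
  by (auto simp: free_gen_def cur_def fun_eq_iff monoid_algebra_def lookup_single when_def)

end


section \<open>Quotients by the kernel of a map\<close>

text \<open>All quotients that occur are quotients by the kernel of an explicit linear map, so that their cosets are
  the fibres of this map.\<close>

definition fibre :: "('r, 'm) module \<Rightarrow> ('m \<Rightarrow> 'v) \<Rightarrow> 'v \<Rightarrow> 'm set" where
  "fibre M \<phi> v = {x \<in> carrier M. \<phi> x = v}"

locale kernel_quotient = abelian_group M for M :: "('r, 'm) module" (structure) +
  fixes \<phi> :: "'m \<Rightarrow> 'v::ab_group_add" and N :: "'m set"
  assumes additive: "x \<in> carrier M \<Longrightarrow> y \<in> carrier M \<Longrightarrow> \<phi> (x \<oplus> y) = \<phi> x + \<phi> y"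
    and kernel: "N = {x \<in> carrier M. \<phi> x = 0}"
begin

lemma coset_eq: "x \<in> carrier M \<Longrightarrow> N +> x = fibre M \<phi> (\<phi> x)"
proof (intro equalityI subsetI)
  fix y assume x: "x \<in> carrier M" and "y \<in> N +> x"
  then show "y \<in> fibre M \<phi> (\<phi> x)"
    by (auto simp: a_r_coset_def' kernel fibre_def additive)
next
  fix y assume x: "x \<in> carrier M" and "y \<in> fibre M \<phi> (\<phi> x)"
  then have y: "y \<in> carrier M" "\<phi> y = \<phi> x"
    by (auto simp: fibre_def)
  have eq: "(y \<ominus> x) \<oplus> x = y"
    using x y by (simp add: a_minus_def a_assoc l_neg)
  have "\<phi> y = \<phi> (y \<ominus> x) + \<phi> x"
    using additive [of "y \<ominus> x" x] x y eq by simp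
  then have "y \<ominus> x \<in> N"
    using x y by (simp add: kernel)
  then show "y \<in> N +> x"
    using eq by (force simp: a_r_coset_def')
qed

lemma carrier_quot: "carrier (quot_module M N) = fibre M \<phi> ` \<phi> ` carrier M"
  by (auto simp: quot_module_def A_RCOSETS_def' coset_eq image_iff)

lemma zero_quot: "\<zero>\<^bsub>quot_module M N\<^esub> = fibre M \<phi> 0"
  by (simp add: quot_module_def kernel fibre_def)

lemma add_quot:
  assumes "x \<in> carrier M" "y \<in> carrier M"
  shows "fibre M \<phi> (\<phi> x) \<oplus>\<^bsub>quot_module M N\<^esub> fibre M \<phi> (\<phi> y) = fibre M \<phi> (\<phi> x + \<phi> y)"
proof -
  have "z \<in> set_add M (fibre M \<phi> (\<phi> x)) (fibre M \<phi> (\<phi> y))" if z: "z \<in> fibre M \<phi> (\<phi> x + \<phi> y)" for z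
  proof -
    have zc: "z \<in> carrier M" "\<phi> z = \<phi> x + \<phi> y"
      using z by (auto simp: fibre_def)
    have eq: "(z \<ominus> y) \<oplus> y = z"
      using zc assms by (simp add: a_minus_def a_assoc l_neg)
    have "\<phi> z = \<phi> (z \<ominus> y) + \<phi> y"
      using additive [of "z \<ominus> y" y] assms zc eq by simp
    then have "z \<ominus> y \<in> fibre M \<phi> (\<phi> x)" "y \<in> fibre M \<phi> (\<phi> y)"
      using assms zc by (auto simp: fibre_def)
    then show ?thesis
      using eq unfolding set_add_def' by force
  qed
  then show ?thesis
    by (auto simp: quot_module_def set_add_def' fibre_def additive)
qed

lemma smult_quot:
  assumes "\<And>x. x \<in> carrier M \<Longrightarrow> a \<odot> x \<in> carrier M" "\<And>x. x \<in> carrier M \<Longrightarrow> \<phi> (a \<odot> x) = \<sigma> (\<phi> x)"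
    and "x \<in> carrier M"
  shows "a \<odot>\<^bsub>quot_module M N\<^esub> fibre M \<phi> (\<phi> x) = fibre M \<phi> (\<sigma> (\<phi> x))"
proof -
  have "a \<odot>\<^bsub>quot_module M N\<^esub> fibre M \<phi> (\<phi> x) = (\<Union>y\<in>fibre M \<phi> (\<phi> x). N +> (a \<odot> y))"
    by (simp add: quot_module_def)
  also have "\<dots> = (\<Union>y\<in>fibre M \<phi> (\<phi> x). fibre M \<phi> (\<sigma> (\<phi> x)))"
    by (rule SUP_cong [OF refl]) (simp add: coset_eq assms fibre_def)
  also have "\<dots> = fibre M \<phi> (\<sigma> (\<phi> x))"
    using assms(3) by (auto simp: fibre_def)
  finally show ?thesis .
qed

lemma fibre_inj: "v \<in> \<phi> ` carrier M \<Longrightarrow> fibre M \<phi> v = fibre M \<phi> w \<Longrightarrow> v = w"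
  by (auto simp: fibre_def)

end

section \<open>The residue field and tensor products with it\<close>

context reduced_monoid_algebra
begin

lemma mult_eq_one_iff: "x \<in> carrier \<Lambda> \<Longrightarrow> y \<in> carrier \<Lambda> \<Longrightarrow> x \<otimes> y = \<one> \<longleftrightarrow> x = \<one> \<and> y = \<one>"
  using no_invertibles [of x y] by auto

lemma restr_one_amul:
  assumes q: "q \<in> supp_in (carrier \<Lambda>)" and p: "p \<in> supp_in (carrier \<Lambda>)"
  shows "restr {\<one>} (amul q p) = scl (lookup q \<one>) (restr {\<one>} p)"
proof (rule lin_eq_supp_in [OF lin_compose [OF lin_restr lin_amul_left] _ q])
  show "lin (\<lambda>q. scl (lookup q \<one>) (restr {\<one>} p))"
    by (rule linI) (simp_all add: lookup_add vs.scale_left_distrib)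
  fix y assume y: "y \<in> carrier \<Lambda>"
  show "restr {\<one>} (amul (bvec y) p) = scl (lookup (bvec y) \<one>) (restr {\<one>} p)"
  proof (cases "y = \<one>")
    case True
    then show ?thesis by (simp add: amul_one p)
  next
    case False
    have "restr {\<one>} (amul (bvec y) p) = 0"
      by (rule lin_eq_supp_in [OF lin_compose [OF lin_restr lin_amul_right] lin_zero p])
        (use y False in \<open>simp add: restr_def mult_eq_one_iff\<close>)
    with False show ?thesis
      by (simp add: lookup_single)
  qed
qed

lemma lookup_amul_one:
  "q \<in> supp_in (carrier \<Lambda>) \<Longrightarrow> p \<in> supp_in (carrier \<Lambda>) \<Longrightarrow> lookup (amul q p) \<one> = lookup q \<one> * lookup p \<one>"
  using arg_cong [OF restr_one_amul [of q p], of "\<lambda>v. lookup v \<one>"] by (simp add: lookup_restr)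

abbreviation Res :: "('a \<Rightarrow> 'k, ('a \<Rightarrow> 'k) set) module" where
  "Res \<equiv> residue_module \<Lambda>"

text \<open>The element of the residue field with the value \<open>c\<close>: the coset of the elements of the algebra
  with constant coefficient \<open>c\<close>.\<close>

definition \<kappa> :: "'k \<Rightarrow> ('a \<Rightarrow> 'k) set" where
  "\<kappa> c = {f \<in> carrier A. f \<one> = c}"

text \<open>As no element of the monoid other than \<open>\<one>\<close> is invertible, the elements without constant term form an
  ideal, and they are sums of multiples of the generators.\<close>

lemma irrelevant_ideal_eq: "(irrelevant_ideal \<Lambda> :: ('a \<Rightarrow> 'k) set) = {f \<in> carrier A. f \<one> = 0}"
proof (intro equalityI subsetI)
  interpret A: cring A
    by (rule cring_A)
  have "ideal {f \<in> carrier A. f \<one> = 0} A"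
  proof (rule idealI [OF A.ring_axioms])
    have inv: "inv\<^bsub>add_monoid A\<^esub> (lookup p) = lookup (- p)" if "p \<in> supp_in (carrier \<Lambda>)" for p
      unfolding a_inv_def [symmetric]
      by (rule A.minus_equality) (use that in \<open>auto simp: add_A zero_A lookup_in_A vs.subspace_neg [OF subspace_supp_in]\<close>)
    show "subgroup {f \<in> carrier A. f \<one> = 0} (add_monoid A)"
    proof (rule subgroup.intro)
      show "inv\<^bsub>add_monoid A\<^esub> x \<in> {f \<in> carrier A. f \<one> = 0}" if x: "x \<in> {f \<in> carrier A. f \<one> = 0}" for x
      proof -
        obtain p where p: "p \<in> supp_in (carrier \<Lambda>)" "x = lookup p" "lookup p \<one> = 0"
          using x by (auto simp: A_carrier_iff)
        show ?thesis
          unfolding p(2) inv [OF p(1)] using p by (simp add: lookup_in_A vs.subspace_neg [OF subspace_supp_in])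
      qed
    qed (auto simp: A.add.m_closed, auto simp: monoid_algebra_def)
  next
    fix a x assume "a \<in> {f \<in> carrier A. f \<one> = 0}" "x \<in> carrier A"
    then obtain p q where "p \<in> supp_in (carrier \<Lambda>)" "q \<in> supp_in (carrier \<Lambda>)" "a = lookup p" "x = lookup q" "lookup p \<one> = 0"
      by (auto simp: A_carrier_iff)
    then show "x \<otimes>\<^bsub>A\<^esub> a \<in> {f \<in> carrier A. f \<one> = 0}" "a \<otimes>\<^bsub>A\<^esub> x \<in> {f \<in> carrier A. f \<one> = 0}"
      by (auto simp: mult_A lookup_amul_one lookup_in_A amul_supp)
  qed
  moreover have "{monom_elt 1 l | l. l \<in> carrier \<Lambda> - {\<one>}} \<subseteq> {f \<in> carrier A. f \<one> = 0}"
    by (auto simp: monom_elt_def monoid_algebra_def split: if_splits)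
  ultimately show "f \<in> {f \<in> carrier A. f \<one> = 0}" if "f \<in> irrelevant_ideal \<Lambda>" for f
    using that unfolding irrelevant_ideal_def genideal_def by blast
next
  fix f :: "'a \<Rightarrow> 'k" assume "f \<in> {f \<in> carrier A. f \<one> = 0}"
  then obtain q where q: "f = lookup q" "q \<in> supp_in (carrier \<Lambda> - {\<one>})"
    by (auto simp: A_carrier_iff supp_in_def in_keys_iff)
  show "f \<in> irrelevant_ideal \<Lambda>"
    unfolding irrelevant_ideal_def genideal_def
  proof (clarify)
    fix I assume I: "ideal I A" and sub: "{monom_elt 1 l | l. l \<in> carrier \<Lambda> - {\<one>}} \<subseteq> I"
    interpret I: ideal I A
      by (rule I)
    have "lookup q \<in> I"
      using q(2)
    proof (induction rule: poly_mapping_add_induct)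
      case zero
      then show ?case using additive_subgroup.zero_closed [OF I.additive_subgroup_axioms] unfolding zero_A .
    next
      case (add p b c)
      have "monom_elt 1 b \<in> I"
        using sub add by blast
      moreover have "monom_elt 1 b = lookup (bvec b :: 'a \<Rightarrow>\<^sub>0 'k)"
        by (auto simp: monom_elt_def fun_eq_iff lookup_single when_def)
      ultimately have "lookup (bvec b :: 'a \<Rightarrow>\<^sub>0 'k) \<in> I"
        by simp
      then have "lookup (Poly_Mapping.single \<one> c) \<otimes>\<^bsub>A\<^esub> lookup (bvec b) \<in> I"
        by (rule I.I_l_closed) (rule lookup_in_A, simp add: supp_in_def)
      moreover have "amul (Poly_Mapping.single \<one> c) (bvec b) = Poly_Mapping.single b c"
        using add by (subst lin_single [OF lin_amul_left]) (simp add: scl_bvec)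
      ultimately have "lookup (Poly_Mapping.single b c) \<in> I"
        by (simp only: mult_A)
      then show ?case
        using additive_subgroup.a_closed [OF I.additive_subgroup_axioms add.IH] by (simp only: add_A [symmetric])
    qed
    then show "f \<in> I"
      by (simp add: q(1))
  qed
qed

lemma kernel_quotient_residue:
  "kernel_quotient (regular_module A) (\<lambda>f. f \<one>) (irrelevant_ideal \<Lambda> :: ('a \<Rightarrow> 'k) set)"
proof -
  interpret A: cring A
    by (rule cring_A)
  have "abelian_group (regular_module A)"
  proof (rule abelian_groupI)
    show "\<exists>y\<in>carrier (regular_module A). y \<oplus>\<^bsub>regular_module A\<^esub> x = \<zero>\<^bsub>regular_module A\<^esub>"
      if "x \<in> carrier (regular_module A)" for x
      by (rule bexI [of _ "\<ominus>\<^bsub>A\<^esub> x"]) (use that A.l_neg in \<open>auto simp: regular_module_def\<close>)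
  qed (auto simp: regular_module_def A.a_ac)
  then show ?thesis
    by (rule kernel_quotient.intro)
      (unfold_locales, auto simp: irrelevant_ideal_eq regular_module_def, simp add: monoid_algebra_def)
qed

lemma \<kappa>_fibre: "\<kappa> = fibre (regular_module A) (\<lambda>f. f \<one>)"
  by (simp add: fun_eq_iff \<kappa>_def fibre_def regular_module_def)

lemma const_in_A: "lookup (Poly_Mapping.single \<one> c) \<in> carrier A"
  by (rule lookup_in_A) (simp add: supp_in_def)

lemma const_in_regular: "lookup (Poly_Mapping.single \<one> c) \<in> carrier (regular_module A)"
  using const_in_A by (simp add: regular_module_def)

lemma carrier_Res: "carrier Res = range \<kappa>"
proof -
  interpret Q: kernel_quotient "regular_module A" "\<lambda>f. f \<one>" "irrelevant_ideal \<Lambda> :: ('a \<Rightarrow> 'k) set"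
    by (rule kernel_quotient_residue)
  have "(\<lambda>f. f \<one>) ` carrier (regular_module A) = (UNIV :: 'k set)"
  proof -
    have "c \<in> (\<lambda>f. f \<one>) ` carrier (regular_module A)" for c :: 'k
      by (rule image_eqI [OF _ const_in_regular [of c]]) simp
    then show ?thesis by blast
  qed
  then show ?thesis
    using Q.carrier_quot by (simp add: residue_module_def \<kappa>_fibre)
qed

lemma \<kappa>_inject [simp]: "\<kappa> c = \<kappa> c' \<longleftrightarrow> c = c'"
proof -
  have "lookup (Poly_Mapping.single \<one> c) \<in> \<kappa> c' \<longleftrightarrow> c = c'" for c c'
    using const_in_A by (simp add: \<kappa>_def)
  then show ?thesis
    by blast
qed

lemma add_Res: "\<kappa> c \<oplus>\<^bsub>Res\<^esub> \<kappa> c' = \<kappa> (c + c')"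
proof -
  interpret Q: kernel_quotient "regular_module A" "\<lambda>f. f \<one>" "irrelevant_ideal \<Lambda> :: ('a \<Rightarrow> 'k) set"
    by (rule kernel_quotient_residue)
  show ?thesis
    using Q.add_quot [OF const_in_regular const_in_regular, of c c'] by (simp add: residue_module_def \<kappa>_fibre)
qed

lemma zero_Res: "\<zero>\<^bsub>Res\<^esub> = \<kappa> 0"
proof -
  interpret Q: kernel_quotient "regular_module A" "\<lambda>f. f \<one>" "irrelevant_ideal \<Lambda> :: ('a \<Rightarrow> 'k) set"
    by (rule kernel_quotient_residue)
  show ?thesis
    using Q.zero_quot by (simp add: residue_module_def \<kappa>_fibre)
qed

lemma smult_Res:
  assumes q: "q \<in> supp_in (carrier \<Lambda>)"
  shows "lookup q \<odot>\<^bsub>Res\<^esub> \<kappa> c = \<kappa> (lookup q \<one> * c)"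
proof -
  interpret Q: kernel_quotient "regular_module A" "\<lambda>f. f \<one>" "irrelevant_ideal \<Lambda> :: ('a \<Rightarrow> 'k) set"
    by (rule kernel_quotient_residue)
  have "lookup q \<odot>\<^bsub>regular_module A\<^esub> x \<in> carrier (regular_module A) \<and>
      (lookup q \<odot>\<^bsub>regular_module A\<^esub> x) \<one> = lookup q \<one> * x \<one>" if "x \<in> carrier (regular_module A)" for x
    using that q by (auto simp: regular_module_def A_carrier_iff mult_A lookup_amul_one intro: amul_supp)
  then show ?thesis
    using Q.smult_quot [where \<sigma> = "\<lambda>c. lookup q \<one> * c", OF _ _ const_in_regular, of "lookup q" c]
    by (simp add: residue_module_def \<kappa>_fibre)
qed

lemma residue_component_eq:
  "l \<in> carrier \<Lambda> \<Longrightarrow> (residue_component \<Lambda> l :: ('a \<Rightarrow> 'k) set set) = (if l = \<one> then range \<kappa> else {\<kappa> 0})"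
proof -
  assume l: "l \<in> carrier \<Lambda>"
  interpret Q: kernel_quotient "regular_module A" "\<lambda>f. f \<one>" "irrelevant_ideal \<Lambda> :: ('a \<Rightarrow> 'k) set"
    by (rule kernel_quotient_residue)
  have in_reg: "x \<in> carrier (regular_module A)" if "x \<in> regular_component \<Lambda> l" for x :: "'a \<Rightarrow> 'k"
    using that by (simp add: regular_component_def regular_module_def)
  have "(residue_component \<Lambda> l :: ('a \<Rightarrow> 'k) set set) = {\<kappa> (x \<one>) | x. x \<in> regular_component \<Lambda> l}"
    unfolding residue_component_def quot_component_def \<kappa>_fibre using Q.coset_eq in_reg by blast
  also have "\<dots> = (if l = \<one> then range \<kappa> else {\<kappa> 0})"
  proof (cases "l = \<one>")
    case True
    have "lookup (Poly_Mapping.single \<one> c :: 'a \<Rightarrow>\<^sub>0 'k) \<in> regular_component \<Lambda> l" for c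
      using const_in_A by (auto simp: regular_component_def True lookup_single when_def)
    then have "\<kappa> c \<in> {\<kappa> (x \<one>) | x. x \<in> regular_component \<Lambda> l}" for c
      by (force intro!: exI [of _ "lookup (Poly_Mapping.single \<one> c :: 'a \<Rightarrow>\<^sub>0 'k)"])
    with True show ?thesis
      by auto
  next
    case False
    have "(\<lambda>x. 0) \<in> regular_component \<Lambda> l"
      by (simp add: regular_component_def monoid_algebra_def)
    moreover have "x \<one> = 0" if "x \<in> regular_component \<Lambda> l" for x :: "'a \<Rightarrow> 'k"
      using that False by (auto simp: regular_component_def)
    ultimately show ?thesis
      using False by force
  qed
  finally show ?thesis .
qed

definition ev :: "('a \<Rightarrow> 'k) set \<Rightarrow> 'k" where
  "ev y = (THE c. y = \<kappa> c)"

lemma ev_\<kappa> [simp]: "ev (\<kappa> c) = c"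
  by (simp add: ev_def)

text \<open>Reduction of a free module modulo the maximal ideal.\<close>

definition const_part :: "('x \<times> 'a \<Rightarrow>\<^sub>0 'k) \<Rightarrow> ('x \<Rightarrow>\<^sub>0 'k)" where
  "const_part = lext (\<lambda>(x, a). if a = \<one> then bvec x else 0)"

lemma lin_const_part: "lin const_part"
  unfolding const_part_def by (rule lin_lext)

lemma const_part_bvec [simp]: "const_part (bvec (x, a)) = (if a = \<one> then bvec x else 0)"
  by (simp add: const_part_def)

lemma const_part_shift:
  assumes y: "y \<in> carrier \<Lambda>" and p: "p \<in> supp_in (X \<times> carrier \<Lambda>)"
  shows "const_part (shift y p) = (if y = \<one> then const_part p else 0)"
proof (rule lin_eq_supp_in [OF lin_compose [OF lin_const_part lin_shift] _ p])
  show "lin (\<lambda>p. if y = \<one> then const_part p else 0)"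
    using lin_const_part lin_zero by (cases "y = \<one>") simp_all
  show "const_part (shift y (bvec b)) = (if y = \<one> then const_part (bvec b) else 0)" if "b \<in> X \<times> carrier \<Lambda>" for b
    using that y by (auto simp: mult_eq_one_iff)
qed

lemma const_part_act:
  assumes q: "q \<in> supp_in (carrier \<Lambda>)" and p: "p \<in> supp_in (X \<times> carrier \<Lambda>)"
  shows "const_part (act q p) = scl (lookup q \<one>) (const_part p)"
proof (rule lin_eq_supp_in [OF lin_compose [OF lin_const_part lin_act_left] _ q])
  show "lin (\<lambda>q. scl (lookup q \<one>) (const_part p))"
    by (rule linI) (simp_all add: lookup_add vs.scale_left_distrib)
  show "const_part (act (bvec y) p) = scl (lookup (bvec y) \<one>) (const_part p)" if "y \<in> carrier \<Lambda>" for y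
    using that p by (simp add: const_part_shift lookup_single)
qed

subsection \<open>The tensor product of a free module with the residue field\<close>

abbreviation tensor_pairs :: "'b set \<Rightarrow> (('b \<Rightarrow> 'a \<Rightarrow> 'k) \<times> ('a \<Rightarrow> 'k) set) set" where
  "tensor_pairs B \<equiv> carrier (FM B) \<times> carrier Res"

abbreviation tensor_vec :: "'b set \<Rightarrow> ((('b \<Rightarrow> 'a \<Rightarrow> 'k) \<times> ('a \<Rightarrow> 'k) set) \<times> 'a \<Rightarrow>\<^sub>0 'k) set" where
  "tensor_vec B \<equiv> supp_in (tensor_pairs B \<times> carrier \<Lambda>)"

text \<open>The map from the free module on all pairs that induces the isomorphism of the tensor product with a
  vector space on the basis of the free module: \<open>x \<otimes> c\<close> is sent to \<open>c\<close> times the reduction of \<open>x\<close>. The map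
  \<open>tensor_lift\<close> is a section of it.\<close>

definition tensor_eval :: "((('b \<Rightarrow> 'a \<Rightarrow> 'k) \<times> ('a \<Rightarrow> 'k) set) \<times> 'a \<Rightarrow>\<^sub>0 'k) \<Rightarrow> ('b \<Rightarrow>\<^sub>0 'k)" where
  "tensor_eval = lext (\<lambda>((x, y), a). if a = \<one> then scl (ev y) (const_part (uncur x)) else 0)"

definition tensor_lift :: "('b \<Rightarrow>\<^sub>0 'k) \<Rightarrow> ((('b \<Rightarrow> 'a \<Rightarrow> 'k) \<times> ('a \<Rightarrow> 'k) set) \<times> 'a \<Rightarrow>\<^sub>0 'k)" where
  "tensor_lift = lext (\<lambda>b. bvec ((free_gen A b, \<kappa> 1), \<one>))"

lemma lin_tensor_eval: "lin tensor_eval"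
  unfolding tensor_eval_def by (rule lin_lext)

lemma lin_tensor_lift: "lin tensor_lift"
  unfolding tensor_lift_def by (rule lin_lext)

lemma tensor_eval_bvec: "tensor_eval (bvec ((cur p, \<kappa> c), a)) = (if a = \<one> then scl c (const_part p) else 0)"
  by (simp add: tensor_eval_def)

lemma tensor_lift_supp: "v \<in> supp_in B \<Longrightarrow> tensor_lift v \<in> tensor_vec B"
  by (rule lin_supp_in [OF lin_tensor_lift])
    (auto simp: tensor_lift_def free_gen_cur carrier_Res intro!: cur_in_FM)

lemma tensor_eval_lift: "tensor_eval (tensor_lift v) = v"
  by (rule lin_eqI [OF lin_compose [OF lin_tensor_eval lin_tensor_lift] lin_id])
    (simp add: tensor_lift_def free_gen_cur tensor_eval_bvec)

lemma tensor_eval_supp: "p \<in> tensor_vec B \<Longrightarrow> tensor_eval p \<in> supp_in B"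
proof (erule lin_supp_in [OF lin_tensor_eval])
  fix z assume "z \<in> tensor_pairs B \<times> carrier \<Lambda>"
  then obtain p c a where z: "z = ((cur p, \<kappa> c), a)" "p \<in> supp_in (B \<times> carrier \<Lambda>)"
    by (auto simp: carrier_Res FM_carrier_iff)
  have "const_part p \<in> supp_in B"
    by (rule lin_supp_in [OF lin_const_part z(2)]) (auto simp: vs.subspace_0 [OF subspace_supp_in])
  then show "tensor_eval (bvec z) \<in> supp_in B"
    by (simp add: z(1) tensor_eval_bvec vs.subspace_0 [OF subspace_supp_in] vs.subspace_scale [OF subspace_supp_in])
qed

lemma tensor_eval_act:
  assumes q: "q \<in> supp_in (carrier \<Lambda>)" and p: "p \<in> tensor_vec B"
  shows "tensor_eval (act q p) = scl (lookup q \<one>) (tensor_eval p)"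
proof (rule lin_eq_supp_in [OF lin_compose [OF lin_tensor_eval lin_act_left] _ q])
  show "lin (\<lambda>q. scl (lookup q \<one>) (tensor_eval p))"
    by (rule linI) (simp_all add: lookup_add vs.scale_left_distrib)
  fix y assume y: "y \<in> carrier \<Lambda>"
  have "tensor_eval (shift y p) = (if y = \<one> then tensor_eval p else 0)"
  proof (rule lin_eq_supp_in [OF lin_compose [OF lin_tensor_eval lin_shift] _ p])
    show "lin (\<lambda>p. if y = \<one> then tensor_eval p else 0)"
      using lin_tensor_eval lin_zero by (cases "y = \<one>") simp_all
    show "tensor_eval (shift y (bvec z)) = (if y = \<one> then tensor_eval (bvec z) else 0)"
      if "z \<in> tensor_pairs B \<times> carrier \<Lambda>" for z
      using that y by (auto simp: tensor_eval_def mult_eq_one_iff)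
  qed
  then show "tensor_eval (act (bvec y) p) = scl (lookup (bvec y) \<one>) (tensor_eval p)"
    by (simp add: lookup_single)
qed

text \<open>The generator of the free module on pairs that becomes the pure tensor of \<open>p\<close> and \<open>c\<close>.\<close>

definition pt :: "('b \<times> 'a \<Rightarrow>\<^sub>0 'k) \<Rightarrow> 'k \<Rightarrow> ((('b \<Rightarrow> 'a \<Rightarrow> 'k) \<times> ('a \<Rightarrow> 'k) set) \<times> 'a \<Rightarrow>\<^sub>0 'k)" where
  "pt p c = bvec ((cur p, \<kappa> c), \<one>)"

lemma pt_supp: "p \<in> supp_in (B \<times> carrier \<Lambda>) \<Longrightarrow> pt p c \<in> tensor_vec B"
  by (auto simp: pt_def carrier_Res intro: cur_in_FM)

lemma tensor_eval_pt: "tensor_eval (pt p c) = scl c (const_part p)"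
  by (simp add: pt_def tensor_eval_bvec)

lemma free_gen_pt: "free_gen A (cur p, \<kappa> c) = cur (pt p c)"
  by (simp add: pt_def free_gen_cur)

abbreviation TF :: "'b set \<Rightarrow> ('a \<Rightarrow> 'k, ('b \<Rightarrow> 'a \<Rightarrow> 'k) \<times> ('a \<Rightarrow> 'k) set \<Rightarrow> 'a \<Rightarrow> 'k) module" where
  "TF B \<equiv> tensor_free A (FM B) Res"

lemma TF_eq: "TF B = FM (tensor_pairs B)"
  by (simp add: tensor_free_def)

text \<open>Elements of the free module have the form \<open>cur p\<close> and those of the residue field the form \<open>\<kappa> c\<close>, so the
  relations can be rewritten as vectors on which linear maps such as \<^const>\<open>tensor_eval\<close> can be
  evaluated.\<close>

lemma tensor_relations_eq:
  "tensor_relations A (FM B) Res = cur `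
    ({pt (p + p') c - (pt p c + pt p' c) | p p' c. p \<in> supp_in (B \<times> carrier \<Lambda>) \<and> p' \<in> supp_in (B \<times> carrier \<Lambda>)} \<union>
     {pt p (c + c') - (pt p c + pt p c') | p c c'. p \<in> supp_in (B \<times> carrier \<Lambda>)} \<union>
     {pt (act q p) c - act q (pt p c) | q p c. q \<in> supp_in (carrier \<Lambda>) \<and> p \<in> supp_in (B \<times> carrier \<Lambda>)} \<union>
     {pt p (lookup q \<one> * c) - act q (pt p c) | q p c. q \<in> supp_in (carrier \<Lambda>) \<and> p \<in> supp_in (B \<times> carrier \<Lambda>)})"
    (is "?L = cur ` (?R1 \<union> ?R2 \<union> ?R3 \<union> ?R4)")
proof -
  let ?P = "supp_in (B \<times> carrier \<Lambda>) :: ('b \<times> 'a \<Rightarrow>\<^sub>0 'k) set"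
  let ?e = "\<lambda>x y. free_gen A (x, y)"
  let ?F = "TF B"
  have FM: "carrier (FM B) = cur ` ?P"
    by (auto simp: FM_carrier_iff)
  have AC: "carrier A = lookup ` supp_in (carrier \<Lambda>)"
    by (auto simp: A_carrier_iff)
  note rules = free_gen_pt add_FM smult_FM add_Res smult_Res TF_eq minus_FM
    vs.subspace_add [OF subspace_supp_in] pt_supp act_supp
  have 1: "?e (x \<oplus>\<^bsub>FM B\<^esub> x') y \<ominus>\<^bsub>?F\<^esub> (?e x y \<oplus>\<^bsub>?F\<^esub> ?e x' y) = cur (pt (p + p') c - (pt p c + pt p' c))"
    if "x = cur p" "x' = cur p'" "y = \<kappa> c" "p \<in> ?P" "p' \<in> ?P" for x x' y p p' c
    using that by (simp add: rules)
  have 2: "?e x (y \<oplus>\<^bsub>Res\<^esub> y') \<ominus>\<^bsub>?F\<^esub> (?e x y \<oplus>\<^bsub>?F\<^esub> ?e x y') = cur (pt p (c + c') - (pt p c + pt p c'))"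
    if "x = cur p" "y = \<kappa> c" "y' = \<kappa> c'" "p \<in> ?P" for x y y' p c c'
    using that by (simp add: rules)
  have 3: "?e (f \<odot>\<^bsub>FM B\<^esub> x) y \<ominus>\<^bsub>?F\<^esub> f \<odot>\<^bsub>?F\<^esub> ?e x y = cur (pt (act q p) c - act q (pt p c))"
    if "f = lookup q" "x = cur p" "y = \<kappa> c" "p \<in> ?P" "q \<in> supp_in (carrier \<Lambda>)" for f x y p q c
    using that by (simp add: rules)
  have 4: "?e x (f \<odot>\<^bsub>Res\<^esub> y) \<ominus>\<^bsub>?F\<^esub> f \<odot>\<^bsub>?F\<^esub> ?e x y = cur (pt p (lookup q \<one> * c) - act q (pt p c))"
    if "f = lookup q" "x = cur p" "y = \<kappa> c" "p \<in> ?P" "q \<in> supp_in (carrier \<Lambda>)" for f x y p q c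
    using that by (simp add: rules)
  have e1: "{?e (x \<oplus>\<^bsub>FM B\<^esub> x') y \<ominus>\<^bsub>?F\<^esub> (?e x y \<oplus>\<^bsub>?F\<^esub> ?e x' y) | x x' y.
      x \<in> carrier (FM B) \<and> x' \<in> carrier (FM B) \<and> y \<in> carrier Res} = cur ` ?R1"
    unfolding FM carrier_Res
  proof (intro equalityI subsetI)
    fix z assume "z \<in> {?e (x \<oplus>\<^bsub>FM B\<^esub> x') y \<ominus>\<^bsub>?F\<^esub> (?e x y \<oplus>\<^bsub>?F\<^esub> ?e x' y) | x x' y. x \<in> cur ` ?P \<and> x' \<in> cur ` ?P \<and> y \<in> range \<kappa>}"
    then obtain p p' c where "p \<in> ?P" "p' \<in> ?P" "z = ?e (cur p \<oplus>\<^bsub>FM B\<^esub> cur p') (\<kappa> c) \<ominus>\<^bsub>?F\<^esub> (?e (cur p) (\<kappa> c) \<oplus>\<^bsub>?F\<^esub> ?e (cur p') (\<kappa> c))"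
      by blast
    with 1 show "z \<in> cur ` ?R1" by blast
  next
    fix z assume "z \<in> cur ` ?R1"
    then obtain p p' c where p: "p \<in> ?P" "p' \<in> ?P" "z = cur (pt (p + p') c - (pt p c + pt p' c))"
      by blast
    show "z \<in> {?e (x \<oplus>\<^bsub>FM B\<^esub> x') y \<ominus>\<^bsub>?F\<^esub> (?e x y \<oplus>\<^bsub>?F\<^esub> ?e x' y) | x x' y. x \<in> cur ` ?P \<and> x' \<in> cur ` ?P \<and> y \<in> range \<kappa>}"
      unfolding mem_Collect_eq
      by (intro exI conjI) (rule trans [OF p(3) 1 [OF refl refl refl p(1,2), symmetric]], (rule imageI rangeI p)+)
  qed
  have e2: "{?e x (y \<oplus>\<^bsub>Res\<^esub> y') \<ominus>\<^bsub>?F\<^esub> (?e x y \<oplus>\<^bsub>?F\<^esub> ?e x y') | x y y'.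
      x \<in> carrier (FM B) \<and> y \<in> carrier Res \<and> y' \<in> carrier Res} = cur ` ?R2"
    unfolding FM carrier_Res
  proof (intro equalityI subsetI)
    fix z assume "z \<in> {?e x (y \<oplus>\<^bsub>Res\<^esub> y') \<ominus>\<^bsub>?F\<^esub> (?e x y \<oplus>\<^bsub>?F\<^esub> ?e x y') | x y y'. x \<in> cur ` ?P \<and> y \<in> range \<kappa> \<and> y' \<in> range \<kappa>}"
    then obtain p c c' where "p \<in> ?P" "z = ?e (cur p) (\<kappa> c \<oplus>\<^bsub>Res\<^esub> \<kappa> c') \<ominus>\<^bsub>?F\<^esub> (?e (cur p) (\<kappa> c) \<oplus>\<^bsub>?F\<^esub> ?e (cur p) (\<kappa> c'))"
      by blast
    with 2 show "z \<in> cur ` ?R2" by blast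
  next
    fix z assume "z \<in> cur ` ?R2"
    then obtain p c c' where p: "p \<in> ?P" "z = cur (pt p (c + c') - (pt p c + pt p c'))"
      by blast
    show "z \<in> {?e x (y \<oplus>\<^bsub>Res\<^esub> y') \<ominus>\<^bsub>?F\<^esub> (?e x y \<oplus>\<^bsub>?F\<^esub> ?e x y') | x y y'. x \<in> cur ` ?P \<and> y \<in> range \<kappa> \<and> y' \<in> range \<kappa>}"
      unfolding mem_Collect_eq
      by (intro exI conjI) (rule trans [OF p(2) 2 [OF refl refl refl p(1), symmetric]], (rule imageI rangeI p)+)
  qed
  have e3: "{?e (f \<odot>\<^bsub>FM B\<^esub> x) y \<ominus>\<^bsub>?F\<^esub> f \<odot>\<^bsub>?F\<^esub> ?e x y | f x y.
      f \<in> carrier A \<and> x \<in> carrier (FM B) \<and> y \<in> carrier Res} = cur ` ?R3"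
    unfolding FM AC carrier_Res
  proof (intro equalityI subsetI)
    fix z assume "z \<in> {?e (f \<odot>\<^bsub>FM B\<^esub> x) y \<ominus>\<^bsub>?F\<^esub> f \<odot>\<^bsub>?F\<^esub> ?e x y | f x y. f \<in> lookup ` supp_in (carrier \<Lambda>) \<and> x \<in> cur ` ?P \<and> y \<in> range \<kappa>}"
    then obtain q p c where "p \<in> ?P" "q \<in> supp_in (carrier \<Lambda>)"
      "z = ?e (lookup q \<odot>\<^bsub>FM B\<^esub> cur p) (\<kappa> c) \<ominus>\<^bsub>?F\<^esub> lookup q \<odot>\<^bsub>?F\<^esub> ?e (cur p) (\<kappa> c)"
      by blast
    with 3 show "z \<in> cur ` ?R3" by blast
  next
    fix z assume "z \<in> cur ` ?R3"
    then obtain q p c where p: "p \<in> ?P" "q \<in> supp_in (carrier \<Lambda>)" "z = cur (pt (act q p) c - act q (pt p c))"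
      by blast
    show "z \<in> {?e (f \<odot>\<^bsub>FM B\<^esub> x) y \<ominus>\<^bsub>?F\<^esub> f \<odot>\<^bsub>?F\<^esub> ?e x y | f x y. f \<in> lookup ` supp_in (carrier \<Lambda>) \<and> x \<in> cur ` ?P \<and> y \<in> range \<kappa>}"
      unfolding mem_Collect_eq
      by (intro exI conjI) (rule trans [OF p(3) 3 [OF refl refl refl p(1,2), symmetric]], (rule imageI rangeI p)+)
  qed
  have e4: "{?e x (f \<odot>\<^bsub>Res\<^esub> y) \<ominus>\<^bsub>?F\<^esub> f \<odot>\<^bsub>?F\<^esub> ?e x y | f x y.
      f \<in> carrier A \<and> x \<in> carrier (FM B) \<and> y \<in> carrier Res} = cur ` ?R4"
    unfolding FM AC carrier_Res
  proof (intro equalityI subsetI)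
    fix z assume "z \<in> {?e x (f \<odot>\<^bsub>Res\<^esub> y) \<ominus>\<^bsub>?F\<^esub> f \<odot>\<^bsub>?F\<^esub> ?e x y | f x y. f \<in> lookup ` supp_in (carrier \<Lambda>) \<and> x \<in> cur ` ?P \<and> y \<in> range \<kappa>}"
    then obtain q p c where "p \<in> ?P" "q \<in> supp_in (carrier \<Lambda>)"
      "z = ?e (cur p) (lookup q \<odot>\<^bsub>Res\<^esub> \<kappa> c) \<ominus>\<^bsub>?F\<^esub> lookup q \<odot>\<^bsub>?F\<^esub> ?e (cur p) (\<kappa> c)"
      by blast
    with 4 show "z \<in> cur ` ?R4" by blast
  next
    fix z assume "z \<in> cur ` ?R4"
    then obtain q p c where p: "p \<in> ?P" "q \<in> supp_in (carrier \<Lambda>)" "z = cur (pt p (lookup q \<one> * c) - act q (pt p c))"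
      by blast
    show "z \<in> {?e x (f \<odot>\<^bsub>Res\<^esub> y) \<ominus>\<^bsub>?F\<^esub> f \<odot>\<^bsub>?F\<^esub> ?e x y | f x y. f \<in> lookup ` supp_in (carrier \<Lambda>) \<and> x \<in> cur ` ?P \<and> y \<in> range \<kappa>}"
      unfolding mem_Collect_eq
      by (intro exI conjI) (rule trans [OF p(3) 4 [OF refl refl refl p(1,2), symmetric]], (rule imageI rangeI p)+)
  qed
  show ?thesis
    unfolding tensor_relations_def Let_def e1 e2 e3 e4 image_Un ..
qed

end

context reduced_monoid_algebra
begin

lemma single_supp: "a \<in> X \<Longrightarrow> Poly_Mapping.single a c \<in> supp_in X"
  by (simp add: supp_in_def)

lemma const_part_supp: "p \<in> supp_in (B \<times> carrier \<Lambda>) \<Longrightarrow> const_part p \<in> supp_in B"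
  by (erule lin_supp_in [OF lin_const_part]) (auto simp: vs.subspace_0 [OF subspace_supp_in])

text \<open>Every element of the free module on pairs is congruent, modulo the tensor relations, to the canonical
  element with the same reduction. Hence there are no relations in the kernel of \<^const>\<open>tensor_eval\<close>
  beyond the defining ones.\<close>

lemma reduction_in_submodule:
  fixes p :: "(('b \<Rightarrow> 'a \<Rightarrow> 'k) \<times> ('a \<Rightarrow> 'k) set) \<times> 'a \<Rightarrow>\<^sub>0 'k"
  assumes N: "submodule N A (TF B)" and rel: "tensor_relations A (FM B) Res \<subseteq> N" and p: "p \<in> tensor_vec B"
  shows "cur (p - tensor_lift (tensor_eval p)) \<in> N"
proof -
  interpret N: submodule N A "TF B"
    by (rule N)
  define S where "S = {p \<in> tensor_vec B. cur p \<in> N}"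
  have act: "act q p \<in> S" if "p \<in> S" "q \<in> supp_in (carrier \<Lambda>)" for q p
    using that N.smult_closed [of "lookup q" "cur p"] by (auto simp: S_def TF_eq smult_FM act_supp lookup_in_A)
  have "vs.subspace S"
  proof (rule vs.subspaceI)
    show "0 \<in> S"
      using N.one_closed by (simp add: S_def TF_eq zero_FM vs.subspace_0 [OF subspace_supp_in])
    show "x + y \<in> S" if "x \<in> S" "y \<in> S" for x y
      using that N.m_closed [of "cur x" "cur y"] by (simp add: S_def TF_eq add_FM vs.subspace_add [OF subspace_supp_in])
    show "scl c x \<in> S" if "x \<in> S" for c x
    proof -
      have "x \<in> tensor_vec B"
        using that by (simp add: S_def)
      then show ?thesis
        using act [OF that single_supp [OF one_closed], of c] by (simp only: act_single_one)
    qed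
  qed
  note sub = vs.subspace_add [OF this] vs.subspace_neg [OF this] vs.subspace_diff [OF this] and S = this
  let ?P = "supp_in (B \<times> carrier \<Lambda>) :: ('b \<times> 'a \<Rightarrow>\<^sub>0 'k) set"
  note in_vec = vs.subspace_add [OF subspace_supp_in] vs.subspace_diff [OF subspace_supp_in] pt_supp act_supp
  have R1: "pt (p + p') c - (pt p c + pt p' c) \<in> S" if "p \<in> ?P" "p' \<in> ?P" for p p' c
  proof -
    have "cur (pt (p + p') c - (pt p c + pt p' c)) \<in> N"
      using rel that unfolding tensor_relations_eq by blast
    moreover have "pt (p + p') c - (pt p c + pt p' c) \<in> tensor_vec B"
      using that by (intro in_vec)
    ultimately show ?thesis
      by (simp add: S_def)
  qed
  have R3: "pt (act q p) c - act q (pt p c) \<in> S" if "q \<in> supp_in (carrier \<Lambda>)" "p \<in> ?P" for q p c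
  proof -
    have "cur (pt (act q p) c - act q (pt p c)) \<in> N"
      using rel that unfolding tensor_relations_eq by blast
    moreover have "pt (act q p) c - act q (pt p c) \<in> tensor_vec B"
      using that by (intro in_vec)
    ultimately show ?thesis
      by (simp add: S_def)
  qed
  have R4: "pt p (lookup q \<one> * c) - act q (pt p c) \<in> S" if "q \<in> supp_in (carrier \<Lambda>)" "p \<in> ?P" for q p c
  proof -
    have "cur (pt p (lookup q \<one> * c) - act q (pt p c)) \<in> N"
      using rel that unfolding tensor_relations_eq by blast
    moreover have "pt p (lookup q \<one> * c) - act q (pt p c) \<in> tensor_vec B"
      using that by (intro in_vec)
    ultimately show ?thesis
      by (simp add: S_def)
  qed
  have claim: "pt p c - tensor_lift (scl c (const_part p)) \<in> S" if "p \<in> ?P" for p c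
    using that
  proof (induction rule: poly_mapping_add_induct)
    case zero
    have "pt (0 + 0) c - (pt 0 c + pt 0 c) \<in> S"
      by (rule R1) (simp_all add: vs.subspace_0 [OF subspace_supp_in])
    then have "pt 0 c \<in> S"
      using sub(2) by fastforce
    then show ?case
      by (simp add: lin_0 [OF lin_const_part] lin_0 [OF lin_tensor_lift])
  next
    case (add p z k)
    obtain b a where z: "z = (b, a)" and ba: "b \<in> B" "a \<in> carrier \<Lambda>"
      using add by (cases z) auto
    define g :: "'b \<times> 'a \<Rightarrow>\<^sub>0 'k" where "g = bvec (b, \<one>)"
    define q where "q = Poly_Mapping.single a k"
    have g: "g \<in> ?P" and q: "q \<in> supp_in (carrier \<Lambda>)"
      using ba by (auto simp: g_def q_def supp_in_def)
    have s: "Poly_Mapping.single z k = act q g"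
      unfolding q_def using ba by (subst lin_single [OF lin_act_left]) (simp add: g_def z scl_bvec)
    define c' where "c' = lookup q \<one> * c"
    have "pt (act q g) c - act q (pt g c) \<in> S" "pt g c' - act q (pt g c) \<in> S"
      using R3 [OF q g] R4 [OF q g] by (auto simp: c'_def)
    then have 1: "pt (act q g) c - pt g c' \<in> S"
      using sub(3) by fastforce
    have "pt g (lookup (Poly_Mapping.single \<one> c') \<one> * 1) - act (Poly_Mapping.single \<one> c') (pt g 1) \<in> S"
      by (rule R4 [OF _ g]) (simp add: supp_in_def)
    then have 2: "pt g c' - scl c' (pt g 1) \<in> S"
      by (simp add: act_single_one [OF pt_supp [OF g]])
    have "scl c' (pt g 1) = tensor_lift (scl c (const_part (act q g)))"
      using g q by (simp add: const_part_act c'_def lin_scl [OF lin_lext] g_def tensor_lift_def pt_def free_gen_cur mult.commute)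
    then have "pt (act q g) c - tensor_lift (scl c (const_part (act q g))) \<in> S"
      using sub(1) [OF 1 2] by simp
    moreover have "pt (p + act q g) c - (pt p c + pt (act q g) c) \<in> S"
      by (rule R1 [OF add.hyps(1) act_supp [OF q g]])
    ultimately have "(pt (p + act q g) c - (pt p c + pt (act q g) c)) + ((pt p c - tensor_lift (scl c (const_part p))) +
        (pt (act q g) c - tensor_lift (scl c (const_part (act q g))))) \<in> S"
      using sub(1) add.IH by blast
    then show ?case
      unfolding s
      by (simp add: lin_add [OF lin_const_part] lin_add [OF lin_tensor_lift] vs.scale_right_distrib algebra_simps)
  qed
  have "p - tensor_lift (tensor_eval p) \<in> S"
  proof (rule lin_in_subspace [OF lin_minus' [OF lin_id lin_compose [OF lin_tensor_lift lin_tensor_eval]] S])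
    fix z assume "z \<in> keys p"
    then obtain p' c a where z: "z = ((cur p', \<kappa> c), a)" "p' \<in> ?P" "a \<in> carrier \<Lambda>"
      using p by (fastforce simp: supp_in_def carrier_Res FM_carrier_iff)
    have bz: "bvec z = act (bvec a) (pt p' c)"
      by (simp add: pt_def z(1) \<open>a \<in> carrier \<Lambda>\<close>)
    have 1: "pt (act (bvec a) p') c - bvec z \<in> S"
      unfolding bz by (rule R3) (use z in auto)
    have 2: "pt (act (bvec a) p') c - tensor_lift (scl c (const_part (act (bvec a) p'))) \<in> S"
      by (rule claim) (use z in \<open>simp add: shift_supp\<close>)
    have "tensor_eval (bvec z) = scl c (const_part (act (bvec a) p'))"
      using z by (simp add: tensor_eval_bvec const_part_shift)
    then show "bvec z - tensor_lift (tensor_eval (bvec z)) \<in> S"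
      using sub(3) [OF 2 1] by simp
  qed
  then show ?thesis
    by (simp add: S_def)
qed

lemma tensor_null_eq: "tensor_null A (FM B) Res = {g \<in> carrier (TF B). tensor_eval (uncur g) = 0}"
proof (intro equalityI subsetI)
  let ?Z = "{g \<in> carrier (TF B). tensor_eval (uncur g) = 0}"
  interpret F: abelian_group "TF B"
    unfolding TF_eq by (rule abelian_group_FM)
  have "submodule ?Z A (TF B)"
  proof (intro submodule.intro subgroup.intro submodule_axioms.intro)
    show "?Z \<subseteq> carrier (add_monoid (TF B))"
      by auto
    show "x \<otimes>\<^bsub>add_monoid (TF B)\<^esub> y \<in> ?Z" if "x \<in> ?Z" "y \<in> ?Z" for x y
      using that by (auto simp: TF_eq FM_carrier_iff add_FM lin_add [OF lin_tensor_eval] intro: vs.subspace_add [OF subspace_supp_in])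
    show "\<one>\<^bsub>add_monoid (TF B)\<^esub> \<in> ?Z"
      by (auto simp: TF_eq FM_carrier_iff zero_FM lin_0 [OF lin_tensor_eval] intro: vs.subspace_0 [OF subspace_supp_in])
    show "inv\<^bsub>add_monoid (TF B)\<^esub> x \<in> ?Z" if x: "x \<in> ?Z" for x
    proof -
      obtain p where p: "p \<in> tensor_vec B" "x = cur p" "tensor_eval p = 0"
        using x by (auto simp: TF_eq FM_carrier_iff)
      have "inv\<^bsub>add_monoid (TF B)\<^esub> x = cur (- p)"
        unfolding a_inv_def [symmetric] p(2) TF_eq by (rule a_inv_FM [OF p(1)])
      then show ?thesis
        using p by (auto simp: TF_eq FM_carrier_iff lin_minus [OF lin_tensor_eval] intro: vs.subspace_neg [OF subspace_supp_in])
    qed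
    show "a \<odot>\<^bsub>TF B\<^esub> x \<in> ?Z" if "a \<in> carrier A" "x \<in> ?Z" for a x
      using that by (auto simp: TF_eq FM_carrier_iff A_carrier_iff smult_FM tensor_eval_act intro: act_supp)
  qed
  moreover have "tensor_relations A (FM B) Res \<subseteq> ?Z"
  proof -
    note in_vec = vs.subspace_add [OF subspace_supp_in] vs.subspace_diff [OF subspace_supp_in] pt_supp act_supp
    have Z: "cur p \<in> ?Z" if "p \<in> tensor_vec B \<and> tensor_eval p = 0" for p
      using that by (auto simp: TF_eq FM_carrier_iff)
    show ?thesis
      unfolding tensor_relations_eq
      by (rule image_subsetI, rule Z)
        (auto simp: lin_diff [OF lin_tensor_eval] lin_add [OF lin_tensor_eval] tensor_eval_pt tensor_eval_act [where B = B] pt_supp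
          lin_add [OF lin_const_part] const_part_act vs.scale_right_distrib vs.scale_left_distrib mult.commute intro!: in_vec)
  qed
  ultimately show "g \<in> ?Z" if "g \<in> tensor_null A (FM B) Res" for g
    using that unfolding tensor_null_def submodule_gen_def by blast
  fix g assume g: "g \<in> ?Z"
  then obtain p where p: "p \<in> tensor_vec B" "g = cur p" "tensor_eval p = 0"
    by (auto simp: TF_eq FM_carrier_iff)
  show "g \<in> tensor_null A (FM B) Res"
    unfolding tensor_null_def submodule_gen_def
    using reduction_in_submodule [OF _ _ p(1)] p by (auto simp: lin_0 [OF lin_tensor_lift])
qed

lemma kernel_quotient_tensor: "kernel_quotient (TF B) (\<lambda>g. tensor_eval (uncur g)) (tensor_null A (FM B) Res)"
proof (rule kernel_quotient.intro)
  show "abelian_group (TF B)"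
    unfolding TF_eq by (rule abelian_group_FM)
  show "kernel_quotient_axioms (TF B) (\<lambda>g. tensor_eval (uncur g)) (tensor_null A (FM B) Res)"
    by unfold_locales (auto simp: tensor_null_eq TF_eq FM_carrier_iff add_FM lin_add [OF lin_tensor_eval])
qed

abbreviation TM :: "'b set \<Rightarrow> ('a \<Rightarrow> 'k, (('b \<Rightarrow> 'a \<Rightarrow> 'k) \<times> ('a \<Rightarrow> 'k) set \<Rightarrow> 'a \<Rightarrow> 'k) set) module" where
  "TM B \<equiv> tensor_module A (FM B) Res"

text \<open>The isomorphism from the vector space on \<open>B\<close> to the tensor product of the free module on \<open>B\<close> with the
  residue field. The following lemmas translate all operations of the tensor product along it.\<close>

definition \<tau> :: "'b set \<Rightarrow> ('b \<Rightarrow>\<^sub>0 'k) \<Rightarrow> (('b \<Rightarrow> 'a \<Rightarrow> 'k) \<times> ('a \<Rightarrow> 'k) set \<Rightarrow> 'a \<Rightarrow> 'k) set" where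
  "\<tau> B v = fibre (TF B) (\<lambda>g. tensor_eval (uncur g)) v"

lemma lift_in_TF: "v \<in> supp_in B \<Longrightarrow> cur (tensor_lift v) \<in> carrier (TF B)"
  unfolding TF_eq by (rule cur_in_FM [OF tensor_lift_supp])

lemma tensor_eval_image: "(\<lambda>g. tensor_eval (uncur g)) ` carrier (TF B) = supp_in B"
proof (intro equalityI subsetI)
  fix v assume "v \<in> (\<lambda>g. tensor_eval (uncur g)) ` carrier (TF B)"
  then obtain p where "p \<in> tensor_vec B" "v = tensor_eval p"
    by (auto simp: TF_eq FM_carrier_iff)
  then show "v \<in> supp_in B"
    using tensor_eval_supp by blast
next
  fix v :: "'b \<Rightarrow>\<^sub>0 'k" assume "v \<in> supp_in B"
  then show "v \<in> (\<lambda>g. tensor_eval (uncur g)) ` carrier (TF B)"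
    by (intro image_eqI [OF _ lift_in_TF]) (simp_all add: tensor_eval_lift)
qed

lemma carrier_TM: "carrier (TM B) = \<tau> B ` supp_in B"
proof -
  interpret Q: kernel_quotient "TF B" "\<lambda>g. tensor_eval (uncur g)" "tensor_null A (FM B) Res"
    by (rule kernel_quotient_tensor)
  show ?thesis
    using Q.carrier_quot unfolding tensor_module_def tensor_eval_image \<tau>_def [abs_def] .
qed

lemma zero_TM: "\<zero>\<^bsub>TM B\<^esub> = \<tau> B 0"
proof -
  interpret Q: kernel_quotient "TF B" "\<lambda>g. tensor_eval (uncur g)" "tensor_null A (FM B) Res"
    by (rule kernel_quotient_tensor)
  show ?thesis
    using Q.zero_quot by (simp add: tensor_module_def \<tau>_def)
qed

lemma add_TM:
  assumes "v \<in> supp_in B" "w \<in> supp_in B"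
  shows "\<tau> B v \<oplus>\<^bsub>TM B\<^esub> \<tau> B w = \<tau> B (v + w)"
proof -
  interpret Q: kernel_quotient "TF B" "\<lambda>g. tensor_eval (uncur g)" "tensor_null A (FM B) Res"
    by (rule kernel_quotient_tensor)
  show ?thesis
    using Q.add_quot [OF lift_in_TF lift_in_TF, OF assms] by (simp add: tensor_module_def \<tau>_def tensor_eval_lift)
qed

lemma smult_TM:
  assumes q: "q \<in> supp_in (carrier \<Lambda>)" and v: "v \<in> supp_in B"
  shows "lookup q \<odot>\<^bsub>TM B\<^esub> \<tau> B v = \<tau> B (scl (lookup q \<one>) v)"
proof -
  interpret Q: kernel_quotient "TF B" "\<lambda>g. tensor_eval (uncur g)" "tensor_null A (FM B) Res"
    by (rule kernel_quotient_tensor)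
  have "lookup q \<odot>\<^bsub>TF B\<^esub> g \<in> carrier (TF B) \<and>
      tensor_eval (uncur (lookup q \<odot>\<^bsub>TF B\<^esub> g)) = scl (lookup q \<one>) (tensor_eval (uncur g))" if "g \<in> carrier (TF B)" for g
    using that q by (auto simp: TF_eq FM_carrier_iff smult_FM tensor_eval_act intro: act_supp)
  then show ?thesis
    using Q.smult_quot [where \<sigma> = "scl (lookup q \<one>)", OF _ _ lift_in_TF [OF v], of "lookup q"]
    by (simp add: tensor_module_def \<tau>_def tensor_eval_lift)
qed

lemma pure_TM:
  assumes p: "p \<in> supp_in (B \<times> carrier \<Lambda>)"
  shows "pure_tensor A (FM B) Res (cur p) (\<kappa> c) = \<tau> B (scl c (const_part p))"
proof -
  interpret Q: kernel_quotient "TF B" "\<lambda>g. tensor_eval (uncur g)" "tensor_null A (FM B) Res"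
    by (rule kernel_quotient_tensor)
  have "cur (pt p c) \<in> carrier (TF B)"
    unfolding TF_eq by (rule cur_in_FM [OF pt_supp [OF p]])
  from Q.coset_eq [OF this] show ?thesis
    by (simp add: pure_tensor_def free_gen_pt \<tau>_def tensor_eval_pt)
qed

lemma \<tau>_inject:
  assumes "v \<in> supp_in B"
  shows "\<tau> B v = \<tau> B w \<longleftrightarrow> v = w"
proof -
  interpret Q: kernel_quotient "TF B" "\<lambda>g. tensor_eval (uncur g)" "tensor_null A (FM B) Res"
    by (rule kernel_quotient_tensor)
  show ?thesis
    using Q.fibre_inj [of v w] assms by (auto simp: \<tau>_def tensor_eval_image)
qed

subsection \<open>Homomorphisms of free modules\<close>

definition lin_of :: "(('b \<Rightarrow> 'a \<Rightarrow> 'k) \<Rightarrow> ('c \<Rightarrow> 'a \<Rightarrow> 'k)) \<Rightarrow> ('b \<times> 'a \<Rightarrow>\<^sub>0 'k) \<Rightarrow> ('c \<times> 'a \<Rightarrow>\<^sub>0 'k)" where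
  "lin_of h = lext (\<lambda>z. uncur (h (cur (bvec z))))"

lemma lin_lin_of: "lin (lin_of h)"
  unfolding lin_of_def by (rule lin_lext)

lemma module_hom_cur:
  assumes h: "h \<in> module_hom A (FM B) (FM B')" and p: "p \<in> supp_in (B \<times> carrier \<Lambda>)"
  shows "h (cur p) = cur (lin_of h p)" and "lin_of h p \<in> supp_in (B' \<times> carrier \<Lambda>)"
proof -
  have cl: "h x \<in> carrier (FM B')" if "x \<in> carrier (FM B)" for x
    using h that by (auto simp: module_hom_def)
  have ad: "h (cur (p + q)) = h (cur p) \<oplus>\<^bsub>FM B'\<^esub> h (cur q)"
    if "p \<in> supp_in (B \<times> carrier \<Lambda>)" "q \<in> supp_in (B \<times> carrier \<Lambda>)" for p q
    using h that by (simp add: module_hom_def add_FM [where X = B, symmetric] cur_in_FM)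
  have sm: "h (cur (act s p)) = lookup s \<odot>\<^bsub>FM B'\<^esub> h (cur p)"
    if "s \<in> supp_in (carrier \<Lambda>)" "p \<in> supp_in (B \<times> carrier \<Lambda>)" for s p
    using h that by (simp add: module_hom_def smult_FM [where X = B, symmetric] cur_in_FM lookup_in_A)
  have bas: "h (cur (bvec z)) = cur (lin_of h (bvec z)) \<and> lin_of h (bvec z) \<in> supp_in (B' \<times> carrier \<Lambda>)"
    if z: "z \<in> B \<times> carrier \<Lambda>" for z
  proof -
    have "h (cur (bvec z)) \<in> carrier (FM B')"
      using z by (intro cl cur_in_FM) simp
    then show ?thesis
      by (auto simp: FM_carrier_iff lin_of_def)
  qed
  have "h (cur p) = cur (lin_of h p) \<and> lin_of h p \<in> supp_in (B' \<times> carrier \<Lambda>)"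
    using p
  proof (induction rule: poly_mapping_add_induct)
    case zero
    have z: "h (cur (0 :: 'b \<times> 'a \<Rightarrow>\<^sub>0 'k)) \<in> carrier (FM B')"
      by (intro cl cur_in_FM vs.subspace_0 [OF subspace_supp_in])
    then obtain q where q: "h (cur (0 :: 'b \<times> 'a \<Rightarrow>\<^sub>0 'k)) = cur q"
      by (auto simp: FM_carrier_iff)
    have "h (cur (act 0 (0 :: 'b \<times> 'a \<Rightarrow>\<^sub>0 'k))) = lookup 0 \<odot>\<^bsub>FM B'\<^esub> cur q"
      unfolding q [symmetric] by (rule sm) (simp_all add: vs.subspace_0 [OF subspace_supp_in])
    then have "h (cur (0 :: 'b \<times> 'a \<Rightarrow>\<^sub>0 'k)) = cur 0"
      unfolding smult_FM lin_0 [OF lin_act_left] .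
    then show ?case
      by (simp add: lin_0 [OF lin_lin_of] vs.subspace_0 [OF subspace_supp_in])
  next
    case (add p z k)
    have bz: "bvec z \<in> supp_in (B \<times> carrier \<Lambda>)"
      using add by simp
    have s: "(Poly_Mapping.single z k :: 'b \<times> 'a \<Rightarrow>\<^sub>0 'k) = act (Poly_Mapping.single \<one> k) (bvec z)"
      by (simp add: act_single_one [OF bz] scl_bvec)
    have one: "Poly_Mapping.single \<one> k \<in> supp_in (carrier \<Lambda>)"
      by (simp add: supp_in_def)
    have B: "lin_of h (bvec z) \<in> supp_in (B' \<times> carrier \<Lambda>)"
      using bas add by blast
    have "h (cur (Poly_Mapping.single z k)) = cur (scl k (lin_of h (bvec z)))"
      unfolding s using sm [OF one bz] bas [of z] add by (simp add: smult_FM act_single_one [OF B])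
    moreover have "lin_of h (Poly_Mapping.single z k) = scl k (lin_of h (bvec z))"
      by (rule lin_single [OF lin_lin_of])
    moreover have "Poly_Mapping.single z k \<in> supp_in (B \<times> carrier \<Lambda>)"
      using add by (simp add: supp_in_def)
    ultimately show ?case
      using ad [OF add.hyps(1), of "Poly_Mapping.single z k"] add B
      by (simp add: add_FM lin_add [OF lin_lin_of] vs.subspace_add [OF subspace_supp_in] vs.subspace_scale [OF subspace_supp_in])
  qed
  then show "h (cur p) = cur (lin_of h p)" "lin_of h p \<in> supp_in (B' \<times> carrier \<Lambda>)"
    by auto
qed

lemma lin_of_act:
  assumes h: "h \<in> module_hom A (FM B) (FM B')" and p: "p \<in> supp_in (B \<times> carrier \<Lambda>)" and q: "q \<in> supp_in (carrier \<Lambda>)"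
  shows "lin_of h (act q p) = act q (lin_of h p)"
proof -
  have "h (cur (act q p)) = lookup q \<odot>\<^bsub>FM B'\<^esub> h (cur p)"
    using h p q by (simp add: module_hom_def smult_FM [where X = B, symmetric] cur_in_FM lookup_in_A)
  then have "cur (lin_of h (act q p)) = cur (act q (lin_of h p))"
    unfolding module_hom_cur [OF h p] module_hom_cur [OF h act_supp [OF q p]] smult_FM .
  then show ?thesis
    by simp
qed

definition residual :: "(('b \<Rightarrow> 'a \<Rightarrow> 'k) \<Rightarrow> ('c \<Rightarrow> 'a \<Rightarrow> 'k)) \<Rightarrow> ('b \<Rightarrow>\<^sub>0 'k) \<Rightarrow> ('c \<Rightarrow>\<^sub>0 'k)" where
  "residual h = lext (\<lambda>b. const_part (lin_of h (bvec (b, \<one>))))"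

lemma lin_residual: "lin (residual h)"
  unfolding residual_def by (rule lin_lext)

lemma lin_of_generator:
  assumes h: "h \<in> module_hom A (FM B) (FM B')" and "b \<in> B" "a \<in> carrier \<Lambda>"
  shows "lin_of h (bvec (b, a)) = shift a (lin_of h (bvec (b, \<one>)))"
  using lin_of_act [OF h, of "bvec (b, \<one>)" "bvec a"] assms by simp

lemma const_part_lin_of:
  assumes h: "h \<in> module_hom A (FM B) (FM B')" and p: "p \<in> supp_in (B \<times> carrier \<Lambda>)"
  shows "const_part (lin_of h p) = residual h (const_part p)"
proof (rule lin_eq_supp_in [OF lin_compose [OF lin_const_part lin_lin_of] lin_compose [OF lin_residual lin_const_part] p])
  fix z assume "z \<in> B \<times> carrier \<Lambda>"
  then obtain b a where z: "z = (b, a)" "b \<in> B" "a \<in> carrier \<Lambda>"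
    by auto
  have "lin_of h (bvec (b, \<one>)) \<in> supp_in (B' \<times> carrier \<Lambda>)"
    by (rule module_hom_cur(2) [OF h]) (simp add: z)
  from const_part_shift [OF z(3) this] show "const_part (lin_of h (bvec z)) = residual h (const_part (bvec z))"
    unfolding z(1) lin_of_generator [OF h z(2,3)] by (simp add: residual_def lin_0 [OF lin_lext])
qed

lemma residual_supp:
  assumes h: "h \<in> module_hom A (FM B) (FM B')" and v: "v \<in> supp_in B"
  shows "residual h v \<in> supp_in B'"
proof (rule lin_supp_in [OF lin_residual v])
  fix b assume b: "b \<in> B"
  have "lin_of h (bvec (b, \<one>)) \<in> supp_in (B' \<times> carrier \<Lambda>)"
    by (rule module_hom_cur(2) [OF h]) (simp add: b)
  then have "const_part (lin_of h (bvec (b, \<one>))) \<in> supp_in B'"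
    by (rule const_part_supp)
  then show "residual h (bvec b) \<in> supp_in B'"
    by (simp add: residual_def)
qed

text \<open>The induced map is defined by a choice. One map with the required property is given by the reduction of
  \<open>h\<close>, hence the chosen map has the property as well; and the property determines the map, since pure
  tensors generate.\<close>

lemma tensor_map_\<tau>:
  assumes h: "h \<in> module_hom A (FM B) (FM B')" and v: "v \<in> supp_in B"
  shows "tensor_map A (FM B) (FM B') Res h (\<tau> B v) = \<tau> B' (residual h v)"
proof -
  let ?Q = "\<lambda>g. g \<in> module_hom A (TM B) (TM B') \<and> (\<forall>x \<in> carrier (FM B). \<forall>y \<in> carrier Res.
    g (pure_tensor A (FM B) Res x y) = pure_tensor A (FM B') Res (h x) y)"
  define g where "g X = \<tau> B' (residual h (SOME v. v \<in> supp_in B \<and> X = \<tau> B v))" for X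
  have g\<tau>: "g (\<tau> B v) = \<tau> B' (residual h v)" if v: "v \<in> supp_in B" for v
  proof -
    have "(SOME w. w \<in> supp_in B \<and> \<tau> B v = \<tau> B w) = v"
      using v by (auto simp: \<tau>_inject)
    then show ?thesis
      by (simp add: g_def)
  qed
  have "?Q g"
  proof (intro conjI ballI)
    show "g \<in> module_hom A (TM B) (TM B')"
      unfolding module_hom_def
      by (auto simp: carrier_TM A_carrier_iff g\<tau> add_TM smult_TM residual_supp [OF h] lin_add [OF lin_residual]
          lin_scl [OF lin_residual] vs.subspace_add [OF subspace_supp_in] vs.subspace_scale [OF subspace_supp_in])
    fix x y assume "x \<in> carrier (FM B)" "y \<in> carrier Res"
    then obtain p c where x: "x = cur p" "p \<in> supp_in (B \<times> carrier \<Lambda>)" "y = \<kappa> c"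
      by (auto simp: FM_carrier_iff carrier_Res)
    have "const_part p \<in> supp_in B"
      by (rule const_part_supp [OF x(2)])
    then show "g (pure_tensor A (FM B) Res x y) = pure_tensor A (FM B') Res (h x) y"
      using x by (simp add: pure_TM g\<tau> module_hom_cur [OF h] vs.subspace_scale [OF subspace_supp_in]
          const_part_lin_of [OF h] lin_scl [OF lin_residual])
  qed
  then have Q: "?Q (tensor_map A (FM B) (FM B') Res h)"
    unfolding tensor_map_def by (rule someI [of ?Q])
  define t where "t = tensor_map A (FM B) (FM B') Res h"
  have pure: "t (\<tau> B (Poly_Mapping.single b c)) = \<tau> B' (residual h (Poly_Mapping.single b c))" if b: "b \<in> B" for b c
  proof -
    have p: "bvec (b, \<one>) \<in> supp_in (B \<times> carrier \<Lambda>)"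
      using b by simp
    have "\<tau> B (Poly_Mapping.single b c) = pure_tensor A (FM B) Res (cur (bvec (b, \<one>))) (\<kappa> c)"
      using pure_TM [OF p] by (simp add: scl_bvec)
    then have "t (\<tau> B (Poly_Mapping.single b c)) = pure_tensor A (FM B') Res (h (cur (bvec (b, \<one>)))) (\<kappa> c)"
      using Q cur_in_FM [OF p] by (simp add: t_def carrier_Res)
    also have "\<dots> = \<tau> B' (scl c (const_part (lin_of h (bvec (b, \<one>)))))"
      unfolding module_hom_cur(1) [OF h p] by (rule pure_TM [OF module_hom_cur(2) [OF h p]])
    also have "\<dots> = \<tau> B' (residual h (Poly_Mapping.single b c))"
      by (simp add: residual_def lext_single)
    finally show ?thesis .
  qed
  have "t (\<tau> B v) = \<tau> B' (residual h v)"
    using v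
  proof (induction rule: poly_mapping_add_induct)
    case zero
    have p: "(0 :: 'b \<times> 'a \<Rightarrow>\<^sub>0 'k) \<in> supp_in (B \<times> carrier \<Lambda>)"
      by (rule vs.subspace_0 [OF subspace_supp_in])
    have "\<tau> B 0 = pure_tensor A (FM B) Res (cur 0) (\<kappa> 0)"
      using pure_TM [OF p, of 0] by simp
    then have "t (\<tau> B 0) = pure_tensor A (FM B') Res (h (cur 0)) (\<kappa> 0)"
      using Q cur_in_FM [OF p] by (simp add: t_def carrier_Res)
    also have "\<dots> = \<tau> B' 0"
      unfolding module_hom_cur(1) [OF h p] using pure_TM [OF module_hom_cur(2) [OF h p], of 0] by simp
    finally show ?case
      by (simp add: lin_0 [OF lin_residual])
  next
    case (add p b c)
    have s: "Poly_Mapping.single b c \<in> supp_in B"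
      using add by (simp add: supp_in_def)
    have "t (\<tau> B p \<oplus>\<^bsub>TM B\<^esub> \<tau> B (Poly_Mapping.single b c)) = t (\<tau> B p) \<oplus>\<^bsub>TM B'\<^esub> t (\<tau> B (Poly_Mapping.single b c))"
      using Q add s unfolding t_def module_hom_def by (simp add: carrier_TM)
    then show ?case
      using add s pure residual_supp [OF h] by (simp add: add_TM lin_add [OF lin_residual])
  qed
  then show ?thesis
    by (simp add: t_def)
qed

end


section \<open>The strands of a graded free resolution\<close>

text \<open>Forgetting the monomials.\<close>

definition dehom :: "('x \<times> 'a \<Rightarrow>\<^sub>0 'k::field) \<Rightarrow> ('x \<Rightarrow>\<^sub>0 'k)" where
  "dehom = lext (\<lambda>(x, a). bvec x)"

lemma lin_dehom: "lin dehom"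
  unfolding dehom_def by (rule lin_lext)

lemma dehom_bvec [simp]: "dehom (bvec (x, a)) = bvec x"
  by (simp add: dehom_def)

locale graded_bases = reduced_monoid_algebra \<Lambda> K
  for \<Lambda> :: "'a monoid" (structure) and K :: "'k::field itself" +
  fixes B :: "nat \<Rightarrow> 'b set" and dg :: "nat \<Rightarrow> 'b \<Rightarrow> 'a"
  assumes dg_closed: "b \<in> B n \<Longrightarrow> dg n b \<in> carrier \<Lambda>"
begin

abbreviation P :: "nat \<Rightarrow> ('b \<times> 'a \<Rightarrow>\<^sub>0 'k) set" where
  "P n \<equiv> supp_in (B n \<times> carrier \<Lambda>)"

definition homog :: "nat \<Rightarrow> 'a \<Rightarrow> ('b \<times> 'a) set" where
  "homog n l = {(b, a). b \<in> B n \<and> a \<in> carrier \<Lambda> \<and> dg n b \<otimes> a = l}"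

lemma homog_P: "p \<in> supp_in (homog n l) \<Longrightarrow> p \<in> P n"
  by (erule supp_in_mono) (auto simp: homog_def)

lemma free_component_eq: "free_component \<Lambda> (B n) (dg n) l = (cur ` supp_in (homog n l) :: ('b \<Rightarrow> 'a \<Rightarrow> 'k) set)"
proof (intro equalityI subsetI)
  fix f :: "'b \<Rightarrow> 'a \<Rightarrow> 'k" assume "f \<in> free_component \<Lambda> (B n) (dg n) l"
  then obtain p where p: "p \<in> P n" "f = cur p" "\<And>b m. lookup p (b, m) \<noteq> 0 \<Longrightarrow> dg n b \<otimes> m = l"
    by (auto simp: free_component_def FM_carrier_iff cur_def)
  then have "p \<in> supp_in (homog n l)"
    by (auto simp: supp_in_def homog_def in_keys_iff subset_iff)
  with p show "f \<in> cur ` supp_in (homog n l)"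
    by blast
next
  fix f :: "'b \<Rightarrow> 'a \<Rightarrow> 'k" assume "f \<in> cur ` supp_in (homog n l)"
  then obtain p where p: "p \<in> supp_in (homog n l)" "f = cur p"
    by blast
  have "dg n b \<otimes> m = l" if "lookup p (b, m) \<noteq> 0" for b m
    using p(1) that by (auto simp: supp_in_def homog_def in_keys_iff subset_iff)
  then show "f \<in> free_component \<Lambda> (B n) (dg n) l"
    using cur_in_FM [OF homog_P [OF p(1)]] by (auto simp: free_component_def p(2) cur_def)
qed

text \<open>A graded map commutes with taking homogeneous components.\<close>

lemma homog_map_restr:
  assumes f: "lin f" "\<And>z l. z \<in> homog m l \<Longrightarrow> l \<in> carrier \<Lambda> \<Longrightarrow> f (bvec z) \<in> supp_in (homog n l)"
    and p: "p \<in> P m" and l: "l \<in> carrier \<Lambda>"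
  shows "f (restr (homog m l) p) = restr (homog n l) (f p)"
proof (rule lin_eq_supp_in [OF lin_compose [OF f(1) lin_restr] lin_compose [OF lin_restr f(1)] p])
  fix z assume "z \<in> B m \<times> carrier \<Lambda>"
  then obtain b a where z: "z = (b, a)" "b \<in> B m" "a \<in> carrier \<Lambda>"
    by auto
  define l' where "l' = dg m b \<otimes> a"
  have zl': "z \<in> homog m l'" and l': "l' \<in> carrier \<Lambda>"
    using z dg_closed by (auto simp: homog_def l'_def)
  then have dz: "f (bvec z) \<in> supp_in (homog n l')"
    by (intro f(2))
  show "f (restr (homog m l) (bvec z)) = restr (homog n l) (f (bvec z))"
  proof (cases "l' = l")
    case True
    then show ?thesis
      using zl' dz by (simp add: restr_id)
  next
    case False
    then have disj: "homog m l \<inter> homog m l' = {}" "homog n l \<inter> homog n l' = {}"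
      by (auto simp: homog_def)
    have "restr (homog m l) (bvec z) = (0 :: 'b \<times> 'a \<Rightarrow>\<^sub>0 'k)"
      by (rule restr_eq_0 [OF _ disj(1)]) (simp add: zl')
    then show ?thesis
      using restr_eq_0 [OF dz disj(2)] by (simp add: lin_0 [OF f(1)])
  qed
qed

lemma dehom_shift: "dehom (shift a p) = dehom p"
  by (rule lin_eqI [OF lin_compose [OF lin_dehom lin_shift] lin_dehom]) auto

abbreviation str :: "nat \<Rightarrow> 'a \<Rightarrow> ('b \<Rightarrow>\<^sub>0 'k) set" where
  "str n l \<equiv> supp_in (below \<Lambda> B dg n l)"

text \<open>The inverse of \<^const>\<open>dehom\<close> on homogeneous elements of degree \<open>l\<close>: by cancellation there is only one
  monomial that completes the degree of \<open>b\<close> to \<open>l\<close>.\<close>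

definition homogenise :: "nat \<Rightarrow> 'a \<Rightarrow> ('b \<Rightarrow>\<^sub>0 'k) \<Rightarrow> ('b \<times> 'a \<Rightarrow>\<^sub>0 'k)" where
  "homogenise n l = lext (\<lambda>b. bvec (b, SOME c. c \<in> carrier \<Lambda> \<and> dg n b \<otimes> c = l))"

lemma lin_homogenise: "lin (homogenise n l)"
  unfolding homogenise_def by (rule lin_lext)

lemma dehom_homogenise: "dehom (homogenise n l v) = v"
  by (rule lin_eqI [OF lin_compose [OF lin_dehom lin_homogenise] lin_id]) (simp add: homogenise_def)

lemma homogenise_homog: "v \<in> str n l \<Longrightarrow> homogenise n l v \<in> supp_in (homog n l)"
proof (erule lin_supp_in [OF lin_homogenise])
  fix b assume b: "b \<in> below \<Lambda> B dg n l"
  then have "\<exists>c. c \<in> carrier \<Lambda> \<and> dg n b \<otimes> c = l"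
    by (auto simp: below_def factor_def)
  from someI_ex [OF this] show "homogenise n l (bvec b) \<in> supp_in (homog n l)"
    using b by (simp add: homogenise_def homog_def below_def)
qed

lemma dehom_str: "p \<in> supp_in (homog n l) \<Longrightarrow> dehom p \<in> str n l"
  by (erule lin_supp_in [OF lin_dehom]) (auto simp: homog_def below_def factor_def)

lemma homogenise_dehom: "p \<in> supp_in (homog n l) \<Longrightarrow> homogenise n l (dehom p) = p"
proof (erule lin_eq_supp_in [OF lin_compose [OF lin_homogenise lin_dehom] lin_id])
  fix z assume "z \<in> homog n l"
  then obtain b a where z: "z = (b, a)" "b \<in> B n" "a \<in> carrier \<Lambda>" "dg n b \<otimes> a = l"
    by (auto simp: homog_def)
  have "(SOME c. c \<in> carrier \<Lambda> \<and> dg n b \<otimes> c = l) = a"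
  proof (rule some_equality)
    show "c = a" if "c \<in> carrier \<Lambda> \<and> dg n b \<otimes> c = l" for c
      using that z dg_closed [OF z(2)] l_cancel [of "dg n b" c a] by simp
  qed (use z in simp)
  then show "homogenise n l (dehom (bvec z)) = bvec z"
    by (simp add: z(1) homogenise_def)
qed

text \<open>A term of a homogeneous element of degree \<open>l\<close> has a constant coefficient if and only if its basis element
  has degree \<open>l\<close>.\<close>

lemma const_part_homog:
  "p \<in> supp_in (homog n l) \<Longrightarrow> const_part p = restr (at_deg B dg n l) (dehom p)"
proof (erule lin_eq_supp_in [OF lin_const_part lin_compose [OF lin_restr lin_dehom]])
  fix z assume "z \<in> homog n l"
  then obtain b a where z: "z = (b, a)" "b \<in> B n" "a \<in> carrier \<Lambda>" "dg n b \<otimes> a = l"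
    by (auto simp: homog_def)
  have "a = \<one> \<longleftrightarrow> dg n b = l"
    using z(3,4) dg_closed [OF z(2)] l_cancel [of "dg n b" a \<one>] by auto
  then show "const_part (bvec z) = restr (at_deg B dg n l) (dehom (bvec z))"
    using z by (simp add: restr_def at_deg_def)
qed

lemma dehom_one: "p \<in> supp_in (homog n \<one>) \<Longrightarrow> const_part p = dehom p"
proof -
  assume p: "p \<in> supp_in (homog n \<one>)"
  have "below \<Lambda> B dg n \<one> \<subseteq> at_deg B dg n \<one>"
    using divides_one dg_closed by (auto simp: below_def at_deg_def)
  then show ?thesis
    using const_part_homog [OF p] dehom_str [OF p] by (simp add: restr_id supp_in_mono)
qed

end

locale record_resolution = reduced_monoid_algebra \<Lambda> K
  for \<Lambda> :: "'a monoid" (structure) and K :: "'k::field itself" +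
  fixes F :: "('a, 'b, 'k, ('a \<Rightarrow> 'k) set) resolution"
  assumes resolution: "graded_free_resolution \<Lambda> (residue_module \<Lambda>) (residue_component \<Lambda>) F"
begin

abbreviation "B \<equiv> res_basis F"
abbreviation "dg \<equiv> res_deg F"

lemma res_module_eq: "res_module \<Lambda> F n = FM (B n)"
  by (simp add: res_module_def)

lemmas resolution_conds = resolution [unfolded graded_free_resolution_def res_module_eq]

sublocale graded_bases \<Lambda> K B dg
  by unfold_locales (rule funcset_mem [OF resolution_conds [THEN conjunct1, THEN spec]])

lemma res_diff_hom: "res_diff F n \<in> module_hom A (FM (B (Suc n))) (FM (B n))"
  by (rule resolution_conds [THEN conjunct2, THEN conjunct1, THEN spec])

lemma res_aug_hom: "res_aug F \<in> module_hom A (FM (B 0)) Res"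
  by (rule resolution_conds [THEN conjunct2, THEN conjunct2, THEN conjunct1])

lemma res_diff_component:
  "l \<in> carrier \<Lambda> \<Longrightarrow> res_diff F n ` res_component \<Lambda> F (Suc n) l \<subseteq> res_component \<Lambda> F n l"
  by (rule resolution_conds [THEN conjunct2, THEN conjunct2, THEN conjunct2, THEN conjunct1, THEN spec, THEN bspec])

lemma res_aug_component:
  "l \<in> carrier \<Lambda> \<Longrightarrow> res_aug F ` res_component \<Lambda> F 0 l \<subseteq> residue_component \<Lambda> l"
  by (rule resolution_conds [THEN conjunct2, THEN conjunct2, THEN conjunct2, THEN conjunct2, THEN conjunct1, THEN bspec])

lemma res_aug_onto: "res_aug F ` carrier (FM (B 0)) = carrier Res"
  by (rule resolution_conds [THEN conjunct2, THEN conjunct2, THEN conjunct2, THEN conjunct2, THEN conjunct2, THEN conjunct1])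

lemma res_aug_kernel: "a_kernel (FM (B 0)) Res (res_aug F) = res_diff F 0 ` carrier (FM (B (Suc 0)))"
  by (rule resolution_conds [THEN conjunct2, THEN conjunct2, THEN conjunct2, THEN conjunct2, THEN conjunct2, THEN conjunct2, THEN conjunct1])

lemma res_diff_kernel:
  "a_kernel (FM (B (Suc n))) (FM (B n)) (res_diff F n) = res_diff F (Suc n) ` carrier (FM (B (Suc (Suc n))))"
  by (rule resolution_conds [THEN conjunct2, THEN conjunct2, THEN conjunct2, THEN conjunct2, THEN conjunct2, THEN conjunct2, THEN conjunct2, THEN spec])

definition \<delta> :: "nat \<Rightarrow> ('b \<times> 'a \<Rightarrow>\<^sub>0 'k) \<Rightarrow> ('b \<times> 'a \<Rightarrow>\<^sub>0 'k)" where
  "\<delta> n = lin_of (res_diff F n)"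

lemma lin_\<delta>: "lin (\<delta> n)"
  unfolding \<delta>_def by (rule lin_lin_of)

lemma res_diff_cur: "p \<in> P (Suc n) \<Longrightarrow> res_diff F n (cur p) = cur (\<delta> n p)"
  unfolding \<delta>_def by (rule module_hom_cur(1) [OF res_diff_hom])

lemma res_component_eq: "res_component \<Lambda> F n l = cur ` supp_in (homog n l)"
  by (simp add: res_component_def free_component_eq)

lemma \<delta>_homog: "p \<in> supp_in (homog (Suc n) l) \<Longrightarrow> l \<in> carrier \<Lambda> \<Longrightarrow> \<delta> n p \<in> supp_in (homog n l)"
proof -
  assume p: "p \<in> supp_in (homog (Suc n) l)" and l: "l \<in> carrier \<Lambda>"
  have "res_diff F n (cur p) \<in> cur ` supp_in (homog n l)"
    using p res_diff_component [OF l, of n] by (auto simp: res_component_eq)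
  then show ?thesis
    by (auto simp: res_diff_cur [OF homog_P [OF p]])
qed

lemma \<delta>_restr:
  "p \<in> P (Suc n) \<Longrightarrow> l \<in> carrier \<Lambda> \<Longrightarrow> \<delta> n (restr (homog (Suc n) l) p) = restr (homog n l) (\<delta> n p)"
  by (rule homog_map_restr [OF lin_\<delta>]) (auto intro: \<delta>_homog)

definition hom_d :: "nat \<Rightarrow> ('b \<Rightarrow>\<^sub>0 'k) \<Rightarrow> ('b \<Rightarrow>\<^sub>0 'k)" where
  "hom_d n = lext (\<lambda>b. dehom (\<delta> n (bvec (b, \<one>))))"

lemma lin_hom_d: "lin (hom_d n)"
  unfolding hom_d_def by (rule lin_lext)

lemma dehom_\<delta>: "p \<in> P (Suc n) \<Longrightarrow> dehom (\<delta> n p) = hom_d n (dehom p)"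
proof (erule lin_eq_supp_in [OF lin_compose [OF lin_dehom lin_\<delta>] lin_compose [OF lin_hom_d lin_dehom]])
  fix z assume "z \<in> B (Suc n) \<times> carrier \<Lambda>"
  then obtain b a where z: "z = (b, a)" "b \<in> B (Suc n)" "a \<in> carrier \<Lambda>"
    by auto
  show "dehom (\<delta> n (bvec z)) = hom_d n (dehom (bvec z))"
    unfolding z(1) \<delta>_def lin_of_generator [OF res_diff_hom z(2,3)] by (simp add: dehom_shift hom_d_def \<delta>_def)
qed

text \<open>The differential of the tensor product with the residue field is the differential of the residual
  complex of the strands.\<close>

lemma residual_eq:
  "v \<in> supp_in (at_deg B dg (Suc n) l) \<Longrightarrow> residual (res_diff F n) v = restr (at_deg B dg n l) (hom_d n v)"
proof (erule lin_eq_supp_in [OF lin_residual lin_compose [OF lin_restr lin_hom_d]])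
  fix b assume b: "b \<in> at_deg B dg (Suc n) l"
  then have "(b, \<one>) \<in> homog (Suc n) l" "l \<in> carrier \<Lambda>"
    using dg_closed by (auto simp: at_deg_def homog_def)
  then have "\<delta> n (bvec (b, \<one>)) \<in> supp_in (homog n l)"
    by (intro \<delta>_homog) auto
  from const_part_homog [OF this] show "residual (res_diff F n) (bvec b) = restr (at_deg B dg n l) (hom_d n (bvec b))"
    by (simp add: residual_def hom_d_def \<delta>_def)
qed

text \<open>The scalar is wrapped into a one-dimensional space of vectors to make the extension by linearity
  available.\<close>

definition \<eta> :: "('b \<Rightarrow>\<^sub>0 'k) \<Rightarrow> 'k" where
  "\<eta> v = lookup (lext (\<lambda>b. Poly_Mapping.single () (ev (res_aug F (cur (bvec (b, \<one>)))))) v) ()"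

lemma aug_add: "\<eta> (u + v) = \<eta> u + \<eta> v" and aug_scl: "\<eta> (scl c v) = c * \<eta> v"
  by (simp_all add: \<eta>_def lin_add [OF lin_lext] lin_scl [OF lin_lext] lookup_add)

lemma res_aug_cur: "p \<in> P 0 \<Longrightarrow> res_aug F (cur p) = \<kappa> (\<eta> (const_part p))"
proof (induction rule: poly_mapping_add_induct)
  case zero
  have 0: "(0 :: 'b \<times> 'a \<Rightarrow>\<^sub>0 'k) \<in> P 0" "(0 :: 'a \<Rightarrow>\<^sub>0 'k) \<in> supp_in (carrier \<Lambda>)"
    by (rule vs.subspace_0 [OF subspace_supp_in])+
  then have "res_aug F (lookup 0 \<odot>\<^bsub>FM (B 0)\<^esub> cur 0) = lookup 0 \<odot>\<^bsub>Res\<^esub> res_aug F (cur 0)"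
    using res_aug_hom cur_in_FM [OF 0(1)] lookup_in_A [OF 0(2)] by (simp add: module_hom_def)
  moreover have "res_aug F (cur 0) \<in> carrier Res"
    using res_aug_hom cur_in_FM [OF 0(1)] by (auto simp: module_hom_def)
  ultimately have "res_aug F (cur 0) = \<kappa> 0"
    using smult_Res [OF 0(2)] by (auto simp: smult_FM lin_0 [OF lin_act_right] carrier_Res)
  then show ?case
    by (simp add: lin_0 [OF lin_const_part] \<eta>_def lin_0 [OF lin_lext])
next
  case (add p z k)
  obtain b a where z: "z = (b, a)" "b \<in> B 0" "a \<in> carrier \<Lambda>"
    using add by auto
  define g :: "'b \<times> 'a \<Rightarrow>\<^sub>0 'k" where "g = bvec (b, \<one>)"
  define q :: "'a \<Rightarrow>\<^sub>0 'k" where "q = Poly_Mapping.single a k"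
  have g: "g \<in> P 0" and q: "q \<in> supp_in (carrier \<Lambda>)"
    using z by (auto simp: g_def q_def supp_in_def)
  have s: "Poly_Mapping.single z k = act q g"
    unfolding q_def using z by (subst lin_single [OF lin_act_left]) (simp add: g_def z scl_bvec)
  have "res_aug F (cur g) \<in> carrier Res"
    using res_aug_hom cur_in_FM [OF g] by (auto simp: module_hom_def)
  then obtain c where c: "res_aug F (cur g) = \<kappa> c"
    by (auto simp: carrier_Res)
  have "res_aug F (cur (act q g)) = lookup q \<odot>\<^bsub>Res\<^esub> \<kappa> c"
    using res_aug_hom cur_in_FM [OF g] lookup_in_A [OF q]
    by (simp add: module_hom_def smult_FM [where X = "B 0", symmetric] flip: c)
  also have "\<dots> = \<kappa> (\<eta> (const_part (act q g)))"
    using c by (simp add: smult_Res [OF q] const_part_act [OF q g] aug_scl)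
      (simp add: g_def \<eta>_def)
  finally have ag: "res_aug F (cur (act q g)) = \<kappa> (\<eta> (const_part (act q g)))" .
  have "res_aug F (cur (p + act q g)) = res_aug F (cur p) \<oplus>\<^bsub>Res\<^esub> res_aug F (cur (act q g))"
    using res_aug_hom cur_in_FM [OF add.hyps(1)] cur_in_FM [OF act_supp [OF q g]]
    by (simp add: module_hom_def add_FM [where X = "B 0", symmetric])
  then show ?case
    unfolding s by (simp add: ag add.IH add_Res lin_add [OF lin_const_part] aug_add)
qed

lemma aug_degree:
  assumes b: "b \<in> B 0" and dg: "dg 0 b \<noteq> \<one>"
  shows "\<eta> (bvec b) = 0"
proof -
  have z: "bvec (b, \<one>) \<in> supp_in (homog 0 (dg 0 b))"
    using b dg_closed by (simp add: homog_def)
  have "res_aug F ` res_component \<Lambda> F 0 (dg 0 b) \<subseteq> residue_component \<Lambda> (dg 0 b)"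
    by (rule res_aug_component [OF dg_closed [OF b]])
  then have "res_aug F ` cur ` supp_in (homog 0 (dg 0 b)) \<subseteq> {\<kappa> 0}"
    using dg by (simp only: res_component_eq residue_component_eq [OF dg_closed [OF b]] if_False)
  then have "res_aug F (cur (bvec (b, \<one>))) = \<kappa> 0"
    using z by blast
  then show ?thesis
    by (simp add: \<eta>_def)
qed

lemma exact_diff:
  assumes p: "p \<in> P (Suc n)"
  shows "\<delta> n p = 0 \<longleftrightarrow> (\<exists>q \<in> P (Suc (Suc n)). p = \<delta> (Suc n) q)"
proof -
  have "a_kernel (FM (B (Suc n))) (FM (B n)) (res_diff F n) = res_diff F (Suc n) ` carrier (FM (B (Suc (Suc n))))"
    by (rule res_diff_kernel)
  then have "cur p \<in> a_kernel (FM (B (Suc n))) (FM (B n)) (res_diff F n) \<longleftrightarrow>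
      (\<exists>q \<in> P (Suc (Suc n)). cur p = res_diff F (Suc n) (cur q))"
    by (auto simp: FM_carrier_iff image_iff)
  moreover have "(\<exists>q \<in> P (Suc (Suc n)). cur p = res_diff F (Suc n) (cur q)) \<longleftrightarrow> (\<exists>q \<in> P (Suc (Suc n)). p = \<delta> (Suc n) q)"
    by (intro bex_cong refl) (simp add: res_diff_cur)
  ultimately show ?thesis
    using cur_in_FM [OF p] by (simp add: a_kernel_def' res_diff_cur [OF p] zero_FM)
qed

lemma exact_aug:
  assumes p: "p \<in> P 0"
  shows "\<eta> (const_part p) = 0 \<longleftrightarrow> (\<exists>q \<in> P (Suc 0). p = \<delta> 0 q)"
proof -
  have "a_kernel (FM (B 0)) Res (res_aug F) = res_diff F 0 ` carrier (FM (B (Suc 0)))"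
    by (rule res_aug_kernel)
  then have "cur p \<in> a_kernel (FM (B 0)) Res (res_aug F) \<longleftrightarrow> (\<exists>q \<in> P (Suc 0). cur p = res_diff F 0 (cur q))"
    by (auto simp: FM_carrier_iff image_iff)
  moreover have "(\<exists>q \<in> P (Suc 0). cur p = res_diff F 0 (cur q)) \<longleftrightarrow> (\<exists>q \<in> P (Suc 0). p = \<delta> 0 q)"
    by (intro bex_cong refl) (simp add: res_diff_cur)
  ultimately show ?thesis
    using cur_in_FM [OF p] by (simp add: a_kernel_def' res_aug_cur [OF p] zero_Res)
qed

text \<open>The maps \<^const>\<open>dehom\<close> and \<^const>\<open>homogenise\<close> identify the component of degree \<open>l\<close> of the resolution
  with its strand. A homogeneous boundary is the boundary of a homogeneous element, so that exactness
  passes to components.\<close>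

sublocale strands: strand_resolution \<Lambda> B dg hom_d \<eta>
proof
  show "\<exists>v\<in>str 0 \<one>. \<eta> v = 1"
  proof -
    have "\<kappa> 1 \<in> res_aug F ` carrier (FM (B 0))"
      by (simp add: res_aug_onto carrier_Res)
    then obtain p where p: "p \<in> P 0" "res_aug F (cur p) = \<kappa> 1"
      by (auto simp: FM_carrier_iff)
    then have "\<eta> (const_part p) = 1"
      by (simp add: res_aug_cur)
    moreover have "\<eta> (const_part p) = \<eta> (const_part (restr (homog 0 \<one>) p))"
    proof -
    have "Poly_Mapping.single () (\<eta> (const_part p)) = Poly_Mapping.single () (\<eta> (const_part (restr (homog 0 \<one>) p)))"
    proof (rule lin_eq_supp_in [where X = "B 0 \<times> carrier \<Lambda>", OF _ _ p(1)])
      show "lin (\<lambda>p. Poly_Mapping.single () (\<eta> (const_part p)))"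
        by (rule linI) (simp_all add: lin_add [OF lin_const_part] lin_scl [OF lin_const_part] aug_add aug_scl
            single_add poly_mapping_eq_iff fun_eq_iff)
      show "lin (\<lambda>p. Poly_Mapping.single () (\<eta> (const_part (restr (homog 0 \<one>) p))))"
        by (rule linI) (simp_all add: lin_add [OF lin_const_part] lin_scl [OF lin_const_part]
            lin_add [OF lin_restr] lin_scl [OF lin_restr] aug_add aug_scl single_add poly_mapping_eq_iff fun_eq_iff)
      fix z assume "z \<in> B 0 \<times> carrier \<Lambda>"
      then obtain b a where z: "z = (b, a)" "b \<in> B 0" "a \<in> carrier \<Lambda>"
        by auto
      have eta0: "\<eta> 0 = 0"
        using aug_scl [of 0 0] by simp
      have "(b, a) \<in> homog 0 \<one> \<longleftrightarrow> dg 0 b = \<one> \<and> a = \<one>"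
        using z dg_closed mult_eq_one_iff by (auto simp: homog_def)
      then show "Poly_Mapping.single () (\<eta> (const_part (bvec z))) =
          Poly_Mapping.single () (\<eta> (const_part (restr (homog 0 \<one>) (bvec z))))"
        using aug_degree [OF z(2)] by (auto simp: z(1) restr_def lin_0 [OF lin_const_part] eta0)
    qed
    then show ?thesis
      by (metis lookup_single_eq)
    qed
    ultimately have "\<eta> (dehom (restr (homog 0 \<one>) p)) = 1"
      using dehom_one [of "restr (homog 0 \<one>) p" 0] by simp
    then show ?thesis
      using dehom_str [of "restr (homog 0 \<one>) p" 0 \<one>] by auto
  qed
  fix l n assume l: "l \<in> carrier \<Lambda>"
  have key: "(\<exists>q \<in> P (Suc n). p = \<delta> n q) \<longleftrightarrow> (\<exists>q \<in> supp_in (homog (Suc n) l). p = \<delta> n q)"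
    if p: "p \<in> supp_in (homog n l)" for p
  proof
    assume "\<exists>q \<in> P (Suc n). p = \<delta> n q"
    then obtain q where q: "q \<in> P (Suc n)" "p = \<delta> n q"
      by blast
    have "p = \<delta> n (restr (homog (Suc n) l) q)"
      using \<delta>_restr [OF q(1) l] restr_id [OF p] q(2) by simp
    then show "\<exists>q \<in> supp_in (homog (Suc n) l). p = \<delta> n q"
      using restr_in by blast
  qed (use homog_P in blast)
  have cycle: "w \<in> strand_cycles \<Lambda> B dg hom_d \<eta> n l \<longleftrightarrow>
      (\<exists>q \<in> P (Suc n). homogenise n l w = \<delta> n q)" if w: "w \<in> str n l" for w
  proof -
    define p where "p = homogenise n l w"
    have p: "p \<in> supp_in (homog n l)" and wp: "w = dehom p"
      using homogenise_homog [OF w] dehom_homogenise by (auto simp: p_def)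
    show ?thesis
    proof (cases n)
      case 0
      have "(l = \<one> \<longrightarrow> \<eta> w = 0) \<longleftrightarrow> \<eta> (const_part p) = 0"
      proof (cases "l = \<one>")
        case True
        then show ?thesis
          using dehom_one p by (simp add: wp)
      next
        case False
        have "res_aug F ` res_component \<Lambda> F 0 l \<subseteq> residue_component \<Lambda> l"
          by (rule res_aug_component [OF l])
        then have "res_aug F ` cur ` supp_in (homog 0 l) \<subseteq> {\<kappa> 0}"
          using False by (simp only: res_component_eq residue_component_eq [OF l] if_False)
        then have "res_aug F (cur p) = \<kappa> 0"
          using p [unfolded 0] by blast
        then show ?thesis
          using False res_aug_cur homog_P [OF p] by (simp add: 0)
      qed
      then show ?thesis
        using exact_aug homog_P [OF p] w by (simp add: strand_cycles_def 0 p_def)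
    next
      case (Suc m)
      have "hom_d m w = dehom (\<delta> m p)"
        using dehom_\<delta> homog_P [OF p] by (simp add: wp Suc)
      moreover have "dehom (\<delta> m p) = 0 \<longleftrightarrow> \<delta> m p = 0"
        using homogenise_dehom [OF \<delta>_homog [OF p [unfolded Suc] l]] lin_0 [OF lin_homogenise] lin_0 [OF lin_dehom] by metis
      ultimately show ?thesis
        using exact_diff homog_P [OF p] w by (simp add: strand_cycles_def Suc p_def)
    qed
  qed
  show "hom_d n ` str (Suc n) l = strand_cycles \<Lambda> B dg hom_d \<eta> n l"
  proof (intro equalityI subsetI)
    fix w assume "w \<in> hom_d n ` str (Suc n) l"
    then obtain v where v: "v \<in> str (Suc n) l" "w = hom_d n v"
      by blast
    define q where "q = homogenise (Suc n) l v"
    have q: "q \<in> supp_in (homog (Suc n) l)"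
      unfolding q_def by (rule homogenise_homog [OF v(1)])
    have w: "w = dehom (\<delta> n q)"
      using dehom_\<delta> [OF homog_P [OF q]] by (simp add: v(2) q_def dehom_homogenise)
    have "w \<in> str n l"
      unfolding w by (rule dehom_str [OF \<delta>_homog [OF q l]])
    moreover have "homogenise n l w = \<delta> n q"
      unfolding w by (rule homogenise_dehom [OF \<delta>_homog [OF q l]])
    ultimately show "w \<in> strand_cycles \<Lambda> B dg hom_d \<eta> n l"
      using cycle homog_P [OF q] by blast
  next
    fix w assume w: "w \<in> strand_cycles \<Lambda> B dg hom_d \<eta> n l"
    then have ws: "w \<in> str n l"
      by (simp add: strand_cycles_def)
    then obtain q where q: "q \<in> supp_in (homog (Suc n) l)" "homogenise n l w = \<delta> n q"
      using cycle w key [OF homogenise_homog [OF ws]] by blast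
    have "w = hom_d n (dehom q)"
      using dehom_homogenise [of n l w] dehom_\<delta> [OF homog_P [OF q(1)]] q(2) by simp
    then show "w \<in> hom_d n ` str (Suc n) l"
      using dehom_str [OF q(1)] by blast
  qed
qed (simp_all add: dg_closed aug_add aug_scl lin_add [OF lin_hom_d] lin_scl [OF lin_hom_d])

subsection \<open>Cycles and boundaries in the residual complex\<close>

lemma abelian_group_TM: "abelian_group (TM (X :: 'b set))"
proof (rule abelian_groupI)
  note cl = vs.subspace_add [OF subspace_supp_in] vs.subspace_neg [OF subspace_supp_in]
  fix x y z assume "x \<in> carrier (TM X)" "y \<in> carrier (TM X)" "z \<in> carrier (TM X)"
  then obtain u v w where u: "u \<in> supp_in X" and v: "v \<in> supp_in X" and w: "w \<in> supp_in X"
    and x: "x = \<tau> X u" and y: "y = \<tau> X v" and z: "z = \<tau> X w"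
    by (auto simp: carrier_TM)
  show "x \<oplus>\<^bsub>TM X\<^esub> y \<in> carrier (TM X)"
    by (simp add: x y u v add_TM carrier_TM cl)
  show "x \<oplus>\<^bsub>TM X\<^esub> y \<oplus>\<^bsub>TM X\<^esub> z = x \<oplus>\<^bsub>TM X\<^esub> (y \<oplus>\<^bsub>TM X\<^esub> z)"
    by (simp add: x y z u v w add_TM cl add.assoc)
  show "x \<oplus>\<^bsub>TM X\<^esub> y = y \<oplus>\<^bsub>TM X\<^esub> x"
    by (simp add: x y u v add_TM add.commute)
  have z0: "0 \<in> supp_in X"
    by (rule vs.subspace_0 [OF subspace_supp_in])
  show "\<zero>\<^bsub>TM X\<^esub> \<oplus>\<^bsub>TM X\<^esub> x = x"
    by (simp add: x u zero_TM add_TM z0)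
  show "\<exists>y\<in>carrier (TM X). y \<oplus>\<^bsub>TM X\<^esub> x = \<zero>\<^bsub>TM X\<^esub>"
  proof (rule bexI)
    show "\<tau> X (- u) \<oplus>\<^bsub>TM X\<^esub> x = \<zero>\<^bsub>TM X\<^esub>"
      by (simp add: x u zero_TM add_TM cl)
    show "\<tau> X (- u) \<in> carrier (TM X)"
      by (simp add: carrier_TM u cl)
  qed
next
  show "\<zero>\<^bsub>TM X\<^esub> \<in> carrier (TM X)"
    by (simp add: zero_TM carrier_TM vs.subspace_0 [OF subspace_supp_in])
qed

lemma res_tensor_eq: "res_tensor \<Lambda> F Res n = TM (B n)"
  by (simp add: res_tensor_def res_module_eq)

lemma res_tensor_diff_\<tau>:
  "v \<in> supp_in (at_deg B dg (Suc n) l) \<Longrightarrow>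
    res_tensor_diff \<Lambda> F Res n (\<tau> (B (Suc n)) v) = \<tau> (B n) (restr (at_deg B dg n l) (hom_d n v))"
  unfolding res_tensor_diff_def res_module_eq
  by (subst tensor_map_\<tau> [OF res_diff_hom])
    (auto simp: residual_eq elim!: supp_in_mono, auto simp: at_deg_def)

lemma at_deg_B: "v \<in> supp_in (at_deg B dg n l) \<Longrightarrow> v \<in> supp_in (B n)"
  by (erule supp_in_mono) (auto simp: at_deg_def)

lemma res_tensor_component_eq:
  assumes l: "l \<in> carrier \<Lambda>"
  shows "res_tensor_component \<Lambda> F Res (residue_component \<Lambda>) n l = \<tau> (B n) ` supp_in (at_deg B dg n l)"
proof -
  let ?S = "{pure_tensor A (FM (B n)) Res x y | x y. \<exists>m \<in> carrier \<Lambda>. \<exists>m' \<in> carrier \<Lambda>.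
    m \<otimes> m' = l \<and> x \<in> res_component \<Lambda> F n m \<and> y \<in> residue_component \<Lambda> m'}"
  let ?V = "supp_in (at_deg B dg n l) :: ('b \<Rightarrow>\<^sub>0 'k) set"
  have S: "?S \<subseteq> \<tau> (B n) ` ?V"
  proof clarify
    fix x :: "'b \<Rightarrow> 'a \<Rightarrow> 'k" and y :: "('a \<Rightarrow> 'k) set" and m m'
    assume m: "m \<in> carrier \<Lambda>" "m' \<in> carrier \<Lambda>" "l = m \<otimes> m'"
      and x: "x \<in> res_component \<Lambda> F n m" and y: "y \<in> residue_component \<Lambda> m'"
    obtain p where p: "x = cur p" "p \<in> supp_in (homog n m)"
      using x by (auto simp: res_component_eq)
    obtain c where c: "y = \<kappa> c" "m' = \<one> \<or> c = 0"
      using y by (auto simp: residue_component_eq m split: if_splits)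
    have "scl c (const_part p) \<in> ?V"
    proof (cases "c = 0")
      case False
      then have "m = l"
        using c(2) m by simp
      then show ?thesis
        unfolding const_part_homog [OF p(2)] by (intro vs.subspace_scale [OF subspace_supp_in]) simp
    qed (simp add: vs.subspace_0 [OF subspace_supp_in])
    then show "pure_tensor A (FM (B n)) Res x y \<in> \<tau> (B n) ` supp_in (at_deg B dg n (m \<otimes> m'))"
      unfolding p(1) c(1) m(3) [symmetric] by (subst pure_TM [OF homog_P [OF p(2)]]) (rule imageI)
  qed
  have gen: "\<tau> (B n) (Poly_Mapping.single b c) \<in> ?S" if "b \<in> at_deg B dg n l" for b c
  proof -
    have b: "bvec (b, \<one>) \<in> supp_in (homog n l)"
      using that l by (simp add: at_deg_def homog_def)
    have "\<tau> (B n) (Poly_Mapping.single b c) = pure_tensor A (FM (B n)) Res (cur (bvec (b, \<one>))) (\<kappa> c)"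
      by (subst pure_TM [OF homog_P [OF b]]) (simp add: scl_bvec)
    moreover have "cur (bvec (b, \<one>)) \<in> res_component \<Lambda> F n l" "\<kappa> c \<in> residue_component \<Lambda> \<one>"
      using b by (auto simp: res_component_eq residue_component_eq)
    ultimately show ?thesis
      using l r_one [OF l] by blast
  qed
  have zero: "\<tau> (B n) 0 = \<one>\<^bsub>add_monoid (TM (B n))\<^esub>"
    by (simp add: zero_TM)
  have "generate (add_monoid (TM (B n))) ?S = \<tau> (B n) ` ?V"
  proof (intro equalityI subsetI)
    fix X assume "X \<in> generate (add_monoid (TM (B n))) ?S"
    then show "X \<in> \<tau> (B n) ` ?V"
    proof induction
      case one
      then show ?case
        unfolding zero [symmetric] by (intro imageI vs.subspace_0 [OF subspace_supp_in])
    next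
      case (incl h)
      then show ?case using S by blast
    next
      case (inv h)
      then obtain v where v: "v \<in> ?V" "h = \<tau> (B n) v"
        using S by blast
      have grp: "group (add_monoid (TM (B n)))"
        using abelian_group_TM by (rule abelian_group.a_group)
      have "inv\<^bsub>add_monoid (TM (B n))\<^esub> h = \<tau> (B n) (- v)"
      proof (rule group.inv_equality [OF grp])
        show "\<tau> (B n) (- v) \<otimes>\<^bsub>add_monoid (TM (B n))\<^esub> h = \<one>\<^bsub>add_monoid (TM (B n))\<^esub>"
          using add_TM [OF vs.subspace_neg [OF subspace_supp_in at_deg_B [OF v(1)]] at_deg_B [OF v(1)]] v(2)
          by (simp add: zero_TM)
      qed (use v at_deg_B [OF v(1)] in \<open>auto simp: carrier_TM vs.subspace_neg [OF subspace_supp_in]\<close>)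
      then show ?case
        using vs.subspace_neg [OF subspace_supp_in v(1)] by simp
    next
      case (eng h1 h2)
      then obtain v w where v: "v \<in> ?V" "h1 = \<tau> (B n) v" and w: "w \<in> ?V" "h2 = \<tau> (B n) w"
        by blast
      then show ?case
        using vs.subspace_add [OF subspace_supp_in v(1) w(1)] add_TM [OF at_deg_B [OF v(1)] at_deg_B [OF w(1)]] by auto
    qed
  next
    fix X assume "X \<in> \<tau> (B n) ` ?V"
    then obtain v where v: "v \<in> ?V" "X = \<tau> (B n) v"
      by blast
    have "\<tau> (B n) v \<in> generate (add_monoid (TM (B n))) ?S"
      using v(1)
    proof (induction rule: poly_mapping_add_induct)
      case zero
      show ?case
        using generate.one [of "add_monoid (TM (B n))" ?S] by (simp add: zero_TM)
    next
      case (add p b c)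
      have "Poly_Mapping.single b c \<in> ?V"
        using add by (simp add: single_supp)
      then have "\<tau> (B n) (p + Poly_Mapping.single b c) = \<tau> (B n) p \<otimes>\<^bsub>add_monoid (TM (B n))\<^esub> \<tau> (B n) (Poly_Mapping.single b c)"
        using add by (simp add: add_TM at_deg_B)
      then show ?case
        using generate.eng [OF add.IH generate.incl [OF gen [OF add.hyps(2)]]] by simp
    qed
    then show "X \<in> generate (add_monoid (TM (B n))) ?S"
      by (simp add: v(2))
  qed
  then show ?thesis
    by (simp add: res_tensor_component_def tensor_component_def res_module_eq)
qed

lemma res_cycles_eq:
  assumes l: "l \<in> carrier \<Lambda>"
  shows "res_cycles \<Lambda> F Res (residue_component \<Lambda>) n l = \<tau> (B n) ` tor_cycles B dg hom_d n l"
proof -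
  have "res_tensor_diff \<Lambda> F Res m (\<tau> (B n) v) = \<zero>\<^bsub>res_tensor \<Lambda> F Res m\<^esub> \<longleftrightarrow>
      restr (at_deg B dg m l) (hom_d m v) = 0"
    if v: "v \<in> supp_in (at_deg B dg n l)" and n: "n = Suc m" for v m
  proof -
    have "restr (at_deg B dg m l) (hom_d m v) \<in> supp_in (B m)"
      by (rule at_deg_B [OF restr_in])
    then show ?thesis
      using res_tensor_diff_\<tau> [of v m l] v by (simp add: n res_tensor_eq zero_TM \<tau>_inject)
  qed
  then show ?thesis
    unfolding res_cycles_def hom_cycles_def res_tensor_component_eq [OF l] by auto
qed

lemma res_boundaries_eq:
  assumes l: "l \<in> carrier \<Lambda>"
  shows "res_boundaries \<Lambda> F Res (residue_component \<Lambda>) n l = \<tau> (B n) ` tor_boundaries B dg hom_d n l"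
  unfolding res_boundaries_def hom_boundaries_def res_tensor_component_eq [OF l] image_image
  by (rule image_cong [OF refl]) (rule res_tensor_diff_\<tau>)

end


section \<open>Dimensions of Tor\<close>

text \<open>A vector space in the sense of modules, identified with a subspace of a space with a basis, so that
  its dimension becomes that of a subspace.\<close>

locale vs_iso =
  fixes V :: "('k::field, 'm) module" (structure) and W :: "('c \<Rightarrow>\<^sub>0 'k) set" and f :: "('c \<Rightarrow>\<^sub>0 'k) \<Rightarrow> 'm"
  assumes subspace: "vs.subspace W" and bij: "bij_betw f W (carrier V)"
    and f_add: "v \<in> W \<Longrightarrow> w \<in> W \<Longrightarrow> f (v + w) = f v \<oplus> f w"
    and f_zero: "f 0 = \<zero>"
    and f_smult: "v \<in> W \<Longrightarrow> f (scl c v) = c \<odot> f v"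
begin

lemmas W_closed = vs.subspace_0 [OF subspace] vs.subspace_add [OF subspace] vs.subspace_scale [OF subspace]

lemma f_inj: "v \<in> W \<Longrightarrow> w \<in> W \<Longrightarrow> f v = f w \<longleftrightarrow> v = w"
  using bij by (auto simp: bij_betw_def inj_on_def)

lemma f_closed: "v \<in> W \<Longrightarrow> f v \<in> carrier V"
  using bij by (auto simp: bij_betw_def)

lemma smult_f_closed: "v \<in> W \<Longrightarrow> c \<odot> f v \<in> carrier V"
  using f_closed [OF W_closed(3)] f_smult by metis

lemma f_onto: "carrier V = f ` W"
  using bij by (auto simp: bij_betw_def)

lemma abelian_monoid_V: "abelian_monoid V"
  by (rule abelian_monoidI)
    (auto simp: f_onto W_closed ac_simps simp flip: f_add f_zero)

sublocale abelian_monoid V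
  by (rule abelian_monoid_V)

lemma finsum_f: "finite Y \<Longrightarrow> g ` Y \<subseteq> W \<Longrightarrow> (\<Oplus>y\<in>Y. f (g y)) = f (\<Sum>y\<in>Y. g y)"
proof (induction Y rule: finite_induct)
  case empty
  then show ?case by (simp add: f_zero)
next
  case (insert y Y)
  then have "(\<Sum>y\<in>Y. g y) \<in> W"
    by (intro vs.subspace_sum [OF subspace]) auto
  with insert show ?case
    by (simp add: finsum_insert f_closed f_add Pi_def image_subset_iff)
qed

lemma combination:
  assumes "finite E" "E \<subseteq> W"
  shows "(\<Oplus>b\<in>f ` E. c b \<odot> b) = f (\<Sum>e\<in>E. scl (c (f e)) e)"
proof -
  have inj: "inj_on f E"
    using bij assms(2) by (auto simp: bij_betw_def intro: inj_on_subset)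
  have "(\<Oplus>b\<in>f ` E. c b \<odot> b) = (\<Oplus>e\<in>E. c (f e) \<odot> f e)"
    by (rule finsum_reindex [OF _ inj]) (use assms(2) in \<open>auto intro!: smult_f_closed\<close>)
  also have "\<dots> = (\<Oplus>e\<in>E. f (scl (c (f e)) e))"
    by (rule finsum_cong') (use assms(2) W_closed in \<open>auto simp: f_smult [symmetric] intro!: f_closed\<close>)
  also have "\<dots> = f (\<Sum>e\<in>E. scl (c (f e)) e)"
    by (rule finsum_f) (use assms W_closed in auto)
  finally show ?thesis .
qed

text \<open>Uniqueness of the coefficients is linear independence, and existence says that the vectors span.\<close>

lemma vs_basis_iff:
  assumes E: "finite E" "E \<subseteq> W"
  shows "vs_basis V (f ` E) \<longleftrightarrow> vs.independent E \<and> W \<subseteq> vs.span E"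
proof -
  have inj: "inj_on f E"
    using bij E(2) by (auto simp: bij_betw_def intro: inj_on_subset)
  have combW: "(\<Sum>e\<in>E. scl (u e) e) \<in> W" for u
    using E(2) W_closed by (intro vs.subspace_sum [OF subspace]) auto
  define push where "push u = (\<lambda>b\<in>f ` E. u (inv_into E f b))" for u :: "('c \<Rightarrow>\<^sub>0 'k) \<Rightarrow> 'k"
  have push: "push u \<in> f ` E \<rightarrow>\<^sub>E UNIV" "e \<in> E \<Longrightarrow> push u (f e) = u e" for u e
    using inj by (auto simp: push_def)
  have iff: "f w = (\<Oplus>b\<in>f ` E. c b \<odot> b) \<longleftrightarrow> w = (\<Sum>e\<in>E. scl (c (f e)) e)" if "w \<in> W" for w c
    unfolding combination [OF E] using f_inj [OF that combW] by simp
  have basis: "vs_basis V (f ` E) \<longleftrightarrow> (\<forall>w\<in>W. \<exists>!c. c \<in> f ` E \<rightarrow>\<^sub>E UNIV \<and> w = (\<Sum>e\<in>E. scl (c (f e)) e))"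
    unfolding vs_basis_def using E iff by (auto simp: f_onto image_mono)
  show ?thesis
    unfolding basis
  proof (intro iffI conjI)
    assume all: "\<forall>w\<in>W. \<exists>!c. c \<in> f ` E \<rightarrow>\<^sub>E UNIV \<and> w = (\<Sum>e\<in>E. scl (c (f e)) e)"
    show "W \<subseteq> vs.span E"
    proof
      fix w assume "w \<in> W"
      with all obtain c where w: "w = (\<Sum>e\<in>E. scl (c (f e)) e)"
        by blast
      show "w \<in> vs.span E"
        unfolding w by (rule vs.span_sum) (rule vs.span_scale [OF vs.span_base])
    qed
    show "vs.independent E"
    proof (rule vs.independent_if_scalars_zero [OF E(1)])
      fix u e assume u: "(\<Sum>x\<in>E. scl (u x) x) = 0" and e: "e \<in> E"
      have "(\<Sum>x\<in>E. scl (push u (f x)) x) = 0"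
        using u push(2) by (simp cong: sum.cong)
      moreover have "(\<Sum>x\<in>E. scl (push (\<lambda>_. 0) (f x)) x) = 0"
        using push(2) by (simp cong: sum.cong)
      moreover obtain c0 where c0: "\<And>c. c \<in> f ` E \<rightarrow>\<^sub>E UNIV \<Longrightarrow> (\<Sum>e\<in>E. scl (c (f e)) e) = 0 \<Longrightarrow> c = c0"
        using bspec [OF all W_closed(1)] unfolding Ex1_def by (metis (no_types))
      ultimately have "push u = push (\<lambda>_. 0)"
        using c0 [OF push(1), of u] c0 [OF push(1), of "\<lambda>_. 0"] by simp
      then show "u e = 0"
        using push(2) [OF e] by metis
    qed
  next
    assume *: "vs.independent E \<and> W \<subseteq> vs.span E"
    show "\<forall>w\<in>W. \<exists>!c. c \<in> f ` E \<rightarrow>\<^sub>E UNIV \<and> w = (\<Sum>e\<in>E. scl (c (f e)) e)"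
    proof
      fix w assume "w \<in> W"
      then obtain u where "w = (\<Sum>e\<in>E. scl (u e) e)"
        using * by (auto simp: vs.span_finite [OF E(1)])
      then have ex: "push u \<in> f ` E \<rightarrow>\<^sub>E UNIV \<and> w = (\<Sum>e\<in>E. scl (push u (f e)) e)"
        using push by (simp cong: sum.cong)
      moreover have "c = c'" if c: "c \<in> f ` E \<rightarrow>\<^sub>E UNIV \<and> w = (\<Sum>e\<in>E. scl (c (f e)) e)"
        and c': "c' \<in> f ` E \<rightarrow>\<^sub>E UNIV \<and> w = (\<Sum>e\<in>E. scl (c' (f e)) e)" for c c'
      proof (rule PiE_ext [of c "f ` E" "\<lambda>_. UNIV" c'])
        have zero: "(\<Sum>e\<in>E. scl (c (f e) - c' (f e)) e) = 0"
          using c c' by (simp add: vs.scale_left_diff_distrib sum_subtractf)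
        have ind: "\<forall>e\<in>E. v e = 0" if "(\<Sum>e\<in>E. scl (v e) e) = 0" for v
          using * E(1) that by (auto simp: vs.dependent_finite)
        from ind [OF zero] have "\<forall>e\<in>E. c (f e) - c' (f e) = 0" .
        then show "\<And>x. x \<in> f ` E \<Longrightarrow> c x = c' x"
          by auto
      qed (use c c' in auto)
      ultimately show "\<exists>!c. c \<in> f ` E \<rightarrow>\<^sub>E UNIV \<and> w = (\<Sum>e\<in>E. scl (c (f e)) e)"
        by blast
    qed
  qed
qed

lemma vs_dim_eq:
  assumes X: "finite X" "W \<subseteq> supp_in X"
  shows "vs_dim V = vs.dim W"
  unfolding vs_dim_def
proof (rule the_equality)
  obtain b where b: "b \<subseteq> W" "vs.independent b" "vs.span b = W" "finite b" "card b = vs.dim W"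
    using finite_dim_supp_in [OF X(1) subspace X(2)] .
  have "vs_basis V (f ` b)"
    using vs_basis_iff [OF b(4,1)] b by simp
  moreover have "card (f ` b) = card b"
    using bij b(1) by (intro card_image) (auto simp: bij_betw_def intro: inj_on_subset)
  ultimately show "\<exists>B. vs_basis V B \<and> card B = vs.dim W"
    using b(5) by metis
next
  fix n assume "\<exists>B. vs_basis V B \<and> card B = n"
  then obtain B where B: "vs_basis V B" "card B = n"
    by blast
  then have "B \<subseteq> f ` W" "finite B"
    by (auto simp: vs_basis_def f_onto)
  then obtain E where E: "E \<subseteq> W" "finite E" "B = f ` E"
    by (meson finite_subset_image)
  then have "vs.independent E" "W \<subseteq> vs.span E"
    using B(1) vs_basis_iff by auto
  then have "card E = vs.dim W"
    using E(1) by (intro vs.basis_card_eq_dim)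
  moreover have "card B = card E"
    unfolding E(3) using bij E(1) by (intro card_image) (auto simp: bij_betw_def intro: inj_on_subset)
  ultimately show "n = vs.dim W"
    using B(2) by simp
qed

end

lemma complement_exists:
  assumes X: "finite X" "S \<subseteq> supp_in X" and S: "vs.subspace S" and T: "vs.subspace T" "T \<subseteq> S"
  obtains W where "vs.subspace W" "W \<subseteq> S" "W \<inter> T = {0}" "\<forall>v\<in>S. \<exists>w\<in>W. v - w \<in> T"
    "vs.dim W = vs.dim S - vs.dim T"
proof -
  have TX: "T \<subseteq> supp_in X"
    using X(2) T(2) by blast
  obtain b where b: "b \<subseteq> T" "vs.independent b" "vs.span b = T" "finite b" "card b = vs.dim T"
    using finite_dim_supp_in [OF X(1) T(1) TX] .
  have "b \<subseteq> S"
    using b(1) T(2) by blast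
  then obtain c where c: "b \<subseteq> c" "c \<subseteq> S" "vs.independent c" "S \<subseteq> vs.span c"
    using vs.maximal_independent_subset_extend [OF _ b(2), of S] by metis
  obtain g where g: "finite g" "vs.span g = S"
    using finite_dim_supp_in [OF X(1) S X(2)] by metis
  have fc: "finite c"
    using vs.independent_span_bound [OF g(1) c(3)] c(2) g(2) by auto
  have cS: "card c = vs.dim S"
    by (rule vs.basis_card_eq_dim [OF c(2,4,3)])
  define e where "e = c - b"
  have ind_e: "vs.independent e"
    using c(3) vs.independent_mono [of c e] by (auto simp: e_def)
  show thesis
  proof
    show "vs.subspace (vs.span e)"
      by (rule vs.subspace_span)
    show "vs.span e \<subseteq> S"
      using c(2) S by (intro vs.span_minimal) (auto simp: e_def)
    have "vs.dim (vs.span e) = card e"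
      by (rule vs.dim_span_eq_card_independent [OF ind_e])
    then show "vs.dim (vs.span e) = vs.dim S - vs.dim T"
      using cS b(4,5) c(1) fc by (simp add: e_def card_Diff_subset)
    have cbe: "c = e \<union> b"
      using c(1) by (auto simp: e_def)
    show "\<forall>v\<in>S. \<exists>w\<in>vs.span e. v - w \<in> T"
    proof
      fix v assume "v \<in> S"
      have "v \<in> vs.span (e \<union> b)"
        using c(4) \<open>v \<in> S\<close> cbe by auto
      then obtain x y where "v = x + y" "x \<in> vs.span e" "y \<in> vs.span b"
        unfolding vs.span_Un by blast
      then show "\<exists>w\<in>vs.span e. v - w \<in> T"
        using b(3) by (intro bexI [of _ x]) auto
    qed
    show "vs.span e \<inter> T = {0}"
    proof (intro equalityI subsetI)
      fix x assume x: "x \<in> vs.span e \<inter> T"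
      have fe: "finite e"
        using fc by (simp add: e_def)
      obtain p where p: "x = (\<Sum>a\<in>e. scl (p a) a)"
        using x vs.span_finite [OF fe] by auto
      obtain q where q: "x = (\<Sum>a\<in>b. scl (q a) a)"
        using x vs.span_finite [OF b(4)] b(3) by auto
      define s where "s a = (if a \<in> e then p a else - q a)" for a
      have "(\<Sum>a\<in>c. scl (s a) a) = (\<Sum>a\<in>e. scl (s a) a) + (\<Sum>a\<in>b. scl (s a) a)"
        unfolding cbe by (rule sum.union_disjoint [OF fe b(4)]) (auto simp: e_def)
      also have "(\<Sum>a\<in>e. scl (s a) a) = x"
        by (simp add: p s_def)
      also have "(\<Sum>a\<in>b. scl (s a) a) = (\<Sum>a\<in>b. - scl (q a) a)"
        by (rule sum.cong) (auto simp: s_def e_def)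
      also have "x + \<dots> = 0"
        by (simp add: q sum_negf)
      finally have "\<forall>a\<in>c. s a = 0"
        using c(3) fc by (auto simp: vs.dependent_finite)
      then have "x = 0"
        unfolding p by (intro sum.neutral) (auto simp: s_def e_def)
      then show "x \<in> {0}" by simp
    qed (simp add: vs.span_zero vs.subspace_0 [OF T(1)])
  qed
qed

context record_resolution
begin

text \<open>The given resolution may have infinitely many basis elements of degree \<open>l\<close>, so its cycles and boundaries
  need not have dimensions to be subtracted. A complement \<open>W\<close> of the boundaries in the cycles of
  the finite resolution is mapped by the comparison \<open>\<phi>\<close> isomorphically to the homology: each cycle of the
  given resolution is congruent to \<open>\<phi> v\<close> for exactly one \<open>v \<in> W\<close>.\<close>

theorem tor_vs_dim:
  fixes B' :: "nat \<Rightarrow> 'c set"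
  assumes C: "strand_resolution \<Lambda> B' dg' (d' :: nat \<Rightarrow> ('c \<Rightarrow>\<^sub>0 'k) \<Rightarrow> _) \<eta>'" and l: "l \<in> carrier \<Lambda>"
    and fin: "finite (at_deg B' dg' n l)"
  shows "vs_dim (quot_module (K_space \<Lambda> (res_tensor \<Lambda> F Res n) (res_cycles \<Lambda> F Res (residue_component \<Lambda>) n l))
      (res_boundaries \<Lambda> F Res (residue_component \<Lambda>) n l)) = hom_dim (\<lambda>m. at_deg B' dg' m l) d' n"
proof -
  interpret C: strand_resolution \<Lambda> B' dg' d' \<eta>'
    by (rule C)
  interpret CD: strand_resolution_pair \<Lambda> B' dg' d' \<eta>' B dg hom_d \<eta>
    by unfold_locales
  let ?Zc = "tor_cycles B' dg' d' n l" and ?Bc = "tor_boundaries B' dg' d' n l"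
  let ?Zd = "tor_cycles B dg hom_d n l" and ?Bd = "tor_boundaries B dg hom_d n l"
  obtain \<phi> where \<phi>: "lin \<phi>" "\<forall>v\<in>?Zc. \<phi> v \<in> ?Zd" "\<forall>v\<in>?Zc. \<phi> v \<in> ?Bd \<longleftrightarrow> v \<in> ?Bc"
    "\<forall>w\<in>?Zd. \<exists>v\<in>?Zc. w - \<phi> v \<in> ?Bd"
    using CD.tor_comparison [OF l, of n] .
  note sZc = subspace_hom_cycles [where d = d', OF C.lin_d, of "\<lambda>n. at_deg B' dg' n l" n]
  note sBc = subspace_hom_boundaries [where d = d', OF C.lin_d, of "\<lambda>n. at_deg B' dg' n l" n]
  note sZd = subspace_hom_cycles [where d = hom_d, OF lin_hom_d, of "\<lambda>n. at_deg B dg n l" n]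
  note sBd = subspace_hom_boundaries [where d = hom_d, OF lin_hom_d, of "\<lambda>n. at_deg B dg n l" n]
  have Zc_sub: "?Zc \<subseteq> supp_in (at_deg B' dg' n l)"
    by (auto simp: hom_cycles_def)
  \<comment> \<open>A complement of the boundaries in the cycles of the finite resolution.\<close>
  obtain W where W: "vs.subspace W" "W \<subseteq> ?Zc" "W \<inter> ?Bc = {0}" "\<forall>v\<in>?Zc. \<exists>w\<in>W. v - w \<in> ?Bc"
    "vs.dim W = vs.dim ?Zc - vs.dim ?Bc"
    using complement_exists [OF fin Zc_sub sZc sBc C.tor_boundaries_cycles [OF l]] .
  have ex1: "\<exists>!v. v \<in> W \<and> w - \<phi> v \<in> ?Bd" if w: "w \<in> ?Zd" for w
  proof (rule ex_ex1I)
    obtain v' where v': "v' \<in> ?Zc" "w - \<phi> v' \<in> ?Bd"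
      using bspec [OF \<phi>(4) w] by blast
    obtain v where v: "v \<in> W" "v' - v \<in> ?Bc"
      using bspec [OF W(4) v'(1)] by blast
    have "\<phi> (v' - v) \<in> ?Bd"
      using \<phi>(3) v v'(1) W(2) vs.subspace_diff [OF sZc] by blast
    then have "(w - \<phi> v') + \<phi> (v' - v) \<in> ?Bd"
      using v'(2) vs.subspace_add [OF sBd] by blast
    then show "\<exists>v. v \<in> W \<and> w - \<phi> v \<in> ?Bd"
      using v(1) by (intro exI [of _ v]) (simp add: lin_diff [OF \<phi>(1)])
  next
    fix v1 v2 assume 1: "v1 \<in> W \<and> w - \<phi> v1 \<in> ?Bd" and 2: "v2 \<in> W \<and> w - \<phi> v2 \<in> ?Bd"
    have "(w - \<phi> v2) - (w - \<phi> v1) \<in> ?Bd"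
      using 1 2 vs.subspace_diff [OF sBd] by blast
    then have "\<phi> (v1 - v2) \<in> ?Bd"
      by (simp add: lin_diff [OF \<phi>(1)])
    moreover have vW: "v1 - v2 \<in> W"
      using 1 2 vs.subspace_diff [OF W(1)] by blast
    ultimately have "v1 - v2 \<in> W \<inter> ?Bc"
      using \<phi>(3) W(2) by blast
    then show "v1 = v2"
      using W(3) by simp
  qed
  define \<theta> where "\<theta> w = (THE v. v \<in> W \<and> w - \<phi> v \<in> ?Bd)" for w
  have \<theta>: "\<theta> w \<in> W" "w - \<phi> (\<theta> w) \<in> ?Bd" if "w \<in> ?Zd" for w
    using theI' [OF ex1 [OF that]] by (auto simp: \<theta>_def)
  have \<theta>_eq: "\<theta> w = v" if "w \<in> ?Zd" "v \<in> W" "w - \<phi> v \<in> ?Bd" for w v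
    using ex1 [OF that(1)] \<theta> that by blast
  have \<theta>_add: "\<theta> (w + w') = \<theta> w + \<theta> w'" if w: "w \<in> ?Zd" "w' \<in> ?Zd" for w w'
  proof (rule \<theta>_eq)
    have "(w - \<phi> (\<theta> w)) + (w' - \<phi> (\<theta> w')) \<in> ?Bd"
      using \<theta> w vs.subspace_add [OF sBd] by blast
    then show "(w + w') - \<phi> (\<theta> w + \<theta> w') \<in> ?Bd"
      by (simp add: lin_add [OF \<phi>(1)] algebra_simps)
  qed (use w \<theta> vs.subspace_add [OF sZd] vs.subspace_add [OF W(1)] in blast)+
  have \<theta>_scl: "\<theta> (scl c w) = scl c (\<theta> w)" if w: "w \<in> ?Zd" for c w
  proof (rule \<theta>_eq)
    have "scl c (w - \<phi> (\<theta> w)) \<in> ?Bd"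
      using \<theta> w vs.subspace_scale [OF sBd] by blast
    then show "scl c w - \<phi> (scl c (\<theta> w)) \<in> ?Bd"
      by (simp add: lin_scl [OF \<phi>(1)] vs.scale_right_diff_distrib)
  qed (use w \<theta> vs.subspace_scale [OF sZd] vs.subspace_scale [OF W(1)] in blast)+
  have \<theta>_0: "\<theta> w = 0 \<longleftrightarrow> w \<in> ?Bd" if w: "w \<in> ?Zd" for w
    using \<theta> [OF w] \<theta>_eq [OF w vs.subspace_0 [OF W(1)]] by (auto simp: lin_0 [OF \<phi>(1)])
  have \<theta>_\<phi>: "\<theta> (\<phi> v) = v" if v: "v \<in> W" for v
    using \<theta>_eq [of "\<phi> v" v] \<phi>(2) v W(2) vs.subspace_0 [OF sBd] by auto
  have Zd_B: "w \<in> supp_in (B n)" if "w \<in> ?Zd" for w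
    by (rule at_deg_B [OF hom_cycles_supp [OF that]])
  define M where "M = K_space \<Lambda> (TM (B n)) (\<tau> (B n) ` ?Zd)"
  \<comment> \<open>The same map on the cycles of the tensor product; its kernel consists of the boundaries.\<close>
  define \<psi> where "\<psi> X = \<theta> (THE w. w \<in> ?Zd \<and> X = \<tau> (B n) w)" for X
  have \<psi>: "\<psi> (\<tau> (B n) w) = \<theta> w" if w: "w \<in> ?Zd" for w
  proof -
    have "(THE w'. w' \<in> ?Zd \<and> \<tau> (B n) w = \<tau> (B n) w') = w"
      using w Zd_B by (auto simp: \<tau>_inject)
    then show ?thesis
      by (simp add: \<psi>_def)
  qed
  have M_carrier: "carrier M = \<tau> (B n) ` ?Zd" and M_zero: "\<zero>\<^bsub>M\<^esub> = \<tau> (B n) 0"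
    and M_add: "\<And>v w. v \<in> ?Zd \<Longrightarrow> w \<in> ?Zd \<Longrightarrow> \<tau> (B n) v \<oplus>\<^bsub>M\<^esub> \<tau> (B n) w = \<tau> (B n) (v + w)"
    using Zd_B by (auto simp: M_def K_space_def zero_TM add_TM)
  have M_smult: "c \<odot>\<^bsub>M\<^esub> \<tau> (B n) w = \<tau> (B n) (scl c w)" if w: "w \<in> ?Zd" for c w
  proof -
    have "monom_elt c \<one> = lookup (Poly_Mapping.single \<one> c)"
      by (auto simp: monom_elt_def fun_eq_iff lookup_single when_def)
    then show ?thesis
      using smult_TM [OF single_supp [OF one_closed] Zd_B [OF w], of c] by (simp add: M_def K_space_def)
  qed
  have M_group: "abelian_group M"
  proof (rule abelian_groupI)
    fix x y z assume "x \<in> carrier M" "y \<in> carrier M" "z \<in> carrier M"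
    then obtain u v w where u: "u \<in> ?Zd" and v: "v \<in> ?Zd" and w: "w \<in> ?Zd"
      and x: "x = \<tau> (B n) u" and y: "y = \<tau> (B n) v" and z: "z = \<tau> (B n) w"
      by (auto simp: M_carrier)
    note cl = vs.subspace_add [OF sZd] vs.subspace_neg [OF sZd] vs.subspace_0 [OF sZd]
    show "x \<oplus>\<^bsub>M\<^esub> y \<in> carrier M"
      by (simp add: x y u v M_add M_carrier cl)
    show "x \<oplus>\<^bsub>M\<^esub> y \<oplus>\<^bsub>M\<^esub> z = x \<oplus>\<^bsub>M\<^esub> (y \<oplus>\<^bsub>M\<^esub> z)"
      by (simp add: x y z u v w M_add cl add.assoc)
    show "x \<oplus>\<^bsub>M\<^esub> y = y \<oplus>\<^bsub>M\<^esub> x"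
      by (simp add: x y u v M_add add.commute)
    show "\<zero>\<^bsub>M\<^esub> \<oplus>\<^bsub>M\<^esub> x = x"
      by (simp add: x u M_zero M_add cl)
    show "\<exists>y\<in>carrier M. y \<oplus>\<^bsub>M\<^esub> x = \<zero>\<^bsub>M\<^esub>"
    proof (rule bexI)
      show "\<tau> (B n) (- u) \<oplus>\<^bsub>M\<^esub> x = \<zero>\<^bsub>M\<^esub>"
        by (simp add: x u M_zero M_add cl)
      show "\<tau> (B n) (- u) \<in> carrier M"
        by (simp add: M_carrier u cl)
    qed
  next
    show "\<zero>\<^bsub>M\<^esub> \<in> carrier M"
      by (simp add: M_zero M_carrier vs.subspace_0 [OF sZd])
  qed
  interpret Q: kernel_quotient M \<psi> "\<tau> (B n) ` ?Bd"
  proof (rule kernel_quotient.intro [OF M_group], unfold_locales)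
    show "\<psi> (x \<oplus>\<^bsub>M\<^esub> y) = \<psi> x + \<psi> y" if xy: "x \<in> carrier M" "y \<in> carrier M" for x y
    proof -
      obtain v w where "v \<in> ?Zd" "w \<in> ?Zd" "x = \<tau> (B n) v" "y = \<tau> (B n) w"
        using xy by (auto simp: M_carrier)
      then show ?thesis
        by (simp add: M_add \<psi> vs.subspace_add [OF sZd] \<theta>_add)
    qed
    show "\<tau> (B n) ` ?Bd = {x \<in> carrier M. \<psi> x = 0}"
      using strands.tor_boundaries_cycles [OF l, of n] by (auto simp: M_carrier \<psi> \<theta>_0)
  qed
  have im: "\<psi> ` carrier M = W"
  proof (intro equalityI subsetI)
    fix v assume v: "v \<in> W"
    have "\<psi> (\<tau> (B n) (\<phi> v)) = v"
      using v W(2) \<phi>(2) by (simp add: \<psi> \<theta>_\<phi> subset_iff)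
    then show "v \<in> \<psi> ` carrier M"
      using v W(2) \<phi>(2) by (auto simp: M_carrier intro!: image_eqI [of v \<psi> "\<tau> (B n) (\<phi> v)"])
  qed (auto simp: M_carrier \<psi> \<theta>)
  interpret I: vs_iso "quot_module M (\<tau> (B n) ` ?Bd)" W "fibre M \<psi>"
  proof
    show "vs.subspace W" by (rule W(1))
    show "bij_betw (fibre M \<psi>) W (carrier (quot_module M (\<tau> (B n) ` ?Bd)))"
      unfolding bij_betw_def Q.carrier_quot im by (auto intro!: inj_onI Q.fibre_inj simp: im)
    show "fibre M \<psi> 0 = \<zero>\<^bsub>quot_module M (\<tau> (B n) ` ?Bd)\<^esub>"
      by (simp add: Q.zero_quot)
    fix v assume v: "v \<in> W"
    then obtain x where x: "x \<in> carrier M" "\<psi> x = v"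
      using im by blast
    show "fibre M \<psi> (v + w) = fibre M \<psi> v \<oplus>\<^bsub>quot_module M (\<tau> (B n) ` ?Bd)\<^esub> fibre M \<psi> w" if "w \<in> W" for w
    proof -
      have "w \<in> \<psi> ` carrier M"
        using that by (simp only: im)
      then obtain y where y: "y \<in> carrier M" "\<psi> y = w"
        by blast
      show ?thesis
        using Q.add_quot [OF x(1) y(1)] by (simp only: x(2) y(2))
    qed
    show "fibre M \<psi> (scl c v) = c \<odot>\<^bsub>quot_module M (\<tau> (B n) ` ?Bd)\<^esub> fibre M \<psi> v" for c
    proof -
      have "c \<odot>\<^bsub>M\<^esub> y \<in> carrier M" "\<psi> (c \<odot>\<^bsub>M\<^esub> y) = scl c (\<psi> y)" if "y \<in> carrier M" for y
        using that by (auto simp: M_carrier M_smult \<psi> \<theta>_scl vs.subspace_scale [OF sZd])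
      from Q.smult_quot [where \<sigma> = "scl c", OF this x(1)] show ?thesis
        by (simp only: x(2))
    qed
  qed
  have "vs_dim (quot_module M (\<tau> (B n) ` ?Bd)) = vs.dim W"
    by (rule I.vs_dim_eq [OF fin]) (use W(2) Zc_sub in blast)
  then show ?thesis
    by (simp add: res_tensor_eq res_cycles_eq [OF l] res_boundaries_eq [OF l] M_def W(5) hom_dim_def)
qed

end


section \<open>Resolutions from their strands\<close>

text \<open>The converse passage, from strands to a graded free resolution over the monoid algebra: monomials are put
  back as the degrees require.\<close>

locale strands_to_resolution =
  graded_bases \<Lambda> K B dg + strand_resolution \<Lambda> B dg d \<eta>
  for \<Lambda> :: "'a monoid" (structure) and K :: "'k::field itself" and B :: "nat \<Rightarrow> 'b set" and dg
    and d :: "nat \<Rightarrow> ('b \<Rightarrow>\<^sub>0 'k) \<Rightarrow> ('b \<Rightarrow>\<^sub>0 'k)" and \<eta>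
begin

definition D :: "nat \<Rightarrow> ('b \<times> 'a \<Rightarrow>\<^sub>0 'k) \<Rightarrow> ('b \<times> 'a \<Rightarrow>\<^sub>0 'k)" where
  "D n = lext (\<lambda>(b, a). homogenise n (dg (Suc n) b \<otimes> a) (d n (bvec b)))"

text \<open>The augmentation is only constrained on the strand of \<open>\<one>\<close>; it is replaced by zero on basis elements of
  other degrees, to make it homogeneous.\<close>

definition \<eta>1 :: "('b \<Rightarrow>\<^sub>0 'k) \<Rightarrow> 'k" where
  "\<eta>1 v = \<eta> (restr (at_deg B dg 0 \<one>) v)"

definition graded_resolution :: "('a, 'b, 'k, ('a \<Rightarrow> 'k) set) resolution" where
  "graded_resolution = \<lparr>res_basis = B, res_deg = dg, res_diff = (\<lambda>n f. cur (D n (uncur f))),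
     res_aug = (\<lambda>f. \<kappa> (\<eta>1 (const_part (uncur f))))\<rparr>"

lemma lin_D: "lin (D n)"
  unfolding D_def by (rule lin_lext)

lemma \<eta>1_add: "\<eta>1 (u + v) = \<eta>1 u + \<eta>1 v" and \<eta>1_scl: "\<eta>1 (scl c v) = c * \<eta>1 v"
  by (simp_all add: \<eta>1_def lin_add [OF lin_restr] lin_scl [OF lin_restr] aug_add aug_scl)

lemma aug_0: "\<eta> 0 = 0"
  using aug_scl [of 0 0] by simp

lemma D_bvec:
  assumes z: "(b, a) \<in> homog (Suc n) l"
  shows "D n (bvec (b, a)) \<in> supp_in (homog n l)" "dehom (D n (bvec (b, a))) = d n (bvec b)"
proof -
  have b: "b \<in> B (Suc n)" "a \<in> carrier \<Lambda>" and l: "l = dg (Suc n) b \<otimes> a"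
    using z by (auto simp: homog_def)
  have lc: "l \<in> carrier \<Lambda>"
    using b dg_closed l by auto
  have "bvec b \<in> str (Suc n) l"
    using b dg_closed l by (auto simp: below_def factor_def)
  then have "d n (bvec b) \<in> str n l"
    by (rule d_strand [OF _ lc])
  then show "D n (bvec (b, a)) \<in> supp_in (homog n l)"
    unfolding D_def by (simp add: homogenise_homog flip: l)
  show "dehom (D n (bvec (b, a))) = d n (bvec b)"
    by (simp add: D_def dehom_homogenise)
qed

lemma D_homog: "p \<in> supp_in (homog (Suc n) l) \<Longrightarrow> D n p \<in> supp_in (homog n l)"
  by (erule lin_supp_in [OF lin_D]) (auto intro: D_bvec(1))

lemma in_homog: "b \<in> B n \<Longrightarrow> a \<in> carrier \<Lambda> \<Longrightarrow> (b, a) \<in> homog n (dg n b \<otimes> a)"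
  by (simp add: homog_def)

lemma D_P: "p \<in> P (Suc n) \<Longrightarrow> D n p \<in> P n"
  by (erule lin_supp_in [OF lin_D]) (auto intro!: homog_P D_bvec(1) in_homog)

lemma dehom_D: "p \<in> P (Suc n) \<Longrightarrow> dehom (D n p) = d n (dehom p)"
  by (erule lin_eq_supp_in [OF lin_compose [OF lin_dehom lin_D] lin_compose [OF lin_d lin_dehom]])
    (auto simp: D_bvec(2) [OF in_homog])

lemma dehom_inj:
  fixes p q :: "'b \<times> 'a \<Rightarrow>\<^sub>0 'k"
  assumes "p \<in> supp_in (homog n l)" "q \<in> supp_in (homog n l)" "dehom p = dehom q"
  shows "p = q"
  using arg_cong [OF assms(3), of "homogenise n l"]
  unfolding homogenise_dehom [OF assms(1)] homogenise_dehom [OF assms(2)] .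

lemma shift_index:
  assumes h: "(b, a) \<in> homog n l" and y: "y \<in> carrier \<Lambda>"
  shows "(b, y \<otimes> a) \<in> homog n (y \<otimes> l)"
proof -
  have b: "b \<in> B n" "a \<in> carrier \<Lambda>" and l: "dg n b \<otimes> a = l"
    using h by (auto simp: homog_def)
  have "dg n b \<otimes> (y \<otimes> a) = y \<otimes> l"
    unfolding l [symmetric] by (rule m_lcomm [OF dg_closed [OF b(1)] y b(2)])
  with b y show ?thesis
    unfolding homog_def by blast
qed

lemma shift_homog: "p \<in> supp_in (homog n l) \<Longrightarrow> y \<in> carrier \<Lambda> \<Longrightarrow> shift y p \<in> supp_in (homog n (y \<otimes> l))"
  by (erule lin_supp_in [OF lin_shift]) (auto simp: shift_index)

lemma D_shift:
  assumes y: "y \<in> carrier \<Lambda>" and p: "p \<in> P (Suc n)"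
  shows "D n (shift y p) = shift y (D n p)"
proof (rule lin_eq_supp_in [OF lin_compose [OF lin_D lin_shift] lin_compose [OF lin_shift lin_D] p])
  fix z assume "z \<in> B (Suc n) \<times> carrier \<Lambda>"
  then obtain b a where z: "z = (b, a)" "b \<in> B (Suc n)" "a \<in> carrier \<Lambda>"
    by auto
  define l where "l = dg (Suc n) b \<otimes> a"
  have h: "(b, a) \<in> homog (Suc n) l"
    unfolding l_def by (rule in_homog [OF z(2,3)])
  have h': "(b, y \<otimes> a) \<in> homog (Suc n) (y \<otimes> l)"
    by (rule shift_index [OF h y])
  show "D n (shift y (bvec z)) = shift y (D n (bvec z))"
    unfolding z(1) shift_bvec
    by (rule dehom_inj [OF D_bvec(1) [OF h'] shift_homog [OF D_bvec(1) [OF h] y]])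
      (simp add: D_bvec(2) [OF h] D_bvec(2) [OF h'] dehom_shift)
qed

lemma D_act:
  assumes q: "q \<in> supp_in (carrier \<Lambda>)" and p: "p \<in> P (Suc n)"
  shows "D n (act q p) = act q (D n p)"
  by (rule lin_eq_supp_in [OF lin_compose [OF lin_D lin_act_left] lin_act_left q]) (simp add: D_shift p)

text \<open>Every element is the sum of its finitely many homogeneous components.\<close>

lemma in_subspace_if_components:
  assumes p: "p \<in> P n" and S: "vs.subspace S"
    and comp: "\<And>l. l \<in> carrier \<Lambda> \<Longrightarrow> restr (homog n l) p \<in> S"
  shows "p \<in> S"
proof -
  define L where "L = (\<lambda>(b, a). dg n b \<otimes> a) ` keys p"
  have "p = (\<Sum>l\<in>L. restr (homog n l) p)"
  proof (rule poly_mapping_eqI)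
    fix z :: "'b \<times> 'a"
    obtain b a where z: "z = (b, a)"
      by (cases z)
    show "lookup p z = lookup (\<Sum>l\<in>L. restr (homog n l) p) z"
    proof (cases "z \<in> keys p")
      case True
      then have ba: "b \<in> B n" "a \<in> carrier \<Lambda>" "dg n b \<otimes> a \<in> L"
        using p by (force simp: supp_in_def L_def z)+
      have "lookup (\<Sum>l\<in>L. restr (homog n l) p) z = (\<Sum>l\<in>L. if l = dg n b \<otimes> a then lookup p z else 0)"
        unfolding lookup_sum by (rule sum.cong) (use ba in \<open>auto simp: lookup_restr z homog_def\<close>)
      also have "\<dots> = lookup p z"
        using ba(3) by (simp add: L_def)
      finally show ?thesis ..
    next
      case False
      then show ?thesis
        by (simp add: lookup_sum lookup_restr not_in_keys_iff_lookup_eq_zero cong: if_cong)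
    qed
  qed
  moreover have "(\<Sum>l\<in>L. restr (homog n l) p) \<in> S"
  proof (rule vs.subspace_sum [OF S])
    fix l assume "l \<in> L"
    then obtain b a where "(b, a) \<in> keys p" "l = dg n b \<otimes> a"
      by (auto simp: L_def)
    then have "l \<in> carrier \<Lambda>"
      using p dg_closed by (auto simp: supp_in_def)
    then show "restr (homog n l) p \<in> S"
      by (rule comp)
  qed
  ultimately show ?thesis
    by simp
qed

lemma image_D_if_cycle:
  assumes p: "p \<in> supp_in (homog n l)" and l: "l \<in> carrier \<Lambda>" and c: "dehom p \<in> cyc n l"
  shows "p \<in> D n ` P (Suc n)"
proof -
  obtain v where v: "v \<in> str (Suc n) l" "dehom p = d n v"
    using exact [OF l, of n] c by blast
  define q where "q = homogenise (Suc n) l v"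
  have q: "q \<in> supp_in (homog (Suc n) l)"
    unfolding q_def by (rule homogenise_homog [OF v(1)])
  have "p = D n q"
    by (rule dehom_inj [OF p D_homog [OF q]])
      (use dehom_D [OF homog_P [OF q]] v(2) in \<open>simp add: q_def dehom_homogenise\<close>)
  then show ?thesis
    using homog_P [OF q] by blast
qed

lemma subspace_image_D: "vs.subspace (D n ` P (Suc n))"
  by (rule vsp.linear_subspace_image [OF lin_D subspace_supp_in])

lemma exact_D:
  assumes p: "p \<in> P (Suc n)"
  shows "D n p = 0 \<longleftrightarrow> p \<in> D (Suc n) ` P (Suc (Suc n))"
proof
  assume 0: "D n p = 0"
  show "p \<in> D (Suc n) ` P (Suc (Suc n))"
  proof (rule in_subspace_if_components [OF p subspace_image_D])
    fix l assume l: "l \<in> carrier \<Lambda>"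
    let ?p = "restr (homog (Suc n) l) p"
    have "D n ?p = restr (homog n l) (D n p)"
      by (rule homog_map_restr [OF lin_D _ p l]) (auto intro: D_homog)
    then have "d n (dehom ?p) = 0"
      using dehom_D [of ?p n] homog_P [OF restr_in] by (simp add: 0 lin_0 [OF lin_restr] lin_0 [OF lin_dehom])
    then show "?p \<in> D (Suc n) ` P (Suc (Suc n))"
      by (intro image_D_if_cycle [OF restr_in l] cycI dehom_str restr_in)
  qed
next
  assume "p \<in> D (Suc n) ` P (Suc (Suc n))"
  then obtain q where q: "q \<in> P (Suc (Suc n))" "p = D (Suc n) q"
    by blast
  show "D n p = 0"
    unfolding q(2)
  proof (rule lin_eq_supp_in [OF lin_compose [OF lin_D lin_D] lin_zero q(1)])
    fix z assume "z \<in> B (Suc (Suc n)) \<times> carrier \<Lambda>"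
    then obtain b a where z: "z = (b, a)" "b \<in> B (Suc (Suc n))" "a \<in> carrier \<Lambda>"
      by auto
    note h = D_bvec [OF in_homog [OF z(2,3)]]
    show "D n (D (Suc n) (bvec z)) = 0"
      unfolding z(1)
    proof (rule dehom_inj [OF D_homog [OF h(1)]])
      show "dehom (D n (D (Suc n) (bvec (b, a)))) = dehom 0"
        using dehom_D [OF homog_P [OF h(1)]] by (simp add: h(2) d_d_bvec z lin_0 [OF lin_dehom])
    qed (rule vs.subspace_0 [OF subspace_supp_in])
  qed
qed

lemma const_part_restr_one:
  assumes p: "p \<in> P 0"
  shows "const_part (restr (homog 0 \<one>) p) = restr (at_deg B dg 0 \<one>) (const_part p)"
proof (rule lin_eq_supp_in [OF lin_compose [OF lin_const_part lin_restr] lin_compose [OF lin_restr lin_const_part] p])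
  fix z assume "z \<in> B 0 \<times> carrier \<Lambda>"
  then obtain b a where z: "z = (b, a)" "b \<in> B 0" "a \<in> carrier \<Lambda>"
    by auto
  have "(b, a) \<in> homog 0 \<one> \<longleftrightarrow> dg 0 b = \<one> \<and> a = \<one>"
    using z dg_closed mult_eq_one_iff by (auto simp: homog_def)
  then show "const_part (restr (homog 0 \<one>) (bvec z)) = restr (at_deg B dg 0 \<one>) (const_part (bvec z))"
    using z(2) by (auto simp: z(1) restr_def lin_0 [OF lin_const_part] at_deg_def lin_0 [OF lin_lext])
qed

lemma str_one: "str n \<one> = supp_in (at_deg B dg n \<one>)"
proof -
  have "below \<Lambda> B dg n \<one> = at_deg B dg n \<one>"
    using divides_one dg_closed by (auto simp: below_def at_deg_def)
  then show ?thesis by simp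
qed

lemma exact_D_aug:
  assumes p: "p \<in> P 0"
  shows "\<eta>1 (const_part p) = 0 \<longleftrightarrow> p \<in> D 0 ` P (Suc 0)"
proof
  assume 0: "\<eta>1 (const_part p) = 0"
  show "p \<in> D 0 ` P (Suc 0)"
  proof (rule in_subspace_if_components [OF p subspace_image_D])
    fix l assume l: "l \<in> carrier \<Lambda>"
    let ?p = "restr (homog 0 l) p"
    have "\<eta> (dehom ?p) = 0" if "l = \<one>"
      using 0 const_part_restr_one [OF p] dehom_one [of ?p 0] that by (simp add: \<eta>1_def)
    then have "dehom ?p \<in> cyc 0 l"
      using dehom_str [OF restr_in] by (simp add: strand_cycles_def)
    then show "?p \<in> D 0 ` P (Suc 0)"
      by (rule image_D_if_cycle [OF restr_in l])
  qed
next
  assume "p \<in> D 0 ` P (Suc 0)"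
  then obtain q where q: "q \<in> P (Suc 0)" "p = D 0 q"
    by blast
  have "\<eta>1 0 = 0"
    by (simp add: \<eta>1_def lin_0 [OF lin_restr] aug_0)
  then have "vs.subspace {p. \<eta>1 (const_part p) = 0}"
    by (intro vs.subspaceI) (auto simp: lin_simps [OF lin_const_part] \<eta>1_add \<eta>1_scl)
  then have "D 0 q \<in> {p. \<eta>1 (const_part p) = 0}"
  proof (rule lin_in_subspace [OF lin_D])
    fix z assume "z \<in> keys q"
    then obtain b a where z: "z = (b, a)" "b \<in> B (Suc 0)" "a \<in> carrier \<Lambda>"
      using q(1) by (auto simp: supp_in_def)
    define l where "l = dg (Suc 0) b \<otimes> a"
    have h: "D 0 (bvec (b, a)) \<in> supp_in (homog 0 l)" "dehom (D 0 (bvec (b, a))) = d 0 (bvec b)"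
      unfolding l_def by (rule D_bvec [OF in_homog [OF z(2,3)]])+
    have "\<eta>1 (const_part (D 0 (bvec (b, a)))) = 0"
    proof (cases "l = \<one>")
      case True
      then have "dg (Suc 0) b = \<one>"
        using z dg_closed mult_eq_one_iff by (auto simp: l_def)
      then have "bvec b \<in> str (Suc 0) \<one>"
        using z(2) by (simp add: str_one at_deg_def)
      then have "\<eta> (d 0 (bvec b)) = 0" and "d 0 (bvec b) \<in> str 0 \<one>"
        by (auto intro: aug_d d_strand)
      then show ?thesis
        using h True dehom_one [of "D 0 (bvec (b, a))" 0] by (simp add: \<eta>1_def restr_id str_one)
    next
      case False
      have "restr (at_deg B dg 0 \<one>) (const_part (D 0 (bvec (b, a)))) = 0"
        unfolding const_part_homog [OF h(1)]
        by (rule restr_eq_0 [OF restr_in]) (use False in \<open>auto simp: at_deg_def\<close>)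
      then show ?thesis
        by (simp add: \<eta>1_def aug_0)
    qed
    then show "D 0 (bvec z) \<in> {p. \<eta>1 (const_part p) = 0}"
      by (simp add: z(1))
  qed
  then show "\<eta>1 (const_part p) = 0"
    by (simp add: q(2))
qed

theorem graded_resolution: "graded_free_resolution \<Lambda> Res (residue_component \<Lambda>) graded_resolution"
proof -
  let ?F = graded_resolution
  have sel: "res_basis ?F = B" "res_deg ?F = dg" "res_diff ?F n = (\<lambda>f. cur (D n (uncur f)))"
    "res_aug ?F = (\<lambda>f. \<kappa> (\<eta>1 (const_part (uncur f))))" for n
    by (simp_all add: graded_resolution_def)
  have mod: "res_module \<Lambda> ?F n = FM (B n)" and comp: "res_component \<Lambda> ?F n l = cur ` supp_in (homog n l)" for n l
    by (simp_all add: res_module_def res_component_def sel free_component_eq)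
  have FM: "carrier (FM (B n)) = cur ` P n" for n
    by (auto simp: FM_carrier_iff)
  have diff_hom: "res_diff ?F n \<in> module_hom A (FM (B (Suc n))) (FM (B n))" for n
    unfolding module_hom_def FM sel
    by (auto simp: A_carrier_iff add_FM smult_FM D_P D_act lin_add [OF lin_D])
  have aug_hom: "res_aug ?F \<in> module_hom A (FM (B 0)) Res"
    unfolding module_hom_def FM sel
    by (auto simp: A_carrier_iff carrier_Res add_FM smult_FM add_Res smult_Res const_part_act
        lin_add [OF lin_const_part] \<eta>1_add \<eta>1_scl)
  have diff_comp: "res_diff ?F n ` (cur ` supp_in (homog (Suc n) l)) \<subseteq> cur ` supp_in (homog n l)" for n l
    unfolding sel by (auto intro: D_homog)
  have aug_comp: "res_aug ?F ` (cur ` supp_in (homog 0 l)) \<subseteq> residue_component \<Lambda> l" if l: "l \<in> carrier \<Lambda>" for l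
  proof (cases "l = \<one>")
    case True
    then show ?thesis
      by (auto simp: sel residue_component_eq)
  next
    case False
    have "\<eta>1 (const_part p) = 0" if "p \<in> supp_in (homog 0 l)" for p
    proof -
      have "restr (at_deg B dg 0 \<one>) (const_part p) = 0"
        unfolding const_part_homog [OF that]
        by (rule restr_eq_0 [OF restr_in]) (use False in \<open>auto simp: at_deg_def\<close>)
      then show ?thesis
        by (simp add: \<eta>1_def aug_0)
    qed
    then show ?thesis
      using False l by (auto simp: sel residue_component_eq)
  qed
  have onto: "res_aug ?F ` carrier (FM (B 0)) = carrier Res"
  proof (intro equalityI subsetI)
    fix y assume "y \<in> carrier Res"
    then obtain c where c: "y = \<kappa> c"
      by (auto simp: carrier_Res)
    obtain v where v: "v \<in> str 0 \<one>" "\<eta> v = 1"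
      using aug_onto by blast
    define p where "p = homogenise 0 \<one> (scl c v)"
    have cv: "scl c v \<in> str 0 \<one>"
      by (rule vs.subspace_scale [OF subspace_supp_in v(1)])
    have p: "p \<in> supp_in (homog 0 \<one>)"
      unfolding p_def by (rule homogenise_homog [OF cv])
    have "const_part p = scl c v"
      using dehom_one [OF p] by (simp add: p_def dehom_homogenise)
    then have "\<eta>1 (const_part p) = c"
      using restr_id [OF cv [unfolded str_one]] v(2) by (simp add: \<eta>1_def aug_scl)
    then show "y \<in> res_aug ?F ` carrier (FM (B 0))"
      unfolding FM sel c using homog_P [OF p] by (intro image_eqI [of _ _ "cur p"]) auto
  qed (auto simp: sel carrier_Res)
  have ker0: "a_kernel (FM (B 0)) Res (res_aug ?F) = res_diff ?F 0 ` carrier (FM (B (Suc 0)))"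
    unfolding a_kernel_def' FM sel zero_Res using exact_D_aug D_P by (auto simp: image_image)
  have ker: "a_kernel (FM (B (Suc n))) (FM (B n)) (res_diff ?F n) = res_diff ?F (Suc n) ` carrier (FM (B (Suc (Suc n))))" for n
    unfolding a_kernel_def' FM sel zero_FM using exact_D [of _ n] D_P [of _ "Suc n"] by (auto simp: image_image)
  show ?thesis
    unfolding graded_free_resolution_def mod comp
    using dg_closed diff_hom aug_hom diff_comp aug_comp onto ker0 ker by (simp add: sel(1,2) Pi_def)
qed

end

text \<open>The basis elements of the resolution that defines \<^const>\<open>Tor\<close> are pairs of a list and an element of the
  module. The chains of divisors become such pairs under any injective map.\<close>

lemma strand_resolution_reindex:
  fixes d :: "nat \<Rightarrow> ('b \<Rightarrow>\<^sub>0 'k::field) \<Rightarrow> ('b \<Rightarrow>\<^sub>0 'k)" and e :: "'b \<Rightarrow> 'c"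
  assumes "strand_resolution G B dg d \<eta>" and e: "inj e"
  shows "\<exists>(B' :: nat \<Rightarrow> 'c set) dg' (d' :: nat \<Rightarrow> ('c \<Rightarrow>\<^sub>0 'k) \<Rightarrow> ('c \<Rightarrow>\<^sub>0 'k)) \<eta>'. strand_resolution G B' dg' d' \<eta>'"
proof -
  interpret C: strand_resolution G B dg d \<eta>
    by (rule assms(1))
  define e' where "e' = inv_into UNIV e"
  have e'e [simp]: "e' (e b) = b" for b
    using e by (simp add: e'_def)
  define E :: "('b \<Rightarrow>\<^sub>0 'k) \<Rightarrow> ('c \<Rightarrow>\<^sub>0 'k)" where "E = lext (\<lambda>b. bvec (e b))"
  define E' :: "('c \<Rightarrow>\<^sub>0 'k) \<Rightarrow> ('b \<Rightarrow>\<^sub>0 'k)" where "E' = lext (\<lambda>c. bvec (e' c))"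
  have lin_E: "lin E" and lin_E': "lin E'"
    by (auto simp: E_def E'_def)
  have E'E [simp]: "E' (E v) = v" for v
    by (rule lin_eqI [OF lin_compose [OF lin_E' lin_E] lin_id]) (simp add: E_def E'_def)
  define B' where "B' n = e ` B n" for n
  define dg' where "dg' n c = dg n (e' c)" for n c
  define d' where "d' n v = E (d n (E' v))" for n v
  define \<eta>' where "\<eta>' v = \<eta> (E' v)" for v
  have below: "below G B' dg' n l = e ` below G B dg n l" for n l
    by (auto simp: below_def B'_def dg'_def)
  have suppE: "E v \<in> supp_in (e ` Y)" if "v \<in> supp_in Y" for v Y
    by (rule lin_supp_in [OF lin_E that]) (simp add: E_def)
  have supp: "supp_in (e ` Y) = E ` supp_in Y" for Y
  proof (intro equalityI subsetI)
    fix w :: "'c \<Rightarrow>\<^sub>0 'k" assume w: "w \<in> supp_in (e ` Y)"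
    show "w \<in> E ` supp_in Y"
    proof (rule image_eqI)
      show "E' w \<in> supp_in Y"
        by (rule lin_supp_in [OF lin_E' w]) (auto simp: E'_def)
      show "w = E (E' w)"
        by (rule lin_eq_supp_in [OF lin_id lin_compose [OF lin_E lin_E'] w]) (auto simp: E'_def E_def)
    qed
  qed (auto intro: suppE)
  have E0: "E v = 0 \<longleftrightarrow> v = 0" for v
    using E'E [of v] lin_0 [OF lin_E] lin_0 [OF lin_E'] by metis
  have lin_d': "lin (d' n)" for n
    unfolding d'_def by (rule lin_compose [OF lin_E lin_compose [OF C.lin_d lin_E']])
  have "strand_resolution G B' dg' d' \<eta>'"
  proof
    show "dg' n b \<in> carrier G" if "b \<in> B' n" for b n
      using that C.dg_closed by (auto simp: B'_def dg'_def)
    show "\<exists>v\<in>supp_in (below G B' dg' 0 \<one>\<^bsub>G\<^esub>). \<eta>' v = 1"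
      using C.aug_onto by (auto simp: below supp \<eta>'_def)
    show "\<eta>' (u + v) = \<eta>' u + \<eta>' v" "\<eta>' (scl c v) = c * \<eta>' v" for u v c
      by (simp_all add: \<eta>'_def lin_add [OF lin_E'] lin_scl [OF lin_E'] C.aug_add C.aug_scl)
    show "d' n (u + v) = d' n u + d' n v" "d' n (scl c v) = scl c (d' n v)" for n u v c
      by (simp_all add: lin_add [OF lin_d'] lin_scl [OF lin_d'])
    show "d' n ` supp_in (below G B' dg' (Suc n) l) = strand_cycles G B' dg' d' \<eta>' n l" if l: "l \<in> carrier G" for n l
    proof -
      have "d' n ` supp_in (below G B' dg' (Suc n) l) = E ` d n ` C.strand (Suc n) l"
        by (simp add: below supp image_image d'_def)
      also have "\<dots> = E ` C.cyc n l"
        by (simp only: C.exact [OF l])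
      also have "\<dots> = strand_cycles G B' dg' d' \<eta>' n l"
        unfolding strand_cycles_def below supp by (cases n) (auto simp: \<eta>'_def d'_def E0)
      finally show ?thesis .
    qed
  qed
  then show ?thesis
    by blast
qed

text \<open>The resolution in the definition of \<^const>\<open>Tor\<close> is an arbitrary one with basis elements of a
  fixed type. Since the bar resolution provides one, the chosen object is a resolution.\<close>

theorem some_resolution_exists:
  fixes \<Lambda> :: "'a monoid"
  assumes "divisor_finite_monoid \<Lambda>"
  shows "record_resolution \<Lambda> (some_resolution \<Lambda> (residue_module \<Lambda> :: ('a \<Rightarrow> 'k::field, _) module) (residue_component \<Lambda>))"
proof -
  interpret M: divisor_finite_monoid \<Lambda>
    by (rule assms)
  interpret A: reduced_monoid_algebra \<Lambda> "TYPE('k)"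
    by unfold_locales
  have "inj (\<lambda>ts :: 'a list. (ts, undefined :: ('a \<Rightarrow> 'k) set))"
    by (auto simp: inj_on_def)
  from strand_resolution_reindex [OF M.bar.strand_resolution_axioms this]
  obtain B' :: "nat \<Rightarrow> ('a list \<times> ('a \<Rightarrow> 'k) set) set" and dg' d' \<eta>'
    where "strand_resolution \<Lambda> B' dg' (d' :: nat \<Rightarrow> (_ \<Rightarrow>\<^sub>0 'k) \<Rightarrow> (_ \<Rightarrow>\<^sub>0 'k)) \<eta>'"
    by blast
  then interpret S: strand_resolution \<Lambda> B' dg' d' \<eta>' .
  interpret R: strands_to_resolution \<Lambda> "TYPE('k)" B' dg' d' \<eta>'
    by unfold_locales (rule S.dg_closed)
  have "graded_free_resolution \<Lambda> A.Res (residue_component \<Lambda>)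
    (some_resolution \<Lambda> A.Res (residue_component \<Lambda>))"
    unfolding some_resolution_def by (rule someI [of "graded_free_resolution \<Lambda> A.Res (residue_component \<Lambda>)", OF R.graded_resolution])
  then show ?thesis
    by (intro record_resolution.intro A.reduced_monoid_algebra_axioms record_resolution_axioms.intro)
qed


section \<open>Affine monoids have finitely many divisors\<close>

text \<open>Dickson's lemma, in the form that each sequence of vectors of natural numbers has a subsequence in which
  all coordinates increase: coordinates are treated one after another, and a monotone sequence of
  natural numbers that decreases is eventually constant.\<close>

lemma dickson:
  fixes s :: "nat \<Rightarrow> 'c \<Rightarrow> nat"
  assumes "finite A"
  shows "\<exists>r :: nat \<Rightarrow> nat. strict_mono r \<and> (\<forall>a\<in>A. incseq (\<lambda>n. s (r n) a))"
  using assms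
proof (induction A)
  case empty
  have "strict_mono (\<lambda>n :: nat. n)"
    by (simp add: strict_mono_def)
  then show ?case by blast
next
  case (insert a A)
  then obtain r where r: "strict_mono r" "\<forall>a\<in>A. incseq (\<lambda>n. s (r n) a)"
    by blast
  obtain f where f: "strict_mono f" "monoseq (\<lambda>n. s (r (f n)) a)"
    using seq_monosub [of "\<lambda>n. s (r n) a"] by blast
  have "\<exists>g :: nat \<Rightarrow> nat. strict_mono g \<and> incseq (\<lambda>n. s (r (g n)) a)"
  proof (cases "incseq (\<lambda>n. s (r (f n)) a)")
    case True
    with f show ?thesis by blast
  next
    case False
    with f(2) have dec: "decseq (\<lambda>n. s (r (f n)) a)"
      by (auto simp: monoseq_iff)
    obtain m where m: "\<And>n. s (r (f m)) a \<le> s (r (f n)) a"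
      using ex_has_least_nat [of "\<lambda>_. True" 0 "\<lambda>n. s (r (f n)) a"] by blast
    have "s (r (f (n + m))) a = s (r (f m)) a" for n
      using decseqD [OF dec, of m "n + m"] m [of "n + m"] by simp
    then have "incseq (\<lambda>n. s (r (f (n + m))) a)"
      by (simp add: incseq_def)
    moreover have "strict_mono (\<lambda>n. f (n + m))"
      using f(1) by (simp add: strict_mono_def)
    ultimately show ?thesis by blast
  qed
  then obtain g where g: "strict_mono g" "incseq (\<lambda>n. s (r (g n)) a)"
    by blast
  have "strict_mono (\<lambda>n. r (g n))"
    using r(1) g(1) by (simp add: strict_mono_def)
  moreover have "incseq (\<lambda>n. s (r (g n)) b)" if "b \<in> A" for b
    using r(2) that g(1) by (simp add: incseq_def strict_mono_less_eq)
  ultimately show ?case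
    using g(2) by (intro exI [of _ "\<lambda>n. r (g n)"]) auto
qed

text \<open>Write \<open>l = x\<^sub>n + y\<^sub>n\<close> with distinct \<open>x\<^sub>n\<close>, and express \<open>x\<^sub>n\<close> and \<open>y\<^sub>n\<close> as combinations of
  finitely many generators. For two indices \<open>i < j\<close> all coefficients increase by Dickson's lemma, so that
  \<open>x\<^sub>j = x\<^sub>i + y\<close> and \<open>y\<^sub>j = y\<^sub>i + z\<close>. Then \<open>y + z = 0\<close> by cancellation, whence \<open>y = 0\<close> and
  \<open>x\<^sub>i = x\<^sub>j\<close>.\<close>

lemma affine_divisor_finite:
  assumes "affine_monoid G"
  shows "divisor_finite_monoid G"
proof -
  interpret affine_monoid G
    by (rule assms)
  interpret reduced_monoid G
    by unfold_locales (rule no_invertibles)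
  obtain A where A: "finite A" "A \<subseteq> carrier G" "\<forall>H. submonoid H G \<and> A \<subseteq> H \<longrightarrow> H = carrier G"
    using finitely_generated by (elim exE conjE) (rule that)
  define ev where "ev k = (\<Otimes>\<^bsub>G\<^esub>a\<in>A. a [^]\<^bsub>G\<^esub> (k a :: nat))" for k
  have ev_closed: "ev k \<in> carrier G" for k
    unfolding ev_def using A(2) by (intro finprod_closed) auto
  have ev_mult: "ev k \<otimes>\<^bsub>G\<^esub> ev m = ev (\<lambda>a. k a + m a)" for k m
  proof -
    have "ev (\<lambda>a. k a + m a) = (\<Otimes>\<^bsub>G\<^esub>a\<in>A. a [^]\<^bsub>G\<^esub> k a \<otimes>\<^bsub>G\<^esub> a [^]\<^bsub>G\<^esub> m a)"
      unfolding ev_def by (rule finprod_cong') (use A(2) in \<open>auto simp: nat_pow_mult\<close>)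
    also have "\<dots> = ev k \<otimes>\<^bsub>G\<^esub> ev m"
      unfolding ev_def by (rule finprod_multf) (use A(2) in auto)
    finally show ?thesis ..
  qed
  have "submonoid (range ev) G"
  proof
    show "range ev \<subseteq> carrier G"
      using ev_closed by auto
    show "x \<otimes>\<^bsub>G\<^esub> y \<in> range ev" if "x \<in> range ev" "y \<in> range ev" for x y
      using that ev_mult by auto
    have "ev (\<lambda>_. 0) = \<one>\<^bsub>G\<^esub>"
      unfolding ev_def by (rule finprod_one_eqI) simp
    then show "\<one>\<^bsub>G\<^esub> \<in> range ev"
      by (intro range_eqI) (rule sym)
  qed
  moreover have "A \<subseteq> range ev"
  proof
    fix a assume a: "a \<in> A"
    have "ev (\<lambda>b. if a = b then 1 else 0) = (\<Otimes>\<^bsub>G\<^esub>b\<in>A. if a = b then b else \<one>\<^bsub>G\<^esub>)"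
      unfolding ev_def by (rule finprod_cong') (use A(2) in auto)
    also have "\<dots> = a"
      using finprod_singleton [OF a A(1), of "\<lambda>b. b"] A(2) by auto
    finally show "a \<in> range ev"
      by (intro range_eqI) (rule sym)
  qed
  ultimately have onto: "range ev = carrier G"
    using A(3) by simp
  have "finite {x \<in> carrier G. x divides\<^bsub>G\<^esub> l}" if l: "l \<in> carrier G" for l
  proof (rule ccontr)
    assume "infinite {x \<in> carrier G. x divides\<^bsub>G\<^esub> l}"
    then obtain x :: "nat \<Rightarrow> 'a" where x: "inj x" "range x \<subseteq> {x \<in> carrier G. x divides\<^bsub>G\<^esub> l}"
      by (auto dest: infinite_countable_subset)
    have "\<exists>k m. x n = ev k \<and> l = ev k \<otimes>\<^bsub>G\<^esub> ev m" for n :: nat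
    proof -
      have "x n \<in> carrier G" "x n divides\<^bsub>G\<^esub> l"
        using x(2) by auto
      then obtain y where y: "y \<in> carrier G" "l = x n \<otimes>\<^bsub>G\<^esub> y"
        by (auto simp: factor_def)
      obtain k m where "x n = ev k" "y = ev m"
        using \<open>x n \<in> carrier G\<close> y(1) unfolding onto [symmetric] by blast
      with y(2) show ?thesis
        by (intro exI [of _ k] exI [of _ m]) simp
    qed
    then have "\<forall>n. \<exists>k m. x n = ev k \<and> l = ev k \<otimes>\<^bsub>G\<^esub> ev m"
      by (intro allI)
    then obtain k m where km: "\<And>n. x n = ev (k n)" "\<And>n. l = ev (k n) \<otimes>\<^bsub>G\<^esub> ev (m n)"
      unfolding choice_iff by (elim exE) (rule that, auto)
    \<comment> \<open>The coefficients of both summands form one vector, so that a single subsequence serves both.\<close>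
    define s where "s n c = (case c of Inl a \<Rightarrow> k n a | Inr a \<Rightarrow> m n a)" for n and c :: "'a + 'a"
    obtain q where q: "strict_mono q" "\<forall>c\<in>A <+> A. incseq (\<lambda>n. s (q n) c)"
      using dickson [of "A <+> A" s] A(1) by auto
    let ?i = "q 0" and ?j = "q 1"
    have le: "k ?i a \<le> k ?j a" "m ?i a \<le> m ?j a" if "a \<in> A" for a
      using bspec [OF q(2), of "Inl a"] bspec [OF q(2), of "Inr a"] that by (auto simp: s_def incseq_def)
    have diff: "\<exists>y \<in> carrier G. ev f' = ev f \<otimes>\<^bsub>G\<^esub> y" if "\<And>a. a \<in> A \<Longrightarrow> f a \<le> f' a" for f f'
    proof (rule bexI [OF _ ev_closed])
      show "ev f' = ev f \<otimes>\<^bsub>G\<^esub> ev (\<lambda>a. f' a - f a)"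
        unfolding ev_mult unfolding ev_def by (rule finprod_cong') (use A(2) that in auto)
    qed
    obtain y z where y: "y \<in> carrier G" "ev (k ?j) = ev (k ?i) \<otimes>\<^bsub>G\<^esub> y"
      and z: "z \<in> carrier G" "ev (m ?j) = ev (m ?i) \<otimes>\<^bsub>G\<^esub> z"
      using diff [of "k ?i" "k ?j"] diff [of "m ?i" "m ?j"] le by blast
    have "l \<otimes>\<^bsub>G\<^esub> \<one>\<^bsub>G\<^esub> = ev (k ?j) \<otimes>\<^bsub>G\<^esub> ev (m ?j)"
      using km(2) [of ?j] l by simp
    also have "\<dots> = (ev (k ?i) \<otimes>\<^bsub>G\<^esub> ev (m ?i)) \<otimes>\<^bsub>G\<^esub> (y \<otimes>\<^bsub>G\<^esub> z)"
      unfolding y(2) z(2) using y(1) z(1) ev_closed by (simp add: m_ac)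
    also have "\<dots> = l \<otimes>\<^bsub>G\<^esub> (y \<otimes>\<^bsub>G\<^esub> z)"
      using km(2) [of ?i] by simp
    finally have "y \<otimes>\<^bsub>G\<^esub> z = \<one>\<^bsub>G\<^esub>"
      using l y(1) z(1) l_cancel [of l "\<one>\<^bsub>G\<^esub>" "y \<otimes>\<^bsub>G\<^esub> z"] by simp
    then have "y = \<one>\<^bsub>G\<^esub>"
      using no_invertibles y(1) z(1) by blast
    then have "x ?j = x ?i"
      using y(2) ev_closed by (simp add: km(1))
    then have "?j = ?i"
      using x(1) by (simp add: inj_eq)
    moreover have "?i < ?j"
      using q(1) by (simp add: strict_mono_def)
    ultimately show False
      by simp
  qed
  then show ?thesis
    by (intro divisor_finite_monoid.intro reduced_monoid_axioms divisor_finite_monoid_axioms.intro)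
qed

section \<open>The normal form in the monoid with an adjoined fraction\<close>

locale adjoin =
  divisor_finite_monoid \<Lambda> for \<Lambda> :: "'a monoid" (structure) +
  fixes \<rho> u u' :: 'a and r :: nat
  assumes r: "r \<ge> 2" and u: "u \<in> carrier \<Lambda> - {\<one>}" and u': "u' \<in> carrier \<Lambda> - {\<one>}" and rho: "\<rho> = u \<otimes> u'"
begin

lemma rho_closed [simp]: "\<rho> \<in> carrier \<Lambda>"
  using u u' rho by simp

text \<open>The normal form of \<open>l + k \<alpha>\<close>: multiples of \<open>r \<alpha>\<close> are replaced by multiples of \<open>\<rho>\<close>. It is invariant
  under the generating relation and equivalent to its argument, so it decides the congruence.\<close>

definition nf :: "'a \<times> nat \<Rightarrow> 'a \<times> nat" where
  "nf = (\<lambda>(l, k). (l \<otimes> (\<rho> [^] (k div r)), k mod r))"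

definition step :: "'a \<times> nat \<Rightarrow> 'a \<times> nat \<Rightarrow> bool" where
  "step p q \<longleftrightarrow> (\<exists>l \<in> carrier \<Lambda>. \<exists>k. p = (l \<otimes> \<rho>, k) \<and> q = (l, r + k))"

lemma nf_step: "step p q \<Longrightarrow> nf p = nf q"
  using r by (auto simp: step_def nf_def m_ac)

lemma nf_equiv: "equivclp step p q \<Longrightarrow> nf p = nf q"
proof (induction rule: equivclp_induct)
  case (step y z)
  then show ?case using nf_step by metis
qed simp

lemma equiv_nf: "l \<in> carrier \<Lambda> \<Longrightarrow> equivclp step (l, k) (nf (l, k))"
proof (induction k arbitrary: l rule: less_induct)
  case (less k)
  show ?case
  proof (cases "k < r")
    case True
    with less(2) have "nf (l, k) = (l, k)"
      by (simp add: nf_def)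
    then show ?thesis by simp
  next
    case False
    define j where "j = k - r"
    have k: "k = r + j" and jk: "j < k"
      using False r by (auto simp: j_def)
    have st: "step (l \<otimes> \<rho>, j) (l, k)"
      using less(2) by (auto simp: step_def k)
    then have "equivclp step (l, k) (l \<otimes> \<rho>, j)"
      by (meson equivclp_sym r_into_equivclp)
    also have "equivclp step (l \<otimes> \<rho>, j) (nf (l \<otimes> \<rho>, j))"
      using less by (intro less(1) jk) auto
    finally show ?thesis
      using nf_step [OF st] by (simp add: equivclp_trans)
  qed
qed

lemma carrier_sum: "carrier (\<Lambda> \<times>\<times> nat_add_monoid) = carrier \<Lambda> \<times> UNIV"
  by (simp add: nat_add_monoid_def)

lemma mult_sum: "(l, k) \<otimes>\<^bsub>\<Lambda> \<times>\<times> nat_add_monoid\<^esub> (m, j) = (l \<otimes> m, k + j)"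
  by (simp add: nat_add_monoid_def DirProd_def)

lemma adjoin_rel_eq: "adjoin_rel \<Lambda> \<rho> r = {(p, q). p \<in> carrier \<Lambda> \<times> UNIV \<and> q \<in> carrier \<Lambda> \<times> UNIV \<and> nf p = nf q}"
proof -
  have eqv: "equivclp step p q \<longleftrightarrow> nf p = nf q"
    if p: "p \<in> carrier \<Lambda> \<times> UNIV" and q: "q \<in> carrier \<Lambda> \<times> UNIV" for p q
  proof
    assume eq: "nf p = nf q"
    have "equivclp step p (nf p)" "equivclp step q (nf q)"
      using equiv_nf p q by auto
    then show "equivclp step p q"
      unfolding eq by (meson equivclp_sym equivclp_trans)
  qed (rule nf_equiv)
  have step: "(\<lambda>p q. \<exists>l \<in> carrier \<Lambda>. \<exists>k. p = (l \<otimes> \<rho>, k) \<and> q = (l, r + k)) = step"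
    by (simp add: fun_eq_iff step_def)
  show ?thesis
    unfolding adjoin_rel_def carrier_sum step by (rule Collect_cong) (auto simp: eqv)
qed

definition cl :: "'a \<Rightarrow> nat \<Rightarrow> ('a \<times> nat) set" where
  "cl l k = adjoin_class \<Lambda> \<rho> r (l, k)"

lemma cl_fibre: "l \<in> carrier \<Lambda> \<Longrightarrow> cl l k = {q \<in> carrier \<Lambda> \<times> UNIV. nf q = nf (l, k)}"
  by (auto simp: cl_def adjoin_class_def adjoin_rel_eq)

lemma cl_self: "l \<in> carrier \<Lambda> \<Longrightarrow> (l, k) \<in> cl l k"
  by (simp add: cl_fibre)

lemma cl_eq_nf: "l \<in> carrier \<Lambda> \<Longrightarrow> m \<in> carrier \<Lambda> \<Longrightarrow> cl l k = cl m j \<longleftrightarrow> nf (l, k) = nf (m, j)"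
  using cl_self [of l k] by (auto simp: cl_fibre)

abbreviation \<Lambda>' :: "('a \<times> nat) set monoid" where
  "\<Lambda>' \<equiv> adjoin_fraction \<Lambda> \<rho> r"

lemma carrier_ext: "carrier \<Lambda>' = {cl l k | l k. l \<in> carrier \<Lambda>}"
proof -
  have "carrier \<Lambda>' = (carrier \<Lambda> \<times> UNIV) // adjoin_rel \<Lambda> \<rho> r"
    unfolding adjoin_fraction_def carrier_sum by simp
  then show ?thesis
    by (auto simp: quotient_def cl_def adjoin_class_def)
qed

lemma nf_mult:
  assumes "l \<in> carrier \<Lambda>" "m \<in> carrier \<Lambda>"
  shows "nf (l \<otimes> m, k + j) = nf (fst (nf (l, k)) \<otimes> fst (nf (m, j)), snd (nf (l, k)) + snd (nf (m, j)))"
proof -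
  have "(k + j) div r = k div r + j div r + (k mod r + j mod r) div r"
    by (rule div_add1_eq)
  then have "l \<otimes> m \<otimes> (\<rho> [^] ((k + j) div r)) =
      (l \<otimes> (\<rho> [^] (k div r))) \<otimes> (m \<otimes> (\<rho> [^] (j div r))) \<otimes> (\<rho> [^] ((k mod r + j mod r) div r))"
    using assms by (simp add: m_ac flip: nat_pow_mult)
  then show ?thesis
    by (simp add: nf_def mod_add_eq)
qed

lemma mult_ext:
  assumes "l \<in> carrier \<Lambda>" "m \<in> carrier \<Lambda>"
  shows "cl l k \<otimes>\<^bsub>\<Lambda>'\<^esub> cl m j = cl (l \<otimes> m) (k + j)"
proof -
  have eq: "adjoin_class \<Lambda> \<rho> r (p \<otimes>\<^bsub>\<Lambda> \<times>\<times> nat_add_monoid\<^esub> q) = cl (l \<otimes> m) (k + j)"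
    if pq: "p \<in> cl l k" "q \<in> cl m j" for p q
  proof -
    obtain l' k' m' j' where p: "p = (l', k')" and q: "q = (m', j')"
      by (cases p, cases q) auto
    have c: "l' \<in> carrier \<Lambda>" "m' \<in> carrier \<Lambda>" and n: "nf (l', k') = nf (l, k)" "nf (m', j') = nf (m, j)"
      using pq assms by (auto simp: p q cl_fibre)
    have "nf (l' \<otimes> m', k' + j') = nf (l \<otimes> m, k + j)"
      unfolding nf_mult [OF c] nf_mult [OF assms] n ..
    then have "cl (l' \<otimes> m') (k' + j') = cl (l \<otimes> m) (k + j)"
      using c assms by (simp add: cl_eq_nf)
    then show ?thesis
      unfolding p q mult_sum by (simp only: cl_def)
  qed
  have "cl l k \<otimes>\<^bsub>\<Lambda>'\<^esub> cl m j = (\<Union>p\<in>cl l k. \<Union>q\<in>cl m j. adjoin_class \<Lambda> \<rho> r (p \<otimes>\<^bsub>\<Lambda> \<times>\<times> nat_add_monoid\<^esub> q))"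
    by (simp add: adjoin_fraction_def)
  also have "\<dots> = (\<Union>p\<in>cl l k. \<Union>q\<in>cl m j. cl (l \<otimes> m) (k + j))"
    by (intro SUP_cong refl eq)
  also have "\<dots> = cl (l \<otimes> m) (k + j)"
    using cl_self assms by blast
  finally show ?thesis .
qed

lemma one_ext: "\<one>\<^bsub>\<Lambda>'\<^esub> = cl \<one> 0"
  by (simp add: adjoin_fraction_def cl_def nat_add_monoid_def)

lemma ext_cases:
  assumes "h \<in> carrier \<Lambda>'"
  obtains l k where "l \<in> carrier \<Lambda>" "k < r" "h = cl l k"
proof -
  obtain l k where l: "l \<in> carrier \<Lambda>" "h = cl l k"
    using assms by (auto simp: carrier_ext)
  have "cl l k = cl (l \<otimes> (\<rho> [^] (k div r))) (k mod r)"
    using l r by (subst cl_eq_nf) (simp_all add: nf_def)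
  then show thesis
    using l r by (intro that [of "l \<otimes> (\<rho> [^] (k div r))" "k mod r"]) auto
qed

lemma cl_closed: "l \<in> carrier \<Lambda> \<Longrightarrow> cl l k \<in> carrier \<Lambda>'"
  by (auto simp: carrier_ext)

text \<open>Cancellation reduces to that in \<open>\<Lambda>\<close> by comparing normal forms. An invertible element has \<open>\<rho>\<close>-multiples
  in its normal form only if \<open>\<rho>\<close> is invertible, which is excluded.\<close>

lemma reduced_ext: "reduced_monoid \<Lambda>'"
proof (intro reduced_monoid.intro comm_monoid_cancelI comm_monoidI reduced_monoid_axioms.intro)
  fix x y z assume "x \<in> carrier \<Lambda>'" "y \<in> carrier \<Lambda>'" "z \<in> carrier \<Lambda>'"
  then obtain l k m j n i where c: "l \<in> carrier \<Lambda>" "m \<in> carrier \<Lambda>" "n \<in> carrier \<Lambda>"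
    and x: "x = cl l k" and y: "y = cl m j" and z: "z = cl n i"
    by (meson ext_cases)
  show "x \<otimes>\<^bsub>\<Lambda>'\<^esub> y \<in> carrier \<Lambda>'" "x \<otimes>\<^bsub>\<Lambda>'\<^esub> y \<otimes>\<^bsub>\<Lambda>'\<^esub> z = x \<otimes>\<^bsub>\<Lambda>'\<^esub> (y \<otimes>\<^bsub>\<Lambda>'\<^esub> z)"
    "x \<otimes>\<^bsub>\<Lambda>'\<^esub> y = y \<otimes>\<^bsub>\<Lambda>'\<^esub> x" "\<one>\<^bsub>\<Lambda>'\<^esub> \<otimes>\<^bsub>\<Lambda>'\<^esub> x = x"
    using c by (simp_all add: x y z one_ext mult_ext cl_closed m_ac add_ac)
next
  fix a b c assume eq: "a \<otimes>\<^bsub>\<Lambda>'\<^esub> c = b \<otimes>\<^bsub>\<Lambda>'\<^esub> c" and "a \<in> carrier \<Lambda>'" "b \<in> carrier \<Lambda>'" "c \<in> carrier \<Lambda>'"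
  then obtain l k m j n i where c: "l \<in> carrier \<Lambda>" "m \<in> carrier \<Lambda>" "n \<in> carrier \<Lambda>" "k < r" "j < r"
    and a: "a = cl l k" and b: "b = cl m j" and cc: "c = cl n i"
    by (meson ext_cases)
  have nfs: "(k + i) mod r = (j + i) mod r"
    "l \<otimes> n \<otimes> (\<rho> [^] ((k + i) div r)) = m \<otimes> n \<otimes> (\<rho> [^] ((j + i) div r))"
    using eq c by (auto simp: a b cc mult_ext cl_eq_nf nf_def)
  have "r dvd k - j" "r dvd j - k"
    using nfs(1) mod_eq_dvd_iff_nat [of "j + i" "k + i" r] mod_eq_dvd_iff_nat [of "k + i" "j + i" r]
    by (cases "j \<le> k"; simp)+
  then have "k = j"
    using c(4,5) by (auto dest!: dvd_imp_le)
  then have "l \<otimes> (n \<otimes> (\<rho> [^] ((k + i) div r))) = m \<otimes> (n \<otimes> (\<rho> [^] ((k + i) div r)))"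
    using nfs(2) c by (simp add: m_assoc)
  then have "l = m"
    using c r_cancel [of l "n \<otimes> (\<rho> [^] ((k + i) div r))" m] by simp
  with \<open>k = j\<close> show "a = b"
    by (simp add: a b)
next
  fix x y assume "x \<in> carrier \<Lambda>'" "y \<in> carrier \<Lambda>'" and eq: "x \<otimes>\<^bsub>\<Lambda>'\<^esub> y = \<one>\<^bsub>\<Lambda>'\<^esub>"
  then obtain l k m j where c: "l \<in> carrier \<Lambda>" "m \<in> carrier \<Lambda>" "k < r" "j < r"
    and x: "x = cl l k" and y: "y = cl m j"
    by (meson ext_cases)
  have nfs: "(k + j) mod r = 0" "(l \<otimes> m) \<otimes> (\<rho> [^] ((k + j) div r)) = \<one>"
    using eq c r by (auto simp: x y one_ext mult_ext cl_eq_nf nf_def)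
  have lm: "l \<otimes> m = \<one>" "\<rho> [^] ((k + j) div r) = \<one>"
    using no_invertibles [OF _ _ nfs(2)] c by auto
  have "(k + j) div r = 0"
  proof (cases "(k + j) div r")
    case (Suc i)
    then have "\<rho> [^] i \<otimes> \<rho> = \<one>"
      using lm(2) by simp
    then have "u \<otimes> u' = \<one>"
      using no_invertibles [of "\<rho> [^] i" \<rho>] rho_closed by (simp add: rho [symmetric])
    then show ?thesis
      using no_invertibles [of u u'] u u' by auto
  qed simp
  then have "k + j = 0"
    using nfs(1) by (metis add_0 mod_mult_div_eq mult_0_right)
  moreover have "l = \<one> \<and> m = \<one>"
    using no_invertibles [OF c(1,2) lm(1)] .
  ultimately show "x = \<one>\<^bsub>\<Lambda>'\<^esub> \<and> y = \<one>\<^bsub>\<Lambda>'\<^esub>"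
    by (simp add: x y one_ext)
qed (use cl_closed [OF one_closed, of 0] in \<open>simp add: one_ext\<close>)

sublocale ext: fraction_extension \<Lambda> \<Lambda>' cl r \<rho> u u'
proof (intro fraction_extension.intro reduced_ext divisor_finite_monoid_axioms fraction_extension_axioms.intro)
  show "\<exists>l\<in>carrier \<Lambda>. \<exists>k<r. h = cl l k" if "h \<in> carrier \<Lambda>'" for h
    using that by (meson ext_cases)
  show "cl l k = cl m j \<longleftrightarrow> k mod r = j mod r \<and> l \<otimes> \<rho> [^] (k div r) = m \<otimes> \<rho> [^] (j div r)"
    if "l \<in> carrier \<Lambda>" "m \<in> carrier \<Lambda>" for l m k j
    using that by (auto simp: cl_eq_nf nf_def)
qed (use r u u' rho cl_closed mult_ext one_ext in auto)

end


section \<open>Formal series\<close>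

text \<open>The product of formal series in \<open>t\<close> and \<open>z\<close> is the convolution over the monoid of pairs of an
  exponent of \<open>t\<close> and an exponent of \<open>z\<close>. The ring axioms are proved for such convolutions.\<close>

definition conv :: "('a, 'm) monoid_scheme \<Rightarrow> ('a \<Rightarrow> int) \<Rightarrow> ('a \<Rightarrow> int) \<Rightarrow> 'a \<Rightarrow> int" where
  "conv N f g p = (\<Sum>(a, b) | a \<in> carrier N \<and> b \<in> carrier N \<and> a \<otimes>\<^bsub>N\<^esub> b = p. f a * g b)"

locale finite_decompositions = comm_monoid_cancel N for N :: "('a, 'm) monoid_scheme" (structure) +
  assumes finite_dec: "p \<in> carrier N \<Longrightarrow> finite {(a, b). a \<in> carrier N \<and> b \<in> carrier N \<and> a \<otimes> b = p}"
begin

abbreviation dec :: "'a \<Rightarrow> ('a \<times> 'a) set" where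
  "dec p \<equiv> {(a, b). a \<in> carrier N \<and> b \<in> carrier N \<and> a \<otimes> b = p}"

lemma finite_dec': "finite (dec p)"
proof (cases "p \<in> carrier N")
  case False
  then have "dec p = {}" by auto
  then show ?thesis by (simp only: finite.emptyI)
qed (rule finite_dec)

lemma conv_comm: "conv N f g = conv N g f"
proof
  fix p
  show "conv N f g p = conv N g f p"
    unfolding conv_def
    by (rule sum.reindex_bij_witness [of _ "\<lambda>(a, b). (b, a)" "\<lambda>(a, b). (b, a)"]) (auto simp: m_comm)
qed

text \<open>Both sides are sums over the decompositions into three factors.\<close>

lemma conv_assoc: "conv N (conv N f g) h = conv N f (conv N g h)"
proof
  fix p
  have "conv N (conv N f g) h p = (\<Sum>q\<in>dec p. \<Sum>s\<in>dec (fst q). f (fst s) * g (snd s) * h (snd q))"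
    unfolding conv_def by (simp add: split_def sum_distrib_right)
  also have "\<dots> = (\<Sum>(q, s)\<in>Sigma (dec p) (\<lambda>q. dec (fst q)). f (fst s) * g (snd s) * h (snd q))"
    by (intro sum.Sigma ballI finite_dec')
  also have "\<dots> = (\<Sum>(q, s)\<in>Sigma (dec p) (\<lambda>q. dec (snd q)). f (fst q) * (g (fst s) * h (snd s)))"
    by (rule sum.reindex_bij_witness [of _ "\<lambda>((a, y), (b, c)). ((a \<otimes> b, c), (a, b))"
          "\<lambda>((x, c), (a, b)). ((a, b \<otimes> c), (b, c))"]) (auto simp: m_assoc)
  also have "\<dots> = (\<Sum>q\<in>dec p. \<Sum>s\<in>dec (snd q). f (fst q) * (g (fst s) * h (snd s)))"
    by (intro sum.Sigma [symmetric] ballI finite_dec')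
  also have "\<dots> = conv N f (conv N g h) p"
    unfolding conv_def by (simp add: split_def sum_distrib_left)
  finally show "conv N (conv N f g) h p = conv N f (conv N g h) p" .
qed

lemma conv_add: "conv N (\<lambda>p. f p + g p) h = (\<lambda>p. conv N f h p + conv N g h p)"
  by (simp add: fun_eq_iff conv_def split_def distrib_right sum.distrib)

lemma conv_delta:
  assumes "a \<in> carrier N" "q \<in> carrier N"
  shows "conv N (\<lambda>b. of_bool (b = a)) f (a \<otimes> q) = f q"
proof -
  have "conv N (\<lambda>b. of_bool (b = a)) f (a \<otimes> q) = (\<Sum>s\<in>{(a, q)}. of_bool (fst s = a) * f (snd s))"
    unfolding conv_def split_def
    by (rule sum.mono_neutral_right) (use assms finite_dec' [of "a \<otimes> q"] in \<open>auto simp: split_def intro: l_cancel [of a]\<close>)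
  then show ?thesis by simp
qed

lemma conv_delta_not:
  assumes "\<And>q. q \<in> carrier N \<Longrightarrow> p \<noteq> a \<otimes> q"
  shows "conv N (\<lambda>b. of_bool (b = a)) f p = 0"
  unfolding conv_def by (rule sum.neutral) (use assms in auto)

end

locale formal_series = divisor_finite_monoid M for M :: "'g monoid" (structure)
begin

abbreviation N :: "(nat \<times> 'g) monoid" where
  "N \<equiv> nat_add_monoid \<times>\<times> M"

lemma nat_add_monoid_simps [simp]:
  "carrier nat_add_monoid = UNIV" "i \<otimes>\<^bsub>nat_add_monoid\<^esub> j = i + j" "\<one>\<^bsub>nat_add_monoid\<^esub> = 0"
  by (simp_all add: nat_add_monoid_def)

lemma factors_divide:
  assumes "x \<in> carrier M" "y \<in> carrier M"
  shows "x divides x \<otimes> y" "y divides x \<otimes> y"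
proof -
  show "x divides x \<otimes> y"
    unfolding factor_def using assms(2) by blast
  show "y divides x \<otimes> y"
    unfolding factor_def using assms m_comm by blast
qed

sublocale conv: finite_decompositions N
proof (intro finite_decompositions.intro comm_monoid_cancelI comm_monoidI finite_decompositions_axioms.intro)
  fix p assume p: "p \<in> carrier N"
  obtain i g where ig: "p = (i, g)"
    by (cases p)
  let ?D = "{..i} \<times> {x \<in> carrier M. x divides g}"
  have "finite (?D \<times> ?D)"
    using p finite_divisors by (simp add: ig)
  moreover have "{(a, b). a \<in> carrier N \<and> b \<in> carrier N \<and> a \<otimes>\<^bsub>N\<^esub> b = p} \<subseteq> ?D \<times> ?D"
    by (auto simp: ig factors_divide)
  ultimately show "finite {(a, b). a \<in> carrier N \<and> b \<in> carrier N \<and> a \<otimes>\<^bsub>N\<^esub> b = p}"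
    by (rule finite_subset [rotated])
qed (auto simp: m_ac dest: r_cancel)

abbreviation S :: "(nat \<Rightarrow> 'g \<Rightarrow> int) ring" where
  "S \<equiv> series_ring M"

lemma in_S: "f \<in> carrier S \<longleftrightarrow> (\<forall>i g. g \<notin> carrier M \<longrightarrow> f i g = 0)"
  by (simp add: series_ring_def)

lemma zero_S: "\<zero>\<^bsub>S\<^esub> = (\<lambda>i g. 0)"
  by (simp add: series_ring_def)

lemma add_S: "f \<oplus>\<^bsub>S\<^esub> f' = (\<lambda>i g. f i g + f' i g)"
  by (simp add: series_ring_def)

lemma one_S: "\<one>\<^bsub>S\<^esub> = series_monom 0 \<one>"
  by (simp add: series_ring_def series_monom_def fun_eq_iff)

lemma mult_S: "f \<otimes>\<^bsub>S\<^esub> f' = (\<lambda>i g. conv N (case_prod f) (case_prod f') (i, g))"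
proof (intro ext)
  fix i g
  show "(f \<otimes>\<^bsub>S\<^esub> f') i g = conv N (case_prod f) (case_prod f') (i, g)"
  proof (cases "g \<in> carrier M")
    case True
    let ?D = "{(x, y). x \<in> carrier M \<and> y \<in> carrier M \<and> x \<otimes> y = g}"
    have "?D \<subseteq> {x \<in> carrier M. x divides g} \<times> {x \<in> carrier M. x divides g}"
      by (auto simp: factors_divide)
    then have fin: "finite ?D"
      by (rule finite_subset) (simp add: True finite_divisors)
    have "(f \<otimes>\<^bsub>S\<^esub> f') i g = (\<Sum>(j, q)\<in>{..i} \<times> ?D. f j (fst q) * f' (i - j) (snd q))"
      by (simp add: series_ring_def sum.cartesian_product split_def)
    also have "\<dots> = conv N (case_prod f) (case_prod f') (i, g)"
      unfolding conv_def
      by (rule sum.reindex_bij_witness [of _ "\<lambda>((j, x), (k, y)). (j, (x, y))"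
            "\<lambda>(j, (x, y)). ((j, x), (i - j, y))"]) auto
    finally show ?thesis .
  next
    case False
    have "(f \<otimes>\<^bsub>S\<^esub> f') i g = 0"
      using False by (auto simp: series_ring_def intro!: sum.neutral)
    moreover have "conv N (case_prod f) (case_prod f') (i, g) = 0"
      unfolding conv_def by (rule sum.neutral) (use False in auto)
    ultimately show ?thesis
      by simp
  qed
qed

lemma monom_S [simp]: "x \<in> carrier M \<Longrightarrow> series_monom j x \<in> carrier S"
  by (auto simp: in_S series_monom_def)

lemma monom_mult:
  assumes "x \<in> carrier M" "y \<in> carrier M"
  shows "(series_monom j x \<otimes>\<^bsub>S\<^esub> f) i (x \<otimes> y) = (if j \<le> i then f (i - j) y else 0)"
proof -
  have delta: "case_prod (series_monom j x) = (\<lambda>b. of_bool (b = (j, x)))"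
    by (auto simp: series_monom_def fun_eq_iff)
  show ?thesis
  proof (cases "j \<le> i")
    case True
    then have "(series_monom j x \<otimes>\<^bsub>S\<^esub> f) i (x \<otimes> y) =
        conv N (\<lambda>b. of_bool (b = (j, x))) (case_prod f) ((j, x) \<otimes>\<^bsub>N\<^esub> (i - j, y))"
      unfolding mult_S delta by simp
    also have "\<dots> = case_prod f (i - j, y)"
      by (rule conv.conv_delta) (use assms in simp_all)
    finally show ?thesis
      using True by simp
  next
    case False
    then show ?thesis
      unfolding mult_S delta by (subst conv.conv_delta_not) auto
  qed
qed

lemma monom_mult_not:
  assumes "\<And>y. y \<in> carrier M \<Longrightarrow> g \<noteq> x \<otimes> y"
  shows "(series_monom j x \<otimes>\<^bsub>S\<^esub> f) i g = 0"
proof -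
  have delta: "case_prod (series_monom j x) = (\<lambda>b. of_bool (b = (j, x)))"
    by (auto simp: series_monom_def fun_eq_iff)
  show ?thesis
    unfolding mult_S delta by (rule conv.conv_delta_not) (use assms in auto)
qed

lemma mult_in_S: "f \<otimes>\<^bsub>S\<^esub> f' \<in> carrier S"
proof -
  have "conv N (case_prod f) (case_prod f') (i, g) = 0" if "g \<notin> carrier M" for i g
    unfolding conv_def by (rule sum.neutral) (use that in auto)
  then show ?thesis
    by (simp add: in_S mult_S)
qed

lemma one_mult_S:
  assumes "f \<in> carrier S"
  shows "\<one>\<^bsub>S\<^esub> \<otimes>\<^bsub>S\<^esub> f = f"
proof (intro ext)
  fix i g
  show "(\<one>\<^bsub>S\<^esub> \<otimes>\<^bsub>S\<^esub> f) i g = f i g"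
  proof (cases "g \<in> carrier M")
    case True
    then show ?thesis
      using monom_mult [of \<one> g 0 f i] by (simp add: one_S)
  next
    case False
    then show ?thesis
      using assms mult_in_S [of "\<one>\<^bsub>S\<^esub>" f] by (simp add: in_S)
  qed
qed

sublocale S: cring S
proof (intro cringI abelian_groupI comm_monoidI)
  show "f \<otimes>\<^bsub>S\<^esub> f' \<otimes>\<^bsub>S\<^esub> f'' = f \<otimes>\<^bsub>S\<^esub> (f' \<otimes>\<^bsub>S\<^esub> f'')" for f f' f''
    by (simp add: mult_S conv.conv_assoc)
  show "f \<otimes>\<^bsub>S\<^esub> f' = f' \<otimes>\<^bsub>S\<^esub> f" for f f'
    unfolding mult_S by (subst conv.conv_comm) rule
  show "(f \<oplus>\<^bsub>S\<^esub> f') \<otimes>\<^bsub>S\<^esub> f'' = f \<otimes>\<^bsub>S\<^esub> f'' \<oplus>\<^bsub>S\<^esub> f' \<otimes>\<^bsub>S\<^esub> f''" for f f' f''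
  proof -
    have "case_prod (\<lambda>i g. f i g + f' i g) = (\<lambda>p. case_prod f p + case_prod f' p)"
      by (simp add: split_def)
    then show ?thesis
      unfolding mult_S add_S by (simp only: conv.conv_add)
  qed
  show "\<exists>f' \<in> carrier S. f' \<oplus>\<^bsub>S\<^esub> f = \<zero>\<^bsub>S\<^esub>" if "f \<in> carrier S" for f
    by (rule bexI [of _ "\<lambda>i g. - f i g"]) (use that in \<open>auto simp: in_S add_S zero_S\<close>)
  show "\<one>\<^bsub>S\<^esub> \<in> carrier S"
    by (simp add: one_S)
  show "f \<otimes>\<^bsub>S\<^esub> f' \<in> carrier S" for f f'
    by (rule mult_in_S)
qed (auto simp: one_mult_S in_S add_S zero_S fun_eq_iff)

end

text \<open>This turns the recursion for the coefficients into the closed formula, and with \<open>q = \<one>\<close> it shows that the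
  geometric series is an inverse.\<close>

lemma (in cring) geometric_recursion:
  assumes "p \<in> carrier R" "q \<in> carrier R" "w \<in> carrier R" "p = q \<oplus> w \<otimes> p"
  shows "(\<one> \<ominus> w) \<otimes> p = q"
proof -
  have "(\<one> \<ominus> w) \<otimes> p = p \<ominus> w \<otimes> p"
    using assms(1-3) by (simp add: minus_eq l_distr l_minus)
  also have "\<dots> = (q \<oplus> w \<otimes> p) \<ominus> w \<otimes> p"
    using assms(4) by simp
  also have "\<dots> = q"
    using assms(1-3) by (simp add: minus_eq a_assoc r_neg)
  finally show ?thesis .
qed

lemma (in cring) eq_mult_inv:
  assumes "p \<in> carrier R" "q \<in> carrier R" "c \<in> Units R" "c \<otimes> p = q"
  shows "p = q \<otimes> inv c"
proof -
  have c: "c \<in> carrier R" "inv c \<in> carrier R"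
    using assms(3) by auto
  have "q \<otimes> inv c = c \<otimes> inv c \<otimes> p"
    using c assms(1) by (simp add: m_ac flip: assms(4))
  then show ?thesis
    using assms(1,3) by simp
qed

text \<open>The unit \<open>1 - x\<^sup>2\<close> factors as \<open>(1 - x)(1 + x)\<close>, so both factors are units and \<open>1 + x\<close> can be
  cancelled.\<close>

lemma (in cring) difference_of_squares_cancel:
  assumes p: "p \<in> carrier R" and q: "q \<in> carrier R" and x: "x \<in> carrier R"
    and unit: "\<one> \<ominus> x \<otimes> x \<in> Units R" and eq: "(\<one> \<ominus> x \<otimes> x) \<otimes> p = q \<otimes> (\<one> \<oplus> x)"
  shows "p = q \<otimes> inv (\<one> \<ominus> x)"
proof -
  have c: "\<one> \<ominus> x \<in> carrier R" "\<one> \<oplus> x \<in> carrier R"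
    using x by auto
  have sq: "\<one> \<ominus> x \<otimes> x = (\<one> \<ominus> x) \<otimes> (\<one> \<oplus> x)"
    using x by algebra
  then have "(\<one> \<ominus> x) \<otimes> (\<one> \<oplus> x) \<in> Units R"
    using unit by simp
  then have units: "\<one> \<ominus> x \<in> Units R" "\<one> \<oplus> x \<in> Units R"
    using unit_factor [of "\<one> \<ominus> x" "\<one> \<oplus> x"] unit_factor [of "\<one> \<oplus> x" "\<one> \<ominus> x"] c by (auto simp: m_comm)
  have "(\<one> \<oplus> x) \<otimes> ((\<one> \<ominus> x) \<otimes> p) = (\<one> \<oplus> x) \<otimes> q"
    using eq c p q unfolding sq by (simp add: m_ac)
  then have "(\<one> \<ominus> x) \<otimes> p = q"
    using Units_l_cancel [OF units(2)] c p q by simp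
  then show ?thesis
    by (intro eq_mult_inv p q units)
qed

context formal_series
begin

text \<open>The inverse is the geometric series; it has at most one term for each exponent of \<open>t\<close>, since
  \<open>j \<ge> 1\<close>.\<close>

lemma one_minus_monom_unit:
  assumes x: "x \<in> carrier M" and j: "j \<ge> 1"
  shows "\<one>\<^bsub>S\<^esub> \<ominus>\<^bsub>S\<^esub> series_monom j x \<in> Units S"
proof -
  define geo :: "nat \<Rightarrow> 'g \<Rightarrow> int" where "geo i g = of_bool (\<exists>n :: nat. i = n * j \<and> g = x [^] n)" for i g
  have geo: "geo \<in> carrier S"
    using x by (auto simp: in_S geo_def)
  have "geo = \<one>\<^bsub>S\<^esub> \<oplus>\<^bsub>S\<^esub> series_monom j x \<otimes>\<^bsub>S\<^esub> geo"
  proof (intro ext)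
    fix i g
    consider (div) i' y where "y \<in> carrier M" "g = x \<otimes> y" "i = i' + j"
      | (low) y where "y \<in> carrier M" "g = x \<otimes> y" "i < j"
      | (not) "\<And>y. y \<in> carrier M \<Longrightarrow> g \<noteq> x \<otimes> y"
      by (metis le_add_diff_inverse2 not_less)
    then show "geo i g = (\<one>\<^bsub>S\<^esub> \<oplus>\<^bsub>S\<^esub> series_monom j x \<otimes>\<^bsub>S\<^esub> geo) i g"
    proof cases
      case div
      have "(\<exists>n. i' + j = n * j \<and> x \<otimes> y = x [^] n) \<longleftrightarrow> (\<exists>n. i' = n * j \<and> y = x [^] n)"
      proof safe
        fix n assume n: "i' + j = n * j" "x \<otimes> y = x [^] n"
        obtain m where m: "n = Suc m"
          using n(1) j by (cases n) auto
        have "x \<otimes> y = x \<otimes> x [^] m"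
          using n(2) x by (simp add: m m_comm)
        then have "y = x [^] m"
          using l_cancel [of x y "x [^] m"] x div(1) by simp
        then show "\<exists>n. i' = n * j \<and> y = x [^] n"
          using n(1) by (intro exI [of _ m]) (simp add: m)
      next
        fix n
        show "\<exists>na. n * j + j = na * j \<and> x \<otimes> x [^] n = x [^] na"
          using x by (intro exI [of _ "Suc n"]) (simp add: m_comm)
      qed
      then have "geo i g = geo i' y"
        by (simp add: geo_def div)
      then show ?thesis
        using j monom_mult [OF x div(1), of j geo i] by (simp add: add_S one_S series_monom_def div)
    next
      case low
      have "geo i g = series_monom 0 \<one> i g"
        using low(3) j by (auto simp: geo_def series_monom_def intro: exI [of _ "0 :: nat"])
      then show ?thesis
        using monom_mult [OF x low(1), of j geo i] low by (simp add: add_S one_S)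
    next
      case not
      have "n = 0" if "g = x [^] n" for n :: nat
        using not [of "x [^] (n - 1)"] that x by (cases n) (auto simp: m_comm)
      then have "geo i g = series_monom 0 \<one> i g"
        by (force simp: geo_def series_monom_def)
      then show ?thesis
        using monom_mult_not [OF not, of j geo i] by (simp add: add_S one_S)
    qed
  qed
  then have "(\<one>\<^bsub>S\<^esub> \<ominus>\<^bsub>S\<^esub> series_monom j x) \<otimes>\<^bsub>S\<^esub> geo = \<one>\<^bsub>S\<^esub>"
    using geo x by (intro S.geometric_recursion) auto
  then show ?thesis
    unfolding Units_def using geo x S.m_comm [of geo] by (auto intro!: bexI [of _ geo])
qed

end

section \<open>The Poincare series\<close>

lemma poincare_series_eq_hom_dim:
  assumes "divisor_finite_monoid \<Lambda>"
    and "strand_resolution \<Lambda> B dg (d :: nat \<Rightarrow> ('c \<Rightarrow>\<^sub>0 'k::field) \<Rightarrow> ('c \<Rightarrow>\<^sub>0 'k)) \<eta>"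
    and "l \<in> carrier \<Lambda>" and "finite (at_deg B dg n l)"
  shows "poincare_series (K :: 'k itself) \<Lambda> n l = int (hom_dim (\<lambda>m. at_deg B dg m l) d n)"
proof -
  interpret record_resolution \<Lambda> "TYPE('k)" "some_resolution \<Lambda> (residue_module \<Lambda>) (residue_component \<Lambda>)"
    using some_resolution_exists [OF assms(1), where ?'k = 'k] .
  show ?thesis
    using tor_vs_dim [OF assms(2-4)] assms(3) by (simp add: poincare_series_def Tor_def Let_def)
qed

context adjoin
begin

sublocale series: formal_series \<Lambda>'
  by (intro formal_series.intro ext.divisor_finite_extension)

abbreviation "PG K \<equiv> series_map \<Lambda> (adjoin_incl \<Lambda> \<rho> r) (poincare_series K \<Lambda>)"
abbreviation "PH K \<equiv> poincare_series K \<Lambda>'"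
abbreviation "X \<equiv> series_monom 1 (fraction \<Lambda> \<rho> r)"
abbreviation "W \<equiv> series_monom 2 (adjoin_incl \<Lambda> \<rho> r \<rho>)"

lemma incl_eq: "adjoin_incl \<Lambda> \<rho> r l = cl l 0"
  by (simp add: adjoin_incl_def cl_def)

lemma fraction_eq: "fraction \<Lambda> \<rho> r = cl \<one> 1"
  by (simp add: fraction_def cl_def)

lemma PG_eq:
  assumes l: "l \<in> carrier \<Lambda>" and k: "k < r"
  shows "PG (K :: 'k::field itself) n (cl l k) = (if k = 0 then int (ext.bar_betti K n l) else 0)"
proof -
  have "{m. m \<in> carrier \<Lambda> \<and> adjoin_incl \<Lambda> \<rho> r m = cl l k} = (if k = 0 then {l} else {})"
    using l k r by (auto simp: incl_eq ext.cl_inj)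
  moreover have "poincare_series K \<Lambda> n l = int (ext.bar_betti K n l)"
    unfolding ext.bar_betti_def
    using poincare_series_eq_hom_dim [OF divisor_finite_monoid_axioms bar.strand_resolution_axioms l finite_at_max [OF l]] .
  ultimately show ?thesis
    by (simp add: series_map_def)
qed

lemma PH_eq:
  assumes l: "l \<in> carrier \<Lambda>" and k: "k < r"
  shows "PH (K :: 'k::field itself) n (cl l k) = int (ext.tate_betti K n (cl l k))"
  unfolding ext.tate_betti_def
  using poincare_series_eq_hom_dim [OF ext.divisor_finite_extension ext.tate.strand_resolution_axioms
      cl_closed [OF l] ext.finite_tate_at [OF l k]] .

text \<open>Subtracting \<open>\<rho>/r\<close> from \<open>l\<close> itself leaves \<open>m + (r - 1) \<rho>/r\<close>, which is not in \<open>\<Lambda>\<close> as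
  \<open>r \<ge> 2\<close>. Therefore only \<open>k = 1\<close> contributes.\<close>

lemma X_mult_PG:
  assumes l: "l \<in> carrier \<Lambda>" and k: "k < r"
  shows "(X \<otimes>\<^bsub>series.S\<^esub> PG (K :: 'k::field itself)) n (cl l k) =
    (if k = 1 \<and> 1 \<le> n then int (ext.bar_betti K (n - 1) l) else 0)"
proof (cases k)
  case 0
  show ?thesis
  proof (cases "\<exists>y \<in> carrier \<Lambda>'. cl l 0 = cl \<one> 1 \<otimes>\<^bsub>\<Lambda>'\<^esub> y")
    case True
    then obtain y where y: "y \<in> carrier \<Lambda>'" "cl l 0 = cl \<one> 1 \<otimes>\<^bsub>\<Lambda>'\<^esub> y"
      by blast
    obtain m j where m: "m \<in> carrier \<Lambda>" "j < r" and "y = cl m j"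
      using y(1) by (rule ext_cases)
    with y(2) have eq: "cl l 0 = cl \<one> 1 \<otimes>\<^bsub>\<Lambda>'\<^esub> cl m j"
      by simp
    with m have "(1 + j) mod r = 0"
      using l by (simp add: mult_ext ext.cl_eq)
    then have "j \<noteq> 0"
      using r by (intro notI) simp
    then show ?thesis
      using series.monom_mult [OF cl_closed [OF one_closed, of 1] cl_closed [OF m(1), of j], of 1 "PG K" n] m
      by (simp add: 0 fraction_eq eq PG_eq)
  next
    case False
    then show ?thesis
      unfolding fraction_eq 0 by (subst series.monom_mult_not) auto
  qed
next
  case (Suc j)
  have "cl l k = cl \<one> 1 \<otimes>\<^bsub>\<Lambda>'\<^esub> cl l j"
    using l by (simp add: mult_ext Suc)
  then show ?thesis
    using series.monom_mult [OF cl_closed [OF one_closed, of 1] cl_closed [OF l, of j], of 1 "PG K" n] l k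
    by (simp add: fraction_eq PG_eq Suc)
qed

lemma W_mult:
  assumes l: "l \<in> carrier \<Lambda>"
  shows "(W \<otimes>\<^bsub>series.S\<^esub> f) n (cl (l \<otimes> \<rho>) k) = (if 2 \<le> n then f (n - 2) (cl l k) else 0)"
proof -
  have "cl (l \<otimes> \<rho>) k = cl \<rho> 0 \<otimes>\<^bsub>\<Lambda>'\<^esub> cl l k"
    using l by (simp add: mult_ext m_comm)
  then show ?thesis
    using series.monom_mult [OF cl_closed [OF rho_closed] cl_closed [OF l]] by (simp add: incl_eq)
qed

lemma W_mult_not:
  assumes l: "l \<in> carrier \<Lambda>" and k: "k < r" and "\<not> \<rho> divides l"
  shows "(W \<otimes>\<^bsub>series.S\<^esub> f) n (cl l k) = 0"
  unfolding incl_eq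
proof (rule series.monom_mult_not)
  fix y assume "y \<in> carrier \<Lambda>'"
  then obtain m j where m: "m \<in> carrier \<Lambda>" "j < r" "y = cl m j"
    by (meson ext_cases)
  show "cl l k \<noteq> cl \<rho> 0 \<otimes>\<^bsub>\<Lambda>'\<^esub> y"
  proof
    assume "cl l k = cl \<rho> 0 \<otimes>\<^bsub>\<Lambda>'\<^esub> y"
    then have "l = \<rho> \<otimes> m"
      using m l k by (simp add: mult_ext ext.cl_inj)
    then show False
      using assms(3) m(1) by (simp add: dividesI)
  qed
qed

lemma PG_in [simp]: "PG K \<in> carrier series.S"
  by (auto simp: series.in_S series_map_def incl_eq cl_closed intro!: sum.neutral)

lemma PH_in [simp]: "PH K \<in> carrier series.S"
  by (auto simp: series.in_S poincare_series_def)

lemma X_in [simp]: "X \<in> carrier series.S"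
  by (simp add: fraction_eq cl_closed)

lemma W_in [simp]: "W \<in> carrier series.S"
  by (simp add: incl_eq cl_closed)

lemma poincare_recursion:
  "PH (K :: 'k::field itself) = PG K \<otimes>\<^bsub>series.S\<^esub> (\<one>\<^bsub>series.S\<^esub> \<oplus>\<^bsub>series.S\<^esub> X) \<oplus>\<^bsub>series.S\<^esub> W \<otimes>\<^bsub>series.S\<^esub> PH K"
proof -
  have "PH K n h = PG K n h + (X \<otimes>\<^bsub>series.S\<^esub> PG K) n h + (W \<otimes>\<^bsub>series.S\<^esub> PH K) n h" for n h
  proof (cases "h \<in> carrier \<Lambda>'")
    case True
    then obtain l k where l: "l \<in> carrier \<Lambda>" and k: "k < r" and h: "h = cl l k"
      by (rule ext_cases)
    show ?thesis
    proof (cases "\<rho> divides l")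
      case True
      then obtain m where m: "m \<in> carrier \<Lambda>" "l = m \<otimes> \<rho>"
        by (auto simp: factor_def m_comm)
      show ?thesis
        unfolding h m(2) using m(1) k
        by (auto simp: PH_eq PG_eq X_mult_PG W_mult ext.tate_betti_mult_rho simp del: One_nat_def)
    next
      case False
      then show ?thesis
        unfolding h using l k
        by (auto simp: PH_eq PG_eq X_mult_PG W_mult_not ext.tate_betti_not_divides simp del: One_nat_def)
    qed
  next
    case False
    then show ?thesis
      using PH_in [of K] PG_in [of K] series.mult_in_S [of X "PG K"] series.mult_in_S [of W "PH K"]
      by (simp add: series.in_S)
  qed
  then have "PH K = PG K \<oplus>\<^bsub>series.S\<^esub> X \<otimes>\<^bsub>series.S\<^esub> PG K \<oplus>\<^bsub>series.S\<^esub> W \<otimes>\<^bsub>series.S\<^esub> PH K"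
    by (simp add: series.add_S fun_eq_iff del: One_nat_def)
  also have "PG K \<oplus>\<^bsub>series.S\<^esub> X \<otimes>\<^bsub>series.S\<^esub> PG K = PG K \<otimes>\<^bsub>series.S\<^esub> (\<one>\<^bsub>series.S\<^esub> \<oplus>\<^bsub>series.S\<^esub> X)"
    by (simp add: series.S.r_distr series.S.m_comm del: One_nat_def)
  finally show ?thesis .
qed

lemma W_unit: "\<one>\<^bsub>series.S\<^esub> \<ominus>\<^bsub>series.S\<^esub> W \<in> Units series.S"
  by (rule series.one_minus_monom_unit) (simp_all add: incl_eq cl_closed)

lemma PH_W: "(\<one>\<^bsub>series.S\<^esub> \<ominus>\<^bsub>series.S\<^esub> W) \<otimes>\<^bsub>series.S\<^esub> PH (K :: 'k::field itself) =
    PG K \<otimes>\<^bsub>series.S\<^esub> (\<one>\<^bsub>series.S\<^esub> \<oplus>\<^bsub>series.S\<^esub> X)"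
  by (intro series.S.geometric_recursion poincare_recursion) (simp_all del: One_nat_def)

theorem poincare_extension:
  "PH (K :: 'k::field itself) = PG K \<otimes>\<^bsub>series.S\<^esub> (\<one>\<^bsub>series.S\<^esub> \<oplus>\<^bsub>series.S\<^esub> X)
    \<otimes>\<^bsub>series.S\<^esub> inv\<^bsub>series.S\<^esub> (\<one>\<^bsub>series.S\<^esub> \<ominus>\<^bsub>series.S\<^esub> W)"
  by (intro series.S.eq_mult_inv PH_W W_unit) (simp_all del: One_nat_def)

text \<open>This is \<open>2 \<cdot> \<rho>/2 = \<rho>\<close>.\<close>

lemma X_square:
  assumes "r = 2"
  shows "X \<otimes>\<^bsub>series.S\<^esub> X = W"
proof (intro ext)
  fix n h
  have two: "1 + 1 = r"
    using assms by simp
  have sq: "cl \<one> 1 \<otimes>\<^bsub>\<Lambda>'\<^esub> cl \<one> 1 = cl \<rho> 0"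
    unfolding mult_ext [OF one_closed one_closed] two using ext.cl_carry [of \<one> 0] r by simp
  show "(X \<otimes>\<^bsub>series.S\<^esub> X) n h = W n h"
  proof (cases "\<exists>y \<in> carrier \<Lambda>'. h = cl \<one> 1 \<otimes>\<^bsub>\<Lambda>'\<^esub> y")
    case True
    then obtain y where y: "y \<in> carrier \<Lambda>'" "h = cl \<one> 1 \<otimes>\<^bsub>\<Lambda>'\<^esub> y" by blast
    have "h = cl \<rho> 0 \<longleftrightarrow> y = cl \<one> 1"
      unfolding y(2) sq [symmetric] using y(1) ext.H.l_cancel [of "cl \<one> 1" y "cl \<one> 1"] cl_closed by auto
    then show ?thesis
      using series.monom_mult [OF cl_closed [OF one_closed, of 1] y(1), of 1 X n] y(2)
      by (auto simp: series_monom_def fraction_eq incl_eq)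
  next
    case False
    then have "h \<noteq> cl \<rho> 0"
      using sq cl_closed [OF one_closed] by metis
    then show ?thesis
      using False series.monom_mult_not [of h "cl \<one> 1" 1 X n]
      by (auto simp: series_monom_def fraction_eq incl_eq)
  qed
qed

theorem poincare_extension_half:
  assumes "r = 2"
  shows "PH (K :: 'k::field itself) = PG K \<otimes>\<^bsub>series.S\<^esub> inv\<^bsub>series.S\<^esub> (\<one>\<^bsub>series.S\<^esub> \<ominus>\<^bsub>series.S\<^esub> X)"
proof (rule series.S.difference_of_squares_cancel)
  show "\<one>\<^bsub>series.S\<^esub> \<ominus>\<^bsub>series.S\<^esub> X \<otimes>\<^bsub>series.S\<^esub> X \<in> Units series.S"
    unfolding X_square [OF assms] by (rule W_unit)
  show "(\<one>\<^bsub>series.S\<^esub> \<ominus>\<^bsub>series.S\<^esub> X \<otimes>\<^bsub>series.S\<^esub> X) \<otimes>\<^bsub>series.S\<^esub> PH K =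
    PG K \<otimes>\<^bsub>series.S\<^esub> (\<one>\<^bsub>series.S\<^esub> \<oplus>\<^bsub>series.S\<^esub> X)"
    unfolding X_square [OF assms] by (rule PH_W)
qed (rule PH_in PG_in X_in)+

end

theorem theorem4p1:
  fixes \<Lambda> :: "'a monoid" and \<rho> :: 'a and r :: nat
  assumes "affine_monoid \<Lambda>" and "\<rho> \<in> carrier \<Lambda>" and "reducible \<Lambda> \<rho>" and "r \<ge> 2"
  shows "(let \<Lambda>' = adjoin_fraction \<Lambda> \<rho> r; S = series_ring \<Lambda>' in
            poincare_series TYPE('k::field) \<Lambda>' =
              series_map \<Lambda> (adjoin_incl \<Lambda> \<rho> r) (poincare_series TYPE('k) \<Lambda>)
                \<otimes>\<^bsub>S\<^esub> (\<one>\<^bsub>S\<^esub> \<oplus>\<^bsub>S\<^esub> series_monom 1 (fraction \<Lambda> \<rho> r))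
                \<otimes>\<^bsub>S\<^esub> inv\<^bsub>S\<^esub> (\<one>\<^bsub>S\<^esub> \<ominus>\<^bsub>S\<^esub> series_monom 2 (adjoin_incl \<Lambda> \<rho> r \<rho>))) \<and>
         (r = 2 \<longrightarrow>
          (let \<Lambda>' = adjoin_fraction \<Lambda> \<rho> 2; S = series_ring \<Lambda>' in
            poincare_series TYPE('k) \<Lambda>' =
              series_map \<Lambda> (adjoin_incl \<Lambda> \<rho> 2) (poincare_series TYPE('k) \<Lambda>)
                \<otimes>\<^bsub>S\<^esub> inv\<^bsub>S\<^esub> (\<one>\<^bsub>S\<^esub> \<ominus>\<^bsub>S\<^esub> series_monom 1 (fraction \<Lambda> \<rho> 2))))"
proof -
  obtain u u' where "u \<in> carrier \<Lambda> - {\<one>\<^bsub>\<Lambda>\<^esub>}" "u' \<in> carrier \<Lambda> - {\<one>\<^bsub>\<Lambda>\<^esub>}" "\<rho> = u \<otimes>\<^bsub>\<Lambda>\<^esub> u'"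
    using assms(3) by (auto simp: reducible_def)
  then interpret adjoin \<Lambda> \<rho> u u' r
    using assms(4) by (intro adjoin.intro affine_divisor_finite assms(1) adjoin_axioms.intro)
  show ?thesis
    unfolding Let_def
    using poincare_extension [of "TYPE('k)"] poincare_extension_half [of "TYPE('k)"] by auto
qed

end
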